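(* Let $\Omega\subset\mathbb{R}^N$ be a bounded open set. Let $p\in[2,N)$ and $1\ge s_0>s_1>s_2>\dots\ge0$. Let $(a_k)_{k\ge0}$ be real numbers with $\sum_{k=0}^{+\infty}a_k\in(0,+\infty)$, $a_0>0$ and $a_k\ge0$ for all $k\ge1$. Let $p_{s_0}^*:=\frac{pN}{N-ps_0}$ and $q\in[1,p_{s_0}^* )$. Let $g:\Omega\times\mathbb{R}\to\mathbb{R}$ be a Carathéodory function for which there exist $a_1',a_2'>0$ with $|g(x,t)|\le a_1'+a_2'|t|^{q-1}$ for a.e. $x\in\Omega$ and all $t\in\mathbb{R}$. Then for every $\gamma>0$ there exists $\Lambda_\gamma>0$ such that the problem $$\sum_{k=0}^{+\infty}a_k(-\Delta_p)^{s_k}u=\lambda g(x,u)+\gamma|u|^{p_{s_0}^*-2}u\ \text{ in }\Omega,\qquad u=0\ \text{ in }\mathbb{R}^N\setminus\Omega,$$ admits at least one weak solution in $\mathbb{X}(\Omega)$ for every $0<\lambda<\Lambda_\gamma$.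
   Context: For $s\in(0,1)$ put $C_{N,p,s}:=\frac{\frac{sp}{2}(1-s)2^{2s-1}}{\pi^{(N-1)/2}}\frac{\Gamma(\frac{N+ps}{2})}{\Gamma(\frac{p+1}{2})\Gamma(2-s)}$ and $[u]_{s,p}:=\left(C_{N,p,s}\iint_{\mathbb{R}^{2N}}\frac{|u(x)-u(y)|^p}{|x-y|^{N+sp}}dx\,dy\right)^{1/p}$; also $[u]_{0,p}:=\|u\|_{L^p(\mathbb{R}^N)}$ and $[u]_{1,p}:=\|\nabla u\|_{L^p(\mathbb{R}^N)}$. $\mathbb{X}(\Omega)$ is the space of measurable $u:\mathbb{R}^N\to\mathbb{R}$ with $u=0$ in $\mathbb{R}^N\setminus\Omega$ and finite norm $\left(\sum_{k\ge0}a_k[u]_{s_k,p}^p\right)^{1/p}$. The operator $(-\Delta_p)^s$ is $2C_{N,p,s}\lim_{\varepsilon\searrow0}\int_{\mathbb{R}^N\setminus B_\varepsilon(x)}\frac{|u(x)-u(y)|^{p-2}(u(x)-u(y))}{|x-y|^{N+sp}}dy$ for $s\in(0,1)$ and $-\operatorname{div}(|\nabla u|^{p-2}\nabla u)$ for $s=1$. Put $E_s(u,v):=C_{N,p,s}\iint_{\mathbb{R}^{2N}}\frac{|u(x)-u(y)|^{p-2}(u(x)-u(y))(v(x)-v(y))}{|x-y|^{N+sp}}dx\,dy$ for $s\in(0,1)$, $E_0(u,v):=\int_\Omega|u|^{p-2}uv\,dx$, $E_1(u,v):=\int_\Omega|\nabla u|^{p-2}\nabla u\cdot\nabla v\,dx$.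 A weak solution is $u\in\mathbb{X}(\Omega)$ with $\sum_{k\ge0}a_kE_{s_k}(u,v)=\int_\Omega(\lambda g(x,u)+\gamma|u|^{p_{s_0}^*-2}u)v\,dx$ for all $v\in\mathbb{X}(\Omega)$. Carathéodory means measurable in the first variable and continuous in the second. *)

theory Defs
  imports "HOL-Analysis.Analysis"
begin

text \<open>
  The ambient space is a Euclidean space \<open>'a\<close> of dimension \<open>N = DIM('a)\<close>; all integrals are taken
  with respect to Lebesgue measure (also on the product \<open>'a \<times> 'a\<close>).
\<close>

text \<open>Powers of extended nonnegative numbers; used only with \<open>r > 0\<close>.\<close>

definition ennreal_powr :: "ennreal \<Rightarrow> real \<Rightarrow> ennreal" where
  "ennreal_powr x r = (if x = \<infinity> then \<infinity> else ennreal (enn2real x powr r))"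

definition Lp_norm :: "real \<Rightarrow> ('a::euclidean_space \<Rightarrow> 'b::real_normed_vector) \<Rightarrow> ennreal" where
  "Lp_norm p f = ennreal_powr (\<integral>\<^sup>+ x. ennreal (norm (f x) powr p) \<partial>lebesgue) (1 / p)"


subsection \<open>Weak gradients\<close>

primrec times_cont_diff :: "nat \<Rightarrow> ('a::euclidean_space \<Rightarrow> real) \<Rightarrow> bool" where
  "times_cont_diff 0 f \<longleftrightarrow> continuous_on UNIV f"
| "times_cont_diff (Suc k) f \<longleftrightarrow>
     (\<forall>x. f differentiable (at x)) \<and>
     (\<forall>i\<in>Basis. times_cont_diff k (\<lambda>x. frechet_derivative f (at x) i))"

definition test_function :: "('a::euclidean_space \<Rightarrow> real) \<Rightarrow> bool" where
  "test_function \<phi> \<longleftrightarrow> (\<forall>k. times_cont_diff k \<phi>) \<and> compact (closure {x. \<phi> x \<noteq> 0})"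

definition locally_integrable :: "('a::euclidean_space \<Rightarrow> 'b::euclidean_space) \<Rightarrow> bool" where
  "locally_integrable f \<longleftrightarrow> (\<forall>K. compact K \<longrightarrow> f absolutely_integrable_on K)"

definition has_weak_gradient ::
    "('a::euclidean_space \<Rightarrow> real) \<Rightarrow> ('a \<Rightarrow> 'a) \<Rightarrow> bool" where
  "has_weak_gradient u G \<longleftrightarrow>
     locally_integrable u \<and> locally_integrable G \<and>
     (\<forall>\<phi>. test_function \<phi> \<longrightarrow> (\<forall>i\<in>Basis.
        (\<integral>x. u x * frechet_derivative \<phi> (at x) i \<partial>lebesgue)
          = - (\<integral>x. (G x \<bullet> i) * \<phi> x \<partial>lebesgue)))"

text \<open>The weak gradient, determined up to null sets when it exists.\<close>

definition weak_gradient :: "('a::euclidean_space \<Rightarrow> real) \<Rightarrow> 'a \<Rightarrow> 'a" where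
  "weak_gradient u = (SOME G. has_weak_gradient u G)"


subsection \<open>The seminorms and the space \<open>X(\<Omega>)\<close>\<close>

definition C_const :: "nat \<Rightarrow> real \<Rightarrow> real \<Rightarrow> real" where
  "C_const N p s =
     ((s * p / 2) * (1 - s) * 2 powr (2 * s - 1)) / pi powr ((real N - 1) / 2)
       * (Gamma ((real N + p * s) / 2) / (Gamma ((p + 1) / 2) * Gamma (2 - s)))"

text \<open>
  For \<open>s = 1\<close> the seminorm is infinite when \<open>u\<close> has no weak gradient. On the diagonal the fractional
  kernel takes the value \<open>0\<close> (division by zero), which is harmless as the diagonal is a null set.
\<close>

definition seminorm_sp :: "real \<Rightarrow> real \<Rightarrow> ('a::euclidean_space \<Rightarrow> real) \<Rightarrow> ennreal" where
  "seminorm_sp s p u =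
     (if s = 0 then Lp_norm p u
      else if s = 1 then
        (if \<exists>G. has_weak_gradient u G then Lp_norm p (weak_gradient u) else \<infinity>)
      else ennreal_powr
        (ennreal (C_const DIM('a) p s) *
          (\<integral>\<^sup>+ z. (case z of (x, y) \<Rightarrow>
             ennreal (\<bar>u x - u y\<bar> powr p / norm (x - y) powr (real DIM('a) + s * p))) \<partial>lebesgue))
        (1 / p))"

text \<open>Since \<open>0 * \<infinity> = 0\<close> in \<^typ>\<open>ennreal\<close>, terms with \<open>a k = 0\<close> impose no condition on \<open>u\<close>.\<close>

definition X_norm ::
    "real \<Rightarrow> (nat \<Rightarrow> real) \<Rightarrow> (nat \<Rightarrow> real) \<Rightarrow> ('a::euclidean_space \<Rightarrow> real) \<Rightarrow> ennreal" where
  "X_norm p s a u =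
     ennreal_powr (\<Sum>k. ennreal (a k) * ennreal_powr (seminorm_sp (s k) p u) p) (1 / p)"

definition X_space ::
    "real \<Rightarrow> (nat \<Rightarrow> real) \<Rightarrow> (nat \<Rightarrow> real) \<Rightarrow> 'a::euclidean_space set \<Rightarrow> ('a \<Rightarrow> real) set" where
  "X_space p s a \<Omega> =
     {u. u \<in> borel_measurable lebesgue \<and> (\<forall>x. x \<notin> \<Omega> \<longrightarrow> u x = 0) \<and> X_norm p s a u < \<infinity>}"


subsection \<open>Weak solutions\<close>

text \<open>
  \<open>|t|^(r-2) t\<close>, for \<open>r \<ge> 2\<close>; the value \<open>0 powr 0 = 0\<close> is irrelevant because of the factor \<open>t\<close>,
  and likewise for the gradients below.
\<close>

definition signed_pow :: "real \<Rightarrow> real \<Rightarrow> real" where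
  "signed_pow r t = \<bar>t\<bar> powr (r - 2) * t"

text \<open>
  By Hoelder's inequality, the integrals below converge absolutely as soon as \<open>u\<close> and \<open>v\<close> have finite
  \<open>(s,p)\<close>-seminorm.
\<close>

definition E_form ::
    "'a::euclidean_space set \<Rightarrow> real \<Rightarrow> real \<Rightarrow> ('a \<Rightarrow> real) \<Rightarrow> ('a \<Rightarrow> real) \<Rightarrow> real" where
  "E_form \<Omega> p s u v =
     (if s = 0 then (LINT x:\<Omega>|lebesgue. signed_pow p (u x) * v x)
      else if s = 1 then
        (LINT x:\<Omega>|lebesgue. norm (weak_gradient u x) powr (p - 2) *
                            (weak_gradient u x \<bullet> weak_gradient v x))
      else C_const DIM('a) p s *
        (\<integral>z. (case z of (x, y) \<Rightarrow>
           signed_pow p (u x - u y) * (v x - v y) / norm (x - y) powr (real DIM('a) + s * p))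
         \<partial>lebesgue))"

definition critical_exponent :: "nat \<Rightarrow> real \<Rightarrow> real \<Rightarrow> real" where
  "critical_exponent N p s = p * real N / (real N - p * s)"

text \<open>
  Convergence of the series and of the right-hand integral is made explicit, so that the equation
  is never an identity between default values of \<open>suminf\<close> or of the Bochner integral.
\<close>

definition weak_solution ::
    "'a::euclidean_space set \<Rightarrow> real \<Rightarrow> (nat \<Rightarrow> real) \<Rightarrow> (nat \<Rightarrow> real) \<Rightarrow>
     ('a \<Rightarrow> real \<Rightarrow> real) \<Rightarrow> real \<Rightarrow> real \<Rightarrow> ('a \<Rightarrow> real) \<Rightarrow> bool" where
  "weak_solution \<Omega> p s a g lam gam u \<longleftrightarrow>
     u \<in> X_space p s a \<Omega> \<and>
     (\<forall>v \<in> X_space p s a \<Omega>.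
        let rhs = (\<lambda>x. (lam * g x (u x)
                        + gam * signed_pow (critical_exponent DIM('a) p (s 0)) (u x)) * v x)
        in set_integrable lebesgue \<Omega> rhs \<and>
           (\<lambda>k. a k * E_form \<Omega> p (s k) u v) sums (LINT x:\<Omega>|lebesgue. rhs x))"


subsection \<open>The nonlinearity\<close>

definition caratheodory :: "'a::euclidean_space set \<Rightarrow> ('a \<Rightarrow> real \<Rightarrow> real) \<Rightarrow> bool" where
  "caratheodory \<Omega> g \<longleftrightarrow>
     (\<forall>t. (\<lambda>x. g x t) \<in> borel_measurable (lebesgue_on \<Omega>)) \<and>
     (\<forall>x\<in>\<Omega>. continuous_on UNIV (g x))"

text \<open>\<open>|t|^(q-1)\<close> is \<open>1\<close> for \<open>q = 1\<close> even at \<open>t = 0\<close>, whereas \<open>0 powr 0 = 0\<close>.\<close>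

definition growth_bound :: "'a::euclidean_space set \<Rightarrow> real \<Rightarrow> ('a \<Rightarrow> real \<Rightarrow> real) \<Rightarrow> bool" where
  "growth_bound \<Omega> q g \<longleftrightarrow>
     (\<exists>c1>0. \<exists>c2>0. AE x in lebesgue_on \<Omega>. \<forall>t.
        \<bar>g x t\<bar> \<le> c1 + c2 * (if q = 1 then 1 else \<bar>t\<bar> powr (q - 1)))"

end

theory Submission
  imports Defs "HOL-Complex_Analysis.Great_Picard"
begin

text \<open>
  Truncating the right-hand side \<open>\<lambda> g(x,t) + \<gamma> |t|^(r-2) t\<close> (with \<open>r\<close> the critical exponent) at \<open>|t| = \<delta>\<close>
  gives a bounded nonlinearity, so the direct method applies: a minimising sequence is compact in \<open>L\<^sup>1\<close> because
  averages of its members over small balls are close to them, and Clarkson's inequality passes to the limit in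
  the gradients. The minimiser solves the truncated equation, whose right-hand side is at most
  \<open>M = \<lambda> K + \<gamma> \<delta>^(r-1)\<close>. Testing with \<open>(u - \<delta>)\<^sup>+\<close> (or comparing with an explicit barrier when only the
  \<open>p\<close>-Laplacian is present) shows \<open>|u| \<le> \<delta>\<close> as soon as \<open>M < \<kappa> \<delta>^(p-1)\<close>. Since \<open>r > p\<close>, this holds for
  \<open>\<delta>\<close> small and then \<open>\<lambda>\<close> small, and the truncation is inactive. No Sobolev embedding is needed.
\<close>

section \<open>Convexity inequalities\<close>

text \<open>The obstacle is that infinitely many orders are mixed. All fractional kernels are
  therefore added up into one density on pairs of points: series and integrals are interchanged
  once, and the variational part sees only a gradient term and one measure. In the nonlocal case the
  estimates use only that this measure dominates a single kernel. Such a kernel couples every point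
  of \<Omega> with a fixed ball outside \<Omega>, where u vanishes, and so gives a zero-order lower
  bound in the test by (u - \<delta>)+. The gradient term alone has no such coupling; the same test
  would bound only the energy of (u - \<delta>)+, hence the barrier. Critical growth is harmless,
  because boundedness of the truncated right-hand side makes the integral of its primitive Lipschitz
  in L^1; the exponent enters only through r > p. Limits are taken strongly in L^1 or by Fatou's
  lemma, never weakly; the hypothesis p \<ge> 2 makes this possible, through the form of Clarkson's
  inequality that rests on the parallelogram law.\<close>

definition pdot :: "real \<Rightarrow> 'b::real_inner \<Rightarrow> 'b \<Rightarrow> real" where
  "pdot p a b = norm a powr (p - 2) * (a \<bullet> b)"

text \<open>After scaling to x + y = 1 this is t^r \<le> t on [0, 1], summed over t = x and t =
  y.\<close>

lemma powr_add_superadditive: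
  fixes x y r :: real
  assumes "0 \<le> x" "0 \<le> y" "1 \<le> r"
  shows "x powr r + y powr r \<le> (x + y) powr r"
proof (cases "x + y = 0")
  case False
  define s where "s = x + y"
  have s: "s > 0" using False assms by (simp add: s_def)
  have *: "t powr r \<le> s powr r * (t / s)" if "0 \<le> t" "t \<le> s" for t
  proof -
    have "(t / s) powr r \<le> (t / s) powr 1" if "t > 0"
      using that \<open>t \<le> s\<close> s assms by (intro powr_mono') auto
    then have "(t / s) powr r \<le> t / s" using that s by (cases "t = 0") auto
    moreover have "t powr r = s powr r * (t / s) powr r"
      using s that by (simp add: powr_mult[symmetric])
    ultimately show ?thesis using mult_left_mono[of "(t / s) powr r" "t / s" "s powr r"] by simp
  qed
  have "x powr r + y powr r \<le> s powr r * (x / s) + s powr r * (y / s)"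
    using assms by (intro add_mono *) (auto simp: s_def)
  also have "\<dots> = s powr r * ((x + y) / s)" by (simp add: add_divide_distrib distrib_left)
  also have "\<dots> = s powr r" using s by (simp add: s_def)
  finally show ?thesis by (simp add: s_def)
next
  case True
  then have "x = 0" "y = 0" using assms by auto
  then show ?thesis by simp
qed

lemma powr_midpoint_convex:
  fixes x y r :: real
  assumes "0 \<le> x" "0 \<le> y" "1 \<le> r"
  shows "((x + y) / 2) powr r \<le> (x powr r + y powr r) / 2"
proof (cases "x = 0 \<or> y = 0")
  case True
  have "(t / 2) powr r \<le> t powr r / 2" if "t \<ge> 0" for t :: real
  proof -
    have "(1/2) powr r \<le> (1/2::real) powr 1" using assms by (intro powr_mono') auto
    then have "t powr r * (1/2) powr r \<le> t powr r * (1/2)" by (intro mult_left_mono) auto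
    then show ?thesis using that by (simp add: powr_mult[symmetric])
  qed
  then show ?thesis using True assms by auto
next
  case False
  then show ?thesis
    using convex_onD[OF powr_convex[OF assms(3)], of "1/2" x y] assms
    by (simp add: field_simps)
qed

lemma norm_powr_via_square: "norm x powr p = ((norm x)\<^sup>2) powr (p / 2)"
proof -
  have "(norm x)\<^sup>2 = norm x powr 2" by (simp add: powr_numeral)
  moreover have "norm x powr p = (norm x powr 2) powr (p / 2)" by (subst powr_powr) simp
  ultimately show ?thesis by simp
qed

text \<open>By the parallelogram law the squared norms of half sum and half difference add up to the
  mean of the squared norms. Raise this identity to the power p / 2 \<ge> 1, with superadditivity on
  the left and convexity on the right.\<close>

lemma clarkson_ineq:
  fixes a b :: "'b::real_inner"
  assumes "2 \<le> p"
  shows "norm ((a + b) /\<^sub>R 2) powr p + norm ((a - b) /\<^sub>R 2) powr p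
         \<le> (norm a powr p + norm b powr p) / 2"
proof -
  have eq: "(norm ((a + b) /\<^sub>R 2))\<^sup>2 + (norm ((a - b) /\<^sub>R 2))\<^sup>2 = ((norm a)\<^sup>2 + (norm b)\<^sup>2) / 2"
    unfolding power2_norm_eq_inner
    by (simp add: inner_add_left inner_add_right inner_diff_left inner_diff_right
        inner_commute field_simps)
  have "norm ((a + b) /\<^sub>R 2) powr p + norm ((a - b) /\<^sub>R 2) powr p
      \<le> (((norm a)\<^sup>2 + (norm b)\<^sup>2) / 2) powr (p / 2)"
    unfolding norm_powr_via_square[of _ p] eq[symmetric]
    using assms by (intro powr_add_superadditive) auto
  also have "\<dots> \<le> (norm a powr p + norm b powr p) / 2"
    unfolding norm_powr_via_square[of _ p] using assms by (intro powr_midpoint_convex) auto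
  finally show ?thesis .
qed

lemma norm_powr_minus_two: "2 \<le> p \<Longrightarrow> norm b powr (p - 2) * (norm b)\<^sup>2 = norm b powr p"
  for b :: "'b::real_normed_vector"
  using powr_add[of "norm b" "p - 2" 2] by (simp add: powr_numeral)

lemma norm_powr_minus_two_mult: "2 \<le> p \<Longrightarrow> norm b powr (p - 2) * norm b = norm b powr (p - 1)"
  for b :: "'b::real_normed_vector"
  using powr_add[of "norm b" "p - 2" 1] by (cases "b = 0") simp_all

lemma pdot_real_nonneg: "0 \<le> a * b \<Longrightarrow> 0 \<le> pdot p a b" for a b :: real
  by (simp add: pdot_def)

lemma signed_pow_eq_pdot: "signed_pow p t * v = pdot p t v" for t v :: real
  by (simp add: signed_pow_def pdot_def)

lemma abs_pdot_le: "2 \<le> p \<Longrightarrow> \<bar>pdot p a b\<bar> \<le> norm a powr (p - 1) * norm b"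
proof -
  assume p: "2 \<le> p"
  have "\<bar>pdot p a b\<bar> \<le> norm a powr (p - 2) * (norm a * norm b)"
    unfolding pdot_def abs_mult by (intro mult_mono Cauchy_Schwarz_ineq2) auto
  then show ?thesis using norm_powr_minus_two_mult[OF p, of a] by (simp add: mult.assoc[symmetric])
qed

text \<open>Young's inequality with the conjugate exponents p / (p - 1) and p.\<close>

lemma powr_mult_le_add:
  fixes x y p :: real
  assumes "0 \<le> x" "0 \<le> y" "1 < p"
  shows "x powr (p - 1) * y \<le> x powr p * (1 - 1/p) + y powr p / p"
proof -
  have "x powr (p - 1) * y \<le> (x powr (p - 1)) powr (p / (p - 1)) / (p / (p - 1)) + y powr p / p"
    using assms by (intro Youngs_inequality) (auto simp: field_simps)
  also have "(x powr (p - 1)) powr (p / (p - 1)) / (p / (p - 1)) = x powr p * (1 - 1/p)"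
  proof -
    have "(p - 1) * (p / (p - 1)) = p" using assms by simp
    then have "(x powr (p - 1)) powr (p / (p - 1)) = x powr p" by (simp only: powr_powr)
    then show ?thesis using assms by (simp add: field_simps)
  qed
  finally show ?thesis .
qed

lemma abs_pdot_le_add:
  assumes "2 \<le> p"
  shows "\<bar>pdot p a b\<bar> \<le> norm a powr p + norm b powr p"
proof -
  have "\<bar>pdot p a b\<bar> \<le> norm a powr p * (1 - 1/p) + norm b powr p / p"
    using abs_pdot_le[OF assms, of a b] powr_mult_le_add[of "norm a" "norm b" p] assms by simp
  also have "\<dots> \<le> norm a powr p * 1 + norm b powr p * 1"
    using assms unfolding divide_inverse
    by (intro add_mono mult_left_mono) (auto simp: divide_simps)
  finally show ?thesis by simp
qed

text \<open>\<open>p * pdot p b\<close> is the derivative at b of the p-th power of the norm, so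
  this is the tangent inequality of a convex function. It comes from Young's inequality, without
  differentiating the norm.\<close>

lemma norm_powr_convex_ineq:
  fixes a b :: "'b::real_inner"
  assumes "2 \<le> p"
  shows "norm b powr p + p * pdot p b (a - b) \<le> norm a powr p"
proof -
  have "pdot p b a \<le> norm b powr p * (1 - 1/p) + norm a powr p / p"
    using abs_pdot_le[OF assms, of b a] powr_mult_le_add[of "norm b" "norm a" p] assms by simp
  then have "p * pdot p b a \<le> p * (norm b powr p * (1 - 1/p) + norm a powr p / p)"
    using assms by (intro mult_left_mono) auto
  also have "\<dots> = (p - 1) * norm b powr p + norm a powr p"
    using assms by (simp add: field_simps)
  finally have "p * pdot p b a \<le> (p - 1) * norm b powr p + norm a powr p" .
  moreover have "pdot p b (a - b) = pdot p b a - norm b powr p"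
    using norm_powr_minus_two[OF assms, of b]
    by (simp add: pdot_def inner_diff_right right_diff_distrib power2_norm_eq_inner)
  ultimately show ?thesis by (simp add: right_diff_distrib left_diff_distrib)
qed

text \<open>Add the tangent inequalities at a and at b. For gradients this is the monotonicity of
  the p-Laplacian, on which the comparison with the barrier rests.\<close>

lemma pdot_monotone:
  fixes a b :: "'b::real_inner"
  assumes "2 \<le> p"
  shows "pdot p b (a - b) \<le> pdot p a (a - b)"
proof -
  have "p * pdot p b (a - b) + p * pdot p a (b - a) \<le> 0"
    using norm_powr_convex_ineq[OF assms, of b a] norm_powr_convex_ineq[OF assms, of a b] by simp
  moreover have "pdot p a (b - a) = - pdot p a (a - b)"
    by (simp add: pdot_def inner_diff_right algebra_simps)
  ultimately have "p * (pdot p b (a - b) - pdot p a (a - b)) \<le> 0"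
    by (simp add: algebra_simps)
  then show ?thesis using assms by (simp add: mult_le_0_iff)
qed

lemma norm_add_powr_le:
  fixes a b :: "'b::real_normed_vector"
  assumes "1 \<le> p"
  shows "norm (a + b) powr p \<le> 2 powr p * (norm a powr p + norm b powr p)"
proof -
  have "norm (a + b) powr p \<le> (2 * ((norm a + norm b) / 2)) powr p"
    using assms norm_triangle_ineq[of a b] by (intro powr_mono2) simp_all
  also have "\<dots> = 2 powr p * ((norm a + norm b) / 2) powr p"
    by (subst powr_mult) auto
  also have "\<dots> \<le> 2 powr p * ((norm a powr p + norm b powr p) / 2)"
    using assms by (intro mult_left_mono powr_midpoint_convex) auto
  also have "\<dots> \<le> 2 powr p * (norm a powr p + norm b powr p)"
    by (intro mult_left_mono) auto
  finally show ?thesis .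
qed

section \<open>Functions with integrable p-th power, and completeness of L^1\<close>

definition Lp_fun :: "real \<Rightarrow> 'm measure \<Rightarrow> ('m \<Rightarrow> 'b::euclidean_space) \<Rightarrow> bool" where
  "Lp_fun p M f \<longleftrightarrow> f \<in> borel_measurable M \<and> integrable M (\<lambda>x. norm (f x) powr p)"

lemma Lp_fun_measurable: "Lp_fun p M f \<Longrightarrow> f \<in> borel_measurable M"
  by (simp add: Lp_fun_def)

lemma Lp_fun_iff:
  "f \<in> borel_measurable M \<Longrightarrow> Lp_fun p M f \<longleftrightarrow> (\<integral>\<^sup>+x. ennreal (norm (f x) powr p) \<partial>M) < \<infinity>"
  for f :: "'m \<Rightarrow> 'b::euclidean_space"
proof -
  assume f: "f \<in> borel_measurable M"
  have "(\<lambda>x. norm (f x) powr p) \<in> borel_measurable M" using f by measurable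
  then show ?thesis using f by (simp add: Lp_fun_def integrable_iff_bounded)
qed

lemma Lp_fun_scale: "Lp_fun p M f \<Longrightarrow> Lp_fun p M (\<lambda>x. c *\<^sub>R f x)"
  by (auto simp: Lp_fun_def powr_mult)

lemma Lp_fun_add:
  assumes "1 \<le> p" "Lp_fun p M f" "Lp_fun p M g"
  shows "Lp_fun p M (\<lambda>x. f x + g x)"
proof -
  have [measurable]: "f \<in> borel_measurable M" "g \<in> borel_measurable M"
    using assms by (auto simp: Lp_fun_def)
  have "integrable M (\<lambda>x. 2 powr p * (norm (f x) powr p + norm (g x) powr p))"
    using assms by (intro integrable_mult_right Bochner_Integration.integrable_add) (auto simp: Lp_fun_def)
  then have "integrable M (\<lambda>x. norm (f x + g x) powr p)"
    by (rule Bochner_Integration.integrable_bound)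
      (use norm_add_powr_le[OF assms(1)] in \<open>auto intro!: AE_I2\<close>)
  then show ?thesis by (simp add: Lp_fun_def)
qed

lemma Lp_fun_diff: "1 \<le> p \<Longrightarrow> Lp_fun p M f \<Longrightarrow> Lp_fun p M g \<Longrightarrow> Lp_fun p M (\<lambda>x. f x - g x)"
  using Lp_fun_add[of p M f "\<lambda>x. (-1) *\<^sub>R g x"] Lp_fun_scale[of p M g "-1"] by simp

lemma pdot_measurable[measurable (raw)]:
  fixes f g :: "'m \<Rightarrow> 'b::euclidean_space"
  assumes [measurable]: "f \<in> borel_measurable M" "g \<in> borel_measurable M"
  shows "(\<lambda>x. pdot p (f x) (g x)) \<in> borel_measurable M"
  unfolding pdot_def by measurable

lemma integrable_pdot:
  assumes "2 \<le> p" "Lp_fun p M f" "Lp_fun p M g"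
  shows "integrable M (\<lambda>x. pdot p (f x) (g x))"
proof (rule Bochner_Integration.integrable_bound)
  show "integrable M (\<lambda>x. norm (f x) powr p + norm (g x) powr p)"
    using assms by (auto simp: Lp_fun_def)
  have [measurable]: "f \<in> borel_measurable M" "g \<in> borel_measurable M"
    using assms by (auto simp: Lp_fun_def)
  show "(\<lambda>x. pdot p (f x) (g x)) \<in> borel_measurable M" by measurable
qed (use abs_pdot_le_add[OF assms(1)] in auto)

lemma integral_clarkson:
  assumes "2 \<le> p" "Lp_fun p M f" "Lp_fun p M g"
  shows "(\<integral>x. norm ((f x + g x) /\<^sub>R 2) powr p \<partial>M) + (\<integral>x. norm ((f x - g x) /\<^sub>R 2) powr p \<partial>M)
         \<le> ((\<integral>x. norm (f x) powr p \<partial>M) + (\<integral>x. norm (g x) powr p \<partial>M)) / 2"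
proof -
  have i: "integrable M (\<lambda>x. norm ((f x + g x) /\<^sub>R 2) powr p)"
    "integrable M (\<lambda>x. norm ((f x - g x) /\<^sub>R 2) powr p)"
    using Lp_fun_scale[OF Lp_fun_add[of p M f g], of "inverse 2"] Lp_fun_scale[OF Lp_fun_diff[of p M f g], of "inverse 2"] assms
    by (auto simp only: Lp_fun_def)
  have j: "integrable M (\<lambda>x. norm (f x) powr p)" "integrable M (\<lambda>x. norm (g x) powr p)"
    using assms by (auto simp: Lp_fun_def)
  have "(\<integral>x. norm ((f x + g x) /\<^sub>R 2) powr p + norm ((f x - g x) /\<^sub>R 2) powr p \<partial>M)
      \<le> (\<integral>x. (norm (f x) powr p + norm (g x) powr p) / 2 \<partial>M)"
    using i j assms by (intro integral_mono clarkson_ineq) auto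
  then show ?thesis using i j by simp
qed

text \<open>The tangent inequality at the displaced point f + t g. It bounds the difference quotient
  of the energy by a first-order term whose limit for t tending to 0 is elementary; this takes the
  place of differentiating the energy under the integral.\<close>

lemma integral_powr_convex_ineq:
  assumes "2 \<le> p" "Lp_fun p M f" "Lp_fun p M g"
  shows "(\<integral>x. norm (f x + t *\<^sub>R g x) powr p \<partial>M) - (\<integral>x. norm (f x) powr p \<partial>M)
         \<le> p * t * (\<integral>x. pdot p (f x + t *\<^sub>R g x) (g x) \<partial>M)"
proof -
  have l: "Lp_fun p M (\<lambda>x. f x + t *\<^sub>R g x)"
    using assms by (intro Lp_fun_add Lp_fun_scale) auto
  have "norm (f x + t *\<^sub>R g x) powr p - norm (f x) powr p \<le> p * t * pdot p (f x + t *\<^sub>R g x) (g x)" for x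
    using norm_powr_convex_ineq[OF assms(1), of "f x + t *\<^sub>R g x" "f x"]
    by (simp add: pdot_def algebra_simps)
  then have "(\<integral>x. norm (f x + t *\<^sub>R g x) powr p - norm (f x) powr p \<partial>M)
      \<le> (\<integral>x. p * t * pdot p (f x + t *\<^sub>R g x) (g x) \<partial>M)"
    using l assms integrable_pdot[OF assms(1) l assms(3)]
    by (intro integral_mono) (auto simp: Lp_fun_def)
  then show ?thesis using l assms by (simp add: Lp_fun_def)
qed

lemma continuous_pdot:
  assumes "2 \<le> p" "(F \<longlongrightarrow> a) net"
  shows "((\<lambda>t. pdot p (F t) b) \<longlongrightarrow> pdot p a b) net"
proof (cases "p = 2")
  case True
  \<comment> \<open>For p = 2 the factor is \<open>norm a powr 0\<close>, which is 0 at a = 0 and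
    hence discontinuous there; the inner product absorbs this.\<close>
  have e: "pdot 2 z b = z \<bullet> b" for z by (cases "z = 0") (auto simp: pdot_def)
  show ?thesis unfolding True e by (intro tendsto_intros assms)
next
  case False
  show ?thesis unfolding pdot_def
    by (intro tendsto_intros tendsto_powr2 assms) (use False assms in auto)
qed

lemma integral_pdot_tendsto:
  assumes "2 \<le> p" "Lp_fun p M f" "Lp_fun p M g"
  shows "(\<lambda>n. \<integral>x. pdot p (f x + inverse (real (Suc n)) *\<^sub>R g x) (g x) \<partial>M)
         \<longlonglongrightarrow> (\<integral>x. pdot p (f x) (g x) \<partial>M)"
proof (rule integral_dominated_convergence)
  have [measurable]: "f \<in> borel_measurable M" "g \<in> borel_measurable M"
    using assms by (auto simp: Lp_fun_def)
  show "(\<lambda>x. pdot p (f x) (g x)) \<in> borel_measurable M" by measurable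
  show "(\<lambda>x. pdot p (f x + inverse (real (Suc n)) *\<^sub>R g x) (g x)) \<in> borel_measurable M" for n
    by measurable
  show "integrable M (\<lambda>x. 2 powr p * (norm (f x) powr p + norm (g x) powr p) + norm (g x) powr p)"
    using assms by (auto simp: Lp_fun_def)
  show "AE x in M. (\<lambda>n. pdot p (f x + inverse (real (Suc n)) *\<^sub>R g x) (g x)) \<longlonglongrightarrow> pdot p (f x) (g x)"
  proof (intro AE_I2 continuous_pdot assms)
    fix x
    have "(\<lambda>n. f x + inverse (real (Suc n)) *\<^sub>R g x) \<longlonglongrightarrow> f x + 0 *\<^sub>R g x"
      by (intro tendsto_intros LIMSEQ_inverse_real_of_nat)
    then show "(\<lambda>n. f x + inverse (real (Suc n)) *\<^sub>R g x) \<longlonglongrightarrow> f x" by simp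
  qed
  fix n
  show "AE x in M. norm (pdot p (f x + inverse (real (Suc n)) *\<^sub>R g x) (g x))
     \<le> 2 powr p * (norm (f x) powr p + norm (g x) powr p) + norm (g x) powr p"
  proof (rule AE_I2)
    fix x
    define c where "c = inverse (real (Suc n))"
    have c: "0 \<le> c" "c \<le> 1" by (auto simp: c_def field_simps)
    have "norm (f x + c *\<^sub>R g x) powr p \<le> 2 powr p * (norm (f x) powr p + norm (c *\<^sub>R g x) powr p)"
      using assms by (intro norm_add_powr_le) auto
    also have "\<dots> \<le> 2 powr p * (norm (f x) powr p + norm (g x) powr p)"
      using c assms by (intro mult_left_mono add_mono powr_mono2) (auto intro: mult_left_le_one_le)
    finally show "norm (pdot p (f x + inverse (real (Suc n)) *\<^sub>R g x) (g x))
     \<le> 2 powr p * (norm (f x) powr p + norm (g x) powr p) + norm (g x) powr p"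
      using abs_pdot_le_add[OF assms(1), of "f x + c *\<^sub>R g x" "g x"] by (simp add: c_def)
  qed
qed

text \<open>A Cauchy sequence has a subsequence converging almost everywhere, and Fatou's lemma
  along it bounds the distance of every late member from the limit. The subsequence is returned too,
  because gradients are later passed to the limit both in L^1 and pointwise.\<close>

lemma L1_complete:
  fixes f :: "nat \<Rightarrow> 'm \<Rightarrow> 'b::euclidean_space"
  assumes f: "\<And>n. integrable M (f n)"
    and c: "\<And>e. e > 0 \<Longrightarrow> \<exists>N. \<forall>i\<ge>N. \<forall>j\<ge>N. (\<integral>x. norm (f i x - f j x) \<partial>M) < e"
  obtains g r where "integrable M g" "(\<lambda>n. \<integral>x. norm (f n x - g x) \<partial>M) \<longlonglongrightarrow> 0"
    "strict_mono r" "AE x in M. (\<lambda>n. f (r n) x) \<longlonglongrightarrow> g x"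
proof -
  obtain r where r: "strict_mono r" "AE x in M. Cauchy (\<lambda>i. f (r i) x)"
    by (rule cauchy_L1_AE_cauchy_subseq[of M f, OF f c]) auto
  have [measurable]: "f n \<in> borel_measurable M" for n using f by auto
  define g where "g x = lim (\<lambda>i. f (r i) x)" for x
  have [measurable]: "g \<in> borel_measurable M"
    unfolding g_def by measurable
  have ae: "AE x in M. (\<lambda>n. f (r n) x) \<longlonglongrightarrow> g x"
    using r(2) by eventually_elim (simp add: g_def Cauchy_convergent_iff convergent_LIMSEQ_iff)
  have small: "\<exists>N. \<forall>i\<ge>N. (\<integral>\<^sup>+x. norm (f i x - g x) \<partial>M) \<le> ennreal e" if e0: "e > 0" for e
  proof -
    obtain N where N: "\<And>i j. i \<ge> N \<Longrightarrow> j \<ge> N \<Longrightarrow> (\<integral>x. norm (f i x - f j x) \<partial>M) < e"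
      using c[OF e0] by blast
    have "(\<integral>\<^sup>+x. norm (f i x - g x) \<partial>M) \<le> ennreal e" if "i \<ge> N" for i
    proof -
      have "(\<integral>\<^sup>+x. norm (f i x - g x) \<partial>M) = (\<integral>\<^sup>+x. liminf (\<lambda>n. ennreal (norm (f i x - f (r n) x))) \<partial>M)"
      proof (rule nn_integral_cong_AE)
        show "AE x in M. ennreal (norm (f i x - g x)) = liminf (\<lambda>n. ennreal (norm (f i x - f (r n) x)))"
          using ae
        proof eventually_elim
          case (elim x)
          have "(\<lambda>n. ennreal (norm (f i x - f (r n) x))) \<longlonglongrightarrow> ennreal (norm (f i x - g x))"
            by (intro tendsto_intros elim)
          then show ?case by (intro lim_imp_Liminf[symmetric]) auto
        qed
      qed
      also have "\<dots> \<le> liminf (\<lambda>n. \<integral>\<^sup>+x. ennreal (norm (f i x - f (r n) x)) \<partial>M)"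
        by (intro nn_integral_liminf) auto
      also have "\<dots> \<le> ennreal e"
      proof (rule Liminf_le)
        show "eventually (\<lambda>n. (\<integral>\<^sup>+x. ennreal (norm (f i x - f (r n) x)) \<partial>M) \<le> ennreal e) sequentially"
          using eventually_ge_at_top[of N]
        proof eventually_elim
          case (elim n)
          then have "r n \<ge> N" using seq_suble[OF r(1), of n] by simp
          then have "(\<integral>x. norm (f i x - f (r n) x) \<partial>M) < e" using N \<open>i \<ge> N\<close> by blast
          then show ?case using f by (subst nn_integral_eq_integral) (auto intro: ennreal_leI)
        qed
      qed simp
      finally show ?thesis .
    qed
    then show ?thesis by blast
  qed
  obtain N where N: "(\<integral>\<^sup>+x. norm (f N x - g x) \<partial>M) \<le> ennreal 1" using small[of 1] by auto
  have "integrable M (\<lambda>x. f N x - g x)"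
    using N by (intro integrableI_bounded) (auto simp: le_less_trans)
  from Bochner_Integration.integrable_diff[OF f[of N] this] have g: "integrable M g" by simp
  have "(\<lambda>n. \<integral>x. norm (f n x - g x) \<partial>M) \<longlonglongrightarrow> 0"
  proof (rule LIMSEQ_I)
    fix e :: real assume "e > 0"
    then obtain N where N: "\<And>i. i \<ge> N \<Longrightarrow> (\<integral>\<^sup>+x. norm (f i x - g x) \<partial>M) \<le> ennreal (e/2)"
      using small[of "e/2"] by auto
    have "norm ((\<integral>x. norm (f i x - g x) \<partial>M) - 0) < e" if "i \<ge> N" for i
    proof -
      have "ennreal (\<integral>x. norm (f i x - g x) \<partial>M) \<le> ennreal (e/2)"
        using N[OF that] f g by (subst (asm) nn_integral_eq_integral) auto
      then have "(\<integral>x. norm (f i x - g x) \<partial>M) \<le> e/2" using \<open>e > 0\<close> by simp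
      moreover have "(\<integral>x. norm (f i x - g x) \<partial>M) \<ge> 0" by simp
      ultimately show ?thesis using \<open>e > 0\<close> by simp
    qed
    then show "\<exists>no. \<forall>n\<ge>no. norm ((\<integral>x. norm (f n x - g x) \<partial>M) - 0) < e" by blast
  qed
  with that g r(1) ae show ?thesis by blast
qed

section \<open>Lebesgue measure on products and translations\<close>

lemma lebesgue_distr_translation: "distr lebesgue lebesgue (\<lambda>x::'a::euclidean_space. x + h) = lebesgue"
  and measurable_lebesgue_translation: "(\<lambda>x::'a. x + h) \<in> lebesgue \<rightarrow>\<^sub>M lebesgue"
proof -
  have eq: "(\<lambda>x. h + (\<Sum>j\<in>Basis. (1 * (x \<bullet> j)) *\<^sub>R j)) = (\<lambda>x::'a. x + h)"
    by (simp add: euclidean_representation add.commute)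
  show "distr lebesgue lebesgue (\<lambda>x::'a. x + h) = lebesgue"
    using lebesgue_affine_euclidean[of "\<lambda>_. 1" h] unfolding eq by (simp add: density_1)
  show "(\<lambda>x::'a. x + h) \<in> lebesgue \<rightarrow>\<^sub>M lebesgue"
    using lebesgue_affine_measurable[of "\<lambda>_. 1" h] unfolding eq by simp
qed

lemma nn_integral_translate:
  fixes f :: "'a::euclidean_space \<Rightarrow> ennreal"
  assumes "f \<in> borel_measurable lebesgue"
  shows "(\<integral>\<^sup>+x. f (x + h) \<partial>lebesgue) = (\<integral>\<^sup>+x. f x \<partial>lebesgue)"
  using nn_integral_distr[OF measurable_lebesgue_translation[of h], of f] assms
  by (simp add: lebesgue_distr_translation)

lemma integrable_translate:
  fixes f :: "'a::euclidean_space \<Rightarrow> 'b::euclidean_space"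
  assumes "integrable lebesgue f"
  shows "integrable lebesgue (\<lambda>x. f (x + h))"
  using integrable_distr[OF measurable_lebesgue_translation[of h], of f] assms
  by (simp add: lebesgue_distr_translation)

lemma integral_translate:
  fixes f :: "'a::euclidean_space \<Rightarrow> 'b::euclidean_space"
  assumes "f \<in> borel_measurable lebesgue"
  shows "(\<integral>x. f (x + h) \<partial>lebesgue) = (\<integral>x. f x \<partial>lebesgue)"
  using integral_distr[OF measurable_lebesgue_translation[of h] assms]
  by (simp add: lebesgue_distr_translation)

lemma AE_translate:
  assumes "AE x in lebesgue. P (x::'a::euclidean_space)"
  shows "AE x in lebesgue. P (x + h)"
  using AE_distrD[OF measurable_lebesgue_translation[of h], of P] assms
  unfolding lebesgue_distr_translation by blast

text \<open>On a product type \<open>lebesgue\<close> is the completion of the product of the Borel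
  measures, not the product of the completions. Almost-everywhere statements are therefore moved to
  \<open>lborel\<close>, where the product theorems apply, and back.\<close>

lemma AE_lebesgue_prodD:
  assumes "AE z in lebesgue. P (z::'a::euclidean_space \<times> 'b::euclidean_space)"
  shows "AE x in lebesgue. AE y in lebesgue. P (x, y)"
proof -
  have "AE z in lborel \<Otimes>\<^sub>M lborel. P z"
    using assms unfolding lborel_prod by (simp add: AE_completion_iff)
  then have "AE x in lborel. AE y in lborel. P (x, y)" by (rule lborel_pair.AE_pair)
  then show ?thesis by (simp add: AE_completion_iff)
qed

lemma AE_lebesgue_fst:
  assumes "AE x in lebesgue. P (x::'a::euclidean_space)"
  shows "AE z in lebesgue. P (fst (z :: 'a \<times> 'b::euclidean_space))"
proof -
  from assms have "AE x in lborel. P x" by (simp add: AE_completion_iff)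
  then obtain N where N: "N \<in> null_sets lborel" "{x. \<not> P x} \<subseteq> N"
    by (rule AE_E3) auto
  have "N \<times> (UNIV::'b set) \<in> null_sets (lborel \<Otimes>\<^sub>M lborel)"
    using N(1) by (intro lborel.times_in_null_sets1) auto
  then have "AE z in lborel \<Otimes>\<^sub>M lborel. P (fst (z :: 'a \<times> 'b))"
    by (rule AE_I') (use N in auto)
  then show ?thesis unfolding lborel_prod by (simp add: AE_completion_iff)
qed

lemma AE_lebesgue_snd:
  assumes "AE x in lebesgue. P (x::'b::euclidean_space)"
  shows "AE z in lebesgue. P (snd (z :: 'a::euclidean_space \<times> 'b))"
proof -
  from assms have "AE x in lborel. P x" by (simp add: AE_completion_iff)
  then obtain N where N: "N \<in> null_sets lborel" "{x. \<not> P x} \<subseteq> N"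
    by (rule AE_E3) auto
  have "(UNIV::'a set) \<times> N \<in> null_sets (lborel \<Otimes>\<^sub>M lborel)"
    using N(1) by (intro lborel.times_in_null_sets2) auto
  then have "AE z in lborel \<Otimes>\<^sub>M lborel. P (snd (z :: 'a \<times> 'b))"
    by (rule AE_I') (use N in auto)
  then show ?thesis unfolding lborel_prod by (simp add: AE_completion_iff)
qed

lemma borel_representative:
  fixes f :: "'a::euclidean_space \<Rightarrow> 'b::euclidean_space"
  assumes "f \<in> borel_measurable lebesgue"
  obtains g where "g \<in> borel_measurable borel" "AE x in lebesgue. f x = g x"
proof -
  have "\<exists>g\<in>borel_measurable lborel. AE x in lborel. f x \<bullet> i = g x" for i
    using assms by (intro completion_ex_borel_measurable_real borel_measurable_inner) auto
  then obtain g where g: "\<And>i. g i \<in> borel_measurable lborel" "\<And>i. AE x in lborel. f x \<bullet> i = g i x"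
    by metis
  show ?thesis
  proof
    show "(\<lambda>x. \<Sum>i\<in>Basis. g i x *\<^sub>R i) \<in> borel_measurable borel"
      using g(1) by (intro borel_measurable_sum borel_measurable_scaleR) auto
    have "AE x in lborel. \<forall>i\<in>Basis. f x \<bullet> i = g i x"
      using g(2) by (intro AE_finite_allI) auto
    then have "AE x in lebesgue. \<forall>i\<in>Basis. f x \<bullet> i = g i x" by (simp add: AE_completion_iff)
    then show "AE x in lebesgue. f x = (\<Sum>i\<in>Basis. g i x *\<^sub>R i)"
    proof eventually_elim
      case (elim x)
      then have "(\<Sum>i\<in>Basis. g i x *\<^sub>R i) = (\<Sum>i\<in>Basis. (f x \<bullet> i) *\<^sub>R i)" by (intro sum.cong) auto
      then show ?case by (simp add: euclidean_representation)
    qed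
  qed
qed

lemma lebesgue_measurable_cong_AE:
  assumes "g \<in> lebesgue \<rightarrow>\<^sub>M borel" "AE x in lebesgue. f x = g x"
  shows "(f::'a::euclidean_space \<Rightarrow> 'b::euclidean_space) \<in> borel_measurable lebesgue"
proof (rule measurableI)
  fix S :: "'b set" assume S: "S \<in> sets borel"
  obtain N where N: "N \<in> null_sets lebesgue" "{x. f x \<noteq> g x} \<subseteq> N"
    by (rule AE_E3[OF assms(2)]) auto
  have "f -` S \<inter> N \<in> null_sets lebesgue" using N(1) by (intro null_sets_completion_subset[OF _ N(1)]) auto
  then have 1: "f -` S \<inter> N \<in> sets lebesgue" by (rule null_setsD2)
  have 2: "g -` S - N \<in> sets lebesgue"
    using measurable_sets[OF assms(1) S] null_setsD2[OF N(1)] by auto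
  have "f -` S \<inter> space lebesgue = (f -` S \<inter> N) \<union> (g -` S - N)" using N(2) by auto
  then show "f -` S \<inter> space lebesgue \<in> sets lebesgue" using 1 2 by (metis sets.Un)
qed simp

text \<open>The cylinder over a null set is null, so a Borel representative of f stays one after
  composition with the projection.\<close>

lemma measurable_fst_lebesgue:
  assumes "f \<in> borel_measurable lebesgue"
  shows "(\<lambda>z. f (fst (z::'a::euclidean_space \<times> 'c::euclidean_space)) :: 'b::euclidean_space) \<in> borel_measurable lebesgue"
proof -
  obtain g where [measurable]: "g \<in> borel_measurable borel" and g: "AE x in lebesgue. f x = g x"
    using borel_representative[OF assms] .
  show ?thesis
    by (rule lebesgue_measurable_cong_AE[of "\<lambda>z. g (fst z)"])
      (auto intro!: AE_lebesgue_fst g measurable_completion simp: borel_prod[symmetric])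
qed

lemma measurable_snd_lebesgue:
  assumes "f \<in> borel_measurable lebesgue"
  shows "(\<lambda>z. f (snd (z::'a::euclidean_space \<times> 'c::euclidean_space)) :: 'b::euclidean_space) \<in> borel_measurable lebesgue"
proof -
  obtain g where [measurable]: "g \<in> borel_measurable borel" and g: "AE x in lebesgue. f x = g x"
    using borel_representative[OF assms] .
  show ?thesis
    by (rule lebesgue_measurable_cong_AE[of "\<lambda>z. g (snd z)"])
      (auto intro!: AE_lebesgue_snd g measurable_completion simp: borel_prod[symmetric])
qed

text \<open>Off a Borel null set the integrand agrees with a Borel function, and almost every slice
  of that null set, in either direction, is null. So Tonelli's theorem for Borel functions carries
  over, although single slices of f may fail to be measurable.\<close>

lemma nn_integral_lebesgue_prod:
  fixes f :: "'a::euclidean_space \<times> 'b::euclidean_space \<Rightarrow> ennreal"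
  assumes "f \<in> borel_measurable lebesgue"
  shows "(\<integral>\<^sup>+z. f z \<partial>lebesgue) = (\<integral>\<^sup>+x. \<integral>\<^sup>+y. f (x, y) \<partial>lebesgue \<partial>lebesgue)"
    and "(\<integral>\<^sup>+z. f z \<partial>lebesgue) = (\<integral>\<^sup>+y. \<integral>\<^sup>+x. f (x, y) \<partial>lebesgue \<partial>lebesgue)"
proof -
  obtain g where g: "g \<in> borel_measurable lborel" "AE z in lborel. f z = g z"
    using completion_ex_borel_measurable[OF assms] by auto
  have gm[measurable]: "g \<in> borel_measurable (lborel \<Otimes>\<^sub>M lborel)" using g(1) by (simp add: lborel_prod)
  have ae: "AE z in lebesgue. f z = g z" using g(2) by (simp add: AE_completion_iff)
  have 0: "(\<integral>\<^sup>+z. f z \<partial>lebesgue) = (\<integral>\<^sup>+z. g z \<partial>(lborel \<Otimes>\<^sub>M lborel))"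
    using nn_integral_cong_AE[OF ae] unfolding lborel_prod by (simp only: nn_integral_completion)
  have "(\<integral>\<^sup>+z. g z \<partial>(lborel \<Otimes>\<^sub>M lborel)) = (\<integral>\<^sup>+x. \<integral>\<^sup>+y. g (x, y) \<partial>lborel \<partial>lborel)"
    by (simp add: lborel.nn_integral_fst)
  also have "\<dots> = (\<integral>\<^sup>+x. \<integral>\<^sup>+y. g (x, y) \<partial>lebesgue \<partial>lebesgue)"
    by (simp add: nn_integral_completion)
  also have "\<dots> = (\<integral>\<^sup>+x. \<integral>\<^sup>+y. f (x, y) \<partial>lebesgue \<partial>lebesgue)"
    by (rule nn_integral_cong_AE, use AE_lebesgue_prodD[OF ae] in eventually_elim)
      (rule nn_integral_cong_AE, auto elim: eventually_mono)
  finally show "(\<integral>\<^sup>+z. f z \<partial>lebesgue) = (\<integral>\<^sup>+x. \<integral>\<^sup>+y. f (x, y) \<partial>lebesgue \<partial>lebesgue)"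
    using 0 by simp
  obtain N where N: "N \<in> null_sets lborel" "{z. f z \<noteq> g z} \<subseteq> N"
    by (rule AE_E3[OF g(2)]) fastforce
  then have Ns[measurable]: "N \<in> sets (lborel \<Otimes>\<^sub>M lborel)" unfolding lborel_prod by auto
  have "AE z in lborel \<Otimes>\<^sub>M lborel. z \<notin> N" using N(1) by (simp add: lborel_prod AE_not_in)
  then have "AE x in lborel. AE y in lborel. (x, y) \<notin> N" by (rule lborel_pair.AE_pair)
  then have "AE y in lborel. AE x in lborel. (x, y) \<notin> N"
    by (subst (asm) lborel_pair.AE_commute) measurable
  then have ae2: "AE y in lebesgue. AE x in lebesgue. f (x, y) = g (x, y)"
    unfolding AE_completion_iff by (elim eventually_mono) (use N(2) in auto)
  have "(\<integral>\<^sup>+z. g z \<partial>(lborel \<Otimes>\<^sub>M lborel)) = (\<integral>\<^sup>+y. \<integral>\<^sup>+x. g (x, y) \<partial>lborel \<partial>lborel)"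
    by (simp add: lborel_pair.nn_integral_snd)
  also have "\<dots> = (\<integral>\<^sup>+y. \<integral>\<^sup>+x. g (x, y) \<partial>lebesgue \<partial>lebesgue)"
    by (simp add: nn_integral_completion)
  also have "\<dots> = (\<integral>\<^sup>+y. \<integral>\<^sup>+x. f (x, y) \<partial>lebesgue \<partial>lebesgue)"
    by (rule nn_integral_cong_AE, use ae2 in eventually_elim)
      (rule nn_integral_cong_AE, auto elim: eventually_mono)
  finally show "(\<integral>\<^sup>+z. f z \<partial>lebesgue) = (\<integral>\<^sup>+y. \<integral>\<^sup>+x. f (x, y) \<partial>lebesgue \<partial>lebesgue)"
    using 0 by simp
qed

text \<open>Enclose A between a compact K and an open U with U - K of small measure. A shift shorter
  than the distance from K to the complement of U changes the indicator at x only if x or x + h lies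
  in U - K.\<close>

lemma indicator_L1_continuity:
  fixes A :: "'a::euclidean_space set"
  assumes A: "A \<in> sets lebesgue" "emeasure lebesgue A < \<infinity>" and e: "e > 0"
  shows "\<exists>d>0. \<forall>h. norm h < d \<longrightarrow> (\<integral>x. \<bar>indicator A (x + h) - indicator A x :: real\<bar> \<partial>lebesgue) < e"
proof -
  \<comment> \<open>\<open>D\<close> below consists of three pieces of measure less than e' and
    enters the final bound twice, so 6 e' must not exceed e.\<close>
  define e' where "e' = e / 16"
  have e': "e' > 0" using e by (simp add: e'_def)
  obtain U where U: "open U" "A \<subseteq> U" "U - A \<in> lmeasurable" "emeasure lebesgue (U - A) < ennreal e'"
    using sets_lebesgue_outer_open[OF A(1) e'] by auto
  obtain T where T: "closed T" "T \<subseteq> A" "A - T \<in> lmeasurable" "emeasure lebesgue (A - T) < ennreal e'"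
    using sets_lebesgue_inner_closed[OF A(1) e'] by auto
  have AL: "A \<in> lmeasurable" using A by (simp add: fmeasurable_def)
  have TL: "T \<in> lmeasurable" using fmeasurable_Diff[OF AL, of "A - T"] T
    by (metis Diff_Diff_Int fmeasurableD inf.absorb_iff2)
  \<comment> \<open>Inner regularity supplies only a closed set; intersecting it with a large ball
    makes it compact at the cost of another e'.\<close>
  have "(\<lambda>n. measure lebesgue (T \<inter> cball 0 (real n))) \<longlonglongrightarrow> measure lebesgue (\<Union>n. T \<inter> cball 0 (real n))"
  proof (rule Lim_measure_incseq)
    show "range (\<lambda>n. T \<inter> cball 0 (real n)) \<subseteq> sets lebesgue" using TL by auto
    show "incseq (\<lambda>n. T \<inter> cball 0 (real n))" by (auto simp: incseq_def)
    have "emeasure lebesgue (\<Union>n. T \<inter> cball 0 (real n)) \<le> emeasure lebesgue T"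
      using TL by (intro emeasure_mono) auto
    then show "emeasure lebesgue (\<Union>n. T \<inter> cball 0 (real n)) \<noteq> \<infinity>" using TL
      by (metis fmeasurableD2 infinity_ennreal_def top.extremum_uniqueI)
  qed
  moreover have "(\<Union>n. T \<inter> cball 0 (real n)) = T" by (auto simp: real_arch_simple)
  ultimately have "eventually (\<lambda>n. measure lebesgue (T \<inter> cball 0 (real n)) > measure lebesgue T - e') sequentially"
    using e' by (intro order_tendstoD) auto
  then obtain n where n: "measure lebesgue (T \<inter> cball 0 (real n)) > measure lebesgue T - e'"
    by (auto simp: eventually_sequentially)
  define K where "K = T \<inter> cball 0 (real n)"
  have K: "compact K" using T(1) by (auto simp: K_def intro: closed_Int_compact)
  have KL: "K \<in> lmeasurable" using K by (rule lmeasurable_compact)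
  have "K \<subseteq> T" "K \<subseteq> U" using T U by (auto simp: K_def)
  obtain d where d: "d > 0" "(\<Union>x\<in>K. ball x d) \<subseteq> U"
    using compact_subset_open_imp_ball_epsilon_subset[OF K U(1) \<open>K \<subseteq> U\<close>] by auto
  define D where "D = U - K"
  have D_eq: "D = (U - A) \<union> (A - T) \<union> (T - K)" using T U \<open>K \<subseteq> T\<close> by (auto simp: D_def)
  have TK: "T - K \<in> lmeasurable" using TL KL by (intro fmeasurable_Diff) auto
  have DL: "D \<in> lmeasurable" unfolding D_eq using U T TK by (intro fmeasurable.Un) auto
  have "measure lebesgue (T - K) = measure lebesgue T - measure lebesgue K"
    using TL KL \<open>K \<subseteq> T\<close> by (intro measurable_measure_Diff) auto
  then have "measure lebesgue (T - K) < e'" using n by (simp add: K_def)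
  moreover have "measure lebesgue (U - A) < e'" "measure lebesgue (A - T) < e'"
    using U(4) T(4) emeasure_eq_measure2[OF U(3)] emeasure_eq_measure2[OF T(3)]
    by (simp_all add: ennreal_less_iff)
  moreover have "measure lebesgue D \<le> measure lebesgue (U - A) + measure lebesgue (A - T) + measure lebesgue (T - K)"
    unfolding D_eq using U T TK
    by (intro order_trans[OF measure_Un_le] add_right_mono) (auto intro: measure_Un_le)
  ultimately have mD: "measure lebesgue D < 3 * e'" and "0 \<le> measure lebesgue D" by simp_all
  have iD: "integrable lebesgue (indicator D :: 'a \<Rightarrow> real)"
    using fmeasurableD[OF DL] fmeasurableD2[OF DL] by (intro integrable_real_indicator) (auto simp: less_top)
  have "(\<integral>x. \<bar>indicator A (x + h) - indicator A x :: real\<bar> \<partial>lebesgue) < e" if h: "norm h < d" for h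
  proof -
    have "\<bar>indicator A (x + h) - indicator A x :: real\<bar> \<le> indicator D x + indicator D (x + h)" for x
    proof -
      have "x + h \<in> U" if "x \<in> K"
        using d(2) that h by (force simp: dist_norm)
      moreover have "x \<in> U" if "x + h \<in> K"
        using d(2) that h by (force simp: dist_norm)
      ultimately show ?thesis
        using U(2) T(2) \<open>K \<subseteq> T\<close> by (auto simp: D_def split: split_indicator)
    qed
    then have "(\<integral>x. \<bar>indicator A (x + h) - indicator A x :: real\<bar> \<partial>lebesgue)
      \<le> (\<integral>x. indicator D x + indicator D (x + h) \<partial>lebesgue)"
      using iD integrable_translate[OF iD, of h]
      by (intro integral_mono_AE') auto
    also have "\<dots> = measure lebesgue D + measure lebesgue D"
      using iD integrable_translate[OF iD, of h] integral_translate[of "indicator D :: 'a \<Rightarrow> real" h] DL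
      by simp
    also have "\<dots> < e" using mD e by (simp add: e'_def)
    finally show ?thesis .
  qed
  then show ?thesis using d(1) by blast
qed

lemma L1_translation_continuity:
  fixes f :: "'a::euclidean_space \<Rightarrow> 'b::euclidean_space"
  assumes "integrable lebesgue f"
  shows "\<forall>e>0. \<exists>d>0. \<forall>h. norm h < d \<longrightarrow> (\<integral>x. norm (f (x + h) - f x) \<partial>lebesgue) < e"
  using assms
proof (induction rule: integrable_induct)
  case (base A c)
  show ?case
  proof (intro allI impI)
    fix e :: real assume e: "e > 0"
    then have "e / (norm c + 1) > 0" by (simp add: add_nonneg_pos)
    from indicator_L1_continuity[OF base this]
    obtain d where d: "d > 0" "\<And>h. norm h < d \<Longrightarrow> (\<integral>x. \<bar>indicator A (x + h) - indicator A x :: real\<bar> \<partial>lebesgue) < e / (norm c + 1)"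
      by blast
    have "(\<integral>x. norm (indicator A (x + h) *\<^sub>R c - indicator A x *\<^sub>R c) \<partial>lebesgue) < e" if "norm h < d" for h
    proof -
      have "(\<integral>x. norm (indicator A (x + h) *\<^sub>R c - indicator A x *\<^sub>R c) \<partial>lebesgue)
         = (\<integral>x. \<bar>indicator A (x + h) - indicator A x :: real\<bar> * norm c \<partial>lebesgue)"
        by (simp add: scaleR_left_diff_distrib[symmetric])
      also have "\<dots> = (\<integral>x. \<bar>indicator A (x + h) - indicator A x :: real\<bar> \<partial>lebesgue) * norm c" by simp
      also have "\<dots> \<le> e / (norm c + 1) * norm c"
        using d(2)[OF that] by (intro mult_right_mono) auto
      also have "\<dots> < e" using e by (simp add: divide_simps add_nonneg_pos)
      finally show ?thesis .
    qed
    then show "\<exists>d>0. \<forall>h. norm h < d \<longrightarrow> (\<integral>x. norm (indicator A (x + h) *\<^sub>R c - indicator A x *\<^sub>R c) \<partial>lebesgue) < e"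
      using d(1) by blast
  qed
next
  case (add f g)
  show ?case
  proof (intro allI impI)
    fix e :: real assume e: "e > 0"
    obtain d1 where d1: "d1 > 0" "\<And>h. norm h < d1 \<Longrightarrow> (\<integral>x. norm (f (x + h) - f x) \<partial>lebesgue) < e / 2"
      using add(3) e by (meson half_gt_zero)
    obtain d2 where d2: "d2 > 0" "\<And>h. norm h < d2 \<Longrightarrow> (\<integral>x. norm (g (x + h) - g x) \<partial>lebesgue) < e / 2"
      using add(4) e by (meson half_gt_zero)
    have "(\<integral>x. norm ((f (x + h) + g (x + h)) - (f x + g x)) \<partial>lebesgue) < e" if "norm h < min d1 d2" for h
    proof -
      have i: "integrable lebesgue (\<lambda>x. f (x + h) - f x)" "integrable lebesgue (\<lambda>x. g (x + h) - g x)"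
        using add(1,2) by (auto intro: integrable_translate)
      have "(\<integral>x. norm ((f (x + h) + g (x + h)) - (f x + g x)) \<partial>lebesgue)
         \<le> (\<integral>x. norm (f (x + h) - f x) + norm (g (x + h) - g x) \<partial>lebesgue)"
        using i Bochner_Integration.integrable_add[OF i]
        by (intro integral_mono) (auto simp: algebra_simps intro!: order_trans[OF _ norm_triangle_ineq])
      also have "\<dots> < e" using i d1(2)[of h] d2(2)[of h] that by simp
      finally show ?thesis .
    qed
    then show "\<exists>d>0. \<forall>h. norm h < d \<longrightarrow> (\<integral>x. norm ((f (x + h) + g (x + h)) - (f x + g x)) \<partial>lebesgue) < e"
      using d1(1) d2(1) by (intro exI[of _ "min d1 d2"]) auto
  qed
next
  case (lim f s)
  show ?case
  proof (intro allI impI)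
    fix e :: real assume e: "e > 0"
    have "(\<lambda>i. \<integral>x. norm (s i x - f x) \<partial>lebesgue) \<longlonglongrightarrow> (\<integral>x. norm (f x - f x) \<partial>lebesgue)"
    proof (rule integral_dominated_convergence[where w="\<lambda>x. 3 * norm (f x)"])
      show "AE x in lebesgue. (\<lambda>i. norm (s i x - f x)) \<longlonglongrightarrow> norm (f x - f x)"
        using lim.hyps(2) by (intro AE_I2 tendsto_intros) blast
      have "norm (s i x - f x) \<le> 3 * norm (f x)" for i x
        using lim.hyps(3)[of x i] norm_triangle_ineq4[of "s i x" "f x"] by simp
      then show "AE x in lebesgue. norm (norm (s i x - f x)) \<le> 3 * norm (f x)" for i by simp
    qed (use lim in auto)
    then have "eventually (\<lambda>i. (\<integral>x. norm (s i x - f x) \<partial>lebesgue) < e / 3) sequentially"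
      using e by (intro order_tendstoD) auto
    then obtain i where i: "(\<integral>x. norm (s i x - f x) \<partial>lebesgue) < e / 3"
      by (auto simp: eventually_sequentially)
    obtain d where d: "d > 0" "\<And>h. norm h < d \<Longrightarrow> (\<integral>x. norm (s i (x + h) - s i x) \<partial>lebesgue) < e / 3"
      using lim.IH[of i] e by (meson divide_pos_pos zero_less_numeral)
    have "(\<integral>x. norm (f (x + h) - f x) \<partial>lebesgue) < e" if "norm h < d" for h
    proof -
      have j: "integrable lebesgue (\<lambda>x. s i x - f x)" using lim by auto
      note j' = integrable_translate[OF j, of h]
      have k: "integrable lebesgue (\<lambda>x. s i (x + h) - s i x)" by (intro Bochner_Integration.integrable_diff integrable_translate lim.hyps(1))
      have "norm (f (x + h) - f x) \<le> norm (s i (x + h) - f (x + h)) + norm (s i (x + h) - s i x) + norm (s i x - f x)" for x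
        by norm
      then have "(\<integral>x. norm (f (x + h) - f x) \<partial>lebesgue)
        \<le> (\<integral>x. norm (s i (x + h) - f (x + h)) + norm (s i (x + h) - s i x) + norm (s i x - f x) \<partial>lebesgue)"
        using j j' k by (intro integral_mono_AE') auto
      also have "\<dots> = (\<integral>x. norm (s i (x + h) - f (x + h)) \<partial>lebesgue) + (\<integral>x. norm (s i (x + h) - s i x) \<partial>lebesgue) + (\<integral>x. norm (s i x - f x) \<partial>lebesgue)"
        using j j' k by simp
      also have "(\<integral>x. norm (s i (x + h) - f (x + h)) \<partial>lebesgue) = (\<integral>x. norm (s i x - f x) \<partial>lebesgue)"
        using j integral_translate[of "\<lambda>x. norm (s i x - f x)" h] by auto
      finally show ?thesis using i d(2)[OF that] by simp
    qed
    then show "\<exists>d>0. \<forall>h. norm h < d \<longrightarrow> (\<integral>x. norm (f (x + h) - f x) \<partial>lebesgue) < e"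
      using d(1) by blast
  qed
qed

section \<open>Test functions and the fundamental lemma\<close>

lemma has_derivative_frechet: "(f has_derivative f') (at x) \<Longrightarrow> frechet_derivative f (at x) = f'"
  by (metis frechet_derivative_at)

lemma times_cont_diff_Suc_imp: "times_cont_diff (Suc k) f \<Longrightarrow> times_cont_diff k f"
proof (induction k arbitrary: f)
  case 0
  then show ?case
    by (auto intro!: continuous_at_imp_continuous_on differentiable_imp_continuous_within)
next
  case (Suc k)
  then show ?case by (metis times_cont_diff.simps(2))
qed

lemma times_cont_diff_const: "times_cont_diff k (\<lambda>x. c)"
  by (induction k arbitrary: c) simp_all

lemma times_cont_diff_add:
  "times_cont_diff k f \<Longrightarrow> times_cont_diff k g \<Longrightarrow> times_cont_diff k (\<lambda>x. f x + g x)"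
proof (induction k arbitrary: f g)
  case 0
  then show ?case by (auto intro: continuous_on_add)
next
  case (Suc k)
  have "frechet_derivative (\<lambda>x. f x + g x) (at x) =
      (\<lambda>i. frechet_derivative f (at x) i + frechet_derivative g (at x) i)" for x
    using Suc.prems by (intro has_derivative_frechet has_derivative_add) (auto simp: frechet_derivative_works[symmetric])
  then show ?case using Suc by auto
qed

lemma times_cont_diff_mult:
  "times_cont_diff k f \<Longrightarrow> times_cont_diff k g \<Longrightarrow> times_cont_diff k (\<lambda>x. f x * g x)"
proof (induction k arbitrary: f g)
  case 0
  then show ?case by (auto intro: continuous_on_mult)
next
  case (Suc k)
  have "frechet_derivative (\<lambda>x. f x * g x) (at x) =
      (\<lambda>i. f x * frechet_derivative g (at x) i + frechet_derivative f (at x) i * g x)" for x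
    using Suc.prems by (intro has_derivative_frechet has_derivative_mult) (auto simp: frechet_derivative_works[symmetric])
  moreover have "times_cont_diff k f" "times_cont_diff k g"
    using Suc.prems by (auto intro: times_cont_diff_Suc_imp)
  ultimately show ?case using Suc by (auto intro!: times_cont_diff_add)
qed

lemma times_cont_diff_prod:
  "finite I \<Longrightarrow> (\<And>i. i \<in> I \<Longrightarrow> times_cont_diff k (f i)) \<Longrightarrow> times_cont_diff k (\<lambda>x. \<Prod>i\<in>I. f i x)"
  by (induction I rule: finite_induct) (auto intro: times_cont_diff_const times_cont_diff_mult)

text \<open>The family d lists all derivatives of a function of one variable, so that the induction
  on k can pass from \<open>d n\<close> to \<open>d (Suc n)\<close> for arbitrary n.\<close>

lemma times_cont_diff_ridge:
  fixes d :: "nat \<Rightarrow> real \<Rightarrow> real" and w :: "'a::euclidean_space"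
  assumes d: "\<And>n t. (d n has_real_derivative d (Suc n) t) (at t)"
  shows "times_cont_diff k (\<lambda>x. d n (x \<bullet> w + c))"
proof (induction k arbitrary: n)
  case 0
  have "continuous_on UNIV (d n)"
    using d by (meson DERIV_isCont continuous_at_imp_continuous_on)
  then have "continuous_on UNIV (\<lambda>x::'a. d n (x \<bullet> w + c))"
    by (rule continuous_on_compose2) (auto intro!: continuous_intros)
  then show ?case by simp
next
  case (Suc k)
  have D: "((\<lambda>x::'a. d n (x \<bullet> w + c)) has_derivative (\<lambda>h. (h \<bullet> w) * d (Suc n) (x \<bullet> w + c))) (at x)" for x
  proof -
    have "((\<lambda>x::'a. x \<bullet> w + c) has_derivative (\<lambda>h. h \<bullet> w)) (at x)"
      by (auto intro!: derivative_eq_intros)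
    moreover have "(d n has_derivative (\<lambda>h. d (Suc n) (x \<bullet> w + c) * h)) (at (x \<bullet> w + c))"
      using d[of n "x \<bullet> w + c"] by (simp add: has_field_derivative_def)
    ultimately show ?thesis
      using has_derivative_compose[of "\<lambda>x. x \<bullet> w + c" "\<lambda>h. h \<bullet> w" x UNIV "d n"] by (simp add: mult.commute)
  qed
  then have "frechet_derivative (\<lambda>x. d n (x \<bullet> w + c)) (at x) = (\<lambda>h. (h \<bullet> w) * d (Suc n) (x \<bullet> w + c))" for x
    by (intro has_derivative_frechet)
  moreover have "(\<lambda>x::'a. d n (x \<bullet> w + c)) differentiable at x" for x
    using D unfolding differentiable_def by blast
  ultimately show ?case
    using Suc by (auto intro!: times_cont_diff_mult times_cont_diff_const)
qed

text \<open>The \<open>n\<close>-th derivative of \<open>exp (- 1 / t)\<close> is a polynomial in \<open>1 / t\<close> times \<open>exp (- 1 / t)\<close>.\<close>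

primrec flat_poly :: "nat \<Rightarrow> real poly" where
  "flat_poly 0 = 1"
| "flat_poly (Suc n) = [:0, 0, 1:] * (flat_poly n - pderiv (flat_poly n))"

definition flat_deriv :: "nat \<Rightarrow> real \<Rightarrow> real" where
  "flat_deriv n t = (if t > 0 then poly (flat_poly n) (1 / t) * exp (- (1 / t)) else 0)"

lemma poly_times_exp_tendsto_0: "((\<lambda>s. poly q s * exp (- s)) \<longlongrightarrow> (0::real)) at_top"
proof -
  have "((\<lambda>s. \<Sum>i\<le>degree q. coeff q i * (s ^ i / exp s)) \<longlongrightarrow> (\<Sum>i\<le>degree q. coeff q i * 0)) at_top"
    by (intro tendsto_intros tendsto_power_div_exp_0)
  then show ?thesis
    by (simp add: poly_altdef exp_minus sum_divide_distrib divide_inverse sum_distrib_right mult.assoc)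
qed

text \<open>At 0 the right-hand difference quotient is s P(s) exp (- s) with s = 1 / h, which tends
  to 0 for every polynomial P; the left-hand one vanishes.\<close>

lemma flat_deriv_has_derivative: "(flat_deriv n has_real_derivative flat_deriv (Suc n) t) (at t)"
proof -
  consider "t > 0" | "t < 0" | "t = 0" by linarith
  then show ?thesis
  proof cases
    case 1
    have "((\<lambda>t. poly (flat_poly n) (1 / t) * exp (- (1 / t))) has_real_derivative flat_deriv (Suc n) t) (at t)"
      using 1 by (auto intro!: derivative_eq_intros DERIV_chain2[OF poly_DERIV]
          simp: flat_deriv_def field_simps power2_eq_square)
    then show ?thesis
      by (rule has_field_derivative_transform_within_open[where S="{0<..}"])
        (use 1 in \<open>auto simp: flat_deriv_def\<close>)
  next
    case 2
    have "((\<lambda>t. 0) has_real_derivative flat_deriv (Suc n) t) (at t)"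
      using 2 by (auto simp: flat_deriv_def)
    then show ?thesis
      by (rule has_field_derivative_transform_within_open[where S="{..<0}"])
        (use 2 in \<open>auto simp: flat_deriv_def\<close>)
  next
    case 3
    have "((\<lambda>s. poly ([:0, 1:] * flat_poly n) s * exp (- s)) \<longlongrightarrow> 0) at_top"
      by (rule poly_times_exp_tendsto_0)
    then have "((\<lambda>h. poly ([:0, 1:] * flat_poly n) (inverse h) * exp (- inverse h)) \<longlongrightarrow> 0) (at_right 0)"
      by (rule filterlim_compose[OF _ filterlim_inverse_at_top_right])
    then have r: "((\<lambda>h. flat_deriv n h / h) \<longlongrightarrow> 0) (at_right 0)"
      by (rule Lim_transform_eventually)
        (auto simp: eventually_at_right_less flat_deriv_def field_simps
          intro!: eventually_mono[OF eventually_at_right_less[of 0]])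
    have l: "((\<lambda>h. flat_deriv n h / h) \<longlongrightarrow> 0) (at_left 0)"
      by (rule tendsto_eventually)
        (auto simp: flat_deriv_def eventually_at_left_field intro!: exI[of _ "-1"])
    have "((\<lambda>h. flat_deriv n h / h) \<longlongrightarrow> 0) (at 0)"
      by (rule filterlim_split_at[OF l r])
    then show ?thesis
      using 3 by (simp add: has_field_derivative_iff flat_deriv_def[of _ 0])
  qed
qed

definition flat :: "real \<Rightarrow> real" where
  "flat t = (if t > 0 then exp (- (1 / t)) else 0)"

lemma flat_eq: "flat = flat_deriv 0"
  by (auto simp: flat_def flat_deriv_def)

lemma flat_bounds: "0 \<le> flat t" "flat t \<le> 1"
  by (auto simp: flat_def)

lemma flat_tendsto: "(\<lambda>m. flat (real (Suc m) * t)) \<longlonglongrightarrow> (if t > 0 then 1 else 0)"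
proof (cases "t > 0")
  case True
  have "(\<lambda>m. exp (- (1 / t * inverse (real (Suc m))))) \<longlonglongrightarrow> exp (- (1 / t * 0))"
    by (intro tendsto_intros LIMSEQ_inverse_real_of_nat)
  then show ?thesis using True by (simp add: flat_def field_simps del: of_nat_Suc)
next
  case False
  then have "flat (real (Suc m) * t) = 0" for m
    by (auto simp: flat_def zero_less_mult_iff simp del: of_nat_Suc)
  then show ?thesis using False by simp
qed

text \<open>Steepening by the factor \<open>Suc m\<close> makes these smooth functions converge
  pointwise to the indicator of the open box, since there every argument of \<open>flat\<close>
  tends to infinity. They provide enough test functions without convolution.\<close>

definition box_bump :: "'a::euclidean_space \<Rightarrow> 'a \<Rightarrow> nat \<Rightarrow> 'a \<Rightarrow> real" where
  "box_bump a b m x = (\<Prod>i\<in>Basis. flat (real (Suc m) * (x \<bullet> i - a \<bullet> i)) * flat (real (Suc m) * (b \<bullet> i - x \<bullet> i)))"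

lemma box_bump_bounds: "0 \<le> box_bump a b m x" "box_bump a b m x \<le> 1"
  unfolding box_bump_def
  by (auto intro!: prod_nonneg prod_le_1 mult_le_one simp: flat_bounds simp del: of_nat_Suc)

lemma box_bump_eq_0: "x \<notin> box a b \<Longrightarrow> box_bump a b m x = 0"
proof -
  assume "x \<notin> box a b"
  then obtain i where i: "i \<in> Basis" "x \<bullet> i \<le> a \<bullet> i \<or> b \<bullet> i \<le> x \<bullet> i"
    by (auto simp: mem_box not_less)
  then have "flat (real (Suc m) * (x \<bullet> i - a \<bullet> i)) * flat (real (Suc m) * (b \<bullet> i - x \<bullet> i)) = 0"
    by (auto simp: flat_def zero_less_mult_iff simp del: of_nat_Suc)
  then show ?thesis unfolding box_bump_def using i(1) by (intro prod_zero) auto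
qed

lemma box_bump_tendsto: "(\<lambda>m. box_bump a b m x) \<longlonglongrightarrow> indicator (box a b) x"
proof -
  have "(\<lambda>m. box_bump a b m x) \<longlonglongrightarrow>
     (\<Prod>i\<in>Basis. (if x \<bullet> i - a \<bullet> i > 0 then 1 else 0) * (if b \<bullet> i - x \<bullet> i > 0 then 1 else 0))"
    unfolding box_bump_def by (intro tendsto_prod tendsto_mult flat_tendsto)
  also have "(\<Prod>i\<in>Basis. (if x \<bullet> i - a \<bullet> i > 0 then 1 else 0) * (if b \<bullet> i - x \<bullet> i > 0 then 1 else 0 :: real)) = indicator (box a b) x"
  proof (cases "x \<in> box a b")
    case True
    then show ?thesis by (auto simp: mem_box)
  next
    case False
    then obtain i where "i \<in> Basis" "x \<bullet> i \<le> a \<bullet> i \<or> b \<bullet> i \<le> x \<bullet> i"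
      by (auto simp: mem_box not_less)
    then have "(\<Prod>i\<in>Basis. (if x \<bullet> i - a \<bullet> i > 0 then 1 else 0) * (if b \<bullet> i - x \<bullet> i > 0 then 1 else 0 :: real)) = 0"
      by (intro prod_zero) force+
    then show ?thesis using False by simp
  qed
  finally show ?thesis .
qed

lemma test_function_box_bump: "test_function (box_bump a b m)"
proof -
  have "times_cont_diff k (box_bump a b m)" for k
  proof -
    have "times_cont_diff k (\<lambda>x. flat (real (Suc m) * (x \<bullet> i - a \<bullet> i)))" for i
      using times_cont_diff_ridge[of flat_deriv, OF flat_deriv_has_derivative, of k 0 "real (Suc m) *\<^sub>R i" "- real (Suc m) * (a \<bullet> i)"]
      unfolding flat_eq by (simp add: algebra_simps del: of_nat_Suc)
    moreover have "times_cont_diff k (\<lambda>x. flat (real (Suc m) * (b \<bullet> i - x \<bullet> i)))" for i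
      using times_cont_diff_ridge[of flat_deriv, OF flat_deriv_has_derivative, of k 0 "- real (Suc m) *\<^sub>R i" "real (Suc m) * (b \<bullet> i)"]
      unfolding flat_eq by (simp add: algebra_simps del: of_nat_Suc)
    ultimately show ?thesis
      unfolding box_bump_def by (intro times_cont_diff_prod times_cont_diff_mult) auto
  qed
  moreover have "closure {x. box_bump a b m x \<noteq> 0} \<subseteq> cbox a b"
    using box_bump_eq_0[of _ a b m] box_subset_cbox[of a b] by (intro closure_minimal) blast+
  then have "compact (closure {x. box_bump a b m x \<noteq> 0})"
    by (metis closed_closure compact_Int_closed compact_cbox inf.absorb_iff2)
  ultimately show ?thesis unfolding test_function_def by blast
qed

text \<open>The positive and the negative part, taken as densities, define measures that agree on
  boxes. Boxes form an intersection-stable generator, so the measures are equal, the two parts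
  coincide almost everywhere, and both vanish.\<close>

lemma AE_zero_if_box_integrals_zero:
  fixes f :: "'a::euclidean_space \<Rightarrow> real"
  assumes f: "integrable lebesgue f"
    and z: "\<And>a b. (\<integral>x. indicator (box a b) x * f x \<partial>lebesgue) = 0"
  shows "AE x in lebesgue. f x = 0"
proof -
  obtain g where g[measurable]: "g \<in> borel_measurable borel" and fg: "AE x in lebesgue. f x = g x"
    using borel_representative[of f] f by auto
  have gi: "integrable lborel g"
  proof -
    have "integrable lebesgue g"
      using f fg by (subst integrable_cong_AE[of _ _ f]) (auto simp: measurable_completion elim: eventually_mono)
    then show ?thesis by (simp add: integrable_completion)
  qed
  have gz: "(\<integral>x. indicator (box a b) x * g x \<partial>lborel) = 0" for a b
  proof -
    have "(\<integral>x. indicator (box a b) x * g x \<partial>lborel) = (\<integral>x. indicator (box a b) x * g x \<partial>lebesgue)"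
      by (simp add: integral_completion)
    also have "\<dots> = (\<integral>x. indicator (box a b) x * f x \<partial>lebesgue)"
      using fg borel_measurable_integrable[OF f]
      by (intro integral_cong_AE borel_measurable_times) (auto simp: measurable_completion elim: eventually_mono)
    finally show ?thesis using z by simp
  qed
  define gp gm where "gp x = ennreal (g x)" and "gm x = ennreal (- g x)" for x
  have gpm[measurable]: "gp \<in> borel_measurable borel" "gm \<in> borel_measurable borel"
    unfolding gp_def gm_def by measurable
  have eq: "emeasure (density lborel gp) (box a b) = emeasure (density lborel gm) (box a b)"
    and fin: "emeasure (density lborel gp) (box a b) \<noteq> \<infinity>" for a b
  proof -
    have i1: "integrable lborel (\<lambda>x. indicator (box a b) x * max 0 (g x))"
      using gi by (intro integrable_mult_indicator[where 'b=real, simplified]) auto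
    have i2: "integrable lborel (\<lambda>x. indicator (box a b) x * max 0 (- g x))"
      using gi by (intro integrable_mult_indicator[where 'b=real, simplified]) auto
    have p: "emeasure (density lborel gp) (box a b) = ennreal (\<integral>x. indicator (box a b) x * max 0 (g x) \<partial>lborel)"
      unfolding gp_def using i1
      by (subst emeasure_density, simp, simp, subst nn_integral_eq_integral[symmetric])
        (auto intro!: nn_integral_cong split: split_indicator simp: ennreal_max_0)
    have m: "emeasure (density lborel gm) (box a b) = ennreal (\<integral>x. indicator (box a b) x * max 0 (- g x) \<partial>lborel)"
      unfolding gm_def using i2
      by (subst emeasure_density, simp, simp, subst nn_integral_eq_integral[symmetric])
        (auto intro!: nn_integral_cong split: split_indicator simp: ennreal_max_0)
    have "(\<integral>x. indicator (box a b) x * max 0 (g x) \<partial>lborel) - (\<integral>x. indicator (box a b) x * max 0 (- g x) \<partial>lborel)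
      = (\<integral>x. indicator (box a b) x * max 0 (g x) - indicator (box a b) x * max 0 (- g x) \<partial>lborel)"
      using i1 i2 by simp
    also have "\<dots> = (\<integral>x. indicator (box a b) x * g x \<partial>lborel)"
      by (intro Bochner_Integration.integral_cong) (auto split: split_indicator)
    finally show "emeasure (density lborel gp) (box a b) = emeasure (density lborel gm) (box a b)"
      unfolding p m gz by simp
    show "emeasure (density lborel gp) (box a b) \<noteq> \<infinity>" unfolding p by simp
  qed
  have "density lborel gp = density lborel gm"
  proof (rule measure_eqI_generator_eq[where E="range (\<lambda>(a, b). box a b)" and \<Omega>=UNIV
        and A="\<lambda>n. box (- (real n *\<^sub>R One)) (real n *\<^sub>R One)"])
    show "Int_stable (range (\<lambda>(a, b). box a b :: 'a set))"
      by (auto simp: Int_stable_def box_Int_box)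
    show "(\<Union>i. box (- (real i *\<^sub>R One)) (real i *\<^sub>R One)) = (UNIV :: 'a set)"
      by (rule UN_box_eq_UNIV)
    show "emeasure (density lborel gp) (box (- (real i *\<^sub>R One)) (real i *\<^sub>R One)) \<noteq> \<infinity>" for i
      by (rule fin)
  qed (auto simp: eq borel_eq_box)
  then have "AE x in lborel. gp x = gm x"
    by (subst (asm) sigma_finite_measure.density_unique_iff) (auto simp: sigma_finite_lborel)
  then have "AE x in lborel. g x = 0"
  proof eventually_elim
    case (elim x)
    then show ?case
      by (cases "g x \<ge> 0") (auto simp: gp_def gm_def ennreal_neg ennreal_eq_0_iff)
  qed
  then have "AE x in lebesgue. g x = 0" by (simp add: AE_completion_iff)
  with fg show ?thesis by eventually_elim simp
qed

text \<open>Boxes suffice: bumps approximate their indicators, and countably many closed boxes cover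
  U. Testing only with functions supported in boxes inside U lets the lemma be applied on the
  complement of a ball, where a weak gradient is shown to vanish.\<close>

lemma fundamental_lemma_on_open:
  fixes f :: "'a::euclidean_space \<Rightarrow> real"
  assumes f: "\<And>K. compact K \<Longrightarrow> set_integrable lebesgue K f" and U: "open U"
    and z: "\<And>\<phi> a b. test_function \<phi> \<Longrightarrow> cbox a b \<subseteq> U \<Longrightarrow> (\<And>x. x \<notin> cbox a b \<Longrightarrow> \<phi> x = 0)
       \<Longrightarrow> (\<integral>x. f x * \<phi> x \<partial>lebesgue) = 0"
  shows "AE x in lebesgue. x \<in> U \<longrightarrow> f x = 0"
proof -
  have fb: "integrable lebesgue (\<lambda>x. indicator (cbox c d) x * f x)" for c d
    using f[of "cbox c d"] by (simp add: set_integrable_def)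
  have bz: "(\<integral>x. indicator (box a b) x * f x \<partial>lebesgue) = 0" if "cbox a b \<subseteq> U" for a b
  proof -
    let ?F = "\<lambda>x. indicator (cbox a b) x * f x"
    have "(\<lambda>m. \<integral>x. ?F x * box_bump a b m x \<partial>lebesgue) \<longlonglongrightarrow> (\<integral>x. ?F x * indicator (box a b) x \<partial>lebesgue)"
    proof (rule integral_dominated_convergence[where w="\<lambda>x. \<bar>?F x\<bar>"])
      have bm: "box_bump a b m \<in> borel_measurable lebesgue" for m
        using test_function_box_bump[of a b m]
        by (auto simp: test_function_def dest!: spec[of _ 0] intro!: measurable_completion borel_measurable_continuous_onI)
      show "(\<lambda>x. ?F x * box_bump a b m x) \<in> borel_measurable lebesgue" for m
        by (rule borel_measurable_times[OF borel_measurable_integrable[OF fb] bm])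
      show "(\<lambda>x. ?F x * indicator (box a b) x) \<in> borel_measurable lebesgue"
        by (rule borel_measurable_times[OF borel_measurable_integrable[OF fb] borel_measurable_indicator]) simp
      show "AE x in lebesgue. (\<lambda>m. ?F x * box_bump a b m x) \<longlonglongrightarrow> ?F x * indicator (box a b) x"
        by (intro AE_I2 tendsto_intros box_bump_tendsto)
      show "AE x in lebesgue. norm (?F x * box_bump a b m x) \<le> \<bar>?F x\<bar>" for m
        using box_bump_bounds[of a b m] by (intro AE_I2) (auto simp: abs_mult intro!: mult_right_le_one_le)
      show "integrable lebesgue (\<lambda>x. \<bar>?F x\<bar>)" using fb[of a b] by auto
    qed
    moreover have "(\<integral>x. ?F x * box_bump a b m x \<partial>lebesgue) = 0" for m
    proof -
      have 0: "box_bump a b m x = 0" if "x \<notin> cbox a b" for x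
        using box_bump_eq_0[of x a b m] box_subset_cbox[of a b] that by auto
      have "(\<integral>x. ?F x * box_bump a b m x \<partial>lebesgue) = (\<integral>x. f x * box_bump a b m x \<partial>lebesgue)"
        by (intro Bochner_Integration.integral_cong) (auto simp: 0 split: split_indicator)
      also have "\<dots> = 0" by (rule z[OF test_function_box_bump that 0])
      finally show ?thesis .
    qed
    ultimately have "(\<integral>x. ?F x * indicator (box a b) x \<partial>lebesgue) = 0"
      by (simp add: LIMSEQ_const_iff)
    moreover have "?F x * indicator (box a b) x = indicator (box a b) x * f x" for x
      using box_subset_cbox[of a b] by (auto split: split_indicator)
    ultimately show ?thesis by simp
  qed
  have c: "AE x in lebesgue. x \<in> cbox c d \<longrightarrow> f x = 0" if cd: "cbox c d \<subseteq> U" for c d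
  proof -
    let ?g = "\<lambda>x. indicator (box c d) x * f x"
    have gi: "integrable lebesgue ?g"
    proof -
      have "?g = (\<lambda>x. indicator (box c d) x *\<^sub>R (indicator (cbox c d) x * f x))"
        using box_subset_cbox[of c d] by (auto simp: fun_eq_iff split: split_indicator)
      then show ?thesis using integrable_mult_indicator[OF _ fb, of "box c d" c d] by simp
    qed
    have "(\<integral>x. indicator (box a b) x * ?g x \<partial>lebesgue) = 0" for a b
    proof -
      obtain a' b' where ab: "box a b \<inter> box c d = box a' b'" by (simp add: box_Int_box)
      show ?thesis
      proof (cases "box a' b' = {}")
        case True
        have "(\<lambda>x. indicator (box a b) x * ?g x) = (\<lambda>x. indicator (box a b \<inter> box c d) x * f x)"
          by (auto split: split_indicator)
        then show ?thesis unfolding ab True by simp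
      next
        case False
        then have "cbox a' b' = closure (box a' b')" by simp
        also have "\<dots> \<subseteq> cbox c d"
          using ab box_subset_cbox[of c d] by (intro closure_minimal) auto
        finally have "cbox a' b' \<subseteq> U" using cd by simp
        from bz[OF this] show ?thesis
          unfolding ab[symmetric] indicator_inter_arith by (simp add: mult.assoc)
      qed
    qed
    from AE_zero_if_box_integrals_zero[OF gi this]
    have 1: "AE x in lebesgue. ?g x = 0" .
    have "cbox c d - box c d \<in> null_sets lebesgue"
      using negligible_frontier_interval[of c d] by (simp add: negligible_iff_null_sets)
    then have "AE x in lebesgue. x \<notin> cbox c d - box c d" by (rule AE_not_in)
    with 1 show ?thesis by eventually_elim (auto split: split_indicator_asm)
  qed
  obtain \<D> where D: "countable \<D>" "\<D> \<subseteq> Pow U" "\<And>X. X \<in> \<D> \<Longrightarrow> \<exists>a b. X = cbox a b" "\<Union>\<D> = U"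
    using open_countable_Union_open_cbox[OF U] by metis
  have "AE x in lebesgue. \<forall>X\<in>\<D>. x \<in> X \<longrightarrow> f x = 0"
  proof (subst AE_ball_countable[OF D(1)], intro ballI)
    fix X assume X: "X \<in> \<D>"
    then obtain a b where "X = cbox a b" using D(3) by blast
    then show "AE x in lebesgue. x \<in> X \<longrightarrow> f x = 0" using c[of a b] D(2) X by auto
  qed
  then show ?thesis by eventually_elim (use D(4) in auto)
qed

section \<open>Bounds and translations of test functions\<close>

lemma test_function_support:
  assumes "test_function \<phi>"
  obtains R where "R > 0" "\<And>x. \<phi> x \<noteq> 0 \<Longrightarrow> norm x \<le> R"
    "\<And>x h. frechet_derivative \<phi> (at x) h \<noteq> 0 \<Longrightarrow> norm x \<le> R"
proof -
  let ?S = "closure {x. \<phi> x \<noteq> 0}"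
  have "bounded ?S" using assms by (auto simp: test_function_def compact_imp_bounded)
  then obtain R where R: "R > 0" "\<And>x. x \<in> ?S \<Longrightarrow> norm x \<le> R" by (meson bounded_pos)
  show thesis
  proof
    show "norm x \<le> R" if "\<phi> x \<noteq> 0" for x
      using R(2)[of x] that closure_subset[of "{x. \<phi> x \<noteq> 0}"] by auto
    show "norm x \<le> R" if "frechet_derivative \<phi> (at x) h \<noteq> 0" for x h
    proof (rule R(2), rule ccontr)
      assume x: "x \<notin> ?S"
      have "(\<phi> has_derivative (\<lambda>h. 0)) (at x)"
        by (rule has_derivative_transform_within_open[where f="\<lambda>x. 0" and s="- ?S"])
          (use x closure_subset[of "{x. \<phi> x \<noteq> 0}"] in auto)
      then have "frechet_derivative \<phi> (at x) = (\<lambda>h. 0)" by (rule has_derivative_frechet)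
      then show False using that by simp
    qed
  qed (rule R(1))
qed

lemma test_function_has_derivative:
  "test_function \<phi> \<Longrightarrow> (\<phi> has_derivative frechet_derivative \<phi> (at x)) (at x)"
  by (auto simp: test_function_def frechet_derivative_works[symmetric] dest: spec[of _ "Suc 0"])

lemma frechet_derivative_basis_expansion:
  fixes h :: "'a::euclidean_space"
  assumes "(\<phi> has_derivative frechet_derivative \<phi> (at x)) (at x)"
  shows "frechet_derivative \<phi> (at x) h = (\<Sum>i\<in>Basis. (h \<bullet> i) * (frechet_derivative \<phi> (at x) i :: real))"
proof -
  interpret linear "frechet_derivative \<phi> (at x)"
    using assms by (rule has_derivative_linear)
  have "frechet_derivative \<phi> (at x) h = frechet_derivative \<phi> (at x) (\<Sum>i\<in>Basis. (h \<bullet> i) *\<^sub>R i)"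
    by (simp add: euclidean_representation)
  also have "\<dots> = (\<Sum>i\<in>Basis. (h \<bullet> i) * frechet_derivative \<phi> (at x) i)"
    by (simp add: sum scale)
  finally show ?thesis .
qed

lemma test_function_continuous: "test_function \<phi> \<Longrightarrow> continuous_on UNIV \<phi>"
  unfolding test_function_def by (metis times_cont_diff.simps(1))

lemma test_function_continuous_deriv:
  assumes "test_function \<phi>"
  shows "continuous_on UNIV (\<lambda>x. frechet_derivative \<phi> (at x) h)"
proof -
  have "continuous_on UNIV (\<lambda>x. frechet_derivative \<phi> (at x) i)" if "i \<in> Basis" for i
    using assms that by (auto simp: test_function_def dest: spec[of _ "Suc 0"])
  then show ?thesis
    unfolding frechet_derivative_basis_expansion[OF test_function_has_derivative[OF assms], of _ h]
    by (intro continuous_intros)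
qed

lemma bounded_continuous_compact_support:
  fixes \<psi> :: "'a::euclidean_space \<Rightarrow> real"
  assumes "continuous_on UNIV \<psi>" "\<And>x. \<psi> x \<noteq> 0 \<Longrightarrow> norm x \<le> R"
  obtains B where "B > 0" "\<And>x. \<bar>\<psi> x\<bar> \<le> B"
proof -
  have "compact (\<psi> ` cball 0 R)"
    using assms by (intro compact_continuous_image) (auto intro: continuous_on_subset)
  then obtain B where B: "B > 0" "\<And>x. x \<in> cball 0 R \<Longrightarrow> norm (\<psi> x) \<le> B"
    using compact_imp_bounded bounded_pos by (metis imageI)
  show ?thesis
  proof
    show "\<bar>\<psi> x\<bar> \<le> B" for x using B(1) B(2)[of x] assms(2)[of x] by (cases "\<psi> x = 0") auto
  qed (rule B)
qed

lemma test_function_bounded: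
  assumes "test_function \<phi>"
  obtains B where "B > 0" "\<And>x. \<bar>\<phi> x\<bar> \<le> B"
proof -
  obtain R where "\<And>x. \<phi> x \<noteq> 0 \<Longrightarrow> norm x \<le> R" using test_function_support[OF assms] by metis
  from bounded_continuous_compact_support[OF test_function_continuous[OF assms] this]
  show ?thesis using that by metis
qed

lemma test_function_bounded_deriv:
  assumes "test_function \<phi>"
  obtains B where "B > 0" "\<And>x. \<bar>frechet_derivative \<phi> (at x) h\<bar> \<le> B"
proof -
  obtain R where "\<And>x. frechet_derivative \<phi> (at x) h \<noteq> 0 \<Longrightarrow> norm x \<le> R"
    using test_function_support[OF assms] by metis
  from bounded_continuous_compact_support[OF test_function_continuous_deriv[OF assms] this]
  show ?thesis using that by metis
qed

lemma test_function_borel: "test_function \<phi> \<Longrightarrow> \<phi> \<in> borel_measurable borel"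
  by (intro borel_measurable_continuous_onI test_function_continuous)

lemma test_function_deriv_borel:
  "test_function \<phi> \<Longrightarrow> (\<lambda>x. frechet_derivative \<phi> (at x) h) \<in> borel_measurable borel"
  by (intro borel_measurable_continuous_onI test_function_continuous_deriv)

lemma frechet_derivative_translate:
  assumes "\<phi> differentiable (at (x + h))"
  shows "(\<lambda>x. \<phi> (x + h)) differentiable (at x)"
    "frechet_derivative (\<lambda>x. \<phi> (x + h)) (at x) = frechet_derivative \<phi> (at (x + h))"
proof -
  have "((\<lambda>x. \<phi> (x + h)) has_derivative frechet_derivative \<phi> (at (x + h))) (at x)"
  proof -
    have "((\<lambda>x. x + h) has_derivative (\<lambda>k. k)) (at x)"
      by (auto intro!: derivative_eq_intros)
    moreover have "(\<phi> has_derivative frechet_derivative \<phi> (at (x + h))) (at (x + h))"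
      using assms by (simp add: frechet_derivative_works)
    ultimately show ?thesis
      using has_derivative_compose[of "\<lambda>x. x + h" "\<lambda>k. k" x UNIV \<phi> "frechet_derivative \<phi> (at (x + h))"] by simp
  qed
  then show "(\<lambda>x. \<phi> (x + h)) differentiable (at x)"
    "frechet_derivative (\<lambda>x. \<phi> (x + h)) (at x) = frechet_derivative \<phi> (at (x + h))"
    by (rule differentiableI, rule has_derivative_frechet)
qed

lemma times_cont_diff_translate: "times_cont_diff k \<phi> \<Longrightarrow> times_cont_diff k (\<lambda>x. \<phi> (x + h))"
proof (induction k arbitrary: \<phi>)
  case 0
  then have "continuous_on UNIV (\<lambda>x. \<phi> (x + h))"
    by (intro continuous_on_compose2[of UNIV \<phi> UNIV "\<lambda>x. x + h"] continuous_intros) auto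
  then show ?case by simp
next
  case (Suc k)
  have "frechet_derivative (\<lambda>x. \<phi> (x + h)) (at x) = frechet_derivative \<phi> (at (x + h))"
    and d: "(\<lambda>x. \<phi> (x + h)) differentiable (at x)" for x
    using frechet_derivative_translate[of \<phi> x h] Suc.prems by auto
  then have "(\<lambda>x. frechet_derivative (\<lambda>x. \<phi> (x + h)) (at x) i) = (\<lambda>x. frechet_derivative \<phi> (at (x + h)) i)" for i
    by metis
  moreover have "times_cont_diff k (\<lambda>x. frechet_derivative \<phi> (at (x + h)) i)" if "i \<in> Basis" for i
    using Suc.IH[of "\<lambda>x. frechet_derivative \<phi> (at x) i"] Suc.prems that by simp
  ultimately show ?case using d by (simp only: times_cont_diff.simps) simp
qed

lemma test_function_translate: "test_function \<phi> \<Longrightarrow> test_function (\<lambda>x. \<phi> (x + h))"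
proof -
  assume \<phi>: "test_function \<phi>"
  obtain R where R: "R > 0" "\<And>x. \<phi> x \<noteq> 0 \<Longrightarrow> norm x \<le> R"
    using test_function_support[OF \<phi>] by metis
  have "{x. \<phi> (x + h) \<noteq> 0} \<subseteq> cball (- h) R"
    using R(2) by (auto simp: dist_norm norm_minus_commute add.commute)
  then have "bounded {x. \<phi> (x + h) \<noteq> 0}" by (rule bounded_subset[OF bounded_cball])
  then show ?thesis
    using \<phi> by (auto simp: test_function_def compact_closure intro: times_cont_diff_translate)
qed

lemma integrable_mult_bounded:
  fixes u :: "'a \<Rightarrow> 'b::euclidean_space"
  assumes u: "integrable M u" and "f \<in> borel_measurable M" and b: "\<And>x. \<bar>f x\<bar> \<le> (B::real)"
  shows "integrable M (\<lambda>x. f x *\<^sub>R u x)"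
proof (rule Bochner_Integration.integrable_bound)
  show "integrable M (\<lambda>x. B * norm (u x))"
    by (intro integrable_mult_right integrable_norm u)
  show "(\<lambda>x. f x *\<^sub>R u x) \<in> borel_measurable M"
    using assms(1,2) by (intro borel_measurable_scaleR) auto
  show "AE x in M. norm (f x *\<^sub>R u x) \<le> norm (B * norm (u x))"
  proof (rule AE_I2)
    fix x
    have "\<bar>f x\<bar> * norm (u x) \<le> \<bar>B\<bar> * norm (u x)"
      using b[of x] by (intro mult_right_mono) auto
    then show "norm (f x *\<^sub>R u x) \<le> norm (B * norm (u x))" by (simp add: abs_mult)
  qed
qed

lemma integrable_mult_bounded':
  fixes u :: "'a \<Rightarrow> real"
  assumes "integrable M u" and "f \<in> borel_measurable M" and "\<And>x. \<bar>f x\<bar> \<le> (B::real)"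
  shows "integrable M (\<lambda>x. u x * f x)"
  using integrable_mult_bounded[OF assms] by (simp add: mult.commute)

section \<open>Weak gradients\<close>

definition wgrad :: "('a::euclidean_space \<Rightarrow> real) \<Rightarrow> ('a \<Rightarrow> 'a) \<Rightarrow> bool" where
  "wgrad u G \<longleftrightarrow> integrable lebesgue u \<and> integrable lebesgue G \<and>
     (\<forall>\<phi>. test_function \<phi> \<longrightarrow> (\<forall>h.
        (\<integral>x. u x * frechet_derivative \<phi> (at x) h \<partial>lebesgue) = - (\<integral>x. (G x \<bullet> h) * \<phi> x \<partial>lebesgue)))"

lemma wgradI:
  assumes u: "integrable lebesgue u" and G: "integrable lebesgue G"
    and e: "\<And>\<phi> i. test_function \<phi> \<Longrightarrow> i \<in> Basis \<Longrightarrow>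
      (\<integral>x. u x * frechet_derivative \<phi> (at x) i \<partial>lebesgue) = - (\<integral>x. (G x \<bullet> i) * \<phi> x \<partial>lebesgue)"
  shows "wgrad u G"
  unfolding wgrad_def
proof (intro conjI allI impI u G)
  fix \<phi> :: "'a \<Rightarrow> real" and h :: 'a assume \<phi>: "test_function \<phi>"
  have i1: "integrable lebesgue (\<lambda>x. u x * frechet_derivative \<phi> (at x) i)" for i
  proof -
    obtain B where B: "\<And>x. \<bar>frechet_derivative \<phi> (at x) i\<bar> \<le> B"
      using test_function_bounded_deriv[OF \<phi>] by metis
    show ?thesis
      using test_function_deriv_borel[OF \<phi>, of i]
      by (intro integrable_mult_bounded'[OF u _ B] measurable_completion) simp
  qed
  have i2: "integrable lebesgue (\<lambda>x. (G x \<bullet> i) * \<phi> x)" for i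
  proof -
    obtain B where B: "\<And>x. \<bar>\<phi> x\<bar> \<le> B" using test_function_bounded[OF \<phi>] by metis
    show ?thesis
      using test_function_borel[OF \<phi>]
      by (intro integrable_mult_bounded'[OF _ _ B] integrable_inner_left[OF G] measurable_completion) simp
  qed
  have "(\<integral>x. u x * frechet_derivative \<phi> (at x) h \<partial>lebesgue)
     = (\<integral>x. (\<Sum>i\<in>Basis. (h \<bullet> i) * (u x * frechet_derivative \<phi> (at x) i)) \<partial>lebesgue)"
    unfolding frechet_derivative_basis_expansion[OF test_function_has_derivative[OF \<phi>], of _ h]
    by (simp add: sum_distrib_left mult_ac)
  also have "\<dots> = (\<Sum>i\<in>Basis. (h \<bullet> i) * (\<integral>x. u x * frechet_derivative \<phi> (at x) i \<partial>lebesgue))"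
    using i1 by simp
  also have "\<dots> = - (\<Sum>i\<in>Basis. (h \<bullet> i) * (\<integral>x. (G x \<bullet> i) * \<phi> x \<partial>lebesgue))"
    using e[OF \<phi>] by (simp add: sum_negf)
  also have "\<dots> = - (\<integral>x. (\<Sum>i\<in>Basis. (h \<bullet> i) * ((G x \<bullet> i) * \<phi> x)) \<partial>lebesgue)"
    using i2 by simp
  also have "(\<lambda>x. \<Sum>i\<in>Basis. (h \<bullet> i) * ((G x \<bullet> i) * \<phi> x)) = (\<lambda>x. (G x \<bullet> h) * \<phi> x)"
  proof
    fix x
    show "(\<Sum>i\<in>Basis. (h \<bullet> i) * ((G x \<bullet> i) * \<phi> x)) = (G x \<bullet> h) * \<phi> x"
      unfolding euclidean_inner[of "G x" h] by (simp add: sum_distrib_left sum_distrib_right mult_ac)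
  qed
  finally show "(\<integral>x. u x * frechet_derivative \<phi> (at x) h \<partial>lebesgue) = - (\<integral>x. (G x \<bullet> h) * \<phi> x \<partial>lebesgue)" .
qed

lemma AE_zero_componentwise:
  fixes f :: "'m \<Rightarrow> 'b::euclidean_space"
  assumes "\<And>i. i \<in> Basis \<Longrightarrow> AE x in M. P x \<longrightarrow> f x \<bullet> i = 0"
  shows "AE x in M. P x \<longrightarrow> f x = 0"
proof -
  have "AE x in M. \<forall>i\<in>Basis. P x \<longrightarrow> f x \<bullet> i = 0"
    using assms by (intro AE_finite_allI) auto
  then show ?thesis by eventually_elim (auto intro: euclidean_eqI)
qed

lemma wgrad_unique:
  fixes u :: "'a::euclidean_space \<Rightarrow> real"
  assumes "wgrad u G" "wgrad u G'"
  shows "AE x in lebesgue. G x = G' x"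
proof -
  have i: "integrable lebesgue (\<lambda>x. (G x - G' x) \<bullet> i)" for i
    using assms by (auto simp: wgrad_def)
  have "AE x in lebesgue. x \<in> UNIV \<longrightarrow> (G x - G' x) \<bullet> i = 0" for i
  proof (rule fundamental_lemma_on_open)
    show "set_integrable lebesgue K (\<lambda>x. (G x - G' x) \<bullet> i)" if "compact K" for K
      unfolding set_integrable_def using that i
      by (intro integrable_mult_indicator) (auto simp: borel_compact)
    fix \<phi> :: "'a \<Rightarrow> real" assume \<phi>: "test_function \<phi>"
    obtain B where "\<And>x. \<bar>\<phi> x\<bar> \<le> B" using test_function_bounded[OF \<phi>] by metis
    then have j: "integrable lebesgue (\<lambda>x. (F x \<bullet> i) * \<phi> x)" if "integrable lebesgue F" for F :: "'a \<Rightarrow> 'a"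
      using test_function_borel[OF \<phi>] that
      by (intro integrable_mult_bounded' integrable_inner_left) (auto simp: measurable_completion)
    have "(\<integral>x. ((G x - G' x) \<bullet> i) * \<phi> x \<partial>lebesgue)
       = (\<integral>x. (G x \<bullet> i) * \<phi> x \<partial>lebesgue) - (\<integral>x. (G' x \<bullet> i) * \<phi> x \<partial>lebesgue)"
      using j[of G] j[of G'] assms
      by (simp add: wgrad_def inner_diff_left left_diff_distrib)
    also have "\<dots> = 0" using assms \<phi> unfolding wgrad_def by (metis add.inverse_inverse diff_self)
    finally show "(\<integral>x. ((G x - G' x) \<bullet> i) * \<phi> x \<partial>lebesgue) = 0" .
  qed simp
  from AE_zero_componentwise[where P="\<lambda>x. x \<in> UNIV" and f="\<lambda>x. G x - G' x", OF this]
  show ?thesis by eventually_elim simp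
qed

lemma wgrad_linear:
  assumes "wgrad u G" "wgrad v H"
  shows "wgrad (\<lambda>x. a * u x + b * v x) (\<lambda>x. a *\<^sub>R G x + b *\<^sub>R H x)"
proof (rule wgradI)
  note [simp] = assms[unfolded wgrad_def, THEN conjunct1] assms[unfolded wgrad_def, THEN conjunct2, THEN conjunct1]
  show "integrable lebesgue (\<lambda>x. a * u x + b * v x)" "integrable lebesgue (\<lambda>x. a *\<^sub>R G x + b *\<^sub>R H x)" by auto
  fix \<phi> :: "'a \<Rightarrow> real" and i :: 'a assume \<phi>: "test_function \<phi>" and "i \<in> Basis"
  obtain B where B: "\<And>x. \<bar>\<phi> x\<bar> \<le> B" using test_function_bounded[OF \<phi>] by metis
  obtain B' where B': "\<And>x. \<bar>frechet_derivative \<phi> (at x) i\<bar> \<le> B'" using test_function_bounded_deriv[OF \<phi>] by metis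
  have j: "integrable lebesgue (\<lambda>x. (F x \<bullet> i) * \<phi> x)" if "integrable lebesgue F" for F :: "'a \<Rightarrow> 'a"
    using test_function_borel[OF \<phi>] that B
    by (intro integrable_mult_bounded' integrable_inner_left) (auto simp: measurable_completion)
  have k: "integrable lebesgue (\<lambda>x. F x * frechet_derivative \<phi> (at x) i)" if "integrable lebesgue F" for F
    using test_function_deriv_borel[OF \<phi>] that B'
    by (intro integrable_mult_bounded') (auto simp: measurable_completion)
  have "(\<integral>x. (a * u x + b * v x) * frechet_derivative \<phi> (at x) i \<partial>lebesgue)
     = (\<integral>x. a * (u x * frechet_derivative \<phi> (at x) i) + b * (v x * frechet_derivative \<phi> (at x) i) \<partial>lebesgue)"
    by (simp add: algebra_simps)
  also have "\<dots> = a * (\<integral>x. u x * frechet_derivative \<phi> (at x) i \<partial>lebesgue) + b * (\<integral>x. v x * frechet_derivative \<phi> (at x) i \<partial>lebesgue)"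
    using k[of u] k[of v] by simp
  also have "\<dots> = - (a * (\<integral>x. (G x \<bullet> i) * \<phi> x \<partial>lebesgue) + b * (\<integral>x. (H x \<bullet> i) * \<phi> x \<partial>lebesgue))"
    using assms \<phi> by (simp add: wgrad_def)
  also have "\<dots> = - (\<integral>x. a * ((G x \<bullet> i) * \<phi> x) + b * ((H x \<bullet> i) * \<phi> x) \<partial>lebesgue)"
    using j[of G] j[of H] by simp
  finally show "(\<integral>x. (a * u x + b * v x) * frechet_derivative \<phi> (at x) i \<partial>lebesgue) =
        - (\<integral>x. ((a *\<^sub>R G x + b *\<^sub>R H x) \<bullet> i) * \<phi> x \<partial>lebesgue)"
    by (simp add: inner_add_left algebra_simps)
qed

lemma integrable_imp_locally_integrable: "integrable lebesgue f \<Longrightarrow> locally_integrable f"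
  unfolding locally_integrable_def set_integrable_def
  by (auto intro!: integrable_mult_indicator simp: borel_compact)

lemma wgrad_has_weak_gradient: "wgrad u G \<Longrightarrow> has_weak_gradient u G"
  by (auto simp: wgrad_def has_weak_gradient_def integrable_imp_locally_integrable)

text \<open>The fundamental lemma on the complement of a ball around \<Omega> shows that G vanishes
  there almost everywhere; local integrability of G thereby becomes integrability.\<close>

lemma has_weak_gradient_wgrad:
  fixes u :: "'a::euclidean_space \<Rightarrow> real"
  assumes w: "has_weak_gradient u G" and z: "bounded \<Omega>" "\<And>x. x \<notin> \<Omega> \<Longrightarrow> u x = 0"
  shows "wgrad u G"
proof -
  obtain R where R: "\<And>x. x \<in> \<Omega> \<Longrightarrow> norm x \<le> R" using z(1) by (auto simp: bounded_iff)
  have lu: "set_integrable lebesgue K u" and lG: "set_integrable lebesgue K G" if "compact K" for K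
    using w that by (auto simp: has_weak_gradient_def locally_integrable_def)
  have uR: "u x = 0" if "norm x > R" for x using R[of x] z(2)[of x] that by (metis not_le)
  have "integrable lebesgue (\<lambda>x. indicator (cball 0 R) x *\<^sub>R u x)"
    using lu[of "cball 0 R"] by (simp add: set_integrable_def)
  also have "(\<lambda>x. indicator (cball 0 R) x *\<^sub>R u x) = u"
    using uR by (auto simp: fun_eq_iff split: split_indicator)
  finally have u: "integrable lebesgue u" .
  have "AE x in lebesgue. x \<in> - cball 0 R \<longrightarrow> G x \<bullet> i = 0" if i: "i \<in> Basis" for i
  proof (rule fundamental_lemma_on_open)
    fix K :: "'a set" assume "compact K"
    from lG[OF this] have "integrable lebesgue (\<lambda>x. (indicator K x *\<^sub>R G x) \<bullet> i)"
      unfolding set_integrable_def by (rule integrable_inner_left)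
    then show "set_integrable lebesgue K (\<lambda>x. G x \<bullet> i)" by (simp add: set_integrable_def)
  next
    fix \<phi> :: "'a \<Rightarrow> real" and a b
    assume \<phi>: "test_function \<phi>" "cbox a b \<subseteq> - cball 0 R" "\<And>x. x \<notin> cbox a b \<Longrightarrow> \<phi> x = 0"
    have z: "u x * frechet_derivative \<phi> (at x) i = 0" for x
    proof (cases "norm x \<le> R")
      case True
      then have "x \<in> - cbox a b" using \<phi>(2) by auto
      then have "(\<phi> has_derivative (\<lambda>h. 0)) (at x)"
        by (rule has_derivative_transform_within_open[where f="\<lambda>x. 0" and s="- cbox a b", rotated 2])
          (use \<phi>(3) in auto)
      then show ?thesis by (simp add: has_derivative_frechet)
    qed (use uR in auto)
    have "(\<integral>x. u x * frechet_derivative \<phi> (at x) i \<partial>lebesgue) = 0" unfolding z by simp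
    moreover have "(\<integral>x. u x * frechet_derivative \<phi> (at x) i \<partial>lebesgue) = - (\<integral>x. (G x \<bullet> i) * \<phi> x \<partial>lebesgue)"
      using w \<phi>(1) i unfolding has_weak_gradient_def by blast
    ultimately show "(\<integral>x. (G x \<bullet> i) * \<phi> x \<partial>lebesgue) = 0" by simp
  qed auto
  from AE_zero_componentwise[where P="\<lambda>x. x \<in> - cball 0 R" and f=G, OF this]
  have Gz: "AE x in lebesgue. x \<in> - cball 0 R \<longrightarrow> G x = 0" .
  have iG: "integrable lebesgue (\<lambda>x. indicator (cball 0 R) x *\<^sub>R G x)"
    using lG[of "cball 0 R"] by (simp add: set_integrable_def)
  have ae: "AE x in lebesgue. G x = indicator (cball 0 R) x *\<^sub>R G x"
    using Gz by eventually_elim (auto split: split_indicator)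
  have "G \<in> borel_measurable lebesgue"
    by (rule lebesgue_measurable_cong_AE[OF borel_measurable_integrable[OF iG] ae])
  from integrable_cong_AE[OF this borel_measurable_integrable[OF iG] ae]
  have "integrable lebesgue G" using iG by simp
  then show ?thesis using w u by (intro wgradI) (auto simp: has_weak_gradient_def)
qed

section \<open>Increments of a function with a weak gradient\<close>

lemma unit_interval_Fubini:
  fixes f :: "'a::euclidean_space \<times> real \<Rightarrow> real"
  assumes [measurable]: "f \<in> borel_measurable (lborel \<Otimes>\<^sub>M lborel)"
    and C: "\<And>t. 0 \<le> t \<Longrightarrow> t \<le> 1 \<Longrightarrow> (\<integral>\<^sup>+x. ennreal \<bar>f (x, t)\<bar> \<partial>lborel) \<le> ennreal C"
  shows "integrable (lborel \<Otimes>\<^sub>M lborel) (\<lambda>z. indicator {0..1} (snd z) * f z)"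
proof (rule integrableI_bounded)
  have "(\<integral>\<^sup>+z. ennreal (norm (indicator {0..1} (snd z) * f z)) \<partial>(lborel \<Otimes>\<^sub>M lborel))
     = (\<integral>\<^sup>+t. \<integral>\<^sup>+x. ennreal (norm (indicator {0..1} t * f (x, t))) \<partial>lborel \<partial>lborel)"
    by (subst lborel_pair.nn_integral_snd[symmetric]) auto
  also have "\<dots> \<le> (\<integral>\<^sup>+t. indicator {0..1::real} t * ennreal C \<partial>lborel)"
    using C by (intro nn_integral_mono) (auto split: split_indicator)
  also have "\<dots> = ennreal C" by (simp add: nn_integral_multc)
  finally show "(\<integral>\<^sup>+z. ennreal (norm (indicator {0..1} (snd z) * f z)) \<partial>(lborel \<Otimes>\<^sub>M lborel)) < \<infinity>"
    by (rule le_less_trans) simp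
qed measurable

text \<open>The path runs backwards from x to x - h, because a translation of u by h turns into a
  translation of the test function by - h.\<close>

lemma test_function_line_integral:
  assumes \<phi>: "test_function \<phi>"
  shows "(\<integral>t. indicator {0..1} t * frechet_derivative \<phi> (at (x - t *\<^sub>R h)) h \<partial>lborel) = \<phi> x - \<phi> (x - h)"
proof -
  have "(\<integral>t. - frechet_derivative \<phi> (at (x - t *\<^sub>R h)) h * indicator {0..1} t \<partial>lborel)
      = \<phi> (x - 1 *\<^sub>R h) - \<phi> (x - 0 *\<^sub>R h)"
  proof (rule integral_FTC_Icc_real)
    fix t :: real
    have "((\<lambda>t. x - t *\<^sub>R h) has_derivative (\<lambda>s. - (s *\<^sub>R h))) (at t)"
      by (auto intro!: derivative_eq_intros)
    from has_derivative_compose[OF this test_function_has_derivative[OF \<phi>]]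
    have "((\<lambda>t. \<phi> (x - t *\<^sub>R h)) has_derivative (\<lambda>s. frechet_derivative \<phi> (at (x - t *\<^sub>R h)) (- (s *\<^sub>R h)))) (at t)" .
    moreover have "frechet_derivative \<phi> (at (x - t *\<^sub>R h)) (- (s *\<^sub>R h)) = - frechet_derivative \<phi> (at (x - t *\<^sub>R h)) h * s" for s
    proof -
      interpret linear "frechet_derivative \<phi> (at (x - t *\<^sub>R h))"
        using test_function_has_derivative[OF \<phi>] by (rule has_derivative_linear)
      show ?thesis by (simp add: neg scale)
    qed
    ultimately show "((\<lambda>t. \<phi> (x - t *\<^sub>R h)) has_real_derivative - frechet_derivative \<phi> (at (x - t *\<^sub>R h)) h) (at t)"
      by (simp add: has_field_derivative_def mult_minus_left[abs_def])
    have "continuous_on UNIV (\<lambda>t. frechet_derivative \<phi> (at (x - t *\<^sub>R h)) h)"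
      by (rule continuous_on_compose2[OF test_function_continuous_deriv[OF \<phi>]]) (auto intro!: continuous_intros)
    then show "isCont (\<lambda>t. - frechet_derivative \<phi> (at (x - t *\<^sub>R h)) h) t"
      by (auto simp: continuous_on_eq_continuous_at)
  qed simp
  then show ?thesis by (simp add: mult.commute)
qed

lemma nn_integral_borel_rep:
  assumes "AE x in lebesgue. f x = g x"
  shows "(\<integral>\<^sup>+x. f x \<partial>lebesgue) = (\<integral>\<^sup>+x. g x \<partial>lborel)"
  using nn_integral_cong_AE[OF assms] by (simp add: nn_integral_completion)

text \<open>The fundamental theorem of calculus along \<open>h\<close>, valid for almost every starting point; testing it against
  a test function moves the increment onto that function, where it is the classical one.\<close>

lemma wgrad_increment_formula:
  fixes u :: "'a::euclidean_space \<Rightarrow> real" and h :: 'a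
  assumes w: "wgrad u G" and Gb[measurable]: "Gb \<in> borel_measurable borel" and GGb: "AE x in lebesgue. G x = Gb x"
  shows "integrable (lborel \<Otimes>\<^sub>M lborel) (\<lambda>z. indicator {0..1} (snd z) * (Gb (fst z + snd z *\<^sub>R h) \<bullet> h))" (is ?I)
    and "AE x in lebesgue. u (x + h) - u x = (\<integral>t. indicator {0..1} t * (Gb (x + t *\<^sub>R h) \<bullet> h) \<partial>lborel)" (is ?F)
proof -
  have u: "integrable lebesgue u" and G: "integrable lebesgue G" using w by (auto simp: wgrad_def)
  have GbT: "AE x in lebesgue. G (x + k) = Gb (x + k)" for k by (rule AE_translate[OF GGb])
  obtain ub where [measurable]: "ub \<in> borel_measurable borel" and ub: "AE x in lebesgue. u x = ub x"
    using borel_representative[of u] u by auto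
  define F where "F z = Gb (fst z + snd z *\<^sub>R h) \<bullet> h" for z :: "'a \<times> real"
  have [measurable]: "F \<in> borel_measurable (lborel \<Otimes>\<^sub>M lborel)" unfolding F_def by measurable
  have FC: "(\<integral>\<^sup>+x. ennreal \<bar>F (x, t)\<bar> \<partial>lborel) = ennreal (\<integral>x. \<bar>G x \<bullet> h\<bar> \<partial>lebesgue)" for t
  proof -
    have "(\<integral>\<^sup>+x. ennreal \<bar>F (x, t)\<bar> \<partial>lborel) = (\<integral>\<^sup>+x. ennreal \<bar>G (x + t *\<^sub>R h) \<bullet> h\<bar> \<partial>lebesgue)"
      unfolding F_def using GbT[of "t *\<^sub>R h"]
      by (intro nn_integral_borel_rep[symmetric]) (auto elim: eventually_mono)
    also have "\<dots> = (\<integral>\<^sup>+x. ennreal \<bar>G x \<bullet> h\<bar> \<partial>lebesgue)"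
      using borel_measurable_integrable[OF G]
      by (intro nn_integral_translate[where f="\<lambda>x. ennreal \<bar>G x \<bullet> h\<bar>"] measurable_compose[OF _ measurable_ennreal]
          borel_measurable_abs borel_measurable_inner) auto
    also have "\<dots> = ennreal (\<integral>x. \<bar>G x \<bullet> h\<bar> \<partial>lebesgue)"
      using G by (intro nn_integral_eq_integral) auto
    finally show ?thesis .
  qed
  have I1: "integrable (lborel \<Otimes>\<^sub>M lborel) (\<lambda>z. indicator {0..1} (snd z) * F z)"
    by (rule unit_interval_Fubini) (auto simp: FC)
  then show ?I by (simp add: F_def)
  define H where "H x = (\<integral>t. indicator {0..1} t * F (x, t) \<partial>lborel)" for x
  have Hi': "integrable lborel H"
    using lborel_pair.integrable_fst'[OF I1] by (simp add: H_def[abs_def])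
  then have Hi: "integrable lebesgue H" by (simp add: integrable_completion)
  have fi: "integrable lebesgue (\<lambda>x. u (x + h) - u x - H x)"
    by (intro Bochner_Integration.integrable_diff integrable_translate u Hi)
  have "AE x in lebesgue. x \<in> UNIV \<longrightarrow> u (x + h) - u x - H x = 0"
  proof (rule fundamental_lemma_on_open)
    show "set_integrable lebesgue K (\<lambda>x. u (x + h) - u x - H x)" if "compact K" for K
      unfolding set_integrable_def using that fi
      by (intro integrable_mult_indicator) (auto simp: borel_compact)
    fix \<phi> :: "'a \<Rightarrow> real" assume \<phi>: "test_function \<phi>"
    note [measurable] = test_function_borel[OF \<phi>] test_function_deriv_borel[OF \<phi>]
    obtain B where B: "\<And>x. \<bar>\<phi> x\<bar> \<le> B" using test_function_bounded[OF \<phi>] by metis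
    obtain B' where B': "\<And>x. \<bar>frechet_derivative \<phi> (at x) h\<bar> \<le> B'"
      using test_function_bounded_deriv[OF \<phi>] by metis
    have Bp: "0 \<le> B" "0 \<le> B'" using B[of 0] B'[of 0] by auto
    have ix: "integrable lebesgue (\<lambda>x. f x * \<phi> (x + k))" if "integrable lebesgue f" for f k
      using that by (intro integrable_mult_bounded'[where B=B] measurable_completion) (auto simp: B)
    have ix': "integrable lebesgue (\<lambda>x. f x * \<phi> x)" if "integrable lebesgue f" for f
      using ix[OF that, of 0] by simp
    define D where "D z = ub (fst z) * frechet_derivative \<phi> (at (fst z - snd z *\<^sub>R h)) h" for z
    have [measurable]: "D \<in> borel_measurable (lborel \<Otimes>\<^sub>M lborel)"
      unfolding D_def by measurable
    have ubi: "integrable lebesgue ub"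
      using u ub by (subst integrable_cong_AE[of _ _ u]) (auto simp: measurable_completion elim: eventually_mono)
    have I2: "integrable (lborel \<Otimes>\<^sub>M lborel) (\<lambda>z. indicator {0..1} (snd z) * D z)"
    proof (rule unit_interval_Fubini)
      fix t
      have "(\<integral>\<^sup>+x. ennreal \<bar>D (x, t)\<bar> \<partial>lborel) \<le> (\<integral>\<^sup>+x. ennreal (\<bar>ub x\<bar> * B') \<partial>lborel)"
        using B' by (intro nn_integral_mono ennreal_leI) (auto simp: D_def abs_mult intro!: mult_left_mono)
      also have "\<dots> = ennreal (\<integral>x. \<bar>ub x\<bar> * B' \<partial>lborel)"
        using ubi Bp by (intro nn_integral_eq_integral) (auto simp: integrable_completion)
      finally show "(\<integral>\<^sup>+x. ennreal \<bar>D (x, t)\<bar> \<partial>lborel) \<le> ennreal (\<integral>x. \<bar>ub x\<bar> * B' \<partial>lborel)" .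
    qed measurable
    define P where "P z = F z * \<phi> (fst z)" for z
    have [measurable]: "P \<in> borel_measurable (lborel \<Otimes>\<^sub>M lborel)"
      unfolding P_def by measurable
    have I3: "integrable (lborel \<Otimes>\<^sub>M lborel) (\<lambda>z. indicator {0..1} (snd z) * P z)"
    proof -
      have "integrable (lborel \<Otimes>\<^sub>M lborel) (\<lambda>z. (indicator {0..1} (snd z) * F z) * \<phi> (fst z))"
        using B by (intro integrable_mult_bounded'[OF I1]) auto
      then show ?thesis by (simp add: P_def mult.assoc)
    qed
    \<comment> \<open>For fixed t, shift the variable by t h: the factor \<phi> becomes its
      translate by - t h, again a test function, to which the definition of the weak gradient
      applies.\<close>
    have inner: "(\<integral>x. P (x, t) \<partial>lborel) = - (\<integral>x. D (x, t) \<partial>lborel)" for t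
    proof -
      let ?k = "t *\<^sub>R h"
      have "(\<integral>x. P (x, t) \<partial>lborel) = (\<integral>x. P (x, t) \<partial>lebesgue)"
        by (simp add: integral_completion)
      also have "\<dots> = (\<integral>x. (G (x + ?k) \<bullet> h) * \<phi> x \<partial>lebesgue)"
      proof (rule integral_cong_AE)
        show "(\<lambda>x. P (x, t)) \<in> borel_measurable lebesgue" by (intro measurable_completion) measurable
        show "(\<lambda>x. G (x + ?k) \<bullet> h * \<phi> x) \<in> borel_measurable lebesgue"
          by (rule borel_measurable_integrable[OF ix'[OF integrable_inner_left[OF integrable_translate[OF G]]]])
        show "AE x in lebesgue. P (x, t) = G (x + ?k) \<bullet> h * \<phi> x"
          using GbT[of ?k] by eventually_elim (simp add: P_def F_def)
      qed
      also have "\<dots> = (\<integral>x. (\<lambda>x. (G x \<bullet> h) * \<phi> (x - ?k)) (x + ?k) \<partial>lebesgue)" by simp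
      also have "\<dots> = (\<integral>x. (G x \<bullet> h) * \<phi> (x - ?k) \<partial>lebesgue)"
        using borel_measurable_integrable[OF ix[OF integrable_inner_left[OF G, of h], of "- ?k"]]
        by (intro integral_translate) simp
      also have "\<dots> = - (\<integral>x. u x * frechet_derivative (\<lambda>x. \<phi> (x + (- ?k))) (at x) h \<partial>lebesgue)"
        using w test_function_translate[OF \<phi>, of "- ?k"] unfolding wgrad_def by simp
      also have "(\<lambda>x. frechet_derivative (\<lambda>x. \<phi> (x + (- ?k))) (at x) h) = (\<lambda>x. frechet_derivative \<phi> (at (x - ?k)) h)"
      proof
        fix x
        have "\<phi> differentiable (at (x + (- ?k)))"
          using test_function_has_derivative[OF \<phi>] by (rule differentiableI)
        from frechet_derivative_translate(2)[OF this]
        show "frechet_derivative (\<lambda>x. \<phi> (x + (- ?k))) (at x) h = frechet_derivative \<phi> (at (x - ?k)) h" by simp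
      qed
      also have "(\<integral>x. u x * frechet_derivative \<phi> (at (x - ?k)) h \<partial>lebesgue) = (\<integral>x. D (x, t) \<partial>lebesgue)"
      proof (rule integral_cong_AE)
        show "(\<lambda>x. D (x, t)) \<in> borel_measurable lebesgue" by (intro measurable_completion) measurable
        show "(\<lambda>x. u x * frechet_derivative \<phi> (at (x - ?k)) h) \<in> borel_measurable lebesgue"
          using borel_measurable_integrable[OF u]
          by (rule borel_measurable_times) (intro measurable_completion, measurable)
        show "AE x in lebesgue. u x * frechet_derivative \<phi> (at (x - ?k)) h = D (x, t)"
          using ub by eventually_elim (simp add: D_def)
      qed
      also have "\<dots> = (\<integral>x. D (x, t) \<partial>lborel)" by (simp add: integral_completion)
      finally show ?thesis .
    qed
    have "(\<integral>x. H x * \<phi> x \<partial>lebesgue) = (\<integral>x. H x * \<phi> x \<partial>lborel)"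
      using borel_measurable_integrable[OF Hi'] by (intro integral_completion borel_measurable_times) auto
    also have "\<dots> = (\<integral>x. (\<integral>t. indicator {0..1} t * P (x, t) \<partial>lborel) \<partial>lborel)"
      by (intro Bochner_Integration.integral_cong) (simp_all add: H_def P_def mult.assoc[symmetric])
    also have "\<dots> = (\<integral>t. (\<integral>x. indicator {0..1} t * P (x, t) \<partial>lborel) \<partial>lborel)"
      using lborel_pair.Fubini_integral[of "\<lambda>x t. indicator {0..1} t * P (x, t)"] I3
      by (simp add: case_prod_unfold)
    also have "\<dots> = (\<integral>t. - (\<integral>x. indicator {0..1} t * D (x, t) \<partial>lborel) \<partial>lborel)"
      by (simp add: inner)
    also have "\<dots> = - (\<integral>t. (\<integral>x. indicator {0..1} t * D (x, t) \<partial>lborel) \<partial>lborel)" by simp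
    also have "\<dots> = - (\<integral>x. (\<integral>t. indicator {0..1} t * D (x, t) \<partial>lborel) \<partial>lborel)"
      using lborel_pair.Fubini_integral[of "\<lambda>x t. indicator {0..1} t * D (x, t)"] I2
      by (simp add: case_prod_unfold)
    also have "\<dots> = - (\<integral>x. ub x * (\<phi> x - \<phi> (x - h)) \<partial>lborel)"
    proof -
      have "(\<integral>t. indicator {0..1} t * D (x, t) \<partial>lborel) = ub x * (\<phi> x - \<phi> (x - h))" for x
        unfolding test_function_line_integral[OF \<phi>, symmetric] D_def
        by (simp add: mult.left_commute)
      then show ?thesis by simp
    qed
    also have "(\<integral>x. ub x * (\<phi> x - \<phi> (x - h)) \<partial>lborel) = (\<integral>x. ub x * (\<phi> x - \<phi> (x - h)) \<partial>lebesgue)"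
      by (intro integral_completion[symmetric]) measurable
    also have "\<dots> = (\<integral>x. u x * (\<phi> x - \<phi> (x - h)) \<partial>lebesgue)"
    proof (rule integral_cong_AE)
      show "(\<lambda>x. ub x * (\<phi> x - \<phi> (x - h))) \<in> borel_measurable lebesgue"
        by (intro measurable_completion) measurable
      show "(\<lambda>x. u x * (\<phi> x - \<phi> (x - h))) \<in> borel_measurable lebesgue"
        using borel_measurable_integrable[OF u]
        by (rule borel_measurable_times) (intro measurable_completion, measurable)
      show "AE x in lebesgue. ub x * (\<phi> x - \<phi> (x - h)) = u x * (\<phi> x - \<phi> (x - h))"
        using ub by eventually_elim simp
    qed
    also have "\<dots> = (\<integral>x. u x * \<phi> x \<partial>lebesgue) - (\<integral>x. u x * \<phi> (x - h) \<partial>lebesgue)"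
      using ix'[OF u] ix[OF u, of "-h"] by (simp add: right_diff_distrib)
    also have "(\<integral>x. u x * \<phi> (x - h) \<partial>lebesgue) = (\<integral>x. u (x + h) * \<phi> x \<partial>lebesgue)"
      using integral_translate[of "\<lambda>x. u x * \<phi> (x - h)" h] borel_measurable_integrable[OF ix[OF u, of "-h"]] by simp
    finally have "(\<integral>x. H x * \<phi> x \<partial>lebesgue) = (\<integral>x. u (x + h) * \<phi> x \<partial>lebesgue) - (\<integral>x. u x * \<phi> x \<partial>lebesgue)"
      by simp
    then show "(\<integral>x. (u (x + h) - u x - H x) * \<phi> x \<partial>lebesgue) = 0"
      using ix'[OF u] ix'[OF Hi] ix'[OF integrable_translate[OF u, of h]]
      by (simp add: left_diff_distrib)
  qed simp
  then show ?F by eventually_elim (simp add: H_def F_def)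
qed

text \<open>The field K is free: K = 0 gives the translation estimate, K = G the L^1 convergence of
  difference quotients. Subtracting K x \<bullet> h under the average over t reduces both to a bound
  for G (x + t h) - K x.\<close>

lemma wgrad_increment_bound:
  fixes u :: "'a::euclidean_space \<Rightarrow> real" and h :: 'a
  assumes w: "wgrad u G" and K: "integrable lebesgue K" and C: "0 \<le> C"
    and b: "\<And>t. 0 \<le> t \<Longrightarrow> t \<le> 1 \<Longrightarrow> (\<integral>x. norm (G (x + t *\<^sub>R h) - K x) \<partial>lebesgue) \<le> C"
  shows "(\<integral>x. \<bar>u (x + h) - u x - K x \<bullet> h\<bar> \<partial>lebesgue) \<le> C * norm h"
proof -
  have u: "integrable lebesgue u" and G: "integrable lebesgue G" using w by (auto simp: wgrad_def)
  obtain Gb where [measurable]: "Gb \<in> borel_measurable borel" and Gb: "AE x in lebesgue. G x = Gb x"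
    using borel_representative[of G] G by auto
  obtain Kb where [measurable]: "Kb \<in> borel_measurable borel" and Kb: "AE x in lebesgue. K x = Kb x"
    using borel_representative[of K] K by auto
  note formula = wgrad_increment_formula[OF w \<open>Gb \<in> borel_measurable borel\<close> Gb, of h]
  define F where "F z = (Gb (fst z + snd z *\<^sub>R h) - Kb (fst z)) \<bullet> h" for z
  have [measurable]: "F \<in> borel_measurable (lborel \<Otimes>\<^sub>M lborel)" unfolding F_def by measurable
  have slice: "(\<integral>\<^sup>+x. ennreal \<bar>F (x, t)\<bar> \<partial>lborel) \<le> ennreal (C * norm h)" if t: "0 \<le> t" "t \<le> 1" for t
  proof -
    have i: "integrable lebesgue (\<lambda>x. norm (G (x + t *\<^sub>R h) - K x) * norm h)"
      by (intro integrable_mult_left integrable_norm Bochner_Integration.integrable_diff integrable_translate G K)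
    have "(\<integral>\<^sup>+x. ennreal \<bar>F (x, t)\<bar> \<partial>lborel) = (\<integral>\<^sup>+x. ennreal \<bar>(G (x + t *\<^sub>R h) - K x) \<bullet> h\<bar> \<partial>lebesgue)"
    proof (rule nn_integral_borel_rep[symmetric])
      show "AE x in lebesgue. ennreal \<bar>(G (x + t *\<^sub>R h) - K x) \<bullet> h\<bar> = ennreal \<bar>F (x, t)\<bar>"
        using Kb AE_translate[OF Gb, of "t *\<^sub>R h"] by eventually_elim (simp add: F_def)
    qed
    also have "\<dots> \<le> (\<integral>\<^sup>+x. ennreal (norm (G (x + t *\<^sub>R h) - K x) * norm h) \<partial>lebesgue)"
      by (intro nn_integral_mono ennreal_leI Cauchy_Schwarz_ineq2)
    also have "\<dots> = ennreal (\<integral>x. norm (G (x + t *\<^sub>R h) - K x) * norm h \<partial>lebesgue)"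
      by (intro nn_integral_eq_integral[OF i]) auto
    also have "\<dots> \<le> ennreal (C * norm h)"
      using b[OF t] by (intro ennreal_leI) (auto intro: mult_right_mono)
    finally show ?thesis .
  qed
  have "AE x in lebesgue. \<bar>u (x + h) - u x - K x \<bullet> h\<bar> \<le> \<integral>\<^sup>+t. ennreal (indicator {0..1} t * \<bar>F (x, t)\<bar>) \<partial>lborel"
  proof -
    have "AE x in lebesgue. integrable lborel (\<lambda>t. indicator {0..1} t * (Gb (x + t *\<^sub>R h) \<bullet> h))"
      using lborel_pair.AE_integrable_fst'[OF formula(1)] by (simp add: AE_completion_iff)
    then show ?thesis using formula(2) Kb
    proof eventually_elim
      case (elim x)
      have i2: "integrable lborel (\<lambda>t. indicator {0..1::real} t * (Kb x \<bullet> h))" by auto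
      have eq: "(\<integral>t. indicator {0..1} t * F (x, t) \<partial>lborel) = u (x + h) - u x - K x \<bullet> h"
        using elim i2 by (simp add: F_def inner_diff_left right_diff_distrib)
      have int: "integrable lborel (\<lambda>t. indicator {0..1} t * F (x, t))"
        using Bochner_Integration.integrable_diff[OF elim(1) i2] by (simp add: F_def inner_diff_left right_diff_distrib)
      have "ennreal (norm (\<integral>t. indicator {0..1} t * F (x, t) \<partial>lborel)) \<le> (\<integral>\<^sup>+t. ennreal (norm (indicator {0..1} t * F (x, t))) \<partial>lborel)"
        by (rule integral_norm_bound_ennreal[OF int])
      then show ?case unfolding eq by (simp add: abs_mult)
    qed
  qed
  then have "(\<integral>\<^sup>+x. ennreal \<bar>u (x + h) - u x - K x \<bullet> h\<bar> \<partial>lebesgue)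
      \<le> (\<integral>\<^sup>+x. \<integral>\<^sup>+t. ennreal (indicator {0..1} t * \<bar>F (x, t)\<bar>) \<partial>lborel \<partial>lebesgue)"
    by (rule nn_integral_mono_AE)
  also have "\<dots> = (\<integral>\<^sup>+x. \<integral>\<^sup>+t. ennreal (indicator {0..1} t * \<bar>F (x, t)\<bar>) \<partial>lborel \<partial>lborel)"
    by (simp add: nn_integral_completion)
  also have "\<dots> = (\<integral>\<^sup>+t. \<integral>\<^sup>+x. ennreal (indicator {0..1} t * \<bar>F (x, t)\<bar>) \<partial>lborel \<partial>lborel)"
    by (rule lborel_pair.Fubini'[symmetric]) measurable
  also have "\<dots> \<le> (\<integral>\<^sup>+t. indicator {0..1::real} t * ennreal (C * norm h) \<partial>lborel)"
    using slice by (intro nn_integral_mono) (auto split: split_indicator)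
  also have "\<dots> = ennreal (C * norm h)" by (simp add: nn_integral_multc)
  finally have "(\<integral>\<^sup>+x. ennreal \<bar>u (x + h) - u x - K x \<bullet> h\<bar> \<partial>lebesgue) \<le> ennreal (C * norm h)" .
  moreover have "integrable lebesgue (\<lambda>x. u (x + h) - u x - K x \<bullet> h)"
    by (intro Bochner_Integration.integrable_diff integrable_translate integrable_inner_left u K)
  ultimately show ?thesis
    using C by (subst (asm) nn_integral_eq_integral) (auto simp: ennreal_le_iff)
qed

lemma wgrad_translation_estimate:
  assumes "wgrad u G"
  shows "(\<integral>x. \<bar>u (x + h) - u x\<bar> \<partial>lebesgue) \<le> (\<integral>x. norm (G x) \<partial>lebesgue) * norm h"
proof -
  have G: "integrable lebesgue G" using assms by (auto simp: wgrad_def)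
  have "(\<integral>x. norm (G (x + t *\<^sub>R h) - 0) \<partial>lebesgue) \<le> (\<integral>x. norm (G x) \<partial>lebesgue)" for t
    using integral_translate[of "\<lambda>x. norm (G x)" "t *\<^sub>R h"] G by auto
  from wgrad_increment_bound[OF assms _ _ this] show ?thesis by simp
qed

text \<open>Take K = G in the increment bound. Translations are continuous in L^1, so G changes by
  less than any given amount along a short segment.\<close>

lemma wgrad_difference_quotient:
  fixes t :: "nat \<Rightarrow> real"
  assumes w: "wgrad u G" and t: "t \<longlonglongrightarrow> 0" "\<And>n. t n \<noteq> 0"
  shows "(\<lambda>n. \<integral>x. \<bar>(u (x + t n *\<^sub>R e) - u x) / t n - G x \<bullet> e\<bar> \<partial>lebesgue) \<longlonglongrightarrow> 0"
proof (rule LIMSEQ_I)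
  fix r :: real assume r: "r > 0"
  have G: "integrable lebesgue G" using w by (auto simp: wgrad_def)
  define \<epsilon> where "\<epsilon> = r / (2 * (norm e + 1))"
  have \<epsilon>: "\<epsilon> > 0" "\<epsilon> * norm e < r" using r by (auto simp: \<epsilon>_def divide_simps add_nonneg_pos add_pos_nonneg algebra_simps)
  obtain d where d: "d > 0" "\<And>h. norm h < d \<Longrightarrow> (\<integral>x. norm (G (x + h) - G x) \<partial>lebesgue) < \<epsilon>"
    using L1_translation_continuity[OF G] \<epsilon>(1) by blast
  have "(\<lambda>n. t n *\<^sub>R e) \<longlonglongrightarrow> 0 *\<^sub>R e" by (intro tendsto_intros t)
  then have "eventually (\<lambda>n. norm (t n *\<^sub>R e) < d) sequentially"
    using d(1) by (auto dest!: tendstoD simp: dist_norm)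
  then obtain N where N: "\<And>n. n \<ge> N \<Longrightarrow> norm (t n *\<^sub>R e) < d" by (auto simp: eventually_sequentially)
  have "norm ((\<integral>x. \<bar>(u (x + t n *\<^sub>R e) - u x) / t n - G x \<bullet> e\<bar> \<partial>lebesgue) - 0) < r" if "n \<ge> N" for n
  proof -
    have "(\<integral>x. norm (G (x + s *\<^sub>R (t n *\<^sub>R e)) - G x) \<partial>lebesgue) \<le> \<epsilon>" if "0 \<le> s" "s \<le> 1" for s
    proof -
      have "norm (s *\<^sub>R (t n *\<^sub>R e)) \<le> norm (t n *\<^sub>R e)" using that by (simp add: abs_mult mult_right_mono mult_left_le_one_le)
      then show ?thesis using d(2)[of "s *\<^sub>R (t n *\<^sub>R e)"] N[OF \<open>n \<ge> N\<close>] by simp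
    qed
    from wgrad_increment_bound[OF w G _ this]
    have 1: "(\<integral>x. \<bar>u (x + t n *\<^sub>R e) - u x - G x \<bullet> (t n *\<^sub>R e)\<bar> \<partial>lebesgue) \<le> \<epsilon> * norm (t n *\<^sub>R e)"
      using \<epsilon> by simp
    have "(\<integral>x. \<bar>(u (x + t n *\<^sub>R e) - u x) / t n - G x \<bullet> e\<bar> \<partial>lebesgue)
      = (\<integral>x. \<bar>u (x + t n *\<^sub>R e) - u x - G x \<bullet> (t n *\<^sub>R e)\<bar> / \<bar>t n\<bar> \<partial>lebesgue)"
      using t(2)[of n] by (intro Bochner_Integration.integral_cong) (auto simp: abs_divide[symmetric] diff_divide_distrib)
    also have "\<dots> \<le> \<epsilon> * norm (t n *\<^sub>R e) / \<bar>t n\<bar>"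
      using divide_right_mono[OF 1, of "\<bar>t n\<bar>"] by simp
    also have "\<dots> = \<epsilon> * norm e" using t(2)[of n] by simp
    finally show ?thesis using \<epsilon>(2) by (simp add: abs_of_nonneg)
  qed
  then show "\<exists>no. \<forall>n\<ge>no. norm ((\<integral>x. \<bar>(u (x + t n *\<^sub>R e) - u x) / t n - G x \<bullet> e\<bar> \<partial>lebesgue) - 0) < r" by blast
qed

section \<open>Difference quotients and integration by parts\<close>

lemma test_function_gradient:
  assumes \<phi>: "test_function (\<phi> :: 'a::euclidean_space \<Rightarrow> real)"
  obtains Z B where "\<And>x h. frechet_derivative \<phi> (at x) h = Z x \<bullet> h" "\<And>x. norm (Z x) \<le> B"
    "Z \<in> borel_measurable borel"
proof -
  define Z where "Z x = (\<Sum>i\<in>Basis. frechet_derivative \<phi> (at x) i *\<^sub>R i)" for x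
  have "\<exists>B. \<forall>x. \<bar>frechet_derivative \<phi> (at x) i\<bar> \<le> B" for i
    using test_function_bounded_deriv[OF \<phi>] by metis
  then obtain B where B: "\<And>i x. \<bar>frechet_derivative \<phi> (at x) i\<bar> \<le> B i" by metis
  show thesis
  proof
    show "frechet_derivative \<phi> (at x) h = Z x \<bullet> h" for x h
      unfolding Z_def frechet_derivative_basis_expansion[OF test_function_has_derivative[OF \<phi>], of x h]
      by (simp add: inner_sum_left mult.commute inner_commute[of h])
    show "norm (Z x) \<le> (\<Sum>i\<in>Basis. B i)" for x
      unfolding Z_def by (rule order_trans[OF norm_sum]) (auto intro!: sum_mono simp: B)
    show "Z \<in> borel_measurable borel"
      unfolding Z_def by (intro borel_measurable_sum borel_measurable_scaleR test_function_deriv_borel[OF \<phi>]) auto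
  qed
qed

lemma bounded_gradient_lipschitz:
  fixes \<zeta> :: "'a::euclidean_space \<Rightarrow> real"
  assumes "\<And>x. (\<zeta> has_derivative (\<lambda>h. Z x \<bullet> h)) (at x)" "\<And>x. norm (Z x) \<le> B"
  shows "\<bar>\<zeta> (x + h) - \<zeta> x\<bar> \<le> B * norm h"
proof -
  have "norm (\<zeta> (x + h) - \<zeta> x) \<le> B * norm (x + h - x)"
  proof (rule differentiable_bound[where S=UNIV])
    show "onorm (\<lambda>h. Z y \<bullet> h) \<le> B" for y
    proof (rule onorm_le)
      fix k
      have "norm (Z y \<bullet> k) \<le> norm (Z y) * norm k" by (simp add: Cauchy_Schwarz_ineq2)
      also have "\<dots> \<le> B * norm k" using assms(2) by (intro mult_right_mono) auto
      finally show "norm (Z y \<bullet> k) \<le> B * norm k" .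
    qed
  qed (use assms in auto)
  then show ?thesis by simp
qed

lemma classical_difference_quotient:
  fixes \<zeta> :: "'a::euclidean_space \<Rightarrow> real" and t :: "nat \<Rightarrow> real"
  assumes d: "(\<zeta> has_derivative (\<lambda>h. Z \<bullet> h)) (at x)" and t: "t \<longlonglongrightarrow> 0" "\<And>n. t n \<noteq> 0"
  shows "(\<lambda>n. (\<zeta> (x + t n *\<^sub>R e) - \<zeta> x) / t n) \<longlonglongrightarrow> Z \<bullet> e"
proof -
  have "((\<lambda>s. x + s *\<^sub>R e) has_derivative (\<lambda>s. s *\<^sub>R e)) (at 0)"
    by (auto intro!: derivative_eq_intros)
  moreover have "(\<zeta> has_derivative (\<lambda>h. Z \<bullet> h)) (at (x + 0 *\<^sub>R e))" using d by simp
  ultimately have "((\<lambda>s. \<zeta> (x + s *\<^sub>R e)) has_derivative (\<lambda>s. Z \<bullet> (s *\<^sub>R e))) (at 0)"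
    by (rule has_derivative_compose)
  then have "((\<lambda>s. \<zeta> (x + s *\<^sub>R e)) has_real_derivative (Z \<bullet> e)) (at 0)"
    by (simp add: has_field_derivative_def mult.commute[of _ "Z \<bullet> e"])
  then have "((\<lambda>s. (\<zeta> (x + s *\<^sub>R e) - \<zeta> x) / s) \<longlongrightarrow> Z \<bullet> e) (at 0)"
    by (simp add: has_field_derivative_iff)
  moreover have "filterlim t (at 0) sequentially"
    using t by (auto simp: filterlim_at)
  ultimately show ?thesis by (rule filterlim_compose)
qed

text \<open>A change of variables moves the difference quotient from v to \<zeta>, with step - t n.
  There it converges pointwise and is bounded by the Lipschitz constant of \<zeta>.\<close>

lemma difference_quotient_adjoint:
  fixes \<zeta> v :: "'a::euclidean_space \<Rightarrow> real" and t :: "nat \<Rightarrow> real"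
  assumes v: "integrable lebesgue v"
    and d: "\<And>x. (\<zeta> has_derivative (\<lambda>h. Z x \<bullet> h)) (at x)" and B: "\<And>x. norm (Z x) \<le> B"
    and Zb: "Z \<in> borel_measurable borel"
    and A: "\<And>x. \<bar>\<zeta> x\<bar> \<le> A" and t: "t \<longlonglongrightarrow> 0" "\<And>n. t n \<noteq> 0"
  shows "(\<lambda>n. \<integral>x. (v (x + t n *\<^sub>R e) - v x) / t n * \<zeta> x \<partial>lebesgue) \<longlonglongrightarrow> - (\<integral>x. v x * (Z x \<bullet> e) \<partial>lebesgue)"
proof -
  have "continuous_on UNIV \<zeta>" using d by (intro has_derivative_continuous_on[where f'="\<lambda>x h. Z x \<bullet> h"]) auto
  then have \<zeta>b: "\<zeta> \<in> borel_measurable borel" by (rule borel_measurable_continuous_onI)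
  have ix: "integrable lebesgue (\<lambda>x. f x * \<zeta> (x + k))" if "integrable lebesgue f" for f k
    using that \<zeta>b by (intro integrable_mult_bounded'[where B=A] measurable_completion) (auto simp: A)
  have eq: "(\<integral>x. (v (x + t n *\<^sub>R e) - v x) / t n * \<zeta> x \<partial>lebesgue)
     = (\<integral>x. v x * - ((\<zeta> (x + (- t n) *\<^sub>R e) - \<zeta> x) / (- t n)) \<partial>lebesgue)" for n
  proof -
    let ?k = "t n *\<^sub>R e"
    have "(\<integral>x. (v (x + ?k) - v x) / t n * \<zeta> x \<partial>lebesgue) = (\<integral>x. (v (x + ?k) * \<zeta> (x + 0) - v x * \<zeta> (x + 0)) / t n \<partial>lebesgue)"
      by (simp add: left_diff_distrib)
    also have "\<dots> = ((\<integral>x. v (x + ?k) * \<zeta> (x + 0) \<partial>lebesgue) - (\<integral>x. v x * \<zeta> (x + 0) \<partial>lebesgue)) / t n"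
      using ix[OF v, of 0] ix[OF integrable_translate[OF v, of ?k], of 0] by simp
    also have "(\<integral>x. v (x + ?k) * \<zeta> (x + 0) \<partial>lebesgue) = (\<integral>x. v x * \<zeta> (x + (- ?k)) \<partial>lebesgue)"
      using integral_translate[of "\<lambda>x. v x * \<zeta> (x - ?k)" ?k] borel_measurable_integrable[OF ix[OF v, of "- ?k"]] by simp
    also have "((\<integral>x. v x * \<zeta> (x + (- ?k)) \<partial>lebesgue) - (\<integral>x. v x * \<zeta> (x + 0) \<partial>lebesgue)) / t n
       = (\<integral>x. (v x * \<zeta> (x + (- ?k)) - v x * \<zeta> (x + 0)) / t n \<partial>lebesgue)"
      using ix[OF v, of 0] ix[OF v, of "- ?k"] by simp
    also have "\<dots> = (\<integral>x. v x * - ((\<zeta> (x + (- t n) *\<^sub>R e) - \<zeta> x) / (- t n)) \<partial>lebesgue)"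
      by (intro Bochner_Integration.integral_cong) (auto simp: right_diff_distrib)
    finally show ?thesis .
  qed
  have "(\<lambda>n. \<integral>x. v x * - ((\<zeta> (x + (- t n) *\<^sub>R e) - \<zeta> x) / (- t n)) \<partial>lebesgue) \<longlonglongrightarrow> (\<integral>x. v x * - (Z x \<bullet> e) \<partial>lebesgue)"
  proof (rule integral_dominated_convergence[where w="\<lambda>x. \<bar>v x\<bar> * (B * norm e)"])
    have m: "(\<lambda>x. v x * f x) \<in> borel_measurable lebesgue" if "f \<in> borel_measurable borel" for f
      using that borel_measurable_integrable[OF v] by (intro borel_measurable_times) (auto intro: measurable_completion)
    note [measurable] = Zb \<zeta>b
    show "(\<lambda>x. v x * - (Z x \<bullet> e)) \<in> borel_measurable lebesgue"
      by (intro m) measurable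
    show "(\<lambda>x. v x * - ((\<zeta> (x + (- t n) *\<^sub>R e) - \<zeta> x) / (- t n))) \<in> borel_measurable lebesgue" for n
      by (intro m) measurable
    show "integrable lebesgue (\<lambda>x. \<bar>v x\<bar> * (B * norm e))" using v by auto
    have "(\<lambda>n. - t n) \<longlonglongrightarrow> - 0" by (intro tendsto_intros t)
    then have "(\<lambda>n. (\<zeta> (x + (- t n) *\<^sub>R e) - \<zeta> x) / (- t n)) \<longlonglongrightarrow> Z x \<bullet> e" for x
      using t(2) by (intro classical_difference_quotient d) auto
    then show "AE x in lebesgue. (\<lambda>n. v x * - ((\<zeta> (x + (- t n) *\<^sub>R e) - \<zeta> x) / (- t n))) \<longlonglongrightarrow> v x * - (Z x \<bullet> e)"
      by (intro AE_I2 tendsto_intros)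
    show "AE x in lebesgue. norm (v x * - ((\<zeta> (x + (- t n) *\<^sub>R e) - \<zeta> x) / (- t n))) \<le> \<bar>v x\<bar> * (B * norm e)" for n
    proof (rule AE_I2)
      fix x
      have "\<bar>\<zeta> (x + (- t n) *\<^sub>R e) - \<zeta> x\<bar> \<le> (B * norm e) * \<bar>t n\<bar>"
        using bounded_gradient_lipschitz[OF d B, of x "(- t n) *\<^sub>R e"] by (simp add: mult_ac)
      then have le: "\<bar>\<zeta> (x + (- t n) *\<^sub>R e) - \<zeta> x\<bar> / \<bar>t n\<bar> \<le> B * norm e"
        using t(2)[of n] by (simp add: pos_divide_le_eq)
      show "norm (v x * - ((\<zeta> (x + (- t n) *\<^sub>R e) - \<zeta> x) / (- t n))) \<le> \<bar>v x\<bar> * (B * norm e)"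
        using mult_left_mono[OF le, of "\<bar>v x\<bar>"] by (simp add: abs_mult abs_divide)
    qed
  qed
  then show ?thesis unfolding eq by simp
qed

section \<open>Positive parts\<close>

lemma norm_integral_le:
  fixes f :: "'m \<Rightarrow> 'b::euclidean_space"
  assumes g: "integrable M g" and le: "\<And>x. norm (f x) \<le> g x"
  shows "norm (\<integral>x. f x \<partial>M) \<le> (\<integral>x. g x \<partial>M)"
proof (cases "integrable M f")
  case True
  have "norm (\<integral>x. f x \<partial>M) \<le> (\<integral>x. norm (f x) \<partial>M)" by (rule integral_norm_bound)
  also have "\<dots> \<le> (\<integral>x. g x \<partial>M)" using True g le by (intro integral_mono) auto
  finally show ?thesis .
next
  case False
  have "0 \<le> (\<integral>x. g x \<partial>M)" using order_trans[OF norm_ge_zero le] by (intro integral_nonneg_AE AE_I2)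
  then show ?thesis using False by (simp add: not_integrable_integral_eq)
qed

lemma null_sequence_if_bounded:
  fixes f :: "nat \<Rightarrow> real"
  assumes "\<And>n. norm (f n) \<le> C * g n" "g \<longlonglongrightarrow> 0"
  shows "f \<longlonglongrightarrow> 0"
proof (rule Lim_null_comparison)
  show "eventually (\<lambda>n. norm (f n) \<le> C * g n) sequentially" using assms(1) by simp
  show "(\<lambda>n. C * g n) \<longlonglongrightarrow> 0" using tendsto_mult_left[OF assms(2), of C] by simp
qed

text \<open>As \<zeta> may lack compact support, the definition of the weak gradient does not apply
  directly. Both sides are limits of the same integrals of difference quotients, taken in L^1 for v
  and classically for \<zeta>. The purpose is to integrate the flux of the barrier by parts.\<close>

lemma wgrad_integration_by_parts:
  fixes \<zeta> v :: "'a::euclidean_space \<Rightarrow> real"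
  assumes v: "wgrad v G"
    and d: "\<And>x. (\<zeta> has_derivative (\<lambda>h. Z x \<bullet> h)) (at x)" and B: "\<And>x. norm (Z x) \<le> B"
    and Zb: "Z \<in> borel_measurable borel" and A: "\<And>x. \<bar>\<zeta> x\<bar> \<le> A"
  shows "(\<integral>x. (G x \<bullet> e) * \<zeta> x \<partial>lebesgue) = - (\<integral>x. v x * (Z x \<bullet> e) \<partial>lebesgue)"
proof (rule LIMSEQ_unique)
  define t where "t n = inverse (real (Suc n))" for n
  have t: "t \<longlonglongrightarrow> 0" "\<And>n. t n \<noteq> 0" unfolding t_def by (auto intro: LIMSEQ_inverse_real_of_nat simp del: of_nat_Suc)
  have vi: "integrable lebesgue v" and Gi: "integrable lebesgue G" using v by (auto simp: wgrad_def)
  let ?q = "\<lambda>n x. (v (x + t n *\<^sub>R e) - v x) / t n"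
  show "(\<lambda>n. \<integral>x. ?q n x * \<zeta> x \<partial>lebesgue) \<longlonglongrightarrow> - (\<integral>x. v x * (Z x \<bullet> e) \<partial>lebesgue)"
    by (rule difference_quotient_adjoint[OF vi d B Zb A t])
  have "continuous_on UNIV \<zeta>" using d by (intro has_derivative_continuous_on[where f'="\<lambda>x h. Z x \<bullet> h"]) auto
  then have \<zeta>b: "\<zeta> \<in> borel_measurable borel" by (rule borel_measurable_continuous_onI)
  have ix: "integrable lebesgue (\<lambda>x. f x * \<zeta> x)" if "integrable lebesgue f" for f
    using that \<zeta>b by (intro integrable_mult_bounded'[where B=A] measurable_completion) (auto simp: A)
  have qi: "integrable lebesgue (?q n)" for n
    by (intro integrable_divide Bochner_Integration.integrable_diff integrable_translate vi)
  have Gei: "integrable lebesgue (\<lambda>x. G x \<bullet> e)" using Gi by auto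
  have le: "norm ((\<integral>x. ?q n x * \<zeta> x \<partial>lebesgue) - (\<integral>x. (G x \<bullet> e) * \<zeta> x \<partial>lebesgue)) \<le> A * (\<integral>x. \<bar>?q n x - G x \<bullet> e\<bar> \<partial>lebesgue)" for n
  proof -
    have "(\<integral>x. ?q n x * \<zeta> x \<partial>lebesgue) - (\<integral>x. (G x \<bullet> e) * \<zeta> x \<partial>lebesgue) = (\<integral>x. (?q n x - G x \<bullet> e) * \<zeta> x \<partial>lebesgue)"
      using ix[OF qi] ix[OF Gei] by (simp add: left_diff_distrib)
    also have "norm \<dots> \<le> (\<integral>x. \<bar>?q n x - G x \<bullet> e\<bar> * A \<partial>lebesgue)"
      using qi Gei A by (intro norm_integral_le) (auto simp: abs_mult intro!: mult_left_mono)
    finally show ?thesis by (simp add: mult.commute)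
  qed
  have "(\<lambda>n. (\<integral>x. ?q n x * \<zeta> x \<partial>lebesgue) - (\<integral>x. (G x \<bullet> e) * \<zeta> x \<partial>lebesgue)) \<longlonglongrightarrow> 0"
    by (rule null_sequence_if_bounded[OF le wgrad_difference_quotient[OF v t]])
  then show "(\<lambda>n. \<integral>x. ?q n x * \<zeta> x \<partial>lebesgue) \<longlonglongrightarrow> (\<integral>x. (G x \<bullet> e) * \<zeta> x \<partial>lebesgue)"
    by (rule LIM_zero_cancel)
qed

text \<open>The limit of (max 0 (g + t D) - max 0 g) / t as t tends to 0 from above
  (\<open>\<sigma>\<close> true) or from below; the side matters only for g = 0.\<close>

definition pos_part_slope :: "bool \<Rightarrow> real \<Rightarrow> real \<Rightarrow> real" where
  "pos_part_slope \<sigma> g D = (if g > 0 then D else if g < 0 then 0 else if \<sigma> then max 0 D else min 0 D)"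

lemma abs_pos_part_slope_le: "\<bar>pos_part_slope \<sigma> g D\<bar> \<le> \<bar>D\<bar>"
  by (auto simp: pos_part_slope_def)

lemma pos_part_quotient_tendsto:
  fixes t d :: "nat \<Rightarrow> real"
  assumes t: "t \<longlonglongrightarrow> 0" "\<And>n. t n \<noteq> 0" "\<And>n. (t n > 0) = \<sigma>" and d: "d \<longlonglongrightarrow> D"
  shows "(\<lambda>n. (max 0 (g + t n * d n) - max 0 g) / t n) \<longlonglongrightarrow> pos_part_slope \<sigma> g D"
proof -
  have "(\<lambda>n. g + t n * d n) \<longlonglongrightarrow> g + 0 * D" by (intro tendsto_intros t d)
  then have gt: "(\<lambda>n. g + t n * d n) \<longlonglongrightarrow> g" by simp
  consider "g > 0" | "g < 0" | "g = 0" by linarith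
  then show ?thesis
  proof cases
    case 1
    have "eventually (\<lambda>n. g + t n * d n > 0) sequentially" using order_tendstoD(1)[OF gt 1] .
    then have "eventually (\<lambda>n. d n = (max 0 (g + t n * d n) - max 0 g) / t n) sequentially"
      by eventually_elim (use 1 t(2) in auto)
    then show ?thesis using 1 d by (auto simp: pos_part_slope_def intro: Lim_transform_eventually)
  next
    case 2
    have "eventually (\<lambda>n. g + t n * d n < 0) sequentially" using order_tendstoD(2)[OF gt 2] .
    then have "eventually (\<lambda>n. (max 0 (g + t n * d n) - max 0 g) / t n = 0) sequentially"
      by eventually_elim (use 2 in auto)
    then show ?thesis using 2 by (auto simp: pos_part_slope_def intro: tendsto_eventually)
  next
    case 3
    have "(max 0 (g + t n * d n) - max 0 g) / t n = (if \<sigma> then max 0 (d n) else min 0 (d n))" for n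
      using t(2)[of n] t(3)[of n] 3
      by (auto simp: max_def min_def zero_le_mult_iff mult_le_0_iff)
    moreover have "(\<lambda>n. if \<sigma> then max 0 (d n) else min 0 (d n)) \<longlonglongrightarrow> (if \<sigma> then max 0 D else min 0 D)"
      using d by (auto intro!: tendsto_intros)
    ultimately show ?thesis using 3 by (simp add: pos_part_slope_def)
  qed
qed

text \<open>The one-sided difference quotients of \<open>max 0 g\<close> converge to different slopes on \<open>{g = 0}\<close>; both are weak
  derivatives, so by uniqueness the slope vanishes there.\<close>

lemma wgrad_pos_part_one_sided:
  fixes u w :: "'a::euclidean_space \<Rightarrow> real" and t :: "nat \<Rightarrow> real"
  assumes u: "wgrad u G"
    and d: "\<And>x. (w has_derivative (\<lambda>h. W x \<bullet> h)) (at x)" and B: "\<And>x. norm (W x) \<le> B"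
    and Wb[measurable]: "W \<in> borel_measurable borel" and wp: "\<And>x. 0 \<le> w x"
    and t: "t \<longlonglongrightarrow> 0" "\<And>n. t n \<noteq> 0" "\<And>n. (t n > 0) = \<sigma>" and \<phi>: "test_function \<phi>"
  shows "(\<integral>x. max 0 (u x - w x) * frechet_derivative \<phi> (at x) e \<partial>lebesgue)
       = - (\<integral>x. pos_part_slope \<sigma> (u x - w x) ((G x - W x) \<bullet> e) * \<phi> x \<partial>lebesgue)"
proof -
  have ui: "integrable lebesgue u" and Gi: "integrable lebesgue G" using u by (auto simp: wgrad_def)
  note um = borel_measurable_integrable[OF ui] and Gm = borel_measurable_integrable[OF Gi]
  have "continuous_on UNIV w" using d by (intro has_derivative_continuous_on[where f'="\<lambda>x h. W x \<bullet> h"]) auto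
  then have wb[measurable]: "w \<in> borel_measurable borel" by (rule borel_measurable_continuous_onI)
  have wm: "w \<in> borel_measurable lebesgue" and Wm: "W \<in> borel_measurable lebesgue"
    using wb Wb by (auto intro: measurable_completion)
  note [measurable] = test_function_borel[OF \<phi>]
  have \<phi>m: "\<phi> \<in> borel_measurable lebesgue" by (intro measurable_completion) simp
  define v where "v x = max 0 (u x - w x)" for x
  have vm: "v \<in> borel_measurable lebesgue" unfolding v_def using um wm by simp
  have vi: "integrable lebesgue v"
  proof (rule Bochner_Integration.integrable_bound[OF ui vm])
    show "AE x in lebesgue. norm (v x) \<le> norm (u x)"
    proof (rule AE_I2)
      fix x show "norm (v x) \<le> norm (u x)" using wp[of x] by (simp add: v_def max_def)
    qed
  qed
  obtain A where A: "\<And>x. \<bar>\<phi> x\<bar> \<le> A" using test_function_bounded[OF \<phi>] by metis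
  have A0: "A \<ge> 0" using A[of 0] by simp
  have \<phi>i: "integrable lebesgue \<phi>"
  proof -
    obtain R where R: "\<And>x. \<phi> x \<noteq> 0 \<Longrightarrow> norm x \<le> R" using test_function_support[OF \<phi>] by metis
    have "integrable lebesgue (\<lambda>x. indicator (cball 0 R) x *\<^sub>R A)"
      using integrable_real_indicator[of "cball 0 R" lebesgue] emeasure_lborel_cball_finite[of 0 R] by auto
    then show ?thesis
      by (rule Bochner_Integration.integrable_bound[OF _ \<phi>m])
        (use R A A0 in \<open>auto split: split_indicator simp: abs_mult intro!: AE_I2\<close>)
  qed
  define D where "D x = (G x - W x) \<bullet> e" for x
  define L where "L x = pos_part_slope \<sigma> (u x - w x) (D x)" for x
  have Dm: "D \<in> borel_measurable lebesgue" unfolding D_def using Gm Wm by (intro borel_measurable_inner borel_measurable_diff) auto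
  have Lm: "L \<in> borel_measurable lebesgue"
    unfolding L_def pos_part_slope_def
    by (intro measurable_If borel_measurable_max borel_measurable_min Dm)
      (use borel_measurable_less[OF um wm] borel_measurable_less[OF wm um] in auto)
  have D\<phi>: "integrable lebesgue (\<lambda>x. D x * \<phi> x)"
  proof -
    have "integrable lebesgue (\<lambda>x. (G x \<bullet> e) * \<phi> x)"
      using Gi \<phi>m by (intro integrable_mult_bounded'[where B=A] A) auto
    moreover have "integrable lebesgue (\<lambda>x. \<phi> x * (W x \<bullet> e))"
    proof (rule integrable_mult_bounded'[where B="B * norm e", OF \<phi>i])
      show "(\<lambda>x. W x \<bullet> e) \<in> borel_measurable lebesgue" using Wm by (intro borel_measurable_inner) auto
      show "\<bar>W x \<bullet> e\<bar> \<le> B * norm e" for x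
        using Cauchy_Schwarz_ineq2[of "W x" e] B[of x] by (meson mult_right_mono norm_ge_zero order_trans)
    qed
    ultimately have "integrable lebesgue (\<lambda>x. (G x \<bullet> e) * \<phi> x - \<phi> x * (W x \<bullet> e))" by auto
    then show ?thesis by (simp add: D_def inner_diff_left algebra_simps)
  qed
  define a where "a n x = (u (x + t n *\<^sub>R e) - u x) / t n - G x \<bullet> e" for n x
  have ai: "integrable lebesgue (a n)" for n
    unfolding a_def by (intro integrable_divide Bochner_Integration.integrable_diff integrable_translate ui integrable_inner_left Gi)
  have a0: "(\<lambda>n. \<integral>x. norm (a n x) \<partial>lebesgue) \<longlonglongrightarrow> 0"
    unfolding a_def real_norm_def by (rule wgrad_difference_quotient[OF u t(1,2)])
  \<comment> \<open>A subsequence turns the L^1 convergence of the quotients of u into convergence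
    almost everywhere; the signs of the steps are inherited.\<close>
  obtain r where r: "strict_mono r" "AE x in lebesgue. (\<lambda>n. a (r n) x) \<longlonglongrightarrow> 0"
    using tendsto_L1_AE_subseq[OF ai a0] by blast
  define s where "s n = t (r n)" for n
  have s: "s \<longlonglongrightarrow> 0" "\<And>n. s n \<noteq> 0" "\<And>n. (s n > 0) = \<sigma>"
    using LIMSEQ_subseq_LIMSEQ[OF t(1) r(1)] t(2,3) by (simp_all add: s_def[abs_def] comp_def)
  define b where "b n x = (w (x + s n *\<^sub>R e) - w x) / s n - W x \<bullet> e" for n x
  have b0: "(\<lambda>n. b n x) \<longlonglongrightarrow> 0" for x
    using tendsto_diff[OF classical_difference_quotient[OF d s(1,2), of x e] tendsto_const[of "W x \<bullet> e"]]
    by (simp add: b_def)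
  have bb: "\<bar>b n x\<bar> \<le> 2 * B * norm e" for n x
  proof -
    have "\<bar>w (x + s n *\<^sub>R e) - w x\<bar> \<le> (B * norm e) * \<bar>s n\<bar>"
      using bounded_gradient_lipschitz[OF d B, of x "s n *\<^sub>R e"] by (simp add: mult_ac)
    then have "\<bar>(w (x + s n *\<^sub>R e) - w x) / s n\<bar> \<le> B * norm e"
      using s(2)[of n] by (simp add: pos_divide_le_eq)
    moreover have "\<bar>W x \<bullet> e\<bar> \<le> B * norm e"
      using Cauchy_Schwarz_ineq2[of "W x" e] B[of x] by (meson mult_right_mono norm_ge_zero order_trans)
    ultimately show ?thesis unfolding b_def by linarith
  qed
  have bm: "b n \<in> borel_measurable lebesgue" for n
    unfolding b_def by (intro measurable_completion) measurable
  define q where "q n x = (v (x + s n *\<^sub>R e) - v x) / s n" for n x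
  define dd where "dd n x = D x + a (r n) x - b n x" for n x
  have dd_eq: "u (x + s n *\<^sub>R e) - w (x + s n *\<^sub>R e) = (u x - w x) + s n * dd n x" for n x
    using s(2)[of n] by (simp add: dd_def a_def b_def D_def s_def inner_diff_left field_simps)
  have q_eq: "q n x = (max 0 ((u x - w x) + s n * dd n x) - max 0 (u x - w x)) / s n" for n x
    by (simp add: q_def v_def dd_eq)
  have q_le: "\<bar>q n x\<bar> \<le> \<bar>dd n x\<bar>" for n x
  proof -
    have "\<bar>max 0 ((u x - w x) + s n * dd n x) - max 0 (u x - w x)\<bar> \<le> \<bar>dd n x\<bar> * \<bar>s n\<bar>"
      using abs_mult[of "s n" "dd n x"] by (simp add: mult.commute)
    then show ?thesis unfolding q_eq abs_divide using s(2)[of n] by (simp add: pos_divide_le_eq)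
  qed
  have ddl: "AE x in lebesgue. (\<lambda>n. dd n x) \<longlonglongrightarrow> D x"
    using r(2)
  proof eventually_elim
    case (elim x)
    have "(\<lambda>n. D x + a (r n) x - b n x) \<longlonglongrightarrow> D x + 0 - 0" by (intro tendsto_intros elim b0)
    then show ?case by (simp add: dd_def)
  qed
  have ql: "AE x in lebesgue. (\<lambda>n. q n x) \<longlonglongrightarrow> L x"
    using ddl unfolding q_eq L_def by eventually_elim (rule pos_part_quotient_tendsto[OF s])
  have qi: "integrable lebesgue (q n)" for n
    unfolding q_def by (intro integrable_divide Bochner_Integration.integrable_diff integrable_translate vi)
  have iA: "integrable lebesgue (\<lambda>x. f x * \<phi> x)" if "integrable lebesgue f" for f
    using that \<phi>m by (intro integrable_mult_bounded'[where B=A] A) auto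
  text \<open>\<open>q n\<close> is dominated only up to the term \<open>a (r n)\<close>, which is small in \<open>L\<^sup>1\<close>; clipping \<open>q n\<close> removes it.\<close>
  define M where "M x = \<bar>D x\<bar> + 2 * B * norm e" for x
  define c where "c n x = max (- M x) (min (M x) (q n x))" for n x
  have M0: "0 \<le> M x" for x using bb[of 0 x] by (auto simp: M_def)
  have Mm: "M \<in> borel_measurable lebesgue" unfolding M_def using Dm by auto
  have cm: "c n \<in> borel_measurable lebesgue" for n
    unfolding c_def using Mm borel_measurable_integrable[OF qi[of n]] by auto
  have cM: "\<bar>c n x\<bar> \<le> M x" for n x using M0[of x] by (simp add: c_def)
  have M\<phi>: "integrable lebesgue (\<lambda>x. M x * \<bar>\<phi> x\<bar>)"
    using integrable_abs[OF D\<phi>] integrable_mult_right[OF integrable_abs[OF \<phi>i], of "2 * B * norm e"]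
    by (simp add: M_def distrib_right abs_mult)
  have L\<phi>: "(\<lambda>n. \<integral>x. c n x * \<phi> x \<partial>lebesgue) \<longlonglongrightarrow> (\<integral>x. L x * \<phi> x \<partial>lebesgue)"
  proof (rule integral_dominated_convergence[where w="\<lambda>x. M x * \<bar>\<phi> x\<bar>"])
    show "(\<lambda>x. L x * \<phi> x) \<in> borel_measurable lebesgue" "(\<lambda>x. c n x * \<phi> x) \<in> borel_measurable lebesgue" for n
      using Lm cm \<phi>m by auto
    show "AE x in lebesgue. (\<lambda>n. c n x * \<phi> x) \<longlonglongrightarrow> L x * \<phi> x"
      using ql
    proof eventually_elim
      case (elim x)
      have "\<bar>L x\<bar> \<le> M x"
        using abs_pos_part_slope_le[of \<sigma> "u x - w x" "D x"] bb[of 0 x] by (simp add: L_def M_def)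
      then have "max (- M x) (min (M x) (L x)) = L x" by auto
      moreover have "(\<lambda>n. c n x) \<longlonglongrightarrow> max (- M x) (min (M x) (L x))"
        unfolding c_def by (intro tendsto_intros elim)
      ultimately show ?case by (intro tendsto_intros) simp
    qed
    show "AE x in lebesgue. norm (c n x * \<phi> x) \<le> M x * \<bar>\<phi> x\<bar>" for n
      by (intro AE_I2) (auto simp: abs_mult intro!: mult_right_mono cM)
  qed (rule M\<phi>)
  have cq: "\<bar>q n x - c n x\<bar> \<le> \<bar>a (r n) x\<bar>" for n x
  proof -
    have "\<bar>q n x\<bar> \<le> M x + \<bar>a (r n) x\<bar>"
      using q_le[of n x] bb[of n x] unfolding dd_def M_def by linarith
    then show ?thesis using M0[of x] unfolding c_def by (auto simp: max_def min_def)
  qed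
  have c\<phi>i: "integrable lebesgue (\<lambda>x. c n x * \<phi> x)" for n
  proof (rule Bochner_Integration.integrable_bound[OF M\<phi>])
    show "(\<lambda>x. c n x * \<phi> x) \<in> borel_measurable lebesgue" using cm \<phi>m by auto
    show "AE x in lebesgue. norm (c n x * \<phi> x) \<le> norm (M x * \<bar>\<phi> x\<bar>)"
      using M0 by (intro AE_I2) (auto simp: abs_mult intro!: mult_right_mono cM)
  qed
  have "norm ((\<integral>x. q n x * \<phi> x \<partial>lebesgue) - (\<integral>x. c n x * \<phi> x \<partial>lebesgue)) \<le> A * (\<integral>x. norm (a (r n) x) \<partial>lebesgue)" for n
  proof -
    have "(\<integral>x. q n x * \<phi> x \<partial>lebesgue) - (\<integral>x. c n x * \<phi> x \<partial>lebesgue) = (\<integral>x. q n x * \<phi> x - c n x * \<phi> x \<partial>lebesgue)"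
      using iA[OF qi] c\<phi>i by simp
    also have "norm \<dots> \<le> (\<integral>x. \<bar>a (r n) x\<bar> * A \<partial>lebesgue)"
    proof (rule norm_integral_le)
      show "norm (q n x * \<phi> x - c n x * \<phi> x) \<le> \<bar>a (r n) x\<bar> * A" for x
        unfolding left_diff_distrib[symmetric] real_norm_def abs_mult
        by (intro mult_mono cq A) auto
      show "integrable lebesgue (\<lambda>x. \<bar>a (r n) x\<bar> * A)" using ai[of "r n"] by auto
    qed
    finally show ?thesis by (simp add: mult.commute)
  qed
  moreover have "(\<lambda>n. \<integral>x. norm (a (r n) x) \<partial>lebesgue) \<longlonglongrightarrow> 0"
    using LIMSEQ_subseq_LIMSEQ[OF a0 r(1)] by (simp add: comp_def)
  ultimately have "(\<lambda>n. (\<integral>x. q n x * \<phi> x \<partial>lebesgue) - (\<integral>x. c n x * \<phi> x \<partial>lebesgue)) \<longlonglongrightarrow> 0"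
    by (rule null_sequence_if_bounded)
  from tendsto_add[OF this L\<phi>]
  have 1: "(\<lambda>n. \<integral>x. q n x * \<phi> x \<partial>lebesgue) \<longlonglongrightarrow> (\<integral>x. L x * \<phi> x \<partial>lebesgue)" by simp
  obtain Z C where Z: "\<And>x h. frechet_derivative \<phi> (at x) h = Z x \<bullet> h" "\<And>x. norm (Z x) \<le> C" "Z \<in> borel_measurable borel"
    using test_function_gradient[OF \<phi>] by metis
  have "(\<phi> has_derivative (\<lambda>h. Z x \<bullet> h)) (at x)" for x
    using test_function_has_derivative[OF \<phi>, of x] by (simp add: Z(1)[symmetric])
  from difference_quotient_adjoint[OF vi this Z(2,3) A s(1,2), of e]
  have "(\<lambda>n. \<integral>x. q n x * \<phi> x \<partial>lebesgue) \<longlonglongrightarrow> - (\<integral>x. v x * (Z x \<bullet> e) \<partial>lebesgue)"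
    by (simp add: q_def)
  from LIMSEQ_unique[OF this 1] show ?thesis by (simp add: Z(1) L_def D_def v_def)
qed

text \<open>Since w \<ge> 0, the positive part is bounded by |u|, and W has to be integrable only
  where u exceeds w. This admits positive constants and the barrier, neither of which is integrable
  over the whole space. On {u = w} equality of the two slopes reads max 0 D = min 0 D, which forces
  D = 0 in every direction.\<close>

lemma wgrad_pos_part:
  fixes u w :: "'a::euclidean_space \<Rightarrow> real"
  assumes u: "wgrad u G"
    and d: "\<And>x. (w has_derivative (\<lambda>h. W x \<bullet> h)) (at x)" and B: "\<And>x. norm (W x) \<le> B"
    and Wb: "W \<in> borel_measurable borel" and wp: "\<And>x. 0 \<le> w x"
    and Wi: "integrable lebesgue (\<lambda>x. if u x > w x then W x else 0)"
  shows "AE x in lebesgue. u x = w x \<longrightarrow> G x = W x"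
    and "wgrad (\<lambda>x. max 0 (u x - w x)) (\<lambda>x. if u x > w x then G x - W x else 0)"
proof -
  have ui: "integrable lebesgue u" and Gi: "integrable lebesgue G" using u by (auto simp: wgrad_def)
  note um = borel_measurable_integrable[OF ui] and Gm = borel_measurable_integrable[OF Gi]
  have "continuous_on UNIV w" using d by (intro has_derivative_continuous_on[where f'="\<lambda>x h. W x \<bullet> h"]) auto
  then have wb: "w \<in> borel_measurable borel" by (rule borel_measurable_continuous_onI)
  have wm: "w \<in> borel_measurable lebesgue" and Wm: "W \<in> borel_measurable lebesgue"
    using wb Wb by (auto intro: measurable_completion)
  define L where "L \<sigma> e x = pos_part_slope \<sigma> (u x - w x) ((G x - W x) \<bullet> e)" for \<sigma> e x
  have Lm: "L \<sigma> e \<in> borel_measurable lebesgue" for \<sigma> e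
    unfolding L_def pos_part_slope_def
    by (intro measurable_If borel_measurable_max borel_measurable_min borel_measurable_inner borel_measurable_diff Gm Wm)
      (use borel_measurable_less[OF um wm] borel_measurable_less[OF wm um] in auto)
  have weak: "(\<integral>x. max 0 (u x - w x) * frechet_derivative \<phi> (at x) e \<partial>lebesgue) = - (\<integral>x. L \<sigma> e x * \<phi> x \<partial>lebesgue)"
    if \<phi>: "test_function \<phi>" for \<phi> e \<sigma>
  proof -
    define t where "t n = (if \<sigma> then inverse (real (Suc n)) else - inverse (real (Suc n)))" for n
    have "t \<longlonglongrightarrow> 0"
      using LIMSEQ_inverse_real_of_nat tendsto_minus[OF LIMSEQ_inverse_real_of_nat]
      unfolding t_def by (cases \<sigma>) simp_all
    from wgrad_pos_part_one_sided[OF u d B Wb wp this _ _ \<phi>, of \<sigma> e] show ?thesis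
      by (simp add: t_def L_def zero_less_mult_iff del: of_nat_Suc)
  qed
  have Lle: "\<bar>L \<sigma> e x\<bar> \<le> (norm (G x) + B) * norm e" for \<sigma> e x
  proof -
    have "\<bar>L \<sigma> e x\<bar> \<le> norm (G x - W x) * norm e"
      unfolding L_def by (rule order_trans[OF abs_pos_part_slope_le Cauchy_Schwarz_ineq2])
    also have "\<dots> \<le> (norm (G x) + B) * norm e"
      using norm_triangle_ineq4[of "G x" "W x"] B[of x] by (intro mult_right_mono) auto
    finally show ?thesis .
  qed
  have LK: "set_integrable lebesgue K (L \<sigma> e)" if K: "compact K" for K \<sigma> e
    unfolding set_integrable_def
  proof (rule Bochner_Integration.integrable_bound)
    have KL: "K \<in> lmeasurable" by (rule lmeasurable_compact[OF K])
    have "integrable lebesgue (\<lambda>x. indicator K x *\<^sub>R norm (G x))"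
      using Gi KL by (intro integrable_mult_indicator) auto
    moreover have "integrable lebesgue (\<lambda>x. indicator K x * B)"
      using fmeasurableD[OF KL] fmeasurableD2[OF KL]
      by (intro integrable_mult_left integrable_real_indicator) (auto simp: less_top)
    ultimately have "integrable lebesgue (\<lambda>x. indicator K x *\<^sub>R norm (G x) + indicator K x * B)"
      by (rule Bochner_Integration.integrable_add)
    then show "integrable lebesgue (\<lambda>x. (indicator K x *\<^sub>R norm (G x) + indicator K x * B) * norm e)"
      by (rule integrable_mult_left)
    show "(\<lambda>x. indicator K x *\<^sub>R L \<sigma> e x) \<in> borel_measurable lebesgue"
      using Lm KL by (intro borel_measurable_scaleR borel_measurable_indicator) auto
    show "AE x in lebesgue. norm (indicator K x *\<^sub>R L \<sigma> e x) \<le> norm ((indicator K x *\<^sub>R norm (G x) + indicator K x * B) * norm e)"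
      by (intro AE_I2) (use Lle[of \<sigma> e] in \<open>auto split: split_indicator intro: order_trans[OF _ abs_ge_self]\<close>)
  qed
  have "AE x in lebesgue. u x = w x \<longrightarrow> (G x - W x) \<bullet> e = 0" for e
  proof -
    have "AE x in lebesgue. x \<in> UNIV \<longrightarrow> L True e x - L False e x = 0"
    proof (rule fundamental_lemma_on_open)
      show "set_integrable lebesgue K (\<lambda>x. L True e x - L False e x)" if "compact K" for K
        using LK[OF that] by (intro set_integral_diff(1))
      fix \<phi> :: "'a \<Rightarrow> real" and a b assume \<phi>: "test_function \<phi>" and 0: "\<And>x. x \<notin> cbox a b \<Longrightarrow> \<phi> x = 0"
      obtain A where A: "\<And>x. \<bar>\<phi> x\<bar> \<le> A" using test_function_bounded[OF \<phi>] by metis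
      have i: "integrable lebesgue (\<lambda>x. L \<sigma> e x * \<phi> x)" for \<sigma>
      proof -
        have "integrable lebesgue (\<lambda>x. (indicator (cbox a b) x *\<^sub>R L \<sigma> e x) * \<phi> x)"
          using LK[OF compact_cbox, of a b \<sigma> e] test_function_borel[OF \<phi>]
          by (intro integrable_mult_bounded'[where B=A] A measurable_completion) (auto simp: set_integrable_def)
        also have "(\<lambda>x. (indicator (cbox a b) x *\<^sub>R L \<sigma> e x) * \<phi> x) = (\<lambda>x. L \<sigma> e x * \<phi> x)"
          using 0 by (auto simp: fun_eq_iff split: split_indicator)
        finally show ?thesis .
      qed
      have "(\<integral>x. L True e x * \<phi> x \<partial>lebesgue) = (\<integral>x. L False e x * \<phi> x \<partial>lebesgue)"
        using weak[OF \<phi>, of e True] weak[OF \<phi>, of e False] by simp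
      then show "(\<integral>x. (L True e x - L False e x) * \<phi> x \<partial>lebesgue) = 0"
        using i by (simp add: left_diff_distrib)
    qed simp
    then show ?thesis
      by eventually_elim (auto simp: L_def pos_part_slope_def max_def min_def split: if_splits)
  qed
  then have "AE x in lebesgue. u x = w x \<longrightarrow> G x - W x = 0"
    by (intro AE_zero_componentwise[where P="\<lambda>x. u x = w x" and f="\<lambda>x. G x - W x"])
  then show *: "AE x in lebesgue. u x = w x \<longrightarrow> G x = W x" by eventually_elim simp
  show "wgrad (\<lambda>x. max 0 (u x - w x)) (\<lambda>x. if u x > w x then G x - W x else 0)"
  proof (rule wgradI)
    show "integrable lebesgue (\<lambda>x. max 0 (u x - w x))"
    proof (rule Bochner_Integration.integrable_bound[OF ui])
      show "(\<lambda>x. max 0 (u x - w x)) \<in> borel_measurable lebesgue" using um wm by auto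
      show "AE x in lebesgue. norm (max 0 (u x - w x)) \<le> norm (u x)"
      proof (rule AE_I2)
        fix x show "norm (max 0 (u x - w x)) \<le> norm (u x)" using wp[of x] by (simp add: max_def)
      qed
    qed
    have "{x. u x > w x} \<in> sets lebesgue"
      using borel_measurable_less[OF wm um] by simp
    then have "integrable lebesgue (\<lambda>x. indicator {x. u x > w x} x *\<^sub>R G x)"
      using Gi by (intro integrable_mult_indicator)
    from Bochner_Integration.integrable_diff[OF this Wi]
    show Hi: "integrable lebesgue (\<lambda>x. if u x > w x then G x - W x else 0)"
      by (rule Bochner_Integration.integrable_cong[THEN iffD1, rotated 2]) (auto split: split_indicator)
    fix \<phi> :: "'a \<Rightarrow> real" and i :: 'a assume \<phi>: "test_function \<phi>"
    have \<phi>m: "\<phi> \<in> borel_measurable lebesgue" using test_function_borel[OF \<phi>] by (intro measurable_completion) simp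
    have "(\<integral>x. L True i x * \<phi> x \<partial>lebesgue) = (\<integral>x. ((if u x > w x then G x - W x else 0) \<bullet> i) * \<phi> x \<partial>lebesgue)"
    proof (rule integral_cong_AE)
      show "AE x in lebesgue. L True i x * \<phi> x = ((if u x > w x then G x - W x else 0) \<bullet> i) * \<phi> x"
        using * by eventually_elim (auto simp: L_def pos_part_slope_def)
      show "(\<lambda>x. L True i x * \<phi> x) \<in> borel_measurable lebesgue" using Lm \<phi>m by auto
      show "(\<lambda>x. ((if u x > w x then G x - W x else 0) \<bullet> i) * \<phi> x) \<in> borel_measurable lebesgue"
        using borel_measurable_integrable[OF integrable_inner_left[OF Hi, of i]] \<phi>m by (rule borel_measurable_times)
    qed
    then show "(\<integral>x. max 0 (u x - w x) * frechet_derivative \<phi> (at x) i \<partial>lebesgue)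
       = - (\<integral>x. ((if u x > w x then G x - W x else 0) \<bullet> i) * \<phi> x \<partial>lebesgue)"
      using weak[OF \<phi>, of i True] by simp
  qed
qed

text \<open>The case w = 0. It makes gradients vanish almost everywhere off \<Omega>, so that
  gradient energies are integrals over a set of finite measure.\<close>

lemma wgrad_zero_on_zero_set:
  assumes "wgrad u G"
  shows "AE x in lebesgue. u x = 0 \<longrightarrow> G x = 0"
  by (rule wgrad_pos_part(1)[OF assms, of "\<lambda>x. 0" "\<lambda>x. 0" 0]) auto

lemma wgrad_closed:
  fixes u :: "nat \<Rightarrow> 'a::euclidean_space \<Rightarrow> real"
  assumes w: "\<And>n. wgrad (u n) (G n)" and v: "integrable lebesgue v" and H: "integrable lebesgue H"
    and uv: "(\<lambda>n. \<integral>x. \<bar>u n x - v x\<bar> \<partial>lebesgue) \<longlonglongrightarrow> 0"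
    and GH: "(\<lambda>n. \<integral>x. norm (G n x - H x) \<partial>lebesgue) \<longlonglongrightarrow> 0"
  shows "wgrad v H"
proof (rule wgradI[OF v H])
  fix \<phi> :: "'a \<Rightarrow> real" and i :: 'a assume \<phi>: "test_function \<phi>"
  have ui: "integrable lebesgue (u n)" and Gi: "integrable lebesgue (G n)" for n using w[of n] by (auto simp: wgrad_def)
  have lim: "(\<lambda>n. \<integral>x. f n x * \<psi> x \<partial>lebesgue) \<longlonglongrightarrow> (\<integral>x. g x * \<psi> x \<partial>lebesgue)"
    if f: "\<And>n. integrable lebesgue (f n)" and g: "integrable lebesgue g" and fg: "(\<lambda>n. \<integral>x. \<bar>f n x - g x\<bar> \<partial>lebesgue) \<longlonglongrightarrow> 0"
      and \<psi>: "\<psi> \<in> borel_measurable borel" "\<And>x. \<bar>\<psi> x\<bar> \<le> B" for f g \<psi> and B :: real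
  proof -
    have i: "integrable lebesgue (\<lambda>x. k x * \<psi> x)" if "integrable lebesgue k" for k
      using that \<psi> by (intro integrable_mult_bounded'[where B=B] measurable_completion) auto
    have "norm ((\<integral>x. f n x * \<psi> x \<partial>lebesgue) - (\<integral>x. g x * \<psi> x \<partial>lebesgue)) \<le> B * (\<integral>x. \<bar>f n x - g x\<bar> \<partial>lebesgue)" for n
    proof -
      have "(\<integral>x. f n x * \<psi> x \<partial>lebesgue) - (\<integral>x. g x * \<psi> x \<partial>lebesgue) = (\<integral>x. (f n x - g x) * \<psi> x \<partial>lebesgue)"
        using i[OF f] i[OF g] by (simp add: left_diff_distrib)
      also have "norm \<dots> \<le> (\<integral>x. \<bar>f n x - g x\<bar> * B \<partial>lebesgue)"
        using f g \<psi>(2) by (intro norm_integral_le) (auto simp: abs_mult intro!: mult_left_mono)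
      finally show ?thesis by (simp add: mult.commute)
    qed
    then have "(\<lambda>n. (\<integral>x. f n x * \<psi> x \<partial>lebesgue) - (\<integral>x. g x * \<psi> x \<partial>lebesgue)) \<longlonglongrightarrow> 0"
      by (rule null_sequence_if_bounded[OF _ fg])
    then show ?thesis by (rule LIM_zero_cancel)
  qed
  obtain A where A: "\<And>x. \<bar>\<phi> x\<bar> \<le> A" using test_function_bounded[OF \<phi>] by metis
  obtain B where B: "\<And>x. \<bar>frechet_derivative \<phi> (at x) i\<bar> \<le> B" using test_function_bounded_deriv[OF \<phi>] by metis
  have Gi0: "(\<lambda>n. \<integral>x. \<bar>G n x \<bullet> i - H x \<bullet> i\<bar> \<partial>lebesgue) \<longlonglongrightarrow> 0"
  proof (rule Lim_null_comparison[OF always_eventually])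
    show "\<forall>n. norm (\<integral>x. \<bar>G n x \<bullet> i - H x \<bullet> i\<bar> \<partial>lebesgue) \<le> (\<integral>x. norm (G n x - H x) \<partial>lebesgue) * norm i"
    proof
      fix n
      have "(\<integral>x. \<bar>G n x \<bullet> i - H x \<bullet> i\<bar> \<partial>lebesgue) \<le> (\<integral>x. norm (G n x - H x) * norm i \<partial>lebesgue)"
        using Gi H by (intro integral_mono) (auto simp: inner_diff_left[symmetric] Cauchy_Schwarz_ineq2)
      then show "norm (\<integral>x. \<bar>G n x \<bullet> i - H x \<bullet> i\<bar> \<partial>lebesgue) \<le> (\<integral>x. norm (G n x - H x) \<partial>lebesgue) * norm i" by simp
    qed
    show "(\<lambda>n. (\<integral>x. norm (G n x - H x) \<partial>lebesgue) * norm i) \<longlonglongrightarrow> 0"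
      using tendsto_mult_right[OF GH, of "norm i"] by simp
  qed
  have 1: "(\<lambda>n. \<integral>x. u n x * frechet_derivative \<phi> (at x) i \<partial>lebesgue) \<longlonglongrightarrow> (\<integral>x. v x * frechet_derivative \<phi> (at x) i \<partial>lebesgue)"
    by (rule lim[OF ui v uv test_function_deriv_borel[OF \<phi>] B])
  have "(\<lambda>n. \<integral>x. (G n x \<bullet> i) * \<phi> x \<partial>lebesgue) \<longlonglongrightarrow> (\<integral>x. (H x \<bullet> i) * \<phi> x \<partial>lebesgue)"
    using Gi H by (intro lim[OF _ _ Gi0 test_function_borel[OF \<phi>] A]) auto
  from tendsto_minus[OF this]
  have 2: "(\<lambda>n. \<integral>x. u n x * frechet_derivative \<phi> (at x) i \<partial>lebesgue) \<longlonglongrightarrow> - (\<integral>x. (H x \<bullet> i) * \<phi> x \<partial>lebesgue)"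
    using w \<phi> by (simp add: wgrad_def)
  show "(\<integral>x. v x * frechet_derivative \<phi> (at x) i \<partial>lebesgue) = - (\<integral>x. (H x \<bullet> i) * \<phi> x \<partial>lebesgue)"
    by (rule LIMSEQ_unique[OF 1 2])
qed

section \<open>Compactness in \<open>L\<^sup>1\<close>\<close>

text \<open>A hat of height 1 over the ball of radius \<rho>. It is Lipschitz, so averages of
  functions bounded in L^1 are equi-Lipschitz. The normalisation by \<open>cone_mass\<close> enters
  only in the average itself.\<close>

definition cone_kernel :: "real \<Rightarrow> 'a::euclidean_space \<Rightarrow> real" where
  "cone_kernel \<rho> z = max 0 (1 - norm z / \<rho>)"

definition cone_mass :: "'a::euclidean_space itself \<Rightarrow> real \<Rightarrow> real" where
  "cone_mass _ \<rho> = (\<integral>z. cone_kernel \<rho> z \<partial>(lebesgue :: 'a measure))"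

lemma cone_kernel_bounds: "0 \<le> cone_kernel \<rho> z" "\<rho> > 0 \<Longrightarrow> cone_kernel \<rho> z \<le> 1"
  by (auto simp: cone_kernel_def)

lemma cone_kernel_borel[measurable]: "cone_kernel \<rho> \<in> borel_measurable borel"
  unfolding cone_kernel_def by measurable

lemma cone_kernel_lipschitz:
  assumes "\<rho> > 0" shows "\<bar>cone_kernel \<rho> x - cone_kernel \<rho> y\<bar> \<le> norm (x - y) / \<rho>"
proof -
  have "\<bar>norm x / \<rho> - norm y / \<rho>\<bar> \<le> norm (x - y) / \<rho>"
    using assms norm_triangle_ineq3[of x y] by (simp add: diff_divide_distrib[symmetric] divide_right_mono)
  then show ?thesis unfolding cone_kernel_def by linarith
qed

lemma cone_kernel_integrable:
  assumes "\<rho> > 0" shows "integrable lebesgue (cone_kernel \<rho> :: 'a::euclidean_space \<Rightarrow> real)"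
proof (rule Bochner_Integration.integrable_bound)
  show "integrable lebesgue (indicator (cball 0 \<rho>) :: 'a \<Rightarrow> real)"
    using emeasure_lborel_cball_finite[of "0::'a" \<rho>] by (intro integrable_real_indicator) auto
  show "cone_kernel \<rho> \<in> borel_measurable lebesgue" by (intro measurable_completion) simp
  show "AE x in lebesgue. norm (cone_kernel \<rho> x) \<le> norm (indicator (cball 0 \<rho>) x :: real)"
    using assms by (intro AE_I2) (auto simp: cone_kernel_def max_def field_simps split: split_indicator)
qed

text \<open>The kernel is at least 1/2 on the ball of half the radius. Only the order \<rho>^N
  matters; it is set against \<rho>^(N + \<sigma>) from a fractional kernel.\<close>

lemma cone_mass_lower_bound:
  assumes \<rho>: "\<rho> > 0"
  shows "unit_ball_vol (real DIM('a)) / 2 * (\<rho> / 2) ^ DIM('a) \<le> cone_mass TYPE('a::euclidean_space) \<rho>"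
proof -
  have i: "integrable lebesgue (\<lambda>z::'a. 1 / 2 * indicator (ball 0 (\<rho> / 2)) z :: real)"
    using emeasure_lborel_ball_finite[of "0::'a" "\<rho> / 2"]
    by (intro integrable_mult_right integrable_real_indicator) auto
  have "(\<integral>z. 1 / 2 * indicator (ball 0 (\<rho> / 2)) z \<partial>(lebesgue :: 'a measure)) \<le> cone_mass TYPE('a) \<rho>"
    unfolding cone_mass_def using \<rho> i cone_kernel_integrable[OF \<rho>, where 'a='a]
    by (intro integral_mono) (auto simp: cone_kernel_def field_simps split: split_indicator)
  moreover have "(\<integral>z. 1 / 2 * indicator (ball 0 (\<rho> / 2)) z \<partial>(lebesgue :: 'a measure)) = 1 / 2 * measure lebesgue (ball (0::'a) (\<rho> / 2))"
    by simp
  moreover have "measure lebesgue (ball (0::'a) (\<rho> / 2)) = unit_ball_vol (real DIM('a)) * (\<rho> / 2) ^ DIM('a)"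
    using \<rho> content_ball[of "\<rho> / 2" "0::'a"] by simp
  ultimately show ?thesis by simp
qed

lemma cone_mass_pos: "\<rho> > 0 \<Longrightarrow> cone_mass TYPE('a::euclidean_space) \<rho> > 0"
  by (rule less_le_trans[OF _ cone_mass_lower_bound]) (auto intro!: mult_pos_pos)

lemma cone_mass_translate: "(\<integral>y. cone_kernel \<rho> (x - y) \<partial>lebesgue) = cone_mass TYPE('a) \<rho>" for x :: "'a::euclidean_space"
proof -
  have "(\<integral>y. cone_kernel \<rho> (x - y) \<partial>lebesgue) = (\<integral>y. cone_kernel \<rho> (y + (- x)) \<partial>lebesgue)"
    by (simp add: cone_kernel_def norm_minus_commute)
  also have "\<dots> = cone_mass TYPE('a) \<rho>"
    unfolding cone_mass_def by (intro integral_translate measurable_completion) simp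
  finally show ?thesis .
qed

definition cone_average :: "real \<Rightarrow> ('a::euclidean_space \<Rightarrow> real) \<Rightarrow> 'a \<Rightarrow> real" where
  "cone_average \<rho> u x = (\<integral>y. u y * cone_kernel \<rho> (x - y) \<partial>lebesgue) / cone_mass TYPE('a) \<rho>"

lemma cone_average_integrand:
  assumes "\<rho> > 0" "integrable lebesgue u"
  shows "integrable lebesgue (\<lambda>y. u y * cone_kernel \<rho> (x - y))"
proof (rule integrable_mult_bounded'[where B=1, OF assms(2)])
  show "(\<lambda>y. cone_kernel \<rho> (x - y)) \<in> borel_measurable lebesgue" by (intro measurable_completion) simp
  show "\<bar>cone_kernel \<rho> (x - y)\<bar> \<le> 1" for y using cone_kernel_bounds[of \<rho> "x - y"] assms by auto
qed

lemma cone_average_bounded: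
  fixes u :: "'a::euclidean_space \<Rightarrow> real"
  assumes "\<rho> > 0" "integrable lebesgue u" "(\<integral>x. \<bar>u x\<bar> \<partial>lebesgue) \<le> B"
  shows "\<bar>cone_average \<rho> u x\<bar> \<le> B / cone_mass TYPE('a) \<rho>"
proof -
  have "norm (\<integral>y. u y * cone_kernel \<rho> (x - y) \<partial>lebesgue) \<le> (\<integral>y. \<bar>u y\<bar> \<partial>lebesgue)"
    using assms cone_kernel_bounds[of \<rho>]
    by (intro norm_integral_le)
      (auto simp: abs_mult abs_of_nonneg[OF cone_kernel_bounds(1)] intro!: mult_right_le_one_le)
  then show ?thesis
    using assms cone_mass_pos[OF assms(1), where 'a='a] by (simp add: cone_average_def divide_right_mono)
qed

lemma cone_average_lipschitz:
  fixes u :: "'a::euclidean_space \<Rightarrow> real"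
  assumes \<rho>: "\<rho> > 0" and u: "integrable lebesgue u" and B: "(\<integral>x. \<bar>u x\<bar> \<partial>lebesgue) \<le> B"
  shows "\<bar>cone_average \<rho> u x - cone_average \<rho> u x'\<bar> \<le> B / (\<rho> * cone_mass TYPE('a) \<rho>) * norm (x - x')"
proof -
  have "(\<integral>y. u y * cone_kernel \<rho> (x - y) \<partial>lebesgue) - (\<integral>y. u y * cone_kernel \<rho> (x' - y) \<partial>lebesgue)
     = (\<integral>y. u y * (cone_kernel \<rho> (x - y) - cone_kernel \<rho> (x' - y)) \<partial>lebesgue)"
    using cone_average_integrand[OF \<rho> u] by (simp add: right_diff_distrib)
  also have "norm \<dots> \<le> (\<integral>y. \<bar>u y\<bar> * (norm (x - x') / \<rho>) \<partial>lebesgue)"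
  proof (rule norm_integral_le)
    show "integrable lebesgue (\<lambda>y. \<bar>u y\<bar> * (norm (x - x') / \<rho>))" using u by auto
    show "norm (u y * (cone_kernel \<rho> (x - y) - cone_kernel \<rho> (x' - y))) \<le> \<bar>u y\<bar> * (norm (x - x') / \<rho>)" for y
      using cone_kernel_lipschitz[OF \<rho>, of "x - y" "x' - y"] unfolding real_norm_def abs_mult
      by (intro mult_left_mono) auto
  qed
  also have "\<dots> \<le> B * (norm (x - x') / \<rho>)"
    using B \<rho> mult_right_mono[OF B, of "norm (x - x') / \<rho>"] by simp
  finally show ?thesis
    using cone_mass_pos[OF \<rho>, where 'a='a] \<rho>
    by (simp add: cone_average_def diff_divide_distrib[symmetric] field_simps)
qed

lemma cone_average_continuous:
  fixes u :: "'a::euclidean_space \<Rightarrow> real"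
  assumes "\<rho> > 0" "integrable lebesgue u"
  shows "continuous_on UNIV (cone_average \<rho> u)"
proof (rule lipschitz_on_continuous_on)
  let ?L = "(\<integral>x. \<bar>u x\<bar> \<partial>lebesgue) / (\<rho> * cone_mass TYPE('a) \<rho>)"
  show "?L-lipschitz_on UNIV (cone_average \<rho> u)"
  proof (rule lipschitz_onI)
    show "dist (cone_average \<rho> u x) (cone_average \<rho> u y) \<le> ?L * dist x y" for x y
      using cone_average_lipschitz[OF assms order_refl] by (simp add: dist_norm)
    show "0 \<le> ?L" using assms cone_mass_pos[OF assms(1), where 'a='a] by (intro divide_nonneg_pos) auto
  qed
qed

text \<open>Divided by the mass of the kernel, this bounds the L^1 distance of u from its average.
  Its value lies in \<open>ennreal\<close>, so that the energies can bound it without a prior proof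
  of integrability.\<close>

definition mean_osc :: "real \<Rightarrow> ('a::euclidean_space \<Rightarrow> real) \<Rightarrow> ennreal" where
  "mean_osc \<rho> u = (\<integral>\<^sup>+z. ennreal (cone_kernel \<rho> (fst z - snd z) * \<bar>u (fst z) - u (snd z)\<bar>) \<partial>lebesgue)"

lemma measurable_diff_lebesgue_prod:
  assumes "u \<in> borel_measurable lebesgue"
  shows "(\<lambda>z::'a::euclidean_space \<times> 'a. u (fst z) - u (snd z) :: real) \<in> borel_measurable lebesgue"
  using measurable_fst_lebesgue[OF assms, where 'c='a] measurable_snd_lebesgue[OF assms, where 'a='a] by (rule borel_measurable_diff)

lemma borel_measurable_lebesgue_prodI:
  assumes "f \<in> borel_measurable (borel \<Otimes>\<^sub>M borel)"
  shows "(f :: 'a::euclidean_space \<times> 'b::euclidean_space \<Rightarrow> 'c::euclidean_space) \<in> borel_measurable lebesgue"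
  using assms by (intro measurable_completion) (simp add: borel_prod)

lemma mean_osc_integrand_measurable:
  fixes u :: "'a::euclidean_space \<Rightarrow> real"
  assumes "u \<in> borel_measurable lebesgue"
  shows "(\<lambda>z. ennreal (cone_kernel \<rho> (fst z - snd z) * \<bar>u (fst z) - u (snd z)\<bar>)) \<in> borel_measurable lebesgue"
proof -
  have "(\<lambda>z::'a \<times> 'a. cone_kernel \<rho> (fst z - snd z)) \<in> borel_measurable lebesgue"
    by (rule borel_measurable_lebesgue_prodI) measurable
  then show ?thesis
    using measurable_diff_lebesgue_prod[OF assms]
    by (intro measurable_compose[OF _ measurable_ennreal] borel_measurable_times borel_measurable_abs)
qed

lemma cone_average_error:
  fixes u :: "'a::euclidean_space \<Rightarrow> real"
  assumes \<rho>: "\<rho> > 0" and u: "integrable lebesgue u"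
  shows "(\<integral>\<^sup>+x. ennreal \<bar>cone_average \<rho> u x - u x\<bar> \<partial>lebesgue) \<le> mean_osc \<rho> u / ennreal (cone_mass TYPE('a) \<rho>)"
proof -
  let ?c = "cone_mass TYPE('a) \<rho>"
  have c: "?c > 0" by (rule cone_mass_pos[OF \<rho>])
  have pt: "ennreal \<bar>cone_average \<rho> u x - u x\<bar> \<le>
      (\<integral>\<^sup>+y. ennreal (cone_kernel \<rho> (x - y) * \<bar>u x - u y\<bar>) \<partial>lebesgue) / ennreal ?c" for x
  proof -
    have ki: "integrable lebesgue (\<lambda>y. cone_kernel \<rho> (x - y))"
      using integrable_translate[OF cone_kernel_integrable[OF \<rho>], of "- x"]
      by (simp add: cone_kernel_def norm_minus_commute)
    have "(\<integral>y. u y * cone_kernel \<rho> (x - y) \<partial>lebesgue) - u x * ?c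
        = (\<integral>y. u y * cone_kernel \<rho> (x - y) - u x * cone_kernel \<rho> (x - y) \<partial>lebesgue)"
      using cone_average_integrand[OF \<rho> u, of x] ki by (simp add: cone_mass_translate)
    then have "cone_average \<rho> u x - u x = (\<integral>y. u y * cone_kernel \<rho> (x - y) - u x * cone_kernel \<rho> (x - y) \<partial>lebesgue) / ?c"
      using c by (simp add: cone_average_def field_simps)
    then have "ennreal \<bar>cone_average \<rho> u x - u x\<bar>
      = ennreal (norm (\<integral>y. u y * cone_kernel \<rho> (x - y) - u x * cone_kernel \<rho> (x - y) \<partial>lebesgue)) / ennreal ?c"
      using c by (simp add: divide_ennreal abs_divide)
    also have "\<dots> \<le> (\<integral>\<^sup>+y. ennreal (norm (u y * cone_kernel \<rho> (x - y) - u x * cone_kernel \<rho> (x - y))) \<partial>lebesgue) / ennreal ?c"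
      using cone_average_integrand[OF \<rho> u, of x] ki
      by (intro divide_right_mono_ennreal integral_norm_bound_ennreal) auto
    also have "(\<lambda>y. norm (u y * cone_kernel \<rho> (x - y) - u x * cone_kernel \<rho> (x - y))) = (\<lambda>y. cone_kernel \<rho> (x - y) * \<bar>u x - u y\<bar>)"
      by (auto simp: fun_eq_iff left_diff_distrib[symmetric] abs_mult mult.commute abs_minus_commute
          abs_of_nonneg[OF cone_kernel_bounds(1)])
    finally show ?thesis .
  qed
  have "(\<integral>\<^sup>+x. ennreal \<bar>cone_average \<rho> u x - u x\<bar> \<partial>lebesgue)
     \<le> (\<integral>\<^sup>+x. (\<integral>\<^sup>+y. ennreal (cone_kernel \<rho> (x - y) * \<bar>u x - u y\<bar>) \<partial>lebesgue) * inverse (ennreal ?c) \<partial>lebesgue)"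
    using pt by (intro nn_integral_mono) (simp add: divide_ennreal_def)
  also have "\<dots> = (\<integral>\<^sup>+x. (\<integral>\<^sup>+y. ennreal (cone_kernel \<rho> (x - y) * \<bar>u x - u y\<bar>) * inverse (ennreal ?c) \<partial>lebesgue) \<partial>lebesgue)"
  proof (intro nn_integral_cong nn_integral_multc[symmetric])
    fix x :: 'a
    have "(\<lambda>y. cone_kernel \<rho> (x - y)) \<in> borel_measurable lebesgue" by (intro measurable_completion) simp
    then show "(\<lambda>y. ennreal (cone_kernel \<rho> (x - y) * \<bar>u x - u y\<bar>)) \<in> borel_measurable lebesgue"
      using borel_measurable_integrable[OF u] by (intro measurable_compose[OF _ measurable_ennreal]) auto
  qed
  also have "\<dots> = (\<integral>\<^sup>+z. ennreal (cone_kernel \<rho> (fst z - snd z) * \<bar>u (fst z) - u (snd z)\<bar>) * inverse (ennreal ?c) \<partial>lebesgue)"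
    using mean_osc_integrand_measurable[OF borel_measurable_integrable[OF u], of \<rho>]
    by (subst nn_integral_lebesgue_prod(1)) auto
  also have "\<dots> = mean_osc \<rho> u * inverse (ennreal ?c)"
    unfolding mean_osc_def
    by (rule nn_integral_multc[OF mean_osc_integrand_measurable[OF borel_measurable_integrable[OF u]]])
  finally show ?thesis by (simp add: divide_ennreal_def)
qed

text \<open>A form of the Riesz-Kolmogorov criterion. At each scale 1 / (j + 1) the averages are
  bounded and equi-Lipschitz, so one subsequence of them converges everywhere for all scales at
  once; \<open>osc\<close> makes the averages, at a suitable scale, uniformly close in L^1 to the
  functions themselves.\<close>

lemma L1_compactness:
  fixes u :: "nat \<Rightarrow> 'a::euclidean_space \<Rightarrow> real"
  assumes u: "\<And>n. integrable lebesgue (u n)" and \<Omega>: "bounded \<Omega>" "\<Omega> \<in> sets lebesgue"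
    and z: "\<And>n x. x \<notin> \<Omega> \<Longrightarrow> u n x = 0" and B: "\<And>n. (\<integral>x. \<bar>u n x\<bar> \<partial>lebesgue) \<le> B"
    and osc: "\<And>\<eta>. \<eta> > 0 \<Longrightarrow> \<exists>j::nat. \<forall>n. mean_osc (inverse (real (Suc j))) (u n)
        \<le> ennreal (\<eta> * cone_mass TYPE('a) (inverse (real (Suc j))))"
  obtains v k where "strict_mono (k :: nat \<Rightarrow> nat)" "integrable lebesgue v" "\<And>x. x \<notin> \<Omega> \<Longrightarrow> v x = 0"
    "(\<lambda>n. \<integral>x. \<bar>u (k n) x - v x\<bar> \<partial>lebesgue) \<longlonglongrightarrow> 0" "AE x in lebesgue. (\<lambda>n. u (k n) x) \<longlonglongrightarrow> v x"
proof -
  define \<rho> where "\<rho> j = inverse (real (Suc j))" for j :: nat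
  have \<rho>: "\<rho> j > 0" for j by (simp add: \<rho>_def)
  let ?c = "\<lambda>j. cone_mass TYPE('a) (\<rho> j)"
  have c: "?c j > 0" for j by (rule cone_mass_pos[OF \<rho>])
  have B0: "B \<ge> 0" using B[of 0] by (rule order_trans[rotated]) simp
  obtain D :: "'a set" where D: "countable D" "\<And>X. open X \<Longrightarrow> X \<noteq> {} \<Longrightarrow> \<exists>d\<in>D. d \<in> X"
    using countable_dense_exists by metis
  \<comment> \<open>The factor \<open>?c\<close> cancels the normalisation, so that one bound B
    serves all scales, as the extraction of a common subsequence requires.\<close>
  define f where "f n p = cone_average (\<rho> (fst p)) (u n) (snd p) * ?c (fst p)" for n and p :: "nat \<times> 'a"
  have fB: "norm (f n p) \<le> B" for n p
    using cone_average_bounded[OF \<rho>[of "fst p"] u[of n] B[of n], of "snd p"] c[of "fst p"]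
    by (simp add: f_def abs_mult pos_le_divide_eq)
  obtain k where k: "strict_mono (k :: nat \<Rightarrow> nat)" "\<And>p. p \<in> UNIV \<times> D \<Longrightarrow> \<exists>l. (\<lambda>n. f (k n) p) \<longlonglongrightarrow> l"
    using function_convergent_subsequence[of "(UNIV::nat set) \<times> D" f B] D(1) fB by (metis countable_SIGMA countableI_type)
  define a where "a j n x = cone_average (\<rho> j) (u (k n)) x" for j n x
  have aD: "Cauchy (\<lambda>n. a j n d)" if d: "d \<in> D" for j d
  proof -
    obtain l where "(\<lambda>n. f (k n) (j, d)) \<longlonglongrightarrow> l" using k(2)[of "(j, d)"] d by auto
    from tendsto_divide[OF this tendsto_const[of "?c j"]] c[of j]
    have "(\<lambda>n. a j n d) \<longlonglongrightarrow> l / ?c j" by (simp add: f_def a_def)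
    then show ?thesis by (rule LIMSEQ_imp_Cauchy)
  qed
  \<comment> \<open>Convergence on the dense set extends to every point by the common Lipschitz
    constant.\<close>
  have aC: "Cauchy (\<lambda>n. a j n x)" for j x
  proof (rule metric_CauchyI)
    fix e :: real assume e: "e > 0"
    define L where "L = B / (\<rho> j * ?c j)"
    have L: "L \<ge> 0" using B0 \<rho>[of j] c[of j] by (simp add: L_def)
    define \<delta> where "\<delta> = e / (3 * (L + 1))"
    have \<delta>: "\<delta> > 0" "L * \<delta> < e / 3" using e L by (auto simp: \<delta>_def divide_simps)
    obtain d where d: "d \<in> D" "d \<in> ball x \<delta>" using D(2)[of "ball x \<delta>"] \<delta>(1) by auto
    have close: "\<bar>a j n x - a j n d\<bar> < e / 3" for n
    proof -
      have "\<bar>a j n x - a j n d\<bar> \<le> L * norm (x - d)"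
        unfolding a_def L_def by (rule cone_average_lipschitz[OF \<rho> u B])
      also have "\<dots> \<le> L * \<delta>" using d(2) L by (intro mult_left_mono) (auto simp: dist_norm)
      finally show ?thesis using \<delta>(2) by simp
    qed
    obtain M where M: "\<And>m n. m \<ge> M \<Longrightarrow> n \<ge> M \<Longrightarrow> dist (a j m d) (a j n d) < e / 3"
      using metric_CauchyD[OF aD[OF d(1)], of "e / 3" j] e by (metis divide_pos_pos zero_less_numeral)
    have "dist (a j m x) (a j n x) < e" if "m \<ge> M" "n \<ge> M" for m n
      using M[OF that, of ] close[of m] close[of n] unfolding dist_real_def by linarith
    then show "\<exists>M. \<forall>m\<ge>M. \<forall>n\<ge>M. dist (a j m x) (a j n x) < e" by blast
  qed
  define l where "l j x = lim (\<lambda>n. a j n x)" for j x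
  have al: "(\<lambda>n. a j n x) \<longlonglongrightarrow> l j x" for j x
    using aC[of j x] by (simp add: l_def Cauchy_convergent_iff convergent_LIMSEQ_iff)
  have am: "a j n \<in> borel_measurable lebesgue" for j n
    unfolding a_def[abs_def] using borel_measurable_continuous_onI[OF cone_average_continuous[OF \<rho> u]]
    by (intro measurable_completion) simp
  have lm: "l j \<in> borel_measurable lebesgue" for j
    by (rule borel_measurable_LIMSEQ_real[of lebesgue "a j"]) (use al am in auto)
  have \<Omega>i: "integrable lebesgue (indicator \<Omega> :: 'a \<Rightarrow> real)"
    using bounded_set_imp_lmeasurable[OF \<Omega>] by (auto simp: fmeasurable_def intro!: integrable_real_indicator)
  have aB: "\<bar>a j n x\<bar> \<le> B / ?c j" for j n x
    unfolding a_def by (rule cone_average_bounded[OF \<rho> u B])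
  have lB: "\<bar>l j x\<bar> \<le> B / ?c j" for j x
    by (rule LIMSEQ_le_const2[OF tendsto_rabs[OF al[of j x]]]) (use aB in auto)
  have La: "(\<lambda>n. \<integral>x. indicator \<Omega> x * \<bar>a j n x - l j x\<bar> \<partial>lebesgue) \<longlonglongrightarrow> 0" for j
  proof -
    have "(\<lambda>n. \<integral>x. indicator \<Omega> x * \<bar>a j n x - l j x\<bar> \<partial>lebesgue) \<longlonglongrightarrow> (\<integral>x. indicator \<Omega> x * \<bar>l j x - l j x\<bar> \<partial>(lebesgue :: 'a measure))"
    proof (rule integral_dominated_convergence[where w="\<lambda>x. indicator \<Omega> x * (2 * (B / ?c j))"])
      show "integrable lebesgue (\<lambda>x. indicator \<Omega> x * (2 * (B / ?c j)))" using \<Omega>i by (intro integrable_mult_left) auto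
      show "(\<lambda>x. indicator \<Omega> x * \<bar>l j x - l j x\<bar>) \<in> borel_measurable lebesgue" by simp
      show "(\<lambda>x. indicator \<Omega> x * \<bar>a j n x - l j x\<bar>) \<in> borel_measurable lebesgue" for n
        using am lm \<Omega>(2) by (intro borel_measurable_times borel_measurable_indicator) auto
      show "AE x in lebesgue. (\<lambda>n. indicator \<Omega> x * \<bar>a j n x - l j x\<bar>) \<longlonglongrightarrow> indicator \<Omega> x * \<bar>l j x - l j x\<bar>"
        by (intro AE_I2 tendsto_intros al)
      have "\<bar>a j n x - l j x\<bar> \<le> 2 * (B / ?c j)" for n x using aB[of j n x] lB[of j x] by linarith
      then show "AE x in lebesgue. norm (indicator \<Omega> x * \<bar>a j n x - l j x\<bar>) \<le> indicator \<Omega> x * (2 * (B / ?c j))" for n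
        by (intro AE_I2) (auto split: split_indicator)
    qed
    then show ?thesis by simp
  qed
  have ai: "integrable lebesgue (\<lambda>x. indicator \<Omega> x * \<bar>a j n x - l j x\<bar>)" for j n
  proof (rule Bochner_Integration.integrable_bound)
    show "integrable lebesgue (\<lambda>x. indicator \<Omega> x * (2 * (B / ?c j)))" using \<Omega>i by (intro integrable_mult_left) auto
    show "(\<lambda>x. indicator \<Omega> x * \<bar>a j n x - l j x\<bar>) \<in> borel_measurable lebesgue"
      using am lm \<Omega>(2) by (intro borel_measurable_times borel_measurable_indicator) auto
    have "\<bar>a j n x - l j x\<bar> \<le> \<bar>2 * (B / ?c j)\<bar>" for x using aB[of j n x] lB[of j x] by linarith
    then show "AE x in lebesgue. norm (indicator \<Omega> x * \<bar>a j n x - l j x\<bar>) \<le> norm (indicator \<Omega> x * (2 * (B / ?c j)))"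
      by (intro AE_I2) (auto split: split_indicator)
  qed
  have err: "integrable lebesgue (\<lambda>x. indicator \<Omega> x * \<bar>a j n x - u (k n) x\<bar>)" for j n
  proof (rule Bochner_Integration.integrable_bound)
    show "integrable lebesgue (\<lambda>x. indicator \<Omega> x * (B / ?c j) + \<bar>u (k n) x\<bar>)"
      using \<Omega>i u by (intro Bochner_Integration.integrable_add integrable_mult_left) auto
    show "(\<lambda>x. indicator \<Omega> x * \<bar>a j n x - u (k n) x\<bar>) \<in> borel_measurable lebesgue"
      using am borel_measurable_integrable[OF u] \<Omega>(2) by (intro borel_measurable_times borel_measurable_indicator) auto
    have "\<bar>a j n x - u (k n) x\<bar> \<le> B / ?c j + \<bar>u (k n) x\<bar>" for x using aB[of j n x] by linarith
    then show "AE x in lebesgue. norm (indicator \<Omega> x * \<bar>a j n x - u (k n) x\<bar>) \<le> norm (indicator \<Omega> x * (B / ?c j) + \<bar>u (k n) x\<bar>)"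
      by (intro AE_I2) (auto split: split_indicator intro: order_trans[OF _ abs_ge_self])
  qed
  have errb: "(\<integral>x. indicator \<Omega> x * \<bar>a j n x - u (k n) x\<bar> \<partial>lebesgue) \<le> \<eta>"
    if \<eta>: "\<eta> > 0" and j: "\<And>n. mean_osc (\<rho> j) (u n) \<le> ennreal (\<eta> * ?c j)" for \<eta> j n
  proof -
    have "ennreal (\<integral>x. indicator \<Omega> x * \<bar>a j n x - u (k n) x\<bar> \<partial>lebesgue)
      = (\<integral>\<^sup>+x. ennreal (indicator \<Omega> x * \<bar>a j n x - u (k n) x\<bar>) \<partial>lebesgue)"
      using err by (intro nn_integral_eq_integral[symmetric]) auto
    also have "\<dots> \<le> (\<integral>\<^sup>+x. ennreal \<bar>cone_average (\<rho> j) (u (k n)) x - u (k n) x\<bar> \<partial>lebesgue)"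
      by (intro nn_integral_mono ennreal_leI) (auto simp: a_def split: split_indicator)
    also have "\<dots> \<le> mean_osc (\<rho> j) (u (k n)) / ennreal (?c j)" by (rule cone_average_error[OF \<rho> u])
    also have "\<dots> \<le> ennreal (\<eta> * ?c j) / ennreal (?c j)" by (intro divide_right_mono_ennreal j)
    also have "\<dots> = ennreal \<eta>" using c[of j] \<eta> by (simp add: divide_ennreal)
    finally show ?thesis using \<eta> by simp
  qed
  have uk: "integrable lebesgue (u (k n))" for n by (rule u)
  have Cau: "\<exists>N. \<forall>m\<ge>N. \<forall>n\<ge>N. (\<integral>x. norm (u (k m) x - u (k n) x) \<partial>lebesgue) < e" if e: "e > 0" for e
  proof -
    obtain j where j: "\<And>n. mean_osc (\<rho> j) (u n) \<le> ennreal (e / 5 * ?c j)"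
      using osc[of "e / 5"] e unfolding \<rho>_def by auto
    have "eventually (\<lambda>n. (\<integral>x. indicator \<Omega> x * \<bar>a j n x - l j x\<bar> \<partial>lebesgue) < e / 5) sequentially"
      using order_tendstoD(2)[OF La[of j], of "e / 5"] e by simp
    then obtain N where N: "\<And>n. n \<ge> N \<Longrightarrow> (\<integral>x. indicator \<Omega> x * \<bar>a j n x - l j x\<bar> \<partial>lebesgue) < e / 5"
      by (auto simp: eventually_sequentially)
    have "(\<integral>x. norm (u (k m) x - u (k n) x) \<partial>lebesgue) < e" if m: "m \<ge> N" and n: "n \<ge> N" for m n
    proof -
      let ?E = "\<lambda>n x. indicator \<Omega> x * \<bar>a j n x - u (k n) x\<bar>" and ?A = "\<lambda>n x. indicator \<Omega> x * \<bar>a j n x - l j x\<bar>"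
      have "(\<integral>x. norm (u (k m) x - u (k n) x) \<partial>lebesgue) \<le> (\<integral>x. (?E m x + ?A m x) + (?A n x + ?E n x) \<partial>lebesgue)"
        using u err ai z by (intro integral_mono) (auto split: split_indicator)
      also have "\<dots> = ((\<integral>x. ?E m x \<partial>lebesgue) + (\<integral>x. ?A m x \<partial>lebesgue)) + ((\<integral>x. ?A n x \<partial>lebesgue) + (\<integral>x. ?E n x \<partial>lebesgue))"
        using err ai by simp
      also have "\<dots> < e"
        using errb[OF _ j, of m] errb[OF _ j, of n] N[OF m] N[OF n] e by simp
      finally show ?thesis .
    qed
    then show ?thesis by blast
  qed
  obtain g r where g: "integrable lebesgue g" "(\<lambda>n. \<integral>x. norm (u (k n) x - g x) \<partial>lebesgue) \<longlonglongrightarrow> 0"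
    "strict_mono (r :: nat \<Rightarrow> nat)" "AE x in lebesgue. (\<lambda>n. u (k (r n)) x) \<longlonglongrightarrow> g x"
    using L1_complete[OF uk Cau] by blast
  \<comment> \<open>The limit is cut off so that it vanishes at every point outside \<Omega>, not
    merely at almost every one, as membership in the energy space demands.\<close>
  define v where "v x = indicator \<Omega> x * g x" for x
  have gv: "AE x in lebesgue. g x = v x"
    using g(4)
  proof eventually_elim
    case (elim x)
    show ?case
    proof (cases "x \<in> \<Omega>")
      case False
      then have "(\<lambda>n. u (k (r n)) x) \<longlonglongrightarrow> 0" using z by simp
      from LIMSEQ_unique[OF elim this] show ?thesis using False by (simp add: v_def)
    qed (simp add: v_def)
  qed
  have vi: "integrable lebesgue v"
    using integrable_mult_indicator[OF \<Omega>(2) g(1)] by (simp add: v_def[abs_def])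
  show thesis
  proof (rule that[of "k \<circ> r" v])
    show "strict_mono (k \<circ> r)" by (rule strict_mono_o[OF k(1) g(3)])
    show "integrable lebesgue v" by (rule vi)
    show "v x = 0" if "x \<notin> \<Omega>" for x using that by (simp add: v_def)
    have "(\<integral>x. \<bar>u ((k \<circ> r) n) x - v x\<bar> \<partial>lebesgue) = (\<integral>x. norm (u (k (r n)) x - g x) \<partial>lebesgue)" for n
      using u vi g(1) gv by (intro integral_cong_AE) (auto elim: eventually_mono)
    then show "(\<lambda>n. \<integral>x. \<bar>u ((k \<circ> r) n) x - v x\<bar> \<partial>lebesgue) \<longlonglongrightarrow> 0"
      using LIMSEQ_subseq_LIMSEQ[OF g(2,3)] by (simp add: comp_def)
    show "AE x in lebesgue. (\<lambda>n. u ((k \<circ> r) n) x) \<longlonglongrightarrow> v x"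
      using g(4) gv by eventually_elim (simp add: comp_def)
  qed
qed

text \<open>For t above \<eta> the factor (t / \<eta>)^(p - 1) is at least 1. Integrated over a set
  of finite measure, this plays the part of Hoelder's inequality with a free parameter.\<close>

lemma le_add_powr:
  fixes t \<eta> p :: real
  assumes "0 \<le> t" "0 < \<eta>" "1 < p"
  shows "t \<le> \<eta> + \<eta> powr (1 - p) * t powr p"
proof (cases "t \<le> \<eta>")
  case True
  then show ?thesis by (simp add: add_increasing2)
next
  case False
  then have t: "t > \<eta>" "t > 0" using assms by auto
  have "1 \<le> (t / \<eta>) powr (p - 1)" using t assms by (intro ge_one_powr_ge_zero) auto
  then have "t * 1 \<le> t * (t / \<eta>) powr (p - 1)" using t by (intro mult_left_mono) auto
  also have "(t / \<eta>) powr (p - 1) = t powr (p - 1) * \<eta> powr (1 - p)"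
    using t assms powr_minus[of \<eta> "p - 1"] by (simp add: powr_divide divide_inverse[of _ "\<eta> powr (p - 1)"])
  also have "t * (t powr (p - 1) * \<eta> powr (1 - p)) = \<eta> powr (1 - p) * t powr p"
    using t powr_add[of t 1 "p - 1"] by simp
  finally show ?thesis using assms by simp
qed

lemma le_small_powr:
  fixes \<epsilon> p :: real
  assumes "0 < \<epsilon>" "1 < p"
  obtains \<eta> where "\<eta> > 0" "\<And>t. 0 \<le> t \<Longrightarrow> t \<le> \<eta> + \<epsilon> * t powr p"
proof
  define \<eta> where "\<eta> = \<epsilon> powr (1 / (1 - p))"
  show "\<eta> > 0" using assms by (simp add: \<eta>_def)
  have "\<eta> powr (1 - p) = \<epsilon>" using assms by (simp add: \<eta>_def powr_powr)
  then show "t \<le> \<eta> + \<epsilon> * t powr p" if "0 \<le> t" for t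
    using le_add_powr[OF that \<open>\<eta> > 0\<close> assms(2)] by simp
qed

section \<open>Mean oscillation controlled by the energies\<close>

definition dif :: "('a::euclidean_space \<Rightarrow> real) \<Rightarrow> 'a \<times> 'a \<Rightarrow> real" where
  "dif u z = u (fst z) - u (snd z)"

text \<open>The measure dominates the one with density c / |x - y|^(N + \<sigma>) on pairs of
  points; \<sigma> stands for the product s p.\<close>

definition fractional_below :: "real \<Rightarrow> real \<Rightarrow> ('a::euclidean_space \<times> 'a) measure \<Rightarrow> bool" where
  "fractional_below \<sigma> c \<mu> \<longleftrightarrow> (\<forall>F\<in>borel_measurable lebesgue.
     (\<integral>\<^sup>+z. F z * ennreal (c / norm (fst z - snd z) powr (real DIM('a) + \<sigma>)) \<partial>lebesgue) \<le> (\<integral>\<^sup>+z. F z \<partial>\<mu>))"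

lemma dif_measurable: "u \<in> borel_measurable lebesgue \<Longrightarrow> dif u \<in> borel_measurable lebesgue"
  unfolding dif_def[abs_def] by (rule measurable_diff_lebesgue_prod)

text \<open>Substitute y = x + h and integrate in x first: the translation estimate gives the factor
  |h|, which is at most \<rho> wherever the kernel does not vanish.\<close>

lemma mean_osc_le_gradient:
  fixes u :: "'a::euclidean_space \<Rightarrow> real"
  assumes w: "wgrad u G" and \<rho>: "\<rho> > 0"
  shows "mean_osc \<rho> u \<le> ennreal (\<rho> * (\<integral>x. norm (G x) \<partial>lebesgue) * cone_mass TYPE('a) \<rho>)"
proof -
  have ui: "integrable lebesgue u" using w by (simp add: wgrad_def)
  obtain ub where [measurable]: "ub \<in> borel_measurable borel" and ub: "AE x in lebesgue. u x = ub x"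
    using borel_representative[OF borel_measurable_integrable[OF ui]] by auto
  let ?N = "\<integral>x. norm (G x) \<partial>lebesgue"
  have slice: "(\<integral>\<^sup>+x. ennreal \<bar>ub x - ub (x + h)\<bar> \<partial>lborel) \<le> ennreal (?N * norm h)" for h
  proof -
    have "(\<integral>\<^sup>+x. ennreal \<bar>ub x - ub (x + h)\<bar> \<partial>lborel) = (\<integral>\<^sup>+x. ennreal \<bar>u (x + h) - u x\<bar> \<partial>lebesgue)"
    proof (rule nn_integral_borel_rep[symmetric])
      show "AE x in lebesgue. ennreal \<bar>u (x + h) - u x\<bar> = ennreal \<bar>ub x - ub (x + h)\<bar>"
        using ub AE_translate[OF ub, of h] by eventually_elim (simp add: abs_minus_commute)
    qed
    also have "\<dots> = ennreal (\<integral>x. \<bar>u (x + h) - u x\<bar> \<partial>lebesgue)"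
      by (intro nn_integral_eq_integral integrable_abs Bochner_Integration.integrable_diff integrable_translate ui) auto
    also have "\<dots> \<le> ennreal (?N * norm h)" by (intro ennreal_leI wgrad_translation_estimate w)
    finally show ?thesis .
  qed
  have "mean_osc \<rho> u = (\<integral>\<^sup>+z. ennreal (cone_kernel \<rho> (fst z - snd z) * \<bar>ub (fst z) - ub (snd z)\<bar>) \<partial>(lborel \<Otimes>\<^sub>M lborel))"
    unfolding mean_osc_def lborel_prod
  proof (rule nn_integral_borel_rep)
    show "AE z in lebesgue. ennreal (cone_kernel \<rho> (fst z - snd z) * \<bar>u (fst z) - u (snd z)\<bar>) = ennreal (cone_kernel \<rho> (fst z - snd z) * \<bar>ub (fst z) - ub (snd z)\<bar>)"
      using AE_lebesgue_fst[OF ub, where 'b='a] AE_lebesgue_snd[OF ub, where 'a='a] by eventually_elim simp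
  qed
  also have "\<dots> = (\<integral>\<^sup>+x. \<integral>\<^sup>+y. ennreal (cone_kernel \<rho> (x - y) * \<bar>ub x - ub y\<bar>) \<partial>lborel \<partial>lborel)"
    by (subst lborel.nn_integral_fst[symmetric]) auto
  also have "\<dots> = (\<integral>\<^sup>+x. \<integral>\<^sup>+h. ennreal (cone_kernel \<rho> h * \<bar>ub x - ub (x + h)\<bar>) \<partial>lborel \<partial>lborel)"
  proof (rule nn_integral_cong)
    fix x
    have m: "(\<lambda>y. ennreal (cone_kernel \<rho> (x - y) * \<bar>ub x - ub y\<bar>)) \<in> borel_measurable lebesgue"
      by (intro measurable_completion) simp
    have "(\<integral>\<^sup>+y. ennreal (cone_kernel \<rho> (x - y) * \<bar>ub x - ub y\<bar>) \<partial>lebesgue)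
       = (\<integral>\<^sup>+h. ennreal (cone_kernel \<rho> (x - (h + x)) * \<bar>ub x - ub (h + x)\<bar>) \<partial>lebesgue)"
      by (rule nn_integral_translate[OF m, symmetric])
    then show "(\<integral>\<^sup>+y. ennreal (cone_kernel \<rho> (x - y) * \<bar>ub x - ub y\<bar>) \<partial>lborel)
       = (\<integral>\<^sup>+h. ennreal (cone_kernel \<rho> h * \<bar>ub x - ub (x + h)\<bar>) \<partial>lborel)"
      by (simp add: nn_integral_completion cone_kernel_def add.commute)
  qed
  also have "\<dots> = (\<integral>\<^sup>+h. \<integral>\<^sup>+x. ennreal (cone_kernel \<rho> h * \<bar>ub x - ub (x + h)\<bar>) \<partial>lborel \<partial>lborel)"
    by (rule lborel_pair.Fubini'[symmetric]) measurable
  also have "\<dots> \<le> (\<integral>\<^sup>+h. ennreal (cone_kernel \<rho> h) * ennreal (\<rho> * ?N) \<partial>(lborel :: 'a measure))"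
  proof (rule nn_integral_mono)
    fix h :: 'a
    have "(\<integral>\<^sup>+x. ennreal (cone_kernel \<rho> h * \<bar>ub x - ub (x + h)\<bar>) \<partial>lborel) = ennreal (cone_kernel \<rho> h) * (\<integral>\<^sup>+x. ennreal \<bar>ub x - ub (x + h)\<bar> \<partial>lborel)"
      by (subst nn_integral_cmult[symmetric]) (auto simp: ennreal_mult' cone_kernel_bounds)
    also have "\<dots> \<le> ennreal (cone_kernel \<rho> h) * ennreal (\<rho> * ?N)"
    proof (cases "norm h \<le> \<rho>")
      case True
      then have "?N * norm h \<le> \<rho> * ?N" by (simp add: mult.commute[of ?N] mult_right_mono)
      then show ?thesis using slice[of h] by (intro mult_left_mono) (auto intro: order_trans ennreal_leI)
    next
      case False
      then have "cone_kernel \<rho> h = 0" using \<rho> by (simp add: cone_kernel_def field_simps)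
      then show ?thesis by simp
    qed
    finally show "(\<integral>\<^sup>+x. ennreal (cone_kernel \<rho> h * \<bar>ub x - ub (x + h)\<bar>) \<partial>lborel) \<le> ennreal (cone_kernel \<rho> h) * ennreal (\<rho> * ?N)" .
  qed
  also have "\<dots> = (\<integral>\<^sup>+h. ennreal (cone_kernel \<rho> h) \<partial>(lborel :: 'a measure)) * ennreal (\<rho> * ?N)"
    by (rule nn_integral_multc) simp
  also have "(\<integral>\<^sup>+h. ennreal (cone_kernel \<rho> h) \<partial>(lborel :: 'a measure)) = ennreal (cone_mass TYPE('a) \<rho>)"
    unfolding cone_mass_def using cone_kernel_integrable[OF \<rho>, where 'a='a] cone_kernel_bounds(1)
    by (subst nn_integral_eq_integral[symmetric]) (auto simp: nn_integral_completion)
  also have "ennreal (cone_mass TYPE('a) \<rho>) * ennreal (\<rho> * ?N) = ennreal (\<rho> * ?N * cone_mass TYPE('a) \<rho>)"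
    using \<rho> cone_mass_pos[OF \<rho>, where 'a='a] by (subst ennreal_mult[symmetric]) (auto simp: mult_ac)
  finally show ?thesis .
qed

text \<open>Split |u(x) - u(y)| by \<open>le_add_powr\<close>. The constant \<eta> is charged only
  to pairs meeting \<Omega>, which produces the measure of \<Omega>. In the power term the cone
  kernel is at most (\<rho> / |x - y|)^(N + \<sigma>) on its support, and that weight is dominated
  by \<mu>.\<close>

lemma mean_osc_le_fractional:
  fixes u :: "'a::euclidean_space \<Rightarrow> real"
  assumes u: "u \<in> borel_measurable lebesgue" and z: "\<And>x. x \<notin> \<Omega> \<Longrightarrow> u x = 0" and \<Omega>: "\<Omega> \<in> lmeasurable"
    and fb: "fractional_below \<sigma> c \<mu>" and \<sigma>: "\<sigma> > 0" and c: "c > 0" and p: "p > 1" and \<eta>: "\<eta> > 0" and \<rho>: "\<rho> > 0"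
    and B: "(\<integral>\<^sup>+z. ennreal (\<bar>dif u z\<bar> powr p) \<partial>\<mu>) \<le> ennreal B" and B0: "0 \<le> B"
  shows "mean_osc \<rho> u \<le> ennreal (2 * \<eta> * measure lebesgue \<Omega> * cone_mass TYPE('a) \<rho>
      + \<eta> powr (1 - p) * \<rho> powr (real DIM('a) + \<sigma>) / c * B)"
proof -
  let ?s = "real DIM('a) + \<sigma>" and ?c = "cone_mass TYPE('a) \<rho>"
  let ?k = "\<eta> powr (1 - p) * \<rho> powr ?s / c"
  have cm: "?c > 0" by (rule cone_mass_pos[OF \<rho>])
  have \<Omega>s: "\<Omega> \<in> sets lebesgue" using \<Omega> by auto
  have \<Omega>f: "emeasure lebesgue \<Omega> = ennreal (measure lebesgue \<Omega>)" using \<Omega> by (rule emeasure_eq_measure2)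
  define K where "K z = ennreal (cone_kernel \<rho> (fst z - snd z))" for z :: "'a \<times> 'a"
  have Km: "K \<in> borel_measurable lebesgue"
    unfolding K_def by (intro measurable_compose[OF _ measurable_ennreal] borel_measurable_lebesgue_prodI) measurable
  have indm: "(\<lambda>z::'a \<times> 'a. indicator \<Omega> (fst z) :: real) \<in> borel_measurable lebesgue" "(\<lambda>z::'a \<times> 'a. indicator \<Omega> (snd z) :: real) \<in> borel_measurable lebesgue"
    using measurable_fst_lebesgue[of "indicator \<Omega> :: 'a \<Rightarrow> real", where 'c='a] measurable_snd_lebesgue[of "indicator \<Omega> :: 'a \<Rightarrow> real", where 'a='a]
      borel_measurable_indicator[OF \<Omega>s] by blast+
  define I1 I2 where "I1 z = ennreal (\<eta> * indicator \<Omega> (fst z)) * K z" and "I2 z = ennreal (\<eta> * indicator \<Omega> (snd z)) * K z" for z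
  have I12m: "I1 \<in> borel_measurable lebesgue" "I2 \<in> borel_measurable lebesgue"
    unfolding I1_def I2_def using indm Km
    by (auto intro!: borel_measurable_times_ennreal measurable_compose[OF _ measurable_ennreal])
  define P where "P z = ennreal (\<bar>dif u z\<bar> powr p)" for z
  have Pm: "P \<in> borel_measurable lebesgue"
    unfolding P_def using dif_measurable[OF u]
    by (intro measurable_compose[OF _ measurable_ennreal] powr_real_measurable borel_measurable_abs) auto
  define I3 where "I3 z = P z * ennreal (c / norm (fst z - snd z) powr ?s)" for z
  have "(\<lambda>z::'a \<times> 'a. c / norm (fst z - snd z) powr ?s) \<in> borel_measurable lebesgue"
    by (rule borel_measurable_lebesgue_prodI) measurable
  then have I3m: "I3 \<in> borel_measurable lebesgue"
    unfolding I3_def using Pm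
    by (intro borel_measurable_times_ennreal measurable_compose[OF _ measurable_ennreal])
  have pt: "ennreal (cone_kernel \<rho> (fst z - snd z) * \<bar>u (fst z) - u (snd z)\<bar>) \<le> (I1 z + I2 z) + ennreal ?k * I3 z" for z
  proof -
    let ?x = "fst z" and ?y = "snd z" and ?d = "\<bar>dif u z\<bar>"
    let ?i = "\<eta> * indicator \<Omega> ?x + \<eta> * indicator \<Omega> ?y :: real"
    have k0: "0 \<le> cone_kernel \<rho> (?x - ?y)" "cone_kernel \<rho> (?x - ?y) \<le> 1" using cone_kernel_bounds \<rho> by auto
    have d: "?d \<le> ?i + \<eta> powr (1 - p) * ?d powr p"
    proof (cases "?x \<in> \<Omega> \<or> ?y \<in> \<Omega>")
      case True
      then have "\<eta> \<le> ?i" using \<eta> by (auto split: split_indicator)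
      then show ?thesis using le_add_powr[of ?d \<eta> p] \<eta> p by linarith
    qed (use z p in \<open>auto simp: dif_def\<close>)
    \<comment> \<open>On the diagonal the weight on the right is c / 0 = 0, so there the inequality
      holds because u(x) - u(y) = 0; beyond distance \<rho> the cone kernel vanishes.\<close>
    have kd: "cone_kernel \<rho> (?x - ?y) * (\<eta> powr (1 - p) * ?d powr p) \<le> ?k * (?d powr p * (c / norm (?x - ?y) powr ?s))"
    proof (cases "?x = ?y \<or> norm (?x - ?y) > \<rho>")
      case True
      then show ?thesis
      proof
        assume "?x = ?y" then show ?thesis by (simp add: dif_def)
      next
        assume "norm (?x - ?y) > \<rho>"
        then have "cone_kernel \<rho> (?x - ?y) = 0" using \<rho> by (simp add: cone_kernel_def field_simps)
        then show ?thesis using c by simp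
      qed
    next
      case False
      then have n: "0 < norm (?x - ?y)" "norm (?x - ?y) \<le> \<rho>" by auto
      have "cone_kernel \<rho> (?x - ?y) \<le> 1 * 1" using k0 by simp
      also have "\<dots> \<le> \<rho> powr ?s / norm (?x - ?y) powr ?s"
        using n \<sigma> powr_mono2[of ?s "norm (?x - ?y)" \<rho>] by (simp add: pos_le_divide_eq)
      finally have "cone_kernel \<rho> (?x - ?y) * (\<eta> powr (1 - p) * ?d powr p)
          \<le> \<rho> powr ?s / norm (?x - ?y) powr ?s * (\<eta> powr (1 - p) * ?d powr p)"
        by (intro mult_right_mono) auto
      also have "\<dots> = ?k * (?d powr p * (c / norm (?x - ?y) powr ?s))" using c by (simp add: field_simps)
      finally show ?thesis .
    qed
    have "cone_kernel \<rho> (?x - ?y) * ?d \<le> cone_kernel \<rho> (?x - ?y) * (?i + \<eta> powr (1 - p) * ?d powr p)"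
      using d k0 by (intro mult_left_mono)
    also have "\<dots> = \<eta> * indicator \<Omega> ?x * cone_kernel \<rho> (?x - ?y) + \<eta> * indicator \<Omega> ?y * cone_kernel \<rho> (?x - ?y)
        + cone_kernel \<rho> (?x - ?y) * (\<eta> powr (1 - p) * ?d powr p)"
      by (simp add: algebra_simps)
    also have "\<dots> \<le> \<eta> * indicator \<Omega> ?x * cone_kernel \<rho> (?x - ?y) + \<eta> * indicator \<Omega> ?y * cone_kernel \<rho> (?x - ?y)
        + ?k * (?d powr p * (c / norm (?x - ?y) powr ?s))"
      using kd by simp
    finally have "ennreal (cone_kernel \<rho> (?x - ?y) * ?d) \<le> ennreal \<dots>" by (rule ennreal_leI)
    also have "\<dots> = (I1 z + I2 z) + ennreal ?k * I3 z"
      using \<eta> c k0 by (simp add: I1_def I2_def I3_def P_def K_def ennreal_mult'[symmetric] ennreal_plus[symmetric] ennreal_mult''[symmetric] del: ennreal_plus)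
    finally show ?thesis by (simp add: dif_def)
  qed
  have mass: "(\<integral>\<^sup>+y. ennreal (cone_kernel \<rho> (x - y)) \<partial>lebesgue) = ennreal ?c" for x :: 'a
  proof -
    have ki: "integrable lebesgue (\<lambda>y. cone_kernel \<rho> (x - y))"
      using integrable_translate[OF cone_kernel_integrable[OF \<rho>], of "- x"]
      by (simp add: cone_kernel_def norm_minus_commute)
    show ?thesis using nn_integral_eq_integral[OF ki AE_I2[OF cone_kernel_bounds(1)]] by (simp add: cone_mass_translate)
  qed
  have mass': "(\<integral>\<^sup>+x. ennreal (cone_kernel \<rho> (x - y)) \<partial>lebesgue) = ennreal ?c" for y :: 'a
    using mass[of y] by (simp add: cone_kernel_def norm_minus_commute)
  have ckm: "(\<lambda>y. ennreal (cone_kernel \<rho> (x - y))) \<in> borel_measurable lebesgue" "(\<lambda>x. ennreal (cone_kernel \<rho> (x - y))) \<in> borel_measurable lebesgue" for x y :: 'a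
    by (intro measurable_completion, simp)+
  have ind: "(\<integral>\<^sup>+x. ennreal (\<eta> * indicator \<Omega> x) * ennreal ?c \<partial>lebesgue) = ennreal (\<eta> * measure lebesgue \<Omega> * ?c)"
  proof -
    have "(\<integral>\<^sup>+x. ennreal (\<eta> * indicator \<Omega> x) * ennreal ?c \<partial>lebesgue) = (\<integral>\<^sup>+x. ennreal (\<eta> * ?c) * indicator \<Omega> x \<partial>lebesgue)"
      using \<eta> cm by (intro nn_integral_cong) (auto split: split_indicator simp: ennreal_mult)
    also have "\<dots> = ennreal (\<eta> * ?c) * ennreal (measure lebesgue \<Omega>)"
      unfolding nn_integral_cmult_indicator[OF \<Omega>s] \<Omega>f ..
    also have "\<dots> = ennreal (\<eta> * measure lebesgue \<Omega> * ?c)"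
      using \<eta> cm by (subst ennreal_mult[symmetric]) (auto simp: mult_ac)
    finally show ?thesis .
  qed
  have i1: "(\<integral>\<^sup>+z. I1 z \<partial>lebesgue) = ennreal (\<eta> * measure lebesgue \<Omega> * ?c)"
    unfolding nn_integral_lebesgue_prod(1)[OF I12m(1)] ind[symmetric]
    by (intro nn_integral_cong) (simp add: I1_def K_def nn_integral_cmult ckm mass)
  have i2: "(\<integral>\<^sup>+z. I2 z \<partial>lebesgue) = ennreal (\<eta> * measure lebesgue \<Omega> * ?c)"
    unfolding nn_integral_lebesgue_prod(2)[OF I12m(2)] ind[symmetric]
    by (intro nn_integral_cong) (simp add: I2_def K_def nn_integral_cmult ckm mass')
  have "(\<integral>\<^sup>+z. I3 z \<partial>lebesgue) \<le> (\<integral>\<^sup>+z. P z \<partial>\<mu>)"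
    unfolding I3_def using fb Pm by (simp add: fractional_below_def)
  also have "\<dots> \<le> ennreal B" using B by (simp add: P_def)
  finally have i3: "(\<integral>\<^sup>+z. I3 z \<partial>lebesgue) \<le> ennreal B" .
  have "mean_osc \<rho> u \<le> (\<integral>\<^sup>+z. (I1 z + I2 z) + ennreal ?k * I3 z \<partial>lebesgue)"
    unfolding mean_osc_def by (intro nn_integral_mono pt)
  also have "\<dots> = ((\<integral>\<^sup>+z. I1 z \<partial>lebesgue) + (\<integral>\<^sup>+z. I2 z \<partial>lebesgue)) + ennreal ?k * (\<integral>\<^sup>+z. I3 z \<partial>lebesgue)"
    using I12m I3m by (simp add: nn_integral_add nn_integral_cmult)
  also have "\<dots> \<le> (ennreal (\<eta> * measure lebesgue \<Omega> * ?c) + ennreal (\<eta> * measure lebesgue \<Omega> * ?c)) + ennreal ?k * ennreal B"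
    unfolding i1 i2 using i3 by (intro add_left_mono mult_left_mono) auto
  also have "\<dots> = ennreal (2 * \<eta> * measure lebesgue \<Omega> * ?c + ?k * B)"
    using \<eta> cm c B0 by (simp add: ennreal_mult'[symmetric] ennreal_plus[symmetric] del: ennreal_plus)
  finally show ?thesis .
qed

text \<open>Pairs of a point of \<Omega> with a point outside carry mass of \<mu>. In use, H is
  |u(x) - u(y)|^p for coercivity and the pairing of u with (u - \<delta>)+ for the upper bound; both
  depend on x alone once y lies outside, where u = 0.\<close>

definition exterior_interaction :: "real \<Rightarrow> 'a::euclidean_space set \<Rightarrow> ('a \<times> 'a) measure \<Rightarrow> bool" where
  "exterior_interaction \<kappa> \<Omega> \<mu> \<longleftrightarrow> (\<forall>\<psi> H. \<psi> \<in> borel_measurable lebesgue \<longrightarrow> (\<forall>x. 0 \<le> \<psi> x) \<longrightarrow> (\<forall>x. x \<notin> \<Omega> \<longrightarrow> \<psi> x = 0) \<longrightarrow>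
      (\<forall>x y. x \<in> \<Omega> \<longrightarrow> y \<notin> \<Omega> \<longrightarrow> ennreal (\<psi> x) \<le> H (x, y)) \<longrightarrow>
      ennreal \<kappa> * (\<integral>\<^sup>+x. ennreal (\<psi> x) \<partial>lebesgue) \<le> (\<integral>\<^sup>+z. H z \<partial>\<mu>))"

lemma exterior_interactionD:
  assumes "exterior_interaction \<kappa> \<Omega> \<mu>" "\<psi> \<in> borel_measurable lebesgue" "\<And>x. 0 \<le> \<psi> x" "\<And>x. x \<notin> \<Omega> \<Longrightarrow> \<psi> x = 0"
    "\<And>x y. x \<in> \<Omega> \<Longrightarrow> y \<notin> \<Omega> \<Longrightarrow> ennreal (\<psi> x) \<le> H (x, y)"
  shows "ennreal \<kappa> * (\<integral>\<^sup>+x. ennreal (\<psi> x) \<partial>lebesgue) \<le> (\<integral>\<^sup>+z. H z \<partial>\<mu>)"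
  using assms unfolding exterior_interaction_def by blast

text \<open>A point of \<open>\<Omega>\<close> interacts at bounded distance with a whole ball outside \<open>\<Omega>\<close>. This replaces the Poincare
  inequality, and also the Sobolev inequality in the bound for the solutions.\<close>

lemma fractional_exterior_interaction:
  fixes \<Omega> :: "'a::euclidean_space set"
  assumes fb: "fractional_below \<sigma> c \<mu>" and \<sigma>: "\<sigma> > 0" and c: "c > 0" and \<Omega>: "bounded \<Omega>"
  shows "\<exists>\<kappa>>0. exterior_interaction \<kappa> \<Omega> \<mu>"
proof -
  let ?s = "real DIM('a) + \<sigma>"
  obtain R where R: "R > 0" "\<And>x. x \<in> \<Omega> \<Longrightarrow> norm x < R" using \<Omega> bounded_pos_less by metis
  obtain e :: 'a where e: "norm e = 1" using norm_Basis nonempty_Basis by blast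
  \<comment> \<open>The points of this ball have norm between 2 R and 4 R. Hence it avoids \<Omega>,
    and its distance from any point of \<Omega> is at most 5 R, whence \<open>k0\<close>
    below.\<close>
  define Y where "Y = ball ((3 * R) *\<^sub>R e) R"
  have Yfar: "2 * R < norm y" "norm y < 4 * R" if "y \<in> Y" for y
  proof -
    have "norm ((3 * R) *\<^sub>R e - y) < R" using that by (simp add: Y_def dist_norm)
    moreover have "norm ((3 * R) *\<^sub>R e) = 3 * R" using e R by simp
    ultimately show "2 * R < norm y" "norm y < 4 * R"
      using norm_triangle_ineq2[of "(3 * R) *\<^sub>R e" y] norm_triangle_ineq3[of "(3 * R) *\<^sub>R e" y] by linarith+
  qed
  have Ym: "Y \<in> sets lebesgue" by (simp add: Y_def)
  have Yp: "measure lebesgue Y > 0" using R content_ball_pos[of R "(3 * R) *\<^sub>R e"] by (simp add: Y_def)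
  have Ye: "emeasure lebesgue Y = ennreal (measure lebesgue Y)"
    by (rule emeasure_eq_measure2) (simp add: Y_def)
  define k0 where "k0 = c / (5 * R) powr ?s"
  have k0: "k0 > 0" using c R by (simp add: k0_def)
  have "exterior_interaction (k0 * measure lebesgue Y) \<Omega> \<mu>"
    unfolding exterior_interaction_def
  proof (intro allI impI)
    fix \<psi> :: "'a \<Rightarrow> real" and H
    assume \<psi>': "\<psi> \<in> borel_measurable lebesgue" "\<forall>x. 0 \<le> \<psi> x" "\<forall>x. x \<notin> \<Omega> \<longrightarrow> \<psi> x = 0"
      and H': "\<forall>x y. x \<in> \<Omega> \<longrightarrow> y \<notin> \<Omega> \<longrightarrow> ennreal (\<psi> x) \<le> H (x, y)"
    then have \<psi>: "\<psi> \<in> borel_measurable lebesgue" "\<And>x. 0 \<le> \<psi> x" "\<And>x. x \<notin> \<Omega> \<Longrightarrow> \<psi> x = 0"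
      and H: "\<And>x y. x \<in> \<Omega> \<Longrightarrow> y \<notin> \<Omega> \<Longrightarrow> ennreal (\<psi> x) \<le> H (x, y)" by auto
    define F where "F z = ennreal (\<psi> (fst z) * indicator Y (snd z))" for z :: "'a \<times> 'a"
    have Fm: "F \<in> borel_measurable lebesgue"
      unfolding F_def using measurable_fst_lebesgue[OF \<psi>(1), where 'c='a]
        measurable_snd_lebesgue[of "indicator Y :: 'a \<Rightarrow> real", where 'a='a] borel_measurable_indicator[OF Ym]
      by (intro measurable_compose[OF _ measurable_ennreal] borel_measurable_times) auto
    have FH: "F z \<le> H z" for z
    proof (cases "fst z \<in> \<Omega> \<and> snd z \<in> Y")
      case True
      then have "snd z \<notin> \<Omega>" using R(2) Yfar(1) R(1) by fastforce
      then show ?thesis using True H[of "fst z" "snd z"] by (simp add: F_def)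
    qed (auto simp: F_def \<psi>(3))
    have Fk: "F z * ennreal k0 \<le> F z * ennreal (c / norm (fst z - snd z) powr ?s)" for z
    proof (cases "fst z \<in> \<Omega> \<and> snd z \<in> Y")
      case True
      then have x: "norm (fst z) < R" and y: "2 * R < norm (snd z)" "norm (snd z) < 4 * R"
        using R(2) Yfar by auto
      have n: "norm (fst z - snd z) \<le> 5 * R" using norm_triangle_ineq4[of "fst z" "snd z"] x y by linarith
      have n0: "0 < norm (fst z - snd z)" using x y R by auto
      have "norm (fst z - snd z) powr ?s \<le> (5 * R) powr ?s" using n \<sigma> by (intro powr_mono2) auto
      then have "k0 \<le> c / norm (fst z - snd z) powr ?s"
        unfolding k0_def using c n0 by (intro divide_left_mono mult_pos_pos) auto
      then show ?thesis by (intro mult_left_mono ennreal_leI) auto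
    qed (auto simp: F_def \<psi>(3))
    have "ennreal (k0 * measure lebesgue Y) * (\<integral>\<^sup>+x. ennreal (\<psi> x) \<partial>lebesgue)
       = (\<integral>\<^sup>+x. ennreal (\<psi> x) * ennreal (k0 * measure lebesgue Y) \<partial>lebesgue)"
      using \<psi>(1) by (subst nn_integral_multc) (auto simp: mult.commute)
    also have "\<dots> = (\<integral>\<^sup>+x. \<integral>\<^sup>+y. F (x, y) * ennreal k0 \<partial>lebesgue \<partial>lebesgue)"
    proof (rule nn_integral_cong)
      fix x
      have "(\<integral>\<^sup>+y. F (x, y) * ennreal k0 \<partial>lebesgue) = (\<integral>\<^sup>+y. ennreal (\<psi> x * k0) * indicator Y y \<partial>lebesgue)"
        using k0 \<psi>(2)[of x] by (intro nn_integral_cong) (auto simp: F_def ennreal_mult split: split_indicator)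
      also have "\<dots> = ennreal (\<psi> x * k0) * ennreal (measure lebesgue Y)"
        unfolding nn_integral_cmult_indicator[OF Ym] Ye ..
      also have "\<dots> = ennreal (\<psi> x) * ennreal (k0 * measure lebesgue Y)"
        using k0 \<psi>(2)[of x] by (simp add: ennreal_mult mult_ac)
      finally show "ennreal (\<psi> x) * ennreal (k0 * measure lebesgue Y) = (\<integral>\<^sup>+y. F (x, y) * ennreal k0 \<partial>lebesgue)" ..
    qed
    also have "\<dots> = (\<integral>\<^sup>+z. F z * ennreal k0 \<partial>lebesgue)"
      using Fm by (intro nn_integral_lebesgue_prod(1)[symmetric]) auto
    also have "\<dots> \<le> (\<integral>\<^sup>+z. F z * ennreal (c / norm (fst z - snd z) powr ?s) \<partial>lebesgue)"
      by (intro nn_integral_mono Fk)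
    also have "\<dots> \<le> (\<integral>\<^sup>+z. F z \<partial>\<mu>)" using fb Fm by (simp add: fractional_below_def)
    also have "\<dots> \<le> (\<integral>\<^sup>+z. H z \<partial>\<mu>)" by (intro nn_integral_mono FH)
    finally show "ennreal (k0 * measure lebesgue Y) * (\<integral>\<^sup>+x. ennreal (\<psi> x) \<partial>lebesgue) \<le> (\<integral>\<^sup>+z. H z \<partial>\<mu>)" .
  qed
  moreover have "k0 * measure lebesgue Y > 0" using k0 Yp by simp
  ultimately show ?thesis by blast
qed

lemma Lp_Fatou:
  fixes h :: "nat \<Rightarrow> 'm \<Rightarrow> 'b::euclidean_space"
  assumes h: "\<And>n. Lp_fun p M (h n)" and g: "g \<in> borel_measurable M" and ae: "AE x in M. (\<lambda>n. h n x) \<longlonglongrightarrow> g x"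
    and a: "(\<lambda>n. \<integral>x. norm (h n x) powr p \<partial>M) \<longlonglongrightarrow> a" and p: "p > 0"
  shows "Lp_fun p M g" "(\<integral>x. norm (g x) powr p \<partial>M) \<le> a"
proof -
  have a0: "a \<ge> 0" by (rule LIMSEQ_le_const[OF a]) auto
  have "(\<integral>\<^sup>+x. ennreal (norm (g x) powr p) \<partial>M) = (\<integral>\<^sup>+x. liminf (\<lambda>n. ennreal (norm (h n x) powr p)) \<partial>M)"
  proof (rule nn_integral_cong_AE)
    show "AE x in M. ennreal (norm (g x) powr p) = liminf (\<lambda>n. ennreal (norm (h n x) powr p))"
      using ae
    proof eventually_elim
      case (elim x)
      have "(\<lambda>n. ennreal (norm (h n x) powr p)) \<longlonglongrightarrow> ennreal (norm (g x) powr p)"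
        using p by (intro tendsto_ennrealI tendsto_powr2 tendsto_norm elim tendsto_const) auto
      then show ?case by (intro lim_imp_Liminf[symmetric]) auto
    qed
  qed
  also have "\<dots> \<le> liminf (\<lambda>n. \<integral>\<^sup>+x. ennreal (norm (h n x) powr p) \<partial>M)"
    using h by (intro nn_integral_liminf) (auto simp: Lp_fun_def)
  also have "\<dots> = liminf (\<lambda>n. ennreal (\<integral>x. norm (h n x) powr p \<partial>M))"
    using h by (subst nn_integral_eq_integral) (auto simp: Lp_fun_def)
  also have "\<dots> = ennreal a"
    using tendsto_ennrealI[OF a] by (intro lim_imp_Liminf) auto
  finally have le: "(\<integral>\<^sup>+x. ennreal (norm (g x) powr p) \<partial>M) \<le> ennreal a" .
  have i: "integrable M (\<lambda>x. norm (g x) powr p)"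
    using le g by (intro integrableI_bounded) (auto simp: le_less_trans)
  then show "Lp_fun p M g" using g by (simp add: Lp_fun_def)
  show "(\<integral>x. norm (g x) powr p \<partial>M) \<le> a"
    using le a0 by (subst (asm) nn_integral_eq_integral[OF i]) auto
qed

lemma Lp_fun_cong_AE:
  assumes "Lp_fun p M f" "g \<in> borel_measurable M" "AE x in M. f x = g x"
  shows "Lp_fun p M g"
proof -
  have "AE x in M. norm (f x) powr p = norm (g x) powr p" using assms(3) by eventually_elim simp
  then show ?thesis
    using assms integrable_cong_AE[of "\<lambda>x. norm (f x) powr p" M "\<lambda>x. norm (g x) powr p"]
    by (auto simp: Lp_fun_def)
qed

section \<open>Minimisation of the energy\<close>

lemma half_sum_scaleR: "(1/2) *\<^sub>R a + (1/2) *\<^sub>R b = (a + b) /\<^sub>R 2"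
  and half_diff_scaleR: "(1/2) *\<^sub>R a + (-1/2) *\<^sub>R b = (a - b) /\<^sub>R 2"
  for a b :: "'b::real_vector"
  by (simp_all add: scaleR_add_right scaleR_diff_right inverse_eq_divide)

text \<open>The energy has a local part with coefficient \<open>A\<close> (zero if the local term is absent) and a nonlocal part given by a measure
  \<open>\<mu>\<close> on pairs of points, which accounts for all fractional terms at once.\<close>

locale energy_setting =
  fixes \<Omega> :: "'a::euclidean_space set" and p A :: real and \<mu> :: "('a \<times> 'a) measure"
  assumes bounded_\<Omega>: "bounded \<Omega>" and open_\<Omega>: "open \<Omega>" and p2: "2 \<le> p" and A0: "0 \<le> A"
    and sets_\<mu>: "sets \<mu> = sets lebesgue" and AE_\<mu>: "\<And>P. (AE z in lebesgue. P z) \<Longrightarrow> (AE z in \<mu>. P z)"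
    and nonlocal: "\<not> 0 < A \<Longrightarrow> \<exists>\<sigma>>0. \<exists>c>0. fractional_below \<sigma> c \<mu>"
begin

text \<open>Without a local term the gradient is set to 0 instead of being required to exist, so
  that one formula for the energy covers both cases.\<close>

definition gr :: "('a \<Rightarrow> real) \<Rightarrow> 'a \<Rightarrow> 'a" where
  "gr u = (if 0 < A then weak_gradient u else (\<lambda>_. 0))"

text \<open>Integrability of u is demanded, not only measurability, since compactness and limits are
  formulated in L^1. That nothing is lost is shown when the space is identified with
  \<open>X_space\<close>.\<close>

definition V :: "('a \<Rightarrow> real) set" where
  "V = {u. integrable lebesgue u \<and> (\<forall>x. x \<notin> \<Omega> \<longrightarrow> u x = 0) \<and> (0 < A \<longrightarrow> (\<exists>G. has_weak_gradient u G)) \<and>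
     Lp_fun p lebesgue (gr u) \<and> Lp_fun p \<mu> (dif u)}"

definition E :: "('a \<Rightarrow> real) \<Rightarrow> real" where
  "E u = A * (\<integral>x. norm (gr u x) powr p \<partial>lebesgue) + (\<integral>z. norm (dif u z) powr p \<partial>\<mu>)"

text \<open>The derivative of E / p at u in the direction v, that is, the left-hand side of the weak
  equation.\<close>

definition D :: "('a \<Rightarrow> real) \<Rightarrow> ('a \<Rightarrow> real) \<Rightarrow> real" where
  "D u v = A * (\<integral>x. pdot p (gr u x) (gr v x) \<partial>lebesgue) + (\<integral>z. pdot p (dif u z) (dif v z) \<partial>\<mu>)"

lemma \<Omega>_lmeasurable: "\<Omega> \<in> lmeasurable"
  using bounded_\<Omega> open_\<Omega> by (intro bounded_set_imp_lmeasurable) auto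

lemma measurable_\<mu>: "f \<in> borel_measurable lebesgue \<Longrightarrow> f \<in> borel_measurable \<mu>"
  using measurable_cong_sets[OF sets_\<mu> refl] by auto

lemma gr_wgrad: "0 < A \<Longrightarrow> has_weak_gradient u G \<Longrightarrow> (\<And>x. x \<notin> \<Omega> \<Longrightarrow> u x = 0) \<Longrightarrow> wgrad u (gr u)"
proof -
  assume a: "0 < A" and w: "has_weak_gradient u G" and z: "\<And>x. x \<notin> \<Omega> \<Longrightarrow> u x = 0"
  have "has_weak_gradient u (weak_gradient u)"
    unfolding weak_gradient_def by (rule someI[where P="has_weak_gradient u", OF w])
  from has_weak_gradient_wgrad[OF this bounded_\<Omega> z] show ?thesis using a by (simp add: gr_def)
qed

lemma gr_nonlocal: "\<not> 0 < A \<Longrightarrow> gr u = (\<lambda>_. 0)"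
  by (simp add: gr_def)

lemma VD:
  assumes "u \<in> V"
  shows "integrable lebesgue u" "x \<notin> \<Omega> \<Longrightarrow> u x = 0" "0 < A \<Longrightarrow> wgrad u (gr u)"
    "Lp_fun p lebesgue (gr u)" "Lp_fun p \<mu> (dif u)"
  using assms gr_wgrad[of u] by (auto simp: V_def)

text \<open>\<open>weak_gradient\<close> is a choice, so a gradient found by construction agrees
  with \<open>gr\<close> only almost everywhere; the second conclusion records this.\<close>

lemma VI:
  assumes u: "integrable lebesgue u" "\<And>x. x \<notin> \<Omega> \<Longrightarrow> u x = 0" and G: "0 < A \<Longrightarrow> wgrad u G" "\<not> 0 < A \<Longrightarrow> G = (\<lambda>_. 0)"
    and L: "Lp_fun p lebesgue G" "Lp_fun p \<mu> (dif u)"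
  shows "u \<in> V" "AE x in lebesgue. gr u x = G x"
proof -
  have *: "gr u \<in> borel_measurable lebesgue \<and> (AE x in lebesgue. gr u x = G x)"
  proof (cases "0 < A")
    case True
    have "wgrad u (gr u)" by (rule gr_wgrad[OF True wgrad_has_weak_gradient[OF G(1)[OF True]] u(2)])
    then show ?thesis using wgrad_unique[OF _ G(1)[OF True]] by (auto simp: wgrad_def[of u "gr u"])
  next
    case False
    show ?thesis unfolding gr_nonlocal[OF False] G(2)[OF False] by simp
  qed
  then show "AE x in lebesgue. gr u x = G x" ..
  have "AE x in lebesgue. G x = gr u x" using * by (auto elim: eventually_mono)
  with * have "Lp_fun p lebesgue (gr u)" using Lp_fun_cong_AE[OF L(1)] by blast
  then show "u \<in> V" using u L(2) wgrad_has_weak_gradient[OF G(1)] by (auto simp: V_def)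
qed

lemma V_linear:
  assumes u: "u \<in> V" and v: "v \<in> V"
  shows "(\<lambda>x. a * u x + b * v x) \<in> V"
    and "AE x in lebesgue. gr (\<lambda>x. a * u x + b * v x) x = a *\<^sub>R gr u x + b *\<^sub>R gr v x"
    and "dif (\<lambda>x. a * u x + b * v x) z = a *\<^sub>R dif u z + b *\<^sub>R dif v z"
proof -
  have d: "dif (\<lambda>x. a * u x + b * v x) = (\<lambda>z. a *\<^sub>R dif u z + b *\<^sub>R dif v z)"
    by (auto simp: dif_def algebra_simps)
  then show "dif (\<lambda>x. a * u x + b * v x) z = a *\<^sub>R dif u z + b *\<^sub>R dif v z" by simp
  have p1: "1 \<le> p" using p2 by simp
  note * = VI[of "\<lambda>x. a * u x + b * v x" "\<lambda>x. a *\<^sub>R gr u x + b *\<^sub>R gr v x"]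
  have "integrable lebesgue (\<lambda>x. a * u x + b * v x)" using VD(1)[OF u] VD(1)[OF v] by auto
  moreover have "a * u x + b * v x = 0" if "x \<notin> \<Omega>" for x using VD(2)[OF u that] VD(2)[OF v that] by simp
  moreover have "wgrad (\<lambda>x. a * u x + b * v x) (\<lambda>x. a *\<^sub>R gr u x + b *\<^sub>R gr v x)" if "0 < A"
    by (rule wgrad_linear[OF VD(3)[OF u that] VD(3)[OF v that]])
  moreover have "(\<lambda>x. a *\<^sub>R gr u x + b *\<^sub>R gr v x) = (\<lambda>_. 0)" if "\<not> 0 < A" using that by (simp add: gr_def)
  moreover have "Lp_fun p lebesgue (\<lambda>x. a *\<^sub>R gr u x + b *\<^sub>R gr v x)"
    by (rule Lp_fun_add[OF p1 Lp_fun_scale[OF VD(4)[OF u]] Lp_fun_scale[OF VD(4)[OF v]]])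
  moreover have "Lp_fun p \<mu> (dif (\<lambda>x. a * u x + b * v x))"
    unfolding d by (rule Lp_fun_add[OF p1 Lp_fun_scale[OF VD(5)[OF u]] Lp_fun_scale[OF VD(5)[OF v]]])
  ultimately show "(\<lambda>x. a * u x + b * v x) \<in> V"
    "AE x in lebesgue. gr (\<lambda>x. a * u x + b * v x) x = a *\<^sub>R gr u x + b *\<^sub>R gr v x"
    using * by blast+
qed

lemma V_zero: "(\<lambda>_. 0) \<in> V"
  by (rule VI(1)[of _ "\<lambda>_. 0"]) (auto simp: wgrad_def Lp_fun_def dif_def[abs_def])

lemma gr_zero_outside: "u \<in> V \<Longrightarrow> AE x in lebesgue. x \<notin> \<Omega> \<longrightarrow> gr u x = 0"
proof (cases "0 < A")
  case True
  assume u: "u \<in> V"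
  show ?thesis using wgrad_zero_on_zero_set[OF VD(3)[OF u True]] by eventually_elim (use VD(2)[OF u] in auto)
qed (simp add: gr_def)

lemma E_parts:
  "0 \<le> (\<integral>z. norm (dif u z) powr p \<partial>\<mu>)" "0 \<le> A * (\<integral>x. norm (gr u x) powr p \<partial>lebesgue)" "0 \<le> E u"
  using A0 by (auto simp: E_def intro!: add_nonneg_nonneg mult_nonneg_nonneg)

lemma integrable_gr: "u \<in> V \<Longrightarrow> integrable lebesgue (gr u)"
  using VD(3)[of u] by (cases "0 < A") (auto simp: wgrad_def gr_def)

lemma indicator_\<Omega>: "integrable lebesgue (\<lambda>x. c * indicator \<Omega> x :: real)"
  "(\<integral>x. c * indicator \<Omega> x \<partial>lebesgue) = c * measure lebesgue \<Omega>"
proof -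
  show "integrable lebesgue (\<lambda>x. c * indicator \<Omega> x :: real)"
    using fmeasurableD[OF \<Omega>_lmeasurable] fmeasurableD2[OF \<Omega>_lmeasurable]
    by (intro integrable_mult_right integrable_real_indicator) (auto simp: less_top)
qed simp

lemma integral_norm_gr_le:
  assumes u: "u \<in> V" and le: "\<And>t. 0 \<le> t \<Longrightarrow> t \<le> \<eta> + \<epsilon> * t powr p"
  shows "(\<integral>x. norm (gr u x) \<partial>lebesgue) \<le> \<eta> * measure lebesgue \<Omega> + \<epsilon> * (\<integral>x. norm (gr u x) powr p \<partial>lebesgue)"
proof -
  have i: "integrable lebesgue (\<lambda>x. norm (gr u x) powr p)" using VD(4)[OF u] by (simp add: Lp_fun_def)
  have "(\<integral>x. norm (gr u x) \<partial>lebesgue) \<le> (\<integral>x. \<eta> * indicator \<Omega> x + \<epsilon> * norm (gr u x) powr p \<partial>lebesgue)"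
  proof (rule integral_mono_AE)
    show "integrable lebesgue (\<lambda>x. norm (gr u x))" by (intro integrable_norm integrable_gr u)
    show "integrable lebesgue (\<lambda>x. \<eta> * indicator \<Omega> x + \<epsilon> * norm (gr u x) powr p)"
      using indicator_\<Omega>(1) i by auto
    show "AE x in lebesgue. norm (gr u x) \<le> \<eta> * indicator \<Omega> x + \<epsilon> * norm (gr u x) powr p"
      using gr_zero_outside[OF u]
    proof eventually_elim
      case (elim x)
      then show ?case using le[of "norm (gr u x)"] p2 by (cases "x \<in> \<Omega>") auto
    qed
  qed
  then show ?thesis using indicator_\<Omega>[of \<eta>] i by simp
qed

text \<open>A shift by the diameter 2 R of a ball around \<Omega> separates u from its translate, so
  |u(x + h) - u(x)| integrates to twice the L^1 norm of u, while the translation estimate bounds it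
  by 2 R times the L^1 norm of the gradient.\<close>

lemma integral_abs_le_gradient:
  assumes loc: "0 < A"
  shows "\<exists>C\<ge>0. \<forall>u\<in>V. (\<integral>x. \<bar>u x\<bar> \<partial>lebesgue) \<le> C * (\<integral>x. norm (gr u x) \<partial>lebesgue)"
proof -
  obtain R where R: "R > 0" "\<And>x. x \<in> \<Omega> \<Longrightarrow> norm x < R" using bounded_\<Omega> bounded_pos_less by metis
  obtain e :: 'a where e: "norm e = 1" using norm_Basis nonempty_Basis by blast
  define h where "h = (2 * R) *\<^sub>R e"
  have h: "norm h = 2 * R" using e R by (simp add: h_def)
  have "(\<integral>x. \<bar>u x\<bar> \<partial>lebesgue) \<le> R * (\<integral>x. norm (gr u x) \<partial>lebesgue)" if u: "u \<in> V" for u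
  proof -
    have ui: "integrable lebesgue u" by (rule VD(1)[OF u])
    have "\<bar>u (x + h) - u x\<bar> = \<bar>u (x + h)\<bar> + \<bar>u x\<bar>" for x
    proof (cases "x \<in> \<Omega>")
      case True
      have "2 * R \<le> norm (x + h) + norm x" using h norm_triangle_ineq4[of "x + h" x] by simp
      then have "x + h \<notin> \<Omega>" using R(2)[of "x + h"] R(2)[OF True] by auto
      then show ?thesis using VD(2)[OF u] by simp
    qed (use VD(2)[OF u] in simp)
    then have "(\<integral>x. \<bar>u (x + h) - u x\<bar> \<partial>lebesgue) = (\<integral>x. \<bar>u (x + h)\<bar> \<partial>lebesgue) + (\<integral>x. \<bar>u x\<bar> \<partial>lebesgue)"
      using ui integrable_translate[OF ui, of h] by simp
    also have "(\<integral>x. \<bar>u (x + h)\<bar> \<partial>lebesgue) = (\<integral>x. \<bar>u x\<bar> \<partial>lebesgue)"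
      using ui by (intro integral_translate[of "\<lambda>x. \<bar>u x\<bar>"]) auto
    finally show ?thesis
      using wgrad_translation_estimate[OF VD(3)[OF u loc], of h] h by (simp add: mult.commute)
  qed
  then show ?thesis using R(1) by (intro exI[of _ R]) auto
qed

text \<open>The energy has order p > 1, so the L^1 norm is sublinear in it; with \<epsilon>
  arbitrary, any perturbation that is Lipschitz in L^1 can be absorbed. The gradient term uses the
  preceding Poincare inequality, the nonlocal one the exterior interaction with \<psi> =
  |u|^p.\<close>

lemma coercive:
  assumes \<epsilon>: "\<epsilon> > 0"
  shows "\<exists>C\<ge>0. \<forall>u\<in>V. (\<integral>x. \<bar>u x\<bar> \<partial>lebesgue) \<le> \<epsilon> * E u + C"
proof (cases "0 < A")
  case True
  obtain R where R: "0 \<le> R" "\<And>u. u \<in> V \<Longrightarrow> (\<integral>x. \<bar>u x\<bar> \<partial>lebesgue) \<le> R * (\<integral>x. norm (gr u x) \<partial>lebesgue)"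
    using integral_abs_le_gradient[OF True] by blast
  \<comment> \<open>Dividing by R + 1 rather than R also covers R = 0 and leaves the harmless factor
    R / (R + 1).\<close>
  obtain \<eta> where \<eta>: "\<eta> > 0" "\<And>t. 0 \<le> t \<Longrightarrow> t \<le> \<eta> + (\<epsilon> * A / (R + 1)) * t powr p"
    using le_small_powr[of "\<epsilon> * A / (R + 1)" p] \<epsilon> True R(1) p2 by auto
  have "(\<integral>x. \<bar>u x\<bar> \<partial>lebesgue) \<le> \<epsilon> * E u + R * (\<eta> * measure lebesgue \<Omega>)" if u: "u \<in> V" for u
  proof -
    let ?I = "\<integral>x. norm (gr u x) powr p \<partial>lebesgue"
    have "(\<integral>x. \<bar>u x\<bar> \<partial>lebesgue) \<le> R * (\<eta> * measure lebesgue \<Omega> + (\<epsilon> * A / (R + 1)) * ?I)"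
      using R(2)[OF u] mult_left_mono[OF integral_norm_gr_le[OF u \<eta>(2)] R(1)] by linarith
    also have "\<dots> = R * (\<eta> * measure lebesgue \<Omega>) + (R / (R + 1)) * (\<epsilon> * (A * ?I))" by (simp add: distrib_left mult_ac)
    also have "(R / (R + 1)) * (\<epsilon> * (A * ?I)) \<le> 1 * (\<epsilon> * E u)"
      using \<epsilon> R(1) E_parts[of u] by (intro mult_mono) (auto simp: E_def)
    finally show ?thesis by simp
  qed
  then show ?thesis using R(1) \<eta>(1) by (intro exI[of _ "R * (\<eta> * measure lebesgue \<Omega>)"]) auto
next
  case False
  obtain \<sigma> c where f: "fractional_below \<sigma> c \<mu>" "\<sigma> > 0" "c > 0" using nonlocal[OF False] by blast
  obtain \<kappa> where \<kappa>: "\<kappa> > 0" "exterior_interaction \<kappa> \<Omega> \<mu>"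
    using fractional_exterior_interaction[OF f bounded_\<Omega>] by blast
  obtain \<eta> where \<eta>: "\<eta> > 0" "\<And>t. 0 \<le> t \<Longrightarrow> t \<le> \<eta> + (\<epsilon> * \<kappa>) * t powr p"
    using le_small_powr[of "\<epsilon> * \<kappa>" p] \<epsilon> \<kappa>(1) p2 by auto
  have "(\<integral>x. \<bar>u x\<bar> \<partial>lebesgue) \<le> \<epsilon> * E u + \<eta> * measure lebesgue \<Omega>" if u: "u \<in> V" for u
  proof -
    have um: "u \<in> borel_measurable lebesgue" using VD(1)[OF u] by auto
    have di: "integrable \<mu> (\<lambda>z. norm (dif u z) powr p)" using VD(5)[OF u] by (simp add: Lp_fun_def)
    have pm: "(\<lambda>x. \<bar>u x\<bar> powr p) \<in> borel_measurable lebesgue"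
      using um by (intro powr_real_measurable borel_measurable_abs) auto
    have "ennreal \<kappa> * (\<integral>\<^sup>+x. ennreal (\<bar>u x\<bar> powr p) \<partial>lebesgue) \<le> (\<integral>\<^sup>+z. ennreal (norm (dif u z) powr p) \<partial>\<mu>)"
      using pm VD(2)[OF u] p2 by (intro exterior_interactionD[OF \<kappa>(2)]) (auto simp: dif_def)
    also have "\<dots> = ennreal (\<integral>z. norm (dif u z) powr p \<partial>\<mu>)" using di by (intro nn_integral_eq_integral) auto
    also have "\<dots> \<le> ennreal (E u)" using E_parts[of u] by (intro ennreal_leI) (simp add: E_def)
    finally have 1: "ennreal \<kappa> * (\<integral>\<^sup>+x. ennreal (\<bar>u x\<bar> powr p) \<partial>lebesgue) \<le> ennreal (E u)" .
    have fin: "(\<integral>\<^sup>+x. ennreal (\<bar>u x\<bar> powr p) \<partial>lebesgue) < \<infinity>"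
    proof (rule ccontr)
      assume "\<not> ?thesis"
      then have "(\<integral>\<^sup>+x. ennreal (\<bar>u x\<bar> powr p) \<partial>lebesgue) = \<infinity>" by (simp add: not_less top_unique)
      then show False using 1 \<kappa>(1) by (simp add: ennreal_mult_top top_unique)
    qed
    have i: "integrable lebesgue (\<lambda>x. \<bar>u x\<bar> powr p)"
      using pm fin by (intro integrableI_bounded) auto
    have "ennreal (\<kappa> * (\<integral>x. \<bar>u x\<bar> powr p \<partial>lebesgue)) \<le> ennreal (E u)"
      using 1 \<kappa>(1) by (subst (asm) nn_integral_eq_integral[OF i]) (auto simp: ennreal_mult)
    then have 2: "\<kappa> * (\<integral>x. \<bar>u x\<bar> powr p \<partial>lebesgue) \<le> E u" using E_parts(3)[of u] by simp
    have "(\<integral>x. \<bar>u x\<bar> \<partial>lebesgue) \<le> (\<integral>x. \<eta> * indicator \<Omega> x + (\<epsilon> * \<kappa>) * \<bar>u x\<bar> powr p \<partial>lebesgue)"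
    proof (rule integral_mono)
      show "\<bar>u x\<bar> \<le> \<eta> * indicator \<Omega> x + (\<epsilon> * \<kappa>) * \<bar>u x\<bar> powr p" for x
        using \<eta>(2)[of "\<bar>u x\<bar>"] VD(2)[OF u, of x] by (auto split: split_indicator)
    qed (use VD(1)[OF u] indicator_\<Omega>(1) i in auto)
    also have "\<dots> = \<eta> * measure lebesgue \<Omega> + \<epsilon> * (\<kappa> * (\<integral>x. \<bar>u x\<bar> powr p \<partial>lebesgue))"
      using indicator_\<Omega>[of \<eta>] i by simp
    also have "\<epsilon> * (\<kappa> * (\<integral>x. \<bar>u x\<bar> powr p \<partial>lebesgue)) \<le> \<epsilon> * E u" using 2 \<epsilon> by (intro mult_left_mono) auto
    finally show ?thesis by simp
  qed
  then show ?thesis using \<eta>(1) by (intro exI[of _ "\<eta> * measure lebesgue \<Omega>"]) auto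
qed

text \<open>One radius serves a whole sublevel of the energy. In the nonlocal case \<theta> is fixed
  before the radius: it makes the constant part small, and the remaining part is of order \<rho>^(N
  + \<sigma>) against a kernel mass of order at least \<rho>^N.\<close>

lemma uniform_mean_osc:
  assumes B: "0 \<le> B" and \<eta>: "0 < \<eta>"
  shows "\<exists>j::nat. \<forall>u\<in>V. E u \<le> B \<longrightarrow> mean_osc (inverse (real (Suc j))) u
        \<le> ennreal (\<eta> * cone_mass TYPE('a) (inverse (real (Suc j))))"
proof -
  have r0: "(\<lambda>j. inverse (real (Suc j))) \<longlonglongrightarrow> 0" by (rule LIMSEQ_inverse_real_of_nat)
  have cm: "cone_mass TYPE('a) (inverse (real (Suc j))) > 0" for j by (intro cone_mass_pos) simp
  show ?thesis
  proof (cases "0 < A")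
    case True
    have A: "A > 0" by (rule True)
    define C where "C = 1 * measure lebesgue \<Omega> + 1 * (B / A)"
    have "(\<lambda>j. inverse (real (Suc j)) * C) \<longlonglongrightarrow> 0 * C" by (intro tendsto_intros r0)
    then have "eventually (\<lambda>j. inverse (real (Suc j)) * C < \<eta>) sequentially" using \<eta> by (intro order_tendstoD) auto
    then obtain j where j: "inverse (real (Suc j)) * C < \<eta>" by (auto simp: eventually_sequentially)
    have "mean_osc (inverse (real (Suc j))) u \<le> ennreal (\<eta> * cone_mass TYPE('a) (inverse (real (Suc j))))"
      if u: "u \<in> V" and Eu: "E u \<le> B" for u
    proof -
      have "A * (\<integral>x. norm (gr u x) powr p \<partial>lebesgue) \<le> B"
        using Eu E_parts(1)[of u] unfolding E_def by linarith
      then have "(\<integral>x. norm (gr u x) powr p \<partial>lebesgue) \<le> B / A" using A by (simp add: pos_le_divide_eq mult.commute)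
      moreover have "(\<integral>x. norm (gr u x) \<partial>lebesgue) \<le> 1 * measure lebesgue \<Omega> + 1 * (\<integral>x. norm (gr u x) powr p \<partial>lebesgue)"
        using le_add_powr[of _ 1 p] p2 by (intro integral_norm_gr_le u) auto
      ultimately have "(\<integral>x. norm (gr u x) \<partial>lebesgue) \<le> C" unfolding C_def by linarith
      then have "inverse (real (Suc j)) * (\<integral>x. norm (gr u x) \<partial>lebesgue) \<le> inverse (real (Suc j)) * C"
        by (intro mult_left_mono) auto
      then have "inverse (real (Suc j)) * (\<integral>x. norm (gr u x) \<partial>lebesgue) \<le> \<eta>" using j by linarith
      then show ?thesis
        using cm[of j]
        by (intro order_trans[OF mean_osc_le_gradient[OF VD(3)[OF u True], of "inverse (real (Suc j))"]]
            ennreal_leI mult_right_mono) auto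
    qed
    then show ?thesis by blast
  next
    case False
    obtain \<sigma> c where f: "fractional_below \<sigma> c \<mu>" "\<sigma> > 0" "c > 0" using nonlocal[OF False] by blast
    define m where "m = measure lebesgue \<Omega>"
    have m: "m \<ge> 0" by (simp add: m_def)
    define \<theta> where "\<theta> = \<eta> / (4 * (m + 1))"
    have \<theta>: "\<theta> > 0" "2 * \<theta> * m \<le> \<eta> / 2" using \<eta> m by (auto simp: \<theta>_def divide_simps)
    define b where "b = unit_ball_vol (real DIM('a)) / 2 / 2 ^ DIM('a)"
    have b: "b > 0" by (simp add: b_def)
    define C where "C = \<theta> powr (1 - p) / c * B / b"
    have "(\<lambda>j. C * inverse (real (Suc j)) powr \<sigma>) \<longlonglongrightarrow> C * 0 powr \<sigma>"
      using f(2) by (intro tendsto_mult tendsto_const tendsto_powr2 r0) auto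
    then have "eventually (\<lambda>j. C * inverse (real (Suc j)) powr \<sigma> < \<eta> / 2) sequentially"
      using \<eta> by (intro order_tendstoD) auto
    then obtain j where j: "C * inverse (real (Suc j)) powr \<sigma> < \<eta> / 2" by (auto simp: eventually_sequentially)
    define \<rho> where "\<rho> = inverse (real (Suc j))"
    have \<rho>: "\<rho> > 0" by (simp add: \<rho>_def)
    have lb: "b * \<rho> powr real DIM('a) \<le> cone_mass TYPE('a) \<rho>"
      using cone_mass_lower_bound[OF \<rho>, where 'a='a] \<rho> by (simp add: b_def powr_realpow power_divide field_simps)
    have "mean_osc \<rho> u \<le> ennreal (\<eta> * cone_mass TYPE('a) \<rho>)" if u: "u \<in> V" and Eu: "E u \<le> B" for u
    proof -
      have um: "u \<in> borel_measurable lebesgue" using VD(1)[OF u] by auto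
      have "(\<integral>\<^sup>+z. ennreal (\<bar>dif u z\<bar> powr p) \<partial>\<mu>) = ennreal (\<integral>z. norm (dif u z) powr p \<partial>\<mu>)"
        using VD(5)[OF u] by (subst nn_integral_eq_integral[symmetric]) (auto simp: Lp_fun_def)
      also have "\<dots> \<le> ennreal B" using Eu E_parts[of u] by (intro ennreal_leI) (simp add: E_def)
      finally have dB: "(\<integral>\<^sup>+z. ennreal (\<bar>dif u z\<bar> powr p) \<partial>\<mu>) \<le> ennreal B" .
      have p1: "p > 1" using p2 by simp
      have "\<theta> powr (1 - p) * \<rho> powr (real DIM('a) + \<sigma>) / c * B = (C * \<rho> powr \<sigma>) * (b * \<rho> powr real DIM('a))"
        using b by (simp add: C_def powr_add field_simps)
      also have "\<dots> \<le> (\<eta> / 2) * cone_mass TYPE('a) \<rho>"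
        using j lb \<eta> b B \<rho> f(3) unfolding \<rho>_def[symmetric] by (intro mult_mono) auto
      finally have 1: "\<theta> powr (1 - p) * \<rho> powr (real DIM('a) + \<sigma>) / c * B \<le> (\<eta> / 2) * cone_mass TYPE('a) \<rho>" .
      have 2: "2 * \<theta> * m * cone_mass TYPE('a) \<rho> \<le> (\<eta> / 2) * cone_mass TYPE('a) \<rho>"
        using \<theta> cone_mass_pos[OF \<rho>, where 'a='a] by (intro mult_right_mono) auto
      show ?thesis
        using mean_osc_le_fractional[OF um VD(2)[OF u] \<Omega>_lmeasurable f p1 \<theta>(1) \<rho> dB B]
        by (rule order_trans) (simp, intro ennreal_leI, use 1 2[unfolded m_def] in linarith)
    qed
    then show ?thesis unfolding \<rho>_def by blast
  qed
qed

lemma E_linear: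
  assumes u: "u \<in> V" and v: "v \<in> V"
  shows "E (\<lambda>x. a * u x + b * v x) = A * (\<integral>x. norm (a *\<^sub>R gr u x + b *\<^sub>R gr v x) powr p \<partial>lebesgue) + (\<integral>z. norm (a *\<^sub>R dif u z + b *\<^sub>R dif v z) powr p \<partial>\<mu>)"
proof -
  let ?w = "\<lambda>x. a * u x + b * v x"
  have m: "gr u \<in> borel_measurable lebesgue" "gr v \<in> borel_measurable lebesgue" "gr ?w \<in> borel_measurable lebesgue"
    using VD(4)[OF u] VD(4)[OF v] VD(4)[OF V_linear(1)[OF u v]] by (auto simp: Lp_fun_def)
  have "(\<integral>x. norm (gr ?w x) powr p \<partial>lebesgue) = (\<integral>x. norm (a *\<^sub>R gr u x + b *\<^sub>R gr v x) powr p \<partial>lebesgue)"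
  proof (rule integral_cong_AE)
    show "AE x in lebesgue. norm (gr ?w x) powr p = norm (a *\<^sub>R gr u x + b *\<^sub>R gr v x) powr p"
      using V_linear(2)[OF u v, of a b] by eventually_elim simp
  qed (use m in \<open>auto intro!: powr_real_measurable borel_measurable_norm\<close>)
  then show ?thesis by (simp add: E_def V_linear(3)[OF u v])
qed

text \<open>For two near-minimisers the midpoint cannot have much less energy, so the energy of
  their half difference must be small.\<close>

lemma E_clarkson:
  assumes u: "u \<in> V" and v: "v \<in> V"
  shows "E (\<lambda>x. 1/2 * u x + 1/2 * v x) + E (\<lambda>x. 1/2 * u x + (-1/2) * v x) \<le> (E u + E v) / 2"
proof -

  have "A * ((\<integral>x. norm ((gr u x + gr v x) /\<^sub>R 2) powr p \<partial>lebesgue) + (\<integral>x. norm ((gr u x - gr v x) /\<^sub>R 2) powr p \<partial>lebesgue))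
     \<le> A * (((\<integral>x. norm (gr u x) powr p \<partial>lebesgue) + (\<integral>x. norm (gr v x) powr p \<partial>lebesgue)) / 2)"
    by (intro mult_left_mono integral_clarkson p2 VD(4) u v A0)
  moreover have "(\<integral>z. norm ((dif u z + dif v z) /\<^sub>R 2) powr p \<partial>\<mu>) + (\<integral>z. norm ((dif u z - dif v z) /\<^sub>R 2) powr p \<partial>\<mu>)
     \<le> ((\<integral>z. norm (dif u z) powr p \<partial>\<mu>) + (\<integral>z. norm (dif v z) powr p \<partial>\<mu>)) / 2"
    by (intro integral_clarkson p2 VD(5) u v)
  ultimately show ?thesis
    unfolding E_linear[OF u v] half_sum_scaleR half_diff_scaleR unfolding E_def by (simp add: distrib_left add_divide_distrib)
qed

end

lemma half_dist: "\<bar>a - (1/2 * a + 1/2 * b)\<bar> = \<bar>a - b\<bar> / 2" "\<bar>b - (1/2 * a + 1/2 * b)\<bar> = \<bar>a - b\<bar> / 2"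
  for a b :: real
  by (simp_all add: abs_if field_simps)

lemma midpoint_arith:
  fixes a b c ja jb jm I x y X :: real
  assumes "\<bar>a - c\<bar> \<le> X" "\<bar>b - c\<bar> \<le> X" "ja < I + x" "jb < I + y" "I \<le> jm"
  shows "(ja + jb) / 2 + (a + b) / 2 - (jm + c) \<le> (x + y) / 2 + X"
  using assms unfolding add_divide_distrib by linarith

lemma average_arith:
  fixes x y P Q X e :: real
  shows "x + P < e \<Longrightarrow> y + Q < e \<Longrightarrow> X \<le> (P + Q) / 2 \<Longrightarrow> (x + y) / 2 + X < e"
  unfolding add_divide_distrib by linarith

context energy_setting
begin

text \<open>Along a minimising sequence that already converges in L^1, the half differences have
  small energy by Clarkson's inequality. So the gradients converge in L^1, and their limit is the
  weak gradient of v. The differences u(x) - u(y) converge almost everywhere without further work,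
  and Fatou's lemma bounds E v by the limit of the energies.\<close>

lemma exists_minimizer:
  assumes M: "0 \<le> M" and \<Phi>: "\<And>u v. integrable lebesgue u \<Longrightarrow> integrable lebesgue v \<Longrightarrow> \<bar>\<Phi> u - \<Phi> v\<bar> \<le> M * (\<integral>x. \<bar>u x - v x\<bar> \<partial>lebesgue)"
  shows "\<exists>u\<in>V. \<forall>v\<in>V. E u / p - \<Phi> u \<le> E v / p - \<Phi> v"
proof -
  have p0: "p > 0" using p2 by simp
  define J where "J u = E u / p - \<Phi> u" for u
  \<comment> \<open>Chosen so that M \<epsilon> \<le> 1 / (2 p): one half of E / p absorbs the
    growth of \<Phi>, and the other half keeps the energy bounded.\<close>
  define \<epsilon> where "\<epsilon> = 1 / (2 * p * (M + 1))"
  have \<epsilon>: "\<epsilon> > 0" using p0 M by (simp add: \<epsilon>_def)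
  obtain C where C: "0 \<le> C" "\<And>u. u \<in> V \<Longrightarrow> (\<integral>x. \<bar>u x\<bar> \<partial>lebesgue) \<le> \<epsilon> * E u + C"
    using coercive[OF \<epsilon>] by blast
  define C0 where "C0 = \<bar>\<Phi> (\<lambda>_. 0)\<bar> + M * C"
  have "M / (M + 1) * (1 / (2 * p)) \<le> 1 * (1 / (2 * p))" using M p0 by (intro mult_right_mono) auto
  then have M\<epsilon>: "M * \<epsilon> \<le> 1 / (2 * p)" by (simp add: \<epsilon>_def mult_ac)
  have lower: "E u / (2 * p) - C0 \<le> J u" if u: "u \<in> V" for u
  proof -
    have "\<Phi> u \<le> \<bar>\<Phi> (\<lambda>_. 0)\<bar> + M * (\<integral>x. \<bar>u x - 0\<bar> \<partial>lebesgue)"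
      using \<Phi>[OF VD(1)[OF u], of "\<lambda>_. 0"] by simp
    also have "\<dots> \<le> \<bar>\<Phi> (\<lambda>_. 0)\<bar> + M * (\<epsilon> * E u + C)" using C(2)[OF u] M by (intro add_left_mono mult_left_mono) auto
    also have "\<dots> = C0 + (M * \<epsilon>) * E u" by (simp add: C0_def algebra_simps)
    also have "\<dots> \<le> C0 + 1 / (2 * p) * E u" using M\<epsilon> E_parts(3)[of u] by (intro add_left_mono mult_right_mono) auto
    finally have "\<Phi> u \<le> C0 + E u / (2 * p)" by simp
    moreover have "E u / p = E u / (2 * p) + E u / (2 * p)" using p0 by (simp add: field_simps)
    ultimately show ?thesis by (simp add: J_def)
  qed
  have lower': "- C0 \<le> J u" if "u \<in> V" for u
    using lower[OF that] divide_nonneg_pos[OF E_parts(3)[of u], of "2 * p"] p0 by linarith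
  define I where "I = Inf (J ` V)"
  have bdd: "bdd_below (J ` V)" using lower' by (auto intro!: bdd_belowI[of _ "- C0"])
  have I: "I \<le> J u" if "u \<in> V" for u unfolding I_def using bdd that by (intro cInf_lower) auto
  have "\<exists>u\<in>V. J u < I + inverse (real (Suc n))" for n
  proof -
    have "Inf (J ` V) < I + inverse (real (Suc n))" by (simp add: I_def)
    then obtain y where "y \<in> J ` V" "y < I + inverse (real (Suc n))"
      using cInf_lessD[of "J ` V"] V_zero by blast
    then show ?thesis by auto
  qed
  then obtain u where u: "\<And>n. u n \<in> V" "\<And>n. J (u n) < I + inverse (real (Suc n))" by metis
  define B where "B = max 0 (2 * p * (I + 1 + C0))"
  have EB: "E (u n) \<le> B" for n
  proof -
    have "E (u n) / (2 * p) \<le> I + 1 + C0"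
      using lower[OF u(1)[of n]] u(2)[of n] inverse_le_1_iff[of "real (Suc n)"] by (simp del: of_nat_Suc)
    then show ?thesis using p0 by (simp add: B_def pos_divide_le_eq mult.commute)
  qed
  have B0: "0 \<le> B" by (simp add: B_def)
  have L1: "(\<integral>x. \<bar>u n x\<bar> \<partial>lebesgue) \<le> \<epsilon> * B + C" for n
  proof -
    have "\<epsilon> * E (u n) \<le> \<epsilon> * B" using \<epsilon> by (intro mult_left_mono EB) simp
    then show ?thesis using C(2)[OF u(1)[of n]] by linarith
  qed
  have osc: "\<exists>j::nat. \<forall>n. mean_osc (inverse (real (Suc j))) (u n) \<le> ennreal (\<eta> * cone_mass TYPE('a) (inverse (real (Suc j))))" if "\<eta> > 0" for \<eta>
    using uniform_mean_osc[OF B0 that] EB u(1) by blast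
  obtain v k where k: "strict_mono k" and v: "integrable lebesgue v" "\<And>x. x \<notin> \<Omega> \<Longrightarrow> v x = 0"
    and kv: "(\<lambda>n. \<integral>x. \<bar>u (k n) x - v x\<bar> \<partial>lebesgue) \<longlonglongrightarrow> 0" "AE x in lebesgue. (\<lambda>n. u (k n) x) \<longlonglongrightarrow> v x"
    using L1_compactness[OF VD(1)[OF u(1)] bounded_\<Omega> fmeasurableD[OF \<Omega>_lmeasurable] VD(2)[OF u(1)] L1 osc] by blast
  define w where "w n = u (k n)" for n
  have w: "w n \<in> V" for n by (simp add: w_def u)
  have wi: "integrable lebesgue (w n)" for n by (rule VD(1)[OF w])
  have Jw: "J (w n) < I + inverse (real (Suc n))" for n
  proof -
    have "real (Suc n) \<le> real (Suc (k n))" using seq_suble[OF k, of n] by simp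
    then have "inverse (real (Suc (k n))) \<le> inverse (real (Suc n))" by (intro le_imp_inverse_le) auto
    then show ?thesis using u(2)[of "k n"] unfolding w_def by linarith
  qed
  have wv: "(\<lambda>n. \<integral>x. \<bar>w n x - v x\<bar> \<partial>lebesgue) \<longlonglongrightarrow> 0" "AE x in lebesgue. (\<lambda>n. w n x) \<longlonglongrightarrow> v x"
    using kv by (simp_all add: w_def)
  have E_eq: "E z = p * (J z + \<Phi> z)" for z using p0 by (simp add: J_def)
  let ?d = "\<lambda>n m. \<integral>x. \<bar>w n x - w m x\<bar> \<partial>lebesgue"
  let ?h = "\<lambda>n m x. 1/2 * w n x + (-1/2) * w m x"
  \<comment> \<open>The midpoint lies in V, so its value is at least I; by the Lipschitz bound
    \<Phi> differs there from its values at both ends by at most M times half their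
    distance.\<close>
  have half: "E (?h n m) \<le> p * ((inverse (real (Suc n)) + inverse (real (Suc m))) / 2 + M * (?d n m / 2))" for n m
  proof -
    let ?m = "\<lambda>x. 1/2 * w n x + 1/2 * w m x"
    have mV: "?m \<in> V" by (rule V_linear(1)[OF w w])
    have dm: "\<bar>\<Phi> (w i) - \<Phi> ?m\<bar> \<le> M * (?d n m / 2)" if "i = n \<or> i = m" for i
    proof -
      have eq: "(\<lambda>x. \<bar>w i x - ?m x\<bar>) = (\<lambda>x. \<bar>w n x - w m x\<bar> / 2)"
      proof
        fix x show "\<bar>w i x - ?m x\<bar> = \<bar>w n x - w m x\<bar> / 2"
          using that half_dist[where a="w n x" and b="w m x"] by metis
      qed
      show ?thesis using \<Phi>[OF wi[of i] VD(1)[OF mV]] unfolding eq by simp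
    qed
    have "E ?m + E (?h n m) \<le> (E (w n) + E (w m)) / 2" by (rule E_clarkson[OF w w])
    then have "E (?h n m) \<le> p * ((J (w n) + J (w m)) / 2 + (\<Phi> (w n) + \<Phi> (w m)) / 2 - (J ?m + \<Phi> ?m))"
      unfolding E_eq[of "w n"] E_eq[of "w m"] E_eq[of ?m] by (simp add: algebra_simps add_divide_distrib)
    also have "\<dots> \<le> p * ((inverse (real (Suc n)) + inverse (real (Suc m))) / 2 + M * (?d n m / 2))"
    proof (rule mult_left_mono)
      have "\<bar>\<Phi> (w n) - \<Phi> ?m\<bar> \<le> M * (?d n m / 2)" "\<bar>\<Phi> (w m) - \<Phi> ?m\<bar> \<le> M * (?d n m / 2)"
        by (rule dm, simp)+
      from midpoint_arith[OF this Jw[of n] Jw[of m] I[OF mV]]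
      show "(J (w n) + J (w m)) / 2 + (\<Phi> (w n) + \<Phi> (w m)) / 2 - (J ?m + \<Phi> ?m)
          \<le> (inverse (real (Suc n)) + inverse (real (Suc m))) / 2 + M * (?d n m / 2)" .
    qed (use p0 in simp)
    finally show ?thesis .
  qed
  have d_small: "\<exists>N. \<forall>n\<ge>N. \<forall>m\<ge>N. E (?h n m) < e" if e: "e > 0" for e
  proof -
    have "(\<lambda>n. inverse (real (Suc n)) + M * (\<integral>x. \<bar>w n x - v x\<bar> \<partial>lebesgue)) \<longlonglongrightarrow> 0 + M * 0"
      by (intro tendsto_intros LIMSEQ_inverse_real_of_nat wv(1))
    then have "eventually (\<lambda>n. inverse (real (Suc n)) + M * (\<integral>x. \<bar>w n x - v x\<bar> \<partial>lebesgue) < e / p) sequentially"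
      using e p0 by (intro order_tendstoD) auto
    then obtain N where N: "\<And>n. n \<ge> N \<Longrightarrow> inverse (real (Suc n)) + M * (\<integral>x. \<bar>w n x - v x\<bar> \<partial>lebesgue) < e / p"
      by (auto simp: eventually_sequentially)
    have "E (?h n m) < e" if n: "n \<ge> N" and m: "m \<ge> N" for n m
    proof -
      have "?d n m \<le> (\<integral>x. \<bar>w n x - v x\<bar> + \<bar>w m x - v x\<bar> \<partial>lebesgue)"
        using wi v(1) by (intro integral_mono) auto
      also have "\<dots> = (\<integral>x. \<bar>w n x - v x\<bar> \<partial>lebesgue) + (\<integral>x. \<bar>w m x - v x\<bar> \<partial>lebesgue)" using wi v(1) by simp
      finally have "M * (?d n m / 2) \<le> M * (((\<integral>x. \<bar>w n x - v x\<bar> \<partial>lebesgue) + (\<integral>x. \<bar>w m x - v x\<bar> \<partial>lebesgue)) / 2)"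
        using M by (intro mult_left_mono) auto
      also have "\<dots> = (M * (\<integral>x. \<bar>w n x - v x\<bar> \<partial>lebesgue) + M * (\<integral>x. \<bar>w m x - v x\<bar> \<partial>lebesgue)) / 2"
        by (simp add: distrib_left)
      finally have "(inverse (real (Suc n)) + inverse (real (Suc m))) / 2 + M * (?d n m / 2) < e / p"
        by (rule average_arith[OF N[OF n] N[OF m]])
      then have "p * ((inverse (real (Suc n)) + inverse (real (Suc m))) / 2 + M * (?d n m / 2)) < e"
        using p0 by (simp add: pos_less_divide_eq mult.commute)
      then show ?thesis using half[of n m] by linarith
    qed
    then show ?thesis by blast
  qed
  \<comment> \<open>Both cases deliver a limit H of the gradients along a subsequence, trivially 0
    when there is no local term, so that the rest of the proof is common to both.\<close>
  have "\<exists>H r. strict_mono (r :: nat \<Rightarrow> nat) \<and> H \<in> borel_measurable lebesgue \<and> (AE x in lebesgue. (\<lambda>n. gr (w (r n)) x) \<longlonglongrightarrow> H x)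
     \<and> (0 < A \<longrightarrow> wgrad v H) \<and> (\<not> 0 < A \<longrightarrow> H = (\<lambda>_. 0))"
  proof (cases "0 < A")
    case False
    show ?thesis
      by (intro exI[of _ "\<lambda>_. 0"] exI[of _ id]) (use False in \<open>simp add: gr_nonlocal strict_mono_id\<close>)
  next
    case True
    have gi: "integrable lebesgue (gr (w n))" for n by (rule integrable_gr[OF w])
    have Cau: "\<exists>N. \<forall>n\<ge>N. \<forall>m\<ge>N. (\<integral>x. norm (gr (w n) x - gr (w m) x) \<partial>lebesgue) < e" if e: "e > 0" for e
    proof -
      let ?m = "measure lebesgue \<Omega>"
      \<comment> \<open>The two contributions of e / 8 keep the half difference below e / 2, hence
        the difference below e.\<close>
      define \<eta> where "\<eta> = e / (8 * (?m + 1))"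
      have \<eta>: "\<eta> > 0" "\<eta> * ?m \<le> e / 8" using e by (auto simp: \<eta>_def divide_simps add_nonneg_pos)
      define c where "c = \<eta> powr (1 - p)"
      have c: "c > 0" using \<eta> by (simp add: c_def)
      obtain N where N: "\<And>n m. n \<ge> N \<Longrightarrow> m \<ge> N \<Longrightarrow> E (?h n m) < A * (e / 8) / c"
        using d_small[of "A * (e / 8) / c"] True e c by auto
      have "(\<integral>x. norm (gr (w n) x - gr (w m) x) \<partial>lebesgue) < e" if n: "n \<ge> N" and m: "m \<ge> N" for n m
      proof -
        have hV: "?h n m \<in> V" by (rule V_linear(1)[OF w w])
        let ?I = "\<integral>x. norm (gr (?h n m) x) powr p \<partial>lebesgue"
        have "A * ?I \<le> E (?h n m)" using E_parts(1)[of "?h n m"] by (simp add: E_def)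
        then have "A * ?I < A * (e / 8) / c" using N[OF n m] by linarith
        then have "c * ?I < e / 8" using True c by (simp add: field_simps)
        moreover have "(\<integral>x. norm (gr (?h n m) x) \<partial>lebesgue) \<le> \<eta> * ?m + c * ?I"
          unfolding c_def using p2 \<eta>(1) by (intro integral_norm_gr_le[OF hV] le_add_powr) auto
        ultimately have s: "(\<integral>x. norm (gr (?h n m) x) \<partial>lebesgue) < e / 2" using \<eta>(2) e by linarith
        have "(\<integral>x. norm (gr (w n) x - gr (w m) x) \<partial>lebesgue) = (\<integral>x. 2 * norm (gr (?h n m) x) \<partial>lebesgue)"
        proof (rule integral_cong_AE)
          show "AE x in lebesgue. norm (gr (w n) x - gr (w m) x) = 2 * norm (gr (?h n m) x)"
            using V_linear(2)[OF w w, of "1/2" n "-1/2" m] by eventually_elim (simp only: half_diff_scaleR norm_scaleR, simp)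
        qed (use integrable_gr[OF hV] gi in auto)
        then show ?thesis using s by simp
      qed
      then show ?thesis by blast
    qed
    obtain H r where H: "integrable lebesgue H" "(\<lambda>n. \<integral>x. norm (gr (w n) x - H x) \<partial>lebesgue) \<longlonglongrightarrow> 0"
      "strict_mono (r :: nat \<Rightarrow> nat)" "AE x in lebesgue. (\<lambda>n. gr (w (r n)) x) \<longlonglongrightarrow> H x"
      using L1_complete[OF gi Cau] by blast
    have "wgrad v H" by (rule wgrad_closed[OF VD(3)[OF w True] v(1) H(1) wv(1) H(2)])
    then show ?thesis using H True by (intro exI[of _ H] exI[of _ r]) auto
  qed
  then obtain H r where r: "strict_mono (r :: nat \<Rightarrow> nat)" and Hm: "H \<in> borel_measurable lebesgue"
    and rH: "AE x in lebesgue. (\<lambda>n. gr (w (r n)) x) \<longlonglongrightarrow> H x" and HA: "0 < A \<Longrightarrow> wgrad v H" "\<not> 0 < A \<Longrightarrow> H = (\<lambda>_. 0)"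
    by blast
  \<comment> \<open>Fatou's lemma is applied to the two parts of the energy separately; their values
    are bounded but may oscillate, whence one more subsequence.\<close>
  define a where "a n = (\<integral>x. norm (gr (w (r n)) x) powr p \<partial>lebesgue)" for n
  define b where "b n = (\<integral>z. norm (dif (w (r n)) z) powr p \<partial>\<mu>)" for n
  have Ew: "E (w (r n)) = A * a n + b n" for n by (simp add: E_def a_def b_def)
  have ab0: "0 \<le> a n" "0 \<le> b n" for n by (simp_all add: a_def b_def)
  have EwB: "E (w n) \<le> B" for n by (simp add: w_def EB)
  have aB: "a n \<le> (if 0 < A then B / A else 0)" for n
  proof (cases "0 < A")
    case True
    have "A * a n \<le> B" using EwB[of "r n"] ab0(2)[of n] Ew[of n] by linarith
    then show ?thesis using True by (simp add: pos_le_divide_eq mult.commute)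
  next
    case False
    then show ?thesis using p2 by (simp add: a_def gr_nonlocal)
  qed
  have bB: "b n \<le> B" for n
    using EwB[of "r n"] ab0[of n] Ew[of n] mult_nonneg_nonneg[OF A0 ab0(1)[of n]] by linarith
  have "range (\<lambda>n. (a n, b n)) \<subseteq> {0..(if 0 < A then B / A else 0)} \<times> {0..B}"
    using ab0 aB bB by (auto intro: antisym)
  then have "bounded (range (\<lambda>n. (a n, b n)))"
    by (rule bounded_subset[rotated]) (intro bounded_Times bounded_closed_interval)
  then obtain l s where s: "strict_mono (s :: nat \<Rightarrow> nat)" and l: "((\<lambda>n. (a n, b n)) \<circ> s) \<longlonglongrightarrow> l"
    using bounded_imp_convergent_subsequence by blast
  have al: "(\<lambda>n. a (s n)) \<longlonglongrightarrow> fst l" and bl: "(\<lambda>n. b (s n)) \<longlonglongrightarrow> snd l"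
    using tendsto_fst[OF l] tendsto_snd[OF l] by (simp_all add: comp_def)
  have aeH: "AE x in lebesgue. (\<lambda>n. gr (w (r (s n))) x) \<longlonglongrightarrow> H x"
    using rH by eventually_elim (use LIMSEQ_subseq_LIMSEQ[OF _ s] in \<open>auto simp: comp_def\<close>)
  have rs: "strict_mono (\<lambda>n. r (s n))" using strict_mono_o[OF r s] by (simp add: comp_def)
  have aew: "AE x in lebesgue. (\<lambda>n. w (r (s n)) x) \<longlonglongrightarrow> v x"
    using wv(2) by eventually_elim (use LIMSEQ_subseq_LIMSEQ[OF _ rs] in \<open>auto simp: comp_def\<close>)
  have aed: "AE z in \<mu>. (\<lambda>n. dif (w (r (s n))) z) \<longlonglongrightarrow> dif v z"
  proof (rule AE_\<mu>)
    show "AE z in lebesgue. (\<lambda>n. dif (w (r (s n))) z) \<longlonglongrightarrow> dif v z"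
      using AE_lebesgue_fst[OF aew, where 'b='a] AE_lebesgue_snd[OF aew, where 'a='a]
      by eventually_elim (auto simp: dif_def intro!: tendsto_diff)
  qed
  have dvm: "dif v \<in> borel_measurable \<mu>"
    using v(1) by (intro measurable_\<mu> dif_measurable) auto
  have p0': "0 < p" by (rule p0)
  note F1 = Lp_Fatou[OF VD(4)[OF w] Hm aeH al[unfolded a_def] p0']
  note F2 = Lp_Fatou[OF VD(5)[OF w] dvm aed bl[unfolded b_def] p0']
  have vV: "v \<in> V" and grv: "AE x in lebesgue. gr v x = H x"
    using VI[OF v HA F1(1) F2(1)] by auto
  have "(\<integral>x. norm (gr v x) powr p \<partial>lebesgue) = (\<integral>x. norm (H x) powr p \<partial>lebesgue)"
  proof (rule integral_cong_AE)
    show "AE x in lebesgue. norm (gr v x) powr p = norm (H x) powr p" using grv by eventually_elim simp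
  qed (use VD(4)[OF vV] F1(1) in \<open>auto simp: Lp_fun_def\<close>)
  then have "E v \<le> A * fst l + snd l"
    unfolding E_def using F1(2) F2(2) A0 by (intro add_mono mult_left_mono) auto
  also have "A * fst l + snd l \<le> p * (I + 0 + \<Phi> v)"
  proof (rule LIMSEQ_le)
    show "(\<lambda>n. A * a (s n) + b (s n)) \<longlonglongrightarrow> A * fst l + snd l" by (intro tendsto_intros al bl)
    have \<Phi>l: "(\<lambda>n. \<Phi> (w (r (s n)))) \<longlonglongrightarrow> \<Phi> v"
    proof (rule LIM_zero_cancel, rule null_sequence_if_bounded)
      show "norm (\<Phi> (w (r (s n))) - \<Phi> v) \<le> M * (\<integral>x. \<bar>w (r (s n)) x - v x\<bar> \<partial>lebesgue)" for n
        using \<Phi>[OF wi v(1)] by simp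
      show "(\<lambda>n. \<integral>x. \<bar>w (r (s n)) x - v x\<bar> \<partial>lebesgue) \<longlonglongrightarrow> 0"
        using LIMSEQ_subseq_LIMSEQ[OF wv(1) rs] by (simp add: comp_def)
    qed
    have "(\<lambda>n. inverse (real (Suc (r (s n))))) \<longlonglongrightarrow> 0"
      using LIMSEQ_subseq_LIMSEQ[OF LIMSEQ_inverse_real_of_nat rs] by (simp add: comp_def)
    then show "(\<lambda>n. p * (I + inverse (real (Suc (r (s n)))) + \<Phi> (w (r (s n))))) \<longlonglongrightarrow> p * (I + 0 + \<Phi> v)"
      by (intro tendsto_intros \<Phi>l)
    have "A * a (s n) + b (s n) \<le> p * (I + inverse (real (Suc (r (s n)))) + \<Phi> (w (r (s n))))" for n
      unfolding Ew[symmetric] E_eq[of "w (r (s n))"] using p0 Jw[of "r (s n)"] by (intro mult_left_mono) auto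
    then show "\<exists>N. \<forall>n\<ge>N. A * a (s n) + b (s n) \<le> p * (I + inverse (real (Suc (r (s n)))) + \<Phi> (w (r (s n))))" by blast
  qed
  finally have "E v / p \<le> I + \<Phi> v" using p0 by (simp add: pos_divide_le_eq mult.commute)
  then have "J v \<le> I" by (simp add: J_def)
  then have "J v \<le> J x" if "x \<in> V" for x using I[OF that] by simp
  then show ?thesis using vV unfolding J_def by blast
qed

text \<open>The form \<open>0 * u x + c * v x\<close> is that of \<open>V_linear\<close>, which
  supplies membership in V and the gradient.\<close>

lemma D_scale_right: "u \<in> V \<Longrightarrow> v \<in> V \<Longrightarrow> D u (\<lambda>x. 0 * u x + c * v x) = c * D u v"
proof -
  assume u: "u \<in> V" and v: "v \<in> V"
  let ?w = "\<lambda>x. 0 * u x + c * v x"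
  have w: "?w \<in> V" by (rule V_linear(1)[OF u v])
  have "(\<integral>x. pdot p (gr u x) (gr ?w x) \<partial>lebesgue) = (\<integral>x. c * pdot p (gr u x) (gr v x) \<partial>lebesgue)"
  proof (rule integral_cong_AE)
    show "AE x in lebesgue. pdot p (gr u x) (gr ?w x) = c * pdot p (gr u x) (gr v x)"
      using V_linear(2)[OF u v, of 0 c] by eventually_elim (simp add: pdot_def)
    show "(\<lambda>x. pdot p (gr u x) (gr ?w x)) \<in> borel_measurable lebesgue"
      by (rule borel_measurable_integrable[OF integrable_pdot[OF p2 VD(4)[OF u] VD(4)[OF w]]])
    show "(\<lambda>x. c * pdot p (gr u x) (gr v x)) \<in> borel_measurable lebesgue"
      using borel_measurable_integrable[OF integrable_pdot[OF p2 VD(4)[OF u] VD(4)[OF v]]] by auto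
  qed
  moreover have "(\<integral>z. pdot p (dif u z) (dif ?w z) \<partial>\<mu>) = (\<integral>z. c * pdot p (dif u z) (dif v z) \<partial>\<mu>)"
    unfolding V_linear(3)[OF u v] by (simp add: pdot_def mult_ac)
  ultimately show ?thesis by (simp add: D_def algebra_simps)
qed

lemma D_minus_left: "u \<in> V \<Longrightarrow> v \<in> V \<Longrightarrow> D (\<lambda>x. 0 * u x + (-1) * u x) v = - D u v"
proof -
  assume u: "u \<in> V" and v: "v \<in> V"
  let ?w = "\<lambda>x. 0 * u x + (-1) * u x"
  have w: "?w \<in> V" by (rule V_linear(1)[OF u u])
  have "(\<integral>x. pdot p (gr ?w x) (gr v x) \<partial>lebesgue) = (\<integral>x. - pdot p (gr u x) (gr v x) \<partial>lebesgue)"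
  proof (rule integral_cong_AE)
    show "AE x in lebesgue. pdot p (gr ?w x) (gr v x) = - pdot p (gr u x) (gr v x)"
      using V_linear(2)[OF u u, of 0 "-1"] by eventually_elim (simp add: pdot_def)
    show "(\<lambda>x. pdot p (gr ?w x) (gr v x)) \<in> borel_measurable lebesgue"
      by (rule borel_measurable_integrable[OF integrable_pdot[OF p2 VD(4)[OF w] VD(4)[OF v]]])
    show "(\<lambda>x. - pdot p (gr u x) (gr v x)) \<in> borel_measurable lebesgue"
      using borel_measurable_integrable[OF integrable_pdot[OF p2 VD(4)[OF u] VD(4)[OF v]]] by auto
  qed
  moreover have "(\<integral>z. pdot p (dif ?w z) (dif v z) \<partial>\<mu>) = (\<integral>z. - pdot p (dif u z) (dif v z) \<partial>\<mu>)"
    unfolding V_linear(3)[OF u u] by (simp add: pdot_def)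
  ultimately show ?thesis by (simp add: D_def)
qed

text \<open>For t > 0, minimality and the tangent inequality at u + t v bound the difference
  quotient of the potential term by the form D taken at u + t v in direction v. Letting t tend to 0
  gives one inequality, and replacing v by - v the other; one-sided estimates therefore
  suffice.\<close>

lemma Euler_Lagrange:
  assumes u: "u \<in> V" and v: "v \<in> V"
    and min: "\<And>w. w \<in> V \<Longrightarrow> E u / p - (\<integral>x. F x (u x) \<partial>lebesgue) \<le> E w / p - (\<integral>x. F x (w x) \<partial>lebesgue)"
    and F0: "\<And>x. F x 0 = 0" and FL: "\<And>x s t. \<bar>F x s - F x t\<bar> \<le> M * \<bar>s - t\<bar>"
    and Fd: "\<And>x t. (F x has_real_derivative f x t) (at t)"
    and Fm: "\<And>w. w \<in> borel_measurable lebesgue \<Longrightarrow> (\<lambda>x. F x (w x)) \<in> borel_measurable lebesgue"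
    and fm: "\<And>w. w \<in> borel_measurable lebesgue \<Longrightarrow> (\<lambda>x. f x (w x)) \<in> borel_measurable lebesgue"
  shows "D u v = (\<integral>x. f x (u x) * v x \<partial>lebesgue)"
proof -
  have p0: "p > 0" using p2 by simp
  have Fi: "integrable lebesgue (\<lambda>x. F x (w x))" if w: "integrable lebesgue w" for w
  proof (rule Bochner_Integration.integrable_bound)
    show "integrable lebesgue (\<lambda>x. M * \<bar>w x\<bar>)" using w by auto
    show "(\<lambda>x. F x (w x)) \<in> borel_measurable lebesgue" using w by (intro Fm) auto
    show "AE x in lebesgue. norm (F x (w x)) \<le> norm (M * \<bar>w x\<bar>)"
      using FL[of _ _ 0] F0 by (intro AE_I2) (auto intro: order_trans[OF _ abs_ge_self])
  qed
  have one: "(\<integral>x. f x (u x) * v x \<partial>lebesgue) \<le> D u v" if v: "v \<in> V" for v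
  proof (rule LIMSEQ_le)
    define t where "t n = inverse (real (Suc n))" for n
    have t: "t n > 0" for n by (simp add: t_def)
    have t0: "t \<longlonglongrightarrow> 0" unfolding t_def[abs_def] by (rule LIMSEQ_inverse_real_of_nat)
    have ui: "integrable lebesgue u" and vi: "integrable lebesgue v" by (rule VD(1)[OF u], rule VD(1)[OF v])
    let ?q = "\<lambda>n x. (F x (u x + t n * v x) - F x (u x)) / t n"
    let ?R = "\<lambda>n. A * (\<integral>x. pdot p (gr u x + t n *\<^sub>R gr v x) (gr v x) \<partial>lebesgue) + (\<integral>z. pdot p (dif u z + t n *\<^sub>R dif v z) (dif v z) \<partial>\<mu>)"
    have ti: "integrable lebesgue (\<lambda>x. u x + t n * v x)" for n using ui vi by auto
    show "?R \<longlonglongrightarrow> D u v"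
      unfolding D_def t_def
      by (intro tendsto_add tendsto_mult tendsto_const integral_pdot_tendsto p2 VD(4) VD(5) u v)
    show "(\<lambda>n. \<integral>x. ?q n x \<partial>lebesgue) \<longlonglongrightarrow> (\<integral>x. f x (u x) * v x \<partial>lebesgue)"
    proof (rule integral_dominated_convergence[where w="\<lambda>x. M * \<bar>v x\<bar>"])
      show "integrable lebesgue (\<lambda>x. M * \<bar>v x\<bar>)" using vi by auto
      show "(\<lambda>x. f x (u x) * v x) \<in> borel_measurable lebesgue" using fm[of u] ui vi by auto
      show "?q n \<in> borel_measurable lebesgue" for n
        using borel_measurable_integrable[OF Fi[OF ti]] borel_measurable_integrable[OF Fi[OF ui]] by auto
      show "AE x in lebesgue. (\<lambda>n. ?q n x) \<longlonglongrightarrow> f x (u x) * v x"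
      proof (rule AE_I2)
        fix x
        have "((\<lambda>s. F x (u x + s * v x)) has_real_derivative f x (u x) * v x) (at 0)"
          by (rule DERIV_chain2[where g="\<lambda>s. u x + s * v x"]) (auto intro!: derivative_eq_intros Fd)
        then have "((\<lambda>s. (F x (u x + s * v x) - F x (u x)) / s) \<longlongrightarrow> f x (u x) * v x) (at 0)"
          by (simp add: has_field_derivative_iff)
        moreover have "filterlim t (at 0) sequentially"
          using t0 t by (auto simp: filterlim_at less_imp_neq[symmetric])
        ultimately show "(\<lambda>n. ?q n x) \<longlonglongrightarrow> f x (u x) * v x" by (rule filterlim_compose)
      qed
      show "AE x in lebesgue. norm (?q n x) \<le> M * \<bar>v x\<bar>" for n
      proof (rule AE_I2)
        fix x
        have "\<bar>F x (u x + t n * v x) - F x (u x)\<bar> \<le> (M * \<bar>v x\<bar>) * t n"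
          using FL[of x "u x + t n * v x" "u x"] t[of n] by (simp add: abs_mult mult_ac)
        then show "norm (?q n x) \<le> M * \<bar>v x\<bar>" using t[of n] by (simp add: pos_divide_le_eq)
      qed
    qed
    have "(\<integral>x. ?q n x \<partial>lebesgue) \<le> ?R n" for n
    proof -
      have tV: "(\<lambda>x. 1 * u x + t n * v x) \<in> V" by (rule V_linear(1)[OF u v])
      have "E (\<lambda>x. 1 * u x + t n * v x) - E u \<le> p * t n * ?R n"
      proof -
        have "A * ((\<integral>x. norm (gr u x + t n *\<^sub>R gr v x) powr p \<partial>lebesgue) - (\<integral>x. norm (gr u x) powr p \<partial>lebesgue))
           \<le> A * (p * t n * (\<integral>x. pdot p (gr u x + t n *\<^sub>R gr v x) (gr v x) \<partial>lebesgue))"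
          by (intro mult_left_mono A0 integral_powr_convex_ineq p2 VD(4) u v)
        moreover have "(\<integral>z. norm (dif u z + t n *\<^sub>R dif v z) powr p \<partial>\<mu>) - (\<integral>z. norm (dif u z) powr p \<partial>\<mu>)
           \<le> p * t n * (\<integral>z. pdot p (dif u z + t n *\<^sub>R dif v z) (dif v z) \<partial>\<mu>)"
          by (intro integral_powr_convex_ineq p2 VD(5) u v)
        ultimately show ?thesis
          unfolding E_linear[OF u v] scaleR_one unfolding E_def by (simp add: algebra_simps)
      qed
      then have "(E (\<lambda>x. 1 * u x + t n * v x) - E u) / p \<le> t n * ?R n" using p0 by (simp add: pos_divide_le_eq mult_ac)
      moreover have "(\<integral>x. F x (u x + t n * v x) \<partial>lebesgue) - (\<integral>x. F x (u x) \<partial>lebesgue) \<le> (E (\<lambda>x. 1 * u x + t n * v x) - E u) / p"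
        using min[OF tV] by (simp add: diff_divide_distrib)
      ultimately have "(\<integral>x. F x (u x + t n * v x) \<partial>lebesgue) - (\<integral>x. F x (u x) \<partial>lebesgue) \<le> t n * ?R n" by linarith
      then have "((\<integral>x. F x (u x + t n * v x) \<partial>lebesgue) - (\<integral>x. F x (u x) \<partial>lebesgue)) / t n \<le> ?R n"
        using t[of n] by (simp add: pos_divide_le_eq mult.commute)
      then show ?thesis using Fi[OF ti] Fi[OF ui] by simp
    qed
    then show "\<exists>N. \<forall>n\<ge>N. (\<integral>x. ?q n x \<partial>lebesgue) \<le> ?R n" by blast
  qed
  have "(\<integral>x. f x (u x) * (0 * u x + (-1) * v x) \<partial>lebesgue) \<le> D u (\<lambda>x. 0 * u x + (-1) * v x)"
    by (rule one[OF V_linear(1)[OF u v]])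
  then have "D u v \<le> (\<integral>x. f x (u x) * v x \<partial>lebesgue)"
    unfolding D_scale_right[OF u v] by simp
  with one[OF v] show ?thesis by simp
qed

section \<open>Bounds for solutions\<close>

text \<open>The hypothesis on \<open>dif\<close> says that truncation contracts differences. It
  holds for constant w, and vacuously when \<mu> is null, which are the two uses. Since w \<ge> 0,
  the set {u > w} lies in the bounded set \<Omega>, so the bound B makes W p-integrable over
  it.\<close>

lemma V_pos_part:
  assumes u: "u \<in> V" and d: "\<And>x. (w has_derivative (\<lambda>h. W x \<bullet> h)) (at x)" and B: "\<And>x. norm (W x) \<le> B"
    and Wb: "W \<in> borel_measurable borel" and wp: "\<And>x. 0 \<le> w x" and nl: "\<not> 0 < A \<Longrightarrow> W = (\<lambda>_. 0)"
    and dif: "AE z in \<mu>. \<bar>dif (\<lambda>x. max 0 (u x - w x)) z\<bar> \<le> \<bar>dif u z\<bar>"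
  shows "(\<lambda>x. max 0 (u x - w x)) \<in> V"
    and "AE x in lebesgue. gr (\<lambda>x. max 0 (u x - w x)) x = (if u x > w x then gr u x - W x else 0)"
proof -
  let ?v = "\<lambda>x. max 0 (u x - w x)" and ?G = "\<lambda>x. if u x > w x then gr u x - W x else 0"
  have p0: "p > 0" using p2 by simp
  have ui: "integrable lebesgue u" by (rule VD(1)[OF u])
  have um: "u \<in> borel_measurable lebesgue" using ui by auto
  have "continuous_on UNIV w" using d by (intro has_derivative_continuous_on[where f'="\<lambda>x h. W x \<bullet> h"]) auto
  then have wb: "w \<in> borel_measurable borel" by (rule borel_measurable_continuous_onI)
  have wm: "w \<in> borel_measurable lebesgue" and Wm: "W \<in> borel_measurable lebesgue"
    using wb Wb by (auto intro: measurable_completion)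
  have S: "{x. u x > w x} \<in> sets lebesgue" using borel_measurable_less[OF wm um] by simp
  have S\<Omega>: "x \<in> \<Omega>" if "u x > w x" for x using that VD(2)[OF u, of x] wp[of x] by fastforce
  have B0: "0 \<le> B" using B[of 0] norm_ge_zero order_trans by blast
  have vm: "?v \<in> borel_measurable lebesgue" using um wm by auto
  have vi: "integrable lebesgue ?v"
  proof (rule Bochner_Integration.integrable_bound[OF ui vm])
    show "AE x in lebesgue. norm (?v x) \<le> norm (u x)"
    proof (rule AE_I2)
      fix x show "norm (?v x) \<le> norm (u x)" using wp[of x] by (simp add: max_def)
    qed
  qed
  have v0: "?v x = 0" if "x \<notin> \<Omega>" for x using VD(2)[OF u that] wp[of x] by simp
  have Wi: "integrable lebesgue (\<lambda>x. if u x > w x then W x else 0)"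
  proof (rule Bochner_Integration.integrable_bound[OF indicator_\<Omega>(1)[of B]])
    show "(\<lambda>x. if u x > w x then W x else 0) \<in> borel_measurable lebesgue"
      using S by (intro measurable_If Wm) auto
    show "AE x in lebesgue. norm (if u x > w x then W x else 0) \<le> norm (B * indicator \<Omega> x)"
      using S\<Omega> B B0 by (intro AE_I2) auto
  qed
  have gm: "gr u \<in> borel_measurable lebesgue" and gp: "integrable lebesgue (\<lambda>x. norm (gr u x) powr p)"
    using VD(4)[OF u] by (auto simp: Lp_fun_def)
  have Gm: "?G \<in> borel_measurable lebesgue" using S gm Wm by (intro measurable_If borel_measurable_diff) auto
  have "integrable lebesgue (\<lambda>x. norm (?G x) powr p)"
  proof (rule Bochner_Integration.integrable_bound)
    show "integrable lebesgue (\<lambda>x. 2 powr p * (norm (gr u x) powr p + B powr p * indicator \<Omega> x))"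
      by (intro integrable_mult_right Bochner_Integration.integrable_add gp indicator_\<Omega>(1))
    show "(\<lambda>x. norm (?G x) powr p) \<in> borel_measurable lebesgue"
      by (rule powr_real_measurable[OF measurable_compose[OF Gm borel_measurable_norm]]) simp
    show "AE x in lebesgue. norm (norm (?G x) powr p) \<le> norm (2 powr p * (norm (gr u x) powr p + B powr p * indicator \<Omega> x))"
    proof (rule AE_I2)
      fix x
      show "norm (norm (?G x) powr p) \<le> norm (2 powr p * (norm (gr u x) powr p + B powr p * indicator \<Omega> x))"
      proof (cases "u x > w x")
        case True
        have "norm (gr u x + (- W x)) powr p \<le> 2 powr p * (norm (gr u x) powr p + norm (- W x) powr p)"
          using p2 by (intro norm_add_powr_le) auto
        also have "\<dots> \<le> 2 powr p * (norm (gr u x) powr p + B powr p)"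
          using B p0 by (intro mult_left_mono add_left_mono powr_mono2) auto
        finally show ?thesis using True S\<Omega>[OF True] by simp
      qed (use p0 in auto)
    qed
  qed
  then have GL: "Lp_fun p lebesgue ?G" using Gm by (simp add: Lp_fun_def)
  have dm: "dif ?v \<in> borel_measurable \<mu>" by (intro measurable_\<mu> dif_measurable vm)
  have dL: "Lp_fun p \<mu> (dif ?v)"
  proof -
    have "integrable \<mu> (\<lambda>z. norm (dif ?v z) powr p)"
    proof (rule Bochner_Integration.integrable_bound)
      show "integrable \<mu> (\<lambda>z. norm (dif u z) powr p)" using VD(5)[OF u] by (simp add: Lp_fun_def)
      show "(\<lambda>z. norm (dif ?v z) powr p) \<in> borel_measurable \<mu>"
        by (rule powr_real_measurable[OF measurable_compose[OF dm borel_measurable_norm]]) simp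
      show "AE z in \<mu>. norm (norm (dif ?v z) powr p) \<le> norm (norm (dif u z) powr p)"
        using dif by eventually_elim (use p0 in \<open>auto intro!: powr_mono2\<close>)
    qed
    then show ?thesis using dm by (simp add: Lp_fun_def)
  qed
  have G0: "?G = (\<lambda>_. 0)" if "\<not> 0 < A" by (auto simp: gr_nonlocal[OF that] nl[OF that])
  show "?v \<in> V" "AE x in lebesgue. gr ?v x = ?G x"
    using VI[OF vi v0 wgrad_pos_part(2)[OF VD(3)[OF u] d B Wb wp Wi] G0 GL dL] by auto
qed

text \<open>As |h| \<le> M, the hypothesis \<open>low\<close> gives c - M > 0 times the integral of
  v at most 0.\<close>

lemma truncation_vanishes:
  fixes v h :: "'a \<Rightarrow> real"
  assumes v: "integrable lebesgue v" "\<And>x. 0 \<le> v x" and h: "\<And>x. \<bar>h x\<bar> \<le> M"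
    and low: "c * (\<integral>x. v x \<partial>lebesgue) \<le> (\<integral>x. h x * v x \<partial>lebesgue)" and M: "M < c"
  shows "AE x in lebesgue. v x = 0"
proof -
  have "norm (\<integral>x. h x * v x \<partial>lebesgue) \<le> (\<integral>x. M * v x \<partial>lebesgue)"
    using v h by (intro norm_integral_le) (auto simp: abs_mult intro!: mult_right_mono)
  then have "(\<integral>x. h x * v x \<partial>lebesgue) \<le> M * (\<integral>x. v x \<partial>lebesgue)" by simp
  then have "(c - M) * (\<integral>x. v x \<partial>lebesgue) \<le> 0" using low by (simp add: left_diff_distrib)
  then have "(\<integral>x. v x \<partial>lebesgue) \<le> 0" using M by (simp add: mult_le_0_iff)
  then have "(\<integral>x. v x \<partial>lebesgue) = 0" using v by (intro antisym integral_nonneg_AE) auto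
  then show ?thesis using v by (subst (asm) integral_nonneg_eq_0_iff_AE) auto
qed

text \<open>Since v = (u - \<delta>)+ is a nondecreasing function of u, the gradient term and every
  pair of points contribute with nonnegative sign. A pair with its second point outside \<Omega>
  contributes u^(p - 1) v \<ge> \<delta>^(p - 1) v, and the exterior interaction turns this into a
  zero-order term.\<close>

lemma upper_bound_nonlocal:
  assumes \<kappa>: "\<kappa> > 0" "exterior_interaction \<kappa> \<Omega> \<mu>" and u: "u \<in> V" and \<delta>: "\<delta> > 0" and M: "M < \<kappa> * \<delta> powr (p - 1)"
    and h: "\<And>x. \<bar>h x\<bar> \<le> M" and eq: "\<And>v. v \<in> V \<Longrightarrow> D u v = (\<integral>x. h x * v x \<partial>lebesgue)"
  shows "AE x in lebesgue. u x \<le> \<delta>"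
proof -
  define v where "v x = max 0 (u x - \<delta>)" for x
  note pos = V_pos_part[OF u, where w="\<lambda>_. \<delta>" and W="\<lambda>_. 0" and B=0]
  have v: "v \<in> V"
    unfolding v_def[abs_def] by (rule pos(1)) (use \<delta> in \<open>auto simp: dif_def\<close>)
  have "AE x in lebesgue. gr v x = (if u x > \<delta> then gr u x - 0 else 0)"
    unfolding v_def[abs_def] by (rule pos(2)) (use \<delta> in \<open>auto simp: dif_def\<close>)
  then have grv: "AE x in lebesgue. gr v x = (if u x > \<delta> then gr u x else 0)"
    by (elim eventually_mono) simp
  have vi: "integrable lebesgue v" and vm: "v \<in> borel_measurable lebesgue" using VD(1)[OF v] by auto
  have v0: "0 \<le> v x" for x by (simp add: v_def)
  have "0 \<le> (\<integral>x. pdot p (gr u x) (gr v x) \<partial>lebesgue)"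
  proof (rule integral_nonneg_AE)
    show "AE x in lebesgue. 0 \<le> pdot p (gr u x) (gr v x)" using grv by eventually_elim (auto simp: pdot_def)
  qed
  then have 1: "(\<integral>z. pdot p (dif u z) (dif v z) \<partial>\<mu>) \<le> D u v" using A0 by (simp add: D_def)
  have pd: "0 \<le> pdot p (dif u z) (dif v z)" for z
  proof (rule pdot_real_nonneg)
    show "0 \<le> dif u z * dif v z"
      by (cases "u (fst z) \<le> u (snd z)") (auto simp: dif_def v_def max_def zero_le_mult_iff)
  qed
  have "ennreal \<kappa> * (\<integral>\<^sup>+x. ennreal (\<delta> powr (p - 1) * v x) \<partial>lebesgue) \<le> (\<integral>\<^sup>+z. ennreal (pdot p (dif u z) (dif v z)) \<partial>\<mu>)"
  proof (rule exterior_interactionD[OF \<kappa>(2)])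
    show "(\<lambda>x. \<delta> powr (p - 1) * v x) \<in> borel_measurable lebesgue" using vm by auto
    fix x y assume x: "x \<in> \<Omega>" and y: "y \<notin> \<Omega>"
    have "\<delta> powr (p - 1) * v x \<le> pdot p (u x) (v x)"
    proof (cases "u x > \<delta>")
      case True
      have "\<delta> powr (p - 1) \<le> u x powr (p - 1)" using True \<delta> p2 by (intro powr_mono2) auto
      also have "\<dots> = \<bar>u x\<bar> powr (p - 2) * u x" using norm_powr_minus_two_mult[OF p2, of "u x"] True \<delta> by simp
      finally have "\<delta> powr (p - 1) * v x \<le> (\<bar>u x\<bar> powr (p - 2) * u x) * v x" by (rule mult_right_mono) (rule v0)
      then show ?thesis by (simp add: pdot_def mult.assoc)
    qed (auto simp: v_def pdot_def)
    then show "ennreal (\<delta> powr (p - 1) * v x) \<le> ennreal (pdot p (dif u (x, y)) (dif v (x, y)))"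
      using VD(2)[OF u y] VD(2)[OF v y] by (intro ennreal_leI) (simp add: dif_def)
  qed (use v0 VD(2)[OF v] in auto)
  also have "\<dots> = ennreal (\<integral>z. pdot p (dif u z) (dif v z) \<partial>\<mu>)"
    using pd by (intro nn_integral_eq_integral integrable_pdot p2 VD(5) u v) auto
  also have "(\<integral>\<^sup>+x. ennreal (\<delta> powr (p - 1) * v x) \<partial>lebesgue) = ennreal (\<delta> powr (p - 1) * (\<integral>x. v x \<partial>lebesgue))"
    using vi v0 by (subst nn_integral_eq_integral) auto
  finally have "\<kappa> * (\<delta> powr (p - 1) * (\<integral>x. v x \<partial>lebesgue)) \<le> (\<integral>z. pdot p (dif u z) (dif v z) \<partial>\<mu>)"
    using \<kappa>(1) pd by (simp add: ennreal_mult'[symmetric] integral_nonneg_AE)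
  then have "(\<kappa> * \<delta> powr (p - 1)) * (\<integral>x. v x \<partial>lebesgue) \<le> (\<integral>x. h x * v x \<partial>lebesgue)"
    using 1 eq[OF v] by (simp add: mult.assoc)
  from truncation_vanishes[OF vi v0 h this M] show ?thesis
    by eventually_elim (auto simp: v_def max_def split: if_splits)
qed

text \<open>Without a nonlocal part, compare with the concave barrier \<open>w = m (\<pi> / 2 + arctan (x \<bullet> e + R + 1))\<close>, for which
  the \<open>p\<close>-Laplacian is explicit because \<open>w\<close> depends on one coordinate only.\<close>

lemma upper_bound_local:
  assumes A: "0 < A" and \<mu>0: "AE z in \<mu>. False"
  shows "\<exists>\<kappa>>0. \<forall>u\<in>V. \<forall>\<delta>>0. \<forall>M h. M < \<kappa> * \<delta> powr (p - 1) \<longrightarrow> (\<forall>x. \<bar>h x\<bar> \<le> M) \<longrightarrow>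
     (\<forall>v\<in>V. D u v = (\<integral>x. h x * v x \<partial>lebesgue)) \<longrightarrow> (AE x in lebesgue. u x \<le> \<delta>)"
proof -
  obtain R where R: "R > 0" "\<And>x. x \<in> \<Omega> \<Longrightarrow> norm x < R" using bounded_\<Omega> bounded_pos_less by metis
  obtain e :: 'a where e: "norm e = 1" using norm_Basis nonempty_Basis by blast
  have ee: "e \<bullet> e = 1" using e by (simp add: norm_eq_1)
  have p0: "p > 0" "p > 1" using p2 by auto
  \<comment> \<open>A lower bound on \<Omega> for 2 (p - 1) T (1 + T^2)^(- p), which is - z / m^(p -
    1) below, by 1 \<le> T \<le> 2 R + 1.\<close>
  define \<kappa>' where "\<kappa>' = 2 * (p - 1) * (1 + (2 * R + 1)\<^sup>2) powr (- p)"
  have s0: "1 + (s::real)\<^sup>2 > 0" for s by (simp add: add_pos_nonneg)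
  have \<kappa>': "\<kappa>' > 0" using p0 s0[of "2 * R + 1"] by (simp add: \<kappa>'_def)
  define \<kappa> where "\<kappa> = A * \<kappa>' / pi powr (p - 1)"
  have \<kappa>: "\<kappa> > 0" using A \<kappa>' by (simp add: \<kappa>_def)
  \<comment> \<open>The shift by R + 1 makes T at least 1 on \<Omega>, where the flux of the barrier
    decreases at a definite rate.\<close>
  define T where "T x = x \<bullet> e + R + 1" for x
  have dT: "(T has_derivative (\<lambda>h. e \<bullet> h)) (at x)" for x
    unfolding T_def by (auto intro!: derivative_eq_intros simp: inner_commute)
  have Tb[measurable]: "T \<in> borel_measurable borel" unfolding T_def by measurable
  have T\<Omega>: "1 \<le> T x" "T x \<le> 2 * R + 1" if "x \<in> \<Omega>" for x
  proof -
    have "\<bar>x \<bullet> e\<bar> \<le> norm x" using Cauchy_Schwarz_ineq2[of x e] e by simp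
    then show "1 \<le> T x" "T x \<le> 2 * R + 1" using R(2)[OF that] by (auto simp: T_def)
  qed
  have bound: "AE x in lebesgue. u x \<le> \<delta>"
    if u: "u \<in> V" and \<delta>: "\<delta> > 0" and M: "M < \<kappa> * \<delta> powr (p - 1)" and h: "\<And>x. \<bar>h x\<bar> \<le> M"
      and eq: "\<And>v. v \<in> V \<Longrightarrow> D u v = (\<integral>x. h x * v x \<partial>lebesgue)" for u \<delta> M h
  proof -
    \<comment> \<open>With this m the barrier stays below m \<pi> = \<delta>.\<close>
    define m where "m = \<delta> / pi"
    have m: "m > 0" using \<delta> by (simp add: m_def)
    have M': "M < A * (m powr (p - 1) * \<kappa>')"
    proof -
      have "\<kappa> * \<delta> powr (p - 1) = A * (m powr (p - 1) * \<kappa>')"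
        using \<delta> by (simp add: \<kappa>_def m_def powr_divide)
      then show ?thesis using M by simp
    qed
    define w where "w x = m * (pi / 2 + arctan (T x))" for x
    define W where "W x = (m / (1 + (T x)\<^sup>2)) *\<^sub>R e" for x
    \<comment> \<open>\<zeta> = (m / (1 + T^2))^(p - 1) is the component along e of the flux |W|^(p
      - 2) W, and z is its derivative along e, so that - z is the negative p-Laplacian of w.\<close>
    define \<zeta> where "\<zeta> x = m powr (p - 1) * (1 + (T x)\<^sup>2) powr (1 - p)" for x
    define z where "z x = m powr (p - 1) * ((1 - p) * (1 + (T x)\<^sup>2) powr (- p) * (2 * T x))" for x
    have dw: "(w has_derivative (\<lambda>h. W x \<bullet> h)) (at x)" for x
    proof -
      have "((\<lambda>t. m * (pi / 2 + arctan t)) has_real_derivative m / (1 + (T x)\<^sup>2)) (at (T x))"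
      proof -
        have "((\<lambda>t. m * (pi / 2 + arctan t)) has_real_derivative m * (0 + inverse (1 + (T x)\<^sup>2))) (at (T x))"
          by (intro DERIV_cmult DERIV_add DERIV_const DERIV_arctan)
        then show ?thesis by (simp only: add_0 divide_inverse)
      qed
      then have "((\<lambda>t. m * (pi / 2 + arctan t)) has_derivative (*) (m / (1 + (T x)\<^sup>2))) (at (T x))"
        by (simp add: has_field_derivative_def)
      from has_derivative_compose[OF dT this] show ?thesis
        unfolding w_def W_def inner_scaleR_left .
    qed
    have d\<zeta>: "(\<zeta> has_derivative (\<lambda>h. (z x *\<^sub>R e) \<bullet> h)) (at x)" for x
    proof -
      have pos: "0 < 1 + (T x)\<^sup>2" by (rule s0)
      have "((\<lambda>t. m powr (p - 1) * (1 + t\<^sup>2) powr (1 - p)) has_real_derivative m powr (p - 1) * ((1 - p) * (1 + (T x)\<^sup>2) powr (1 - p - 1) * (2 * T x))) (at (T x))"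
        using pos by (intro DERIV_cmult DERIV_fun_powr) (auto intro!: derivative_eq_intros)
      moreover have "1 - p - 1 = - p" by simp
      ultimately have "((\<lambda>t. m powr (p - 1) * (1 + t\<^sup>2) powr (1 - p)) has_derivative (\<lambda>k. z x * k)) (at (T x))"
        by (simp add: has_field_derivative_def z_def)
      from has_derivative_compose[OF dT this] show ?thesis
        unfolding \<zeta>_def inner_scaleR_left .
    qed
    have q1: "m / (1 + (T x)\<^sup>2) > 0" for x using m s0[of "T x"] by simp
    have Wn: "norm (W x) = m / (1 + (T x)\<^sup>2)" for x using q1[of x] m e by (simp add: W_def)
    have Wm: "norm (W x) \<le> m" for x unfolding Wn using m s0[of "T x"] by (simp add: pos_divide_le_eq field_simps)
    have Wb: "W \<in> borel_measurable borel" unfolding W_def by measurable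
    have wp: "0 \<le> w x" for x using m arctan_lbound[of "T x"] by (simp add: w_def)
    have zb: "norm (z x *\<^sub>R e) \<le> m powr (p - 1) * (p - 1)" for x
    proof -
      have pos: "0 < 1 + (T x)\<^sup>2" by (rule s0)
      have "2 * \<bar>T x\<bar> \<le> 1 + (T x)\<^sup>2" using zero_le_power2[of "\<bar>T x\<bar> - 1"] by (simp add: power2_diff)
      moreover have "(1 + (T x)\<^sup>2) powr (- p) \<le> (1 + (T x)\<^sup>2) powr (- 1)" using p0 by (intro powr_mono) auto
      ultimately have "(1 + (T x)\<^sup>2) powr (- p) * (2 * \<bar>T x\<bar>) \<le> (1 + (T x)\<^sup>2) powr (- 1) * (1 + (T x)\<^sup>2)"
        by (intro mult_mono) auto
      also have "\<dots> = 1" using pos by (simp add: powr_minus_divide)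
      finally have "(p - 1) * ((1 + (T x)\<^sup>2) powr (- p) * (2 * \<bar>T x\<bar>)) \<le> (p - 1) * 1" using p0 by (intro mult_left_mono) auto
      then have "m powr (p - 1) * ((p - 1) * ((1 + (T x)\<^sup>2) powr (- p) * (2 * \<bar>T x\<bar>))) \<le> m powr (p - 1) * (p - 1)"
        by (intro mult_left_mono) auto
      then show ?thesis using e p0 by (simp add: z_def abs_mult mult_ac)
    qed
    have zB: "(\<lambda>x. z x *\<^sub>R e) \<in> borel_measurable borel" unfolding z_def by measurable
    have \<zeta>b: "\<bar>\<zeta> x\<bar> \<le> m powr (p - 1) * 1" for x
    proof -
      have "(1 + (T x)\<^sup>2) powr (1 - p) \<le> (1 + (T x)\<^sup>2) powr 0" using p0 by (intro powr_mono) auto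
      also have "\<dots> = 1" using s0[of "T x"] by simp
      finally show ?thesis unfolding \<zeta>_def abs_mult by (intro mult_mono) auto
    qed
    define v where "v x = max 0 (u x - w x)" for x
    \<comment> \<open>For a nonconstant w the truncation may enlarge differences; the condition
      holds because \<mu> is null.\<close>
    have difv: "AE z in \<mu>. \<bar>dif (\<lambda>x. max 0 (u x - w x)) z\<bar> \<le> \<bar>dif u z\<bar>" using \<mu>0 by eventually_elim simp
    have v: "v \<in> V" and grv: "AE x in lebesgue. gr v x = (if u x > w x then gr u x - W x else 0)"
      using V_pos_part[OF u dw Wm Wb wp _ difv] A by (simp_all add: v_def[abs_def])
    have vi: "integrable lebesgue v" by (rule VD(1)[OF v])
    have v0: "0 \<le> v x" for x by (simp add: v_def)
    have \<zeta>W: "pdot p (W x) g = (g \<bullet> e) * \<zeta> x" for x g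
    proof -
      have "norm (W x) powr (p - 2) * (m / (1 + (T x)\<^sup>2)) = (m / (1 + (T x)\<^sup>2)) powr (p - 1)"
        using norm_powr_minus_two_mult[OF p2, of "W x"] by (simp add: Wn)
      also have "\<dots> = \<zeta> x"
        using m s0[of "T x"] powr_minus_divide[of "1 + (T x)\<^sup>2" "p - 1"] by (simp add: \<zeta>_def powr_divide)
      finally have "norm (W x) powr (p - 2) * (m / (1 + (T x)\<^sup>2)) * (g \<bullet> e) = \<zeta> x * (g \<bullet> e)" by simp
      moreover have "W x \<bullet> g = m / (1 + (T x)\<^sup>2) * (g \<bullet> e)" by (simp add: W_def inner_commute)
      ultimately show ?thesis unfolding pdot_def by (simp only: mult.assoc mult.commute[of "\<zeta> x"])
    qed
    \<comment> \<open>Monotonicity replaces the unknown flux of u by the explicit one of the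
      barrier.\<close>
    have pw: "AE x in lebesgue. (gr v x \<bullet> e) * \<zeta> x \<le> pdot p (gr u x) (gr v x)"
      using grv
    proof eventually_elim
      case (elim x)
      show ?case
      proof (cases "u x > w x")
        case True
        then have g: "gr v x = gr u x - W x" using elim by simp
        show ?thesis unfolding \<zeta>W[symmetric] g by (rule pdot_monotone[OF p2])
      next
        case False
        then have "gr v x = 0" using elim by simp
        then show ?thesis by (simp add: pdot_def)
      qed
    qed
    have \<zeta>m: "\<zeta> \<in> borel_measurable lebesgue"
    proof -
      have "\<zeta> \<in> borel_measurable borel" unfolding \<zeta>_def by measurable
      then show ?thesis by (intro measurable_completion) simp
    qed
    have gvi: "integrable lebesgue (\<lambda>x. (gr v x \<bullet> e) * \<zeta> x)"
      by (rule integrable_mult_bounded'[OF integrable_inner_left[OF integrable_gr[OF v]] \<zeta>m \<zeta>b])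
    have zvi: "integrable lebesgue (\<lambda>x. v x * (z x *\<^sub>R e \<bullet> e))"
    proof (rule integrable_mult_bounded'[OF vi])
      show "(\<lambda>x. z x *\<^sub>R e \<bullet> e) \<in> borel_measurable lebesgue"
        using zB by (intro borel_measurable_inner measurable_completion) auto
      show "\<bar>z x *\<^sub>R e \<bullet> e\<bar> \<le> m powr (p - 1) * (p - 1)" for x using zb[of x] e ee by simp
    qed
    have "(m powr (p - 1) * \<kappa>') * (\<integral>x. v x \<partial>lebesgue) = (\<integral>x. (m powr (p - 1) * \<kappa>') * v x \<partial>lebesgue)" by simp
    also have "\<dots> \<le> (\<integral>x. - (v x * (z x *\<^sub>R e \<bullet> e)) \<partial>lebesgue)"
    proof (rule integral_mono)
      show "m powr (p - 1) * \<kappa>' * v x \<le> - (v x * (z x *\<^sub>R e \<bullet> e))" for x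
      proof (cases "x \<in> \<Omega>")
        case True
        have "(1 + (2 * R + 1)\<^sup>2) powr (- p) \<le> (1 + (T x)\<^sup>2) powr (- p)"
          using T\<Omega>[OF True] p0 s0[of "T x"] by (intro powr_mono2') (auto intro!: power_mono)
        then have "(1 + (2 * R + 1)\<^sup>2) powr (- p) * 1 \<le> (1 + (T x)\<^sup>2) powr (- p) * T x"
          using T\<Omega>[OF True] by (intro mult_mono) auto
        then have "\<kappa>' \<le> 2 * (p - 1) * ((1 + (T x)\<^sup>2) powr (- p) * T x)"
          unfolding \<kappa>'_def using p0 by (intro mult_left_mono) auto
        then have "m powr (p - 1) * \<kappa>' \<le> m powr (p - 1) * (2 * (p - 1) * ((1 + (T x)\<^sup>2) powr (- p) * T x))"
          by (rule mult_left_mono) simp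
        also have "\<dots> = - z x" by (simp add: z_def algebra_simps)
        finally have "m powr (p - 1) * \<kappa>' * v x \<le> - z x * v x" by (rule mult_right_mono) (rule v0)
        then show ?thesis using ee by (simp add: mult.commute)
      qed (use VD(2)[OF v] in simp)
    qed (use vi zvi in auto)
    also have "\<dots> = (\<integral>x. (gr v x \<bullet> e) * \<zeta> x \<partial>lebesgue)"
      using wgrad_integration_by_parts[OF VD(3)[OF v A] d\<zeta> zb zB \<zeta>b, of e] by simp
    also have "\<dots> \<le> (\<integral>x. pdot p (gr u x) (gr v x) \<partial>lebesgue)"
      by (intro integral_mono_AE gvi integrable_pdot p2 VD(4) u v pw)
    finally have "A * ((m powr (p - 1) * \<kappa>') * (\<integral>x. v x \<partial>lebesgue)) \<le> A * (\<integral>x. pdot p (gr u x) (gr v x) \<partial>lebesgue)"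
      using A by (intro mult_left_mono) auto
    moreover have "(\<integral>z. pdot p (dif u z) (dif v z) \<partial>\<mu>) = 0"
      using \<mu>0 by (intro integral_eq_zero_AE) auto
    ultimately have "(A * (m powr (p - 1) * \<kappa>')) * (\<integral>x. v x \<partial>lebesgue) \<le> (\<integral>x. h x * v x \<partial>lebesgue)"
      using eq[OF v] by (simp add: D_def mult.assoc)
    from truncation_vanishes[OF vi v0 h this M'] show ?thesis
    proof eventually_elim
      case (elim x)
      have "m * (pi / 2 + arctan (T x)) \<le> m * pi" using m arctan_ubound[of "T x"] by (intro mult_left_mono) auto
      then have "w x \<le> \<delta>" by (simp add: w_def m_def)
      then show ?case using elim by (simp add: v_def max_def split: if_splits)
    qed
  qed
  then show ?thesis using \<kappa> by blast
qed

text \<open>What matters is that \<kappa> is fixed before u, \<delta>, M and h, so that \<delta> and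
  \<lambda> can be adjusted to it later. The bound from below is the one from above for - u, which
  solves the equation with - h.\<close>

lemma sup_bound:
  assumes "(\<exists>\<sigma>>0. \<exists>c>0. fractional_below \<sigma> c \<mu>) \<or> (0 < A \<and> (AE z in \<mu>. False))"
  shows "\<exists>\<kappa>>0. \<forall>u\<in>V. \<forall>\<delta>>0. \<forall>M h. M < \<kappa> * \<delta> powr (p - 1) \<longrightarrow> (\<forall>x. \<bar>h x\<bar> \<le> M) \<longrightarrow>
     (\<forall>v\<in>V. D u v = (\<integral>x. h x * v x \<partial>lebesgue)) \<longrightarrow> (AE x in lebesgue. \<bar>u x\<bar> \<le> \<delta>)"
proof -
  define up where "up \<kappa> \<longleftrightarrow> (\<forall>u\<in>V. \<forall>\<delta>>0. \<forall>M h. M < \<kappa> * \<delta> powr (p - 1) \<longrightarrow> (\<forall>x. \<bar>h x\<bar> \<le> M) \<longrightarrow>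
     (\<forall>v\<in>V. D u v = (\<integral>x. h x * v x \<partial>lebesgue)) \<longrightarrow> (AE x in lebesgue. u x \<le> \<delta>))" for \<kappa>
  have "\<exists>\<kappa>>0. up \<kappa>"
    using assms
  proof (elim disjE)
    assume "\<exists>\<sigma>>0. \<exists>c>0. fractional_below \<sigma> c \<mu>"
    then obtain \<sigma> c where f: "fractional_below \<sigma> c \<mu>" "\<sigma> > 0" "c > 0" by blast
    obtain \<kappa> where \<kappa>: "\<kappa> > 0" "exterior_interaction \<kappa> \<Omega> \<mu>"
      using fractional_exterior_interaction[OF f bounded_\<Omega>] by blast
    have "up \<kappa>"
      unfolding up_def
    proof (intro ballI allI impI)
      fix u \<delta> M h
      assume "u \<in> V" "(0::real) < \<delta>" "M < \<kappa> * \<delta> powr (p - 1)" "\<forall>x. \<bar>h x\<bar> \<le> M"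
        "\<forall>v\<in>V. D u v = (\<integral>x. h x * v x \<partial>lebesgue)"
      then show "AE x in lebesgue. u x \<le> \<delta>"
        by (intro upper_bound_nonlocal[OF \<kappa>, of u \<delta> M h]) auto
    qed
    then show ?thesis using \<kappa>(1) by blast
  next
    assume "0 < A \<and> (AE z in \<mu>. False)"
    then show ?thesis unfolding up_def by (intro upper_bound_local) auto
  qed
  then obtain \<kappa> where \<kappa>: "\<kappa> > 0" and up: "up \<kappa>" by blast
  have up': "AE x in lebesgue. u x \<le> \<delta>"
    if "u \<in> V" "\<delta> > 0" "M < \<kappa> * \<delta> powr (p - 1)" "\<And>x. \<bar>h x\<bar> \<le> M"
      "\<And>v. v \<in> V \<Longrightarrow> D u v = (\<integral>x. h x * v x \<partial>lebesgue)" for u \<delta> M h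
    by (rule up[unfolded up_def, rule_format, OF that])
  have "AE x in lebesgue. \<bar>u x\<bar> \<le> \<delta>"
    if u: "u \<in> V" and \<delta>: "\<delta> > 0" and M: "M < \<kappa> * \<delta> powr (p - 1)" and h: "\<forall>x. \<bar>h x\<bar> \<le> M"
      and eq: "\<forall>v\<in>V. D u v = (\<integral>x. h x * v x \<partial>lebesgue)" for u \<delta> M h
  proof -
    let ?n = "\<lambda>x. 0 * u x + (-1) * u x"
    have n: "?n \<in> V" by (rule V_linear(1)[OF u u])
    have "AE x in lebesgue. ?n x \<le> \<delta>"
    proof (rule up'[OF n \<delta> M, where h="\<lambda>x. - h x"])
      show "\<bar>- h x\<bar> \<le> M" for x using h by simp
      show "D ?n v = (\<integral>x. - h x * v x \<partial>lebesgue)" if "v \<in> V" for v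
        using D_minus_left[OF u that] eq that by simp
    qed
    moreover have "AE x in lebesgue. u x \<le> \<delta>"
      by (rule up'[OF u \<delta> M, where h=h]) (use h eq in auto)
    ultimately show ?thesis by eventually_elim auto
  qed
  then show ?thesis using \<kappa> by blast
qed

end

section \<open>The truncated nonlinearity\<close>

text \<open>Round w down to the grid of mesh 1 / (n + 1): the composite is then glued from countably
  many measurable slices, and continuity in the second variable gives the limit.\<close>

lemma caratheodory_measurable_comp:
  fixes f :: "'m \<Rightarrow> real \<Rightarrow> real"
  assumes m: "\<And>t. (\<lambda>x. f x t) \<in> borel_measurable M" and c: "\<And>x. continuous_on UNIV (f x)"
    and [measurable]: "w \<in> borel_measurable M"
  shows "(\<lambda>x. f x (w x)) \<in> borel_measurable M"
proof (rule borel_measurable_LIMSEQ_real)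
  let ?w = "\<lambda>n x. real_of_int \<lfloor>real (Suc n) * w x\<rfloor> / real (Suc n)"
  show "(\<lambda>x. f x (?w n x)) \<in> borel_measurable M" for n
    by (rule measurable_compose_countable[where f="\<lambda>i x. f x (real_of_int i / real (Suc n))" and g="\<lambda>x. \<lfloor>real (Suc n) * w x\<rfloor>"])
      (rule m, measurable)
  show "(\<lambda>n. f x (?w n x)) \<longlonglongrightarrow> f x (w x)" for x
  proof (rule continuous_on_tendsto_compose[OF c])
    have b: "\<bar>?w n x - w x\<bar> \<le> 1 / real (Suc n)" for n
    proof -
      have "\<bar>real_of_int \<lfloor>real (Suc n) * w x\<rfloor> - real (Suc n) * w x\<bar> \<le> 1" by linarith
      then have "\<bar>real_of_int \<lfloor>real (Suc n) * w x\<rfloor> - real (Suc n) * w x\<bar> / real (Suc n) \<le> 1 / real (Suc n)"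
        by (intro divide_right_mono) auto
      moreover have "?w n x - w x = (real_of_int \<lfloor>real (Suc n) * w x\<rfloor> - real (Suc n) * w x) / real (Suc n)"
        by (simp add: diff_divide_distrib del: of_nat_Suc)
      ultimately show ?thesis by (simp only: abs_divide abs_of_nat)
    qed
    have "(\<lambda>n. 1 / real (Suc n)) \<longlonglongrightarrow> 0" by (rule lim_1_over_n[THEN LIMSEQ_Suc])
    then have "(\<lambda>n. ?w n x - w x) \<longlonglongrightarrow> 0"
      by (rule Lim_null_comparison[rotated]) (use b in auto)
    then show "(\<lambda>n. ?w n x) \<longlonglongrightarrow> w x" by (rule LIM_zero_cancel)
  qed auto
qed

lemma caratheodory_primitive:
  fixes f :: "'a::euclidean_space \<Rightarrow> real \<Rightarrow> real"
  assumes m: "\<And>t. (\<lambda>x. f x t) \<in> borel_measurable lebesgue" and c: "\<And>x. continuous_on UNIV (f x)"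
    and b: "\<And>x t. \<bar>f x t\<bar> \<le> M"
  shows "\<exists>F. (\<forall>x. F x 0 = 0) \<and> (\<forall>x s t. \<bar>F x s - F x t\<bar> \<le> M * \<bar>s - t\<bar>) \<and>
    (\<forall>x t. (F x has_real_derivative f x t) (at t)) \<and>
    (\<forall>w\<in>borel_measurable lebesgue. (\<lambda>x. F x (w x)) \<in> borel_measurable lebesgue)"
proof -
  define F where "F x t = (LBINT \<tau>=ereal 0..ereal t. f x \<tau>)" for x t
  have d: "(F x has_real_derivative f x t) (at t)" for x t
  proof -
    \<comment> \<open>The interval contains 0 and has t in its interior, so the derivative within it
      is the two-sided one.\<close>
    let ?a = "- \<bar>t\<bar> - 1" and ?b = "\<bar>t\<bar> + 1"
    have "((\<lambda>u. LBINT y=ereal 0..ereal u. f x y) has_vector_derivative f x t) (at t within {?a..?b})"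
      by (rule interval_integral_FTC2) (auto intro: continuous_on_subset[OF c])
    moreover have "at t within {?a..?b} = at t" by (rule at_within_interior) auto
    ultimately show ?thesis by (simp add: F_def[abs_def] has_real_derivative_iff_has_vector_derivative)
  qed
  have L: "\<bar>F x s - F x t\<bar> \<le> M * \<bar>s - t\<bar>" for x s t
    using field_differentiable_bound[of UNIV "F x" "f x" M s t] d b by simp
  have Fc: "continuous_on UNIV (F x)" for x
    using d DERIV_isCont by (intro continuous_at_imp_continuous_on) blast
  have Fm: "(\<lambda>x. F x t) \<in> borel_measurable lebesgue" for t
  proof -
    \<comment> \<open>Joint measurability is the composition lemma on the product space, with the
      second coordinate in the role of w.\<close>
    have "(\<lambda>z. f (fst z) (snd z)) \<in> borel_measurable (lebesgue \<Otimes>\<^sub>M lborel)"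
      by (rule caratheodory_measurable_comp[where f="\<lambda>z. f (fst z)"])
        (auto intro: measurable_compose[OF measurable_fst m] c)
    then have [measurable]: "(\<lambda>(x, \<tau>). f x \<tau>) \<in> borel_measurable (lebesgue \<Otimes>\<^sub>M lborel)"
      by (simp add: case_prod_beta')
    have "(\<lambda>x. \<integral>\<tau>. indicator (einterval a b) \<tau> *\<^sub>R f x \<tau> \<partial>lborel) \<in> borel_measurable lebesgue" for a b
    proof (rule lborel.borel_measurable_lebesgue_integral)
      show "(\<lambda>(x, \<tau>). indicator (einterval a b) \<tau> *\<^sub>R f x \<tau>) \<in> borel_measurable (lebesgue \<Otimes>\<^sub>M lborel)"
        unfolding case_prod_beta'
        by (intro borel_measurable_scaleR measurable_compose[OF measurable_snd] borel_measurable_indicator)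
          (use \<open>(\<lambda>z. f (fst z) (snd z)) \<in> _\<close> in auto)
    qed
    then show ?thesis
      unfolding F_def interval_lebesgue_integral_def set_lebesgue_integral_def by simp
  qed
  have "(\<lambda>x. F x (w x)) \<in> borel_measurable lebesgue" if "w \<in> borel_measurable lebesgue" for w
    by (rule caratheodory_measurable_comp[OF Fm Fc that])
  moreover have "F x 0 = 0" for x by (simp add: F_def)
  ultimately show ?thesis using d L by (intro exI[of _ F]) auto
qed

lemma continuous_signed_pow: "2 < r \<Longrightarrow> continuous_on UNIV (signed_pow r)"
  unfolding signed_pow_def[abs_def] by (intro continuous_intros continuous_on_powr') auto

lemma abs_signed_pow_le:
  assumes "2 < r" "\<bar>t\<bar> \<le> \<delta>"
  shows "\<bar>signed_pow r t\<bar> \<le> \<delta> powr (r - 1)"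
proof -
  have "\<bar>signed_pow r t\<bar> \<le> \<delta> powr (r - 2) * \<delta>"
    unfolding signed_pow_def abs_mult using assms by (intro mult_mono) (auto intro!: powr_mono2)
  also have "\<dots> = \<delta> powr (r - 1)"
    using powr_mult_base[of \<delta> "r - 2"] assms by (simp add: mult.commute)
  finally show ?thesis .
qed

text \<open>f is set to 0 off \<Omega> and on the null set where the bound on g fails, so that its
  own bound holds at every point, as the minimisation demands. As \<delta> \<le> 1, a bound K for g
  on [-1, 1] is all that the growth of g has to supply.\<close>

lemma truncated_nonlinearity:
  fixes g :: "'a::euclidean_space \<Rightarrow> real \<Rightarrow> real"
  assumes \<Omega>: "open \<Omega>" and g: "caratheodory \<Omega> g" and K: "AE x in lebesgue_on \<Omega>. \<forall>t. \<bar>t\<bar> \<le> 1 \<longrightarrow> \<bar>g x t\<bar> \<le> K"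
    and \<delta>: "0 < \<delta>" "\<delta> \<le> 1" and r: "2 < r" and lam: "0 \<le> lam" and gam: "0 \<le> gam" and K0: "0 \<le> K"
  shows "\<exists>f. (\<forall>t. (\<lambda>x. f x t) \<in> borel_measurable lebesgue) \<and> (\<forall>x. continuous_on UNIV (f x)) \<and>
    (\<forall>x t. \<bar>f x t\<bar> \<le> lam * K + gam * \<delta> powr (r - 1)) \<and>
    (AE x in lebesgue. x \<in> \<Omega> \<longrightarrow> (\<forall>t. \<bar>t\<bar> \<le> \<delta> \<longrightarrow> f x t = lam * g x t + gam * signed_pow r t))"
proof -
  have \<Omega>m: "\<Omega> \<in> sets lebesgue" using \<Omega> by auto
  have "AE x in lebesgue. x \<in> \<Omega> \<longrightarrow> (\<forall>t. \<bar>t\<bar> \<le> 1 \<longrightarrow> \<bar>g x t\<bar> \<le> K)"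
    using K \<Omega>m by (simp add: AE_restrict_space_iff)
  then obtain N where N: "N \<in> null_sets lebesgue" "\<And>x t. x \<in> \<Omega> \<Longrightarrow> x \<notin> N \<Longrightarrow> \<bar>t\<bar> \<le> 1 \<Longrightarrow> \<bar>g x t\<bar> \<le> K"
    by (rule AE_E3) auto
  define cl where "cl t = max (- \<delta>) (min \<delta> t)" for t :: real
  have cl: "\<bar>cl t\<bar> \<le> \<delta>" for t using \<delta> by (auto simp: cl_def)
  define f where "f x t = (if x \<in> \<Omega> - N then lam * g x (cl t) + gam * signed_pow r (cl t) else 0)" for x t
  have "(\<lambda>x. f x t) \<in> borel_measurable lebesgue" for t
  proof -
    have "(\<lambda>x. if x \<in> \<Omega> then g x (cl t) else 0) \<in> borel_measurable lebesgue"
      using g \<Omega>m by (simp add: caratheodory_def borel_measurable_if)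
    then have "(\<lambda>x. indicator (\<Omega> - N) x * (lam * (if x \<in> \<Omega> then g x (cl t) else 0) + gam * signed_pow r (cl t))) \<in> borel_measurable lebesgue"
      using \<Omega>m N(1) by (intro borel_measurable_times borel_measurable_add borel_measurable_const borel_measurable_indicator) auto
    also have "(\<lambda>x. indicator (\<Omega> - N) x * (lam * (if x \<in> \<Omega> then g x (cl t) else 0) + gam * signed_pow r (cl t))) = (\<lambda>x. f x t)"
      by (auto simp: f_def)
    finally show ?thesis .
  qed
  moreover have "continuous_on UNIV (f x)" for x
  proof (cases "x \<in> \<Omega> - N")
    case True
    have clc: "continuous_on UNIV cl" unfolding cl_def[abs_def] by (intro continuous_intros)
    have "continuous_on UNIV (\<lambda>t. g x (cl t))"
      by (rule continuous_on_compose2[OF _ clc]) (use g True in \<open>auto simp: caratheodory_def\<close>)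
    moreover have "continuous_on UNIV (\<lambda>t. signed_pow r (cl t))"
      by (rule continuous_on_compose2[OF continuous_signed_pow[OF r] clc]) simp
    ultimately show ?thesis using True unfolding f_def[abs_def] by (simp add: continuous_on_add continuous_on_mult_left)
  next
    case False
    then have "f x = (\<lambda>_. 0)" by (auto simp: f_def)
    then show ?thesis by simp
  qed
  moreover have "\<bar>f x t\<bar> \<le> lam * K + gam * \<delta> powr (r - 1)" for x t
  proof (cases "x \<in> \<Omega> - N")
    case True
    have "\<bar>g x (cl t)\<bar> \<le> K" using N(2)[of x "cl t"] True cl[of t] \<delta> by auto
    then have "lam * \<bar>g x (cl t)\<bar> + gam * \<bar>signed_pow r (cl t)\<bar> \<le> lam * K + gam * \<delta> powr (r - 1)"
      using abs_signed_pow_le[OF r cl] lam gam by (intro add_mono mult_left_mono) auto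
    moreover have "\<bar>f x t\<bar> \<le> lam * \<bar>g x (cl t)\<bar> + gam * \<bar>signed_pow r (cl t)\<bar>"
      using True lam gam abs_triangle_ineq[of "lam * g x (cl t)" "gam * signed_pow r (cl t)"] by (simp add: f_def abs_mult)
    ultimately show ?thesis by linarith
  next
    case False
    then have "f x t = 0" by (auto simp: f_def)
    then show ?thesis using lam gam K0 by simp
  qed
  moreover have "AE x in lebesgue. x \<in> \<Omega> \<longrightarrow> (\<forall>t. \<bar>t\<bar> \<le> \<delta> \<longrightarrow> f x t = lam * g x t + gam * signed_pow r t)"
    using AE_not_in[OF N(1)] by eventually_elim (auto simp: f_def cl_def)
  ultimately show ?thesis by blast
qed

section \<open>Superposition of fractional kernels\<close>

definition fractional_weight :: "real \<Rightarrow> real \<Rightarrow> 'a::euclidean_space \<times> 'a \<Rightarrow> real" where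
  "fractional_weight c \<sigma> z = c / norm (fst z - snd z) powr (real DIM('a) + \<sigma>)"

text \<open>The series is formed in \<open>ennreal\<close>, where it always has a value, possibly
  infinite; finiteness is a matter of the functions integrated. In use, b k contains a k and the
  normalising constant, and \<sigma> k is s k times p.\<close>

definition fractional_measure :: "(nat \<Rightarrow> real) \<Rightarrow> (nat \<Rightarrow> real) \<Rightarrow> ('a::euclidean_space \<times> 'a) measure" where
  "fractional_measure b \<sigma> = density lebesgue (\<lambda>z. \<Sum>k. ennreal (fractional_weight (b k) (\<sigma> k) z))"

lemma fractional_weight_measurable: "fractional_weight c \<sigma> \<in> borel_measurable lebesgue"
  unfolding fractional_weight_def[abs_def] by (rule borel_measurable_lebesgue_prodI) measurable

lemma fractional_weight_nonneg: "0 \<le> c \<Longrightarrow> 0 \<le> fractional_weight c \<sigma> z"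
  by (simp add: fractional_weight_def)

lemma fractional_weight_sum_measurable:
  "(\<lambda>z. \<Sum>k. ennreal (fractional_weight (b k) (\<sigma> k) z)) \<in> borel_measurable lebesgue"
  by (intro borel_measurable_suminf_order measurable_compose[OF fractional_weight_measurable measurable_ennreal])

lemma nn_integral_fractional_measure:
  fixes F :: "'a::euclidean_space \<times> 'a \<Rightarrow> ennreal"
  assumes F: "F \<in> borel_measurable lebesgue"
  shows "(\<integral>\<^sup>+z. F z \<partial>fractional_measure b \<sigma>)
    = (\<Sum>k. \<integral>\<^sup>+z. F z * ennreal (fractional_weight (b k) (\<sigma> k) z) \<partial>lebesgue)"
proof -
  have "(\<integral>\<^sup>+z. F z \<partial>fractional_measure b \<sigma>) = (\<integral>\<^sup>+z. (\<Sum>k. ennreal (fractional_weight (b k) (\<sigma> k) z)) * F z \<partial>lebesgue)"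
    unfolding fractional_measure_def by (rule nn_integral_density[OF fractional_weight_sum_measurable F])
  also have "\<dots> = (\<integral>\<^sup>+z. (\<Sum>k. F z * ennreal (fractional_weight (b k) (\<sigma> k) z)) \<partial>lebesgue)"
    by (simp add: ennreal_suminf_cmult mult.commute)
  also have "\<dots> = (\<Sum>k. \<integral>\<^sup>+z. F z * ennreal (fractional_weight (b k) (\<sigma> k) z) \<partial>lebesgue)"
    by (intro nn_integral_suminf borel_measurable_times_ennreal F measurable_compose[OF fractional_weight_measurable measurable_ennreal])
  finally show ?thesis .
qed

lemma fractional_below_fractional_measure: "fractional_below (\<sigma> k) (b k) (fractional_measure b \<sigma>)"
  unfolding fractional_below_def
proof
  fix F :: "'a \<times> 'a \<Rightarrow> ennreal" assume F: "F \<in> borel_measurable lebesgue"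
  let ?t = "\<lambda>k. \<integral>\<^sup>+z. F z * ennreal (fractional_weight (b k) (\<sigma> k) z) \<partial>lebesgue"
  have "sum ?t {k} \<le> suminf ?t" by (intro sum_le_suminf summableI) auto
  then show "(\<integral>\<^sup>+z. F z * ennreal (b k / norm (fst z - snd z) powr (real DIM('a) + \<sigma> k)) \<partial>lebesgue) \<le> (\<integral>\<^sup>+z. F z \<partial>fractional_measure b \<sigma>)"
    unfolding nn_integral_fractional_measure[OF F] by (simp add: fractional_weight_def)
qed

lemma AE_fractional_measure: "(AE z in lebesgue. P z) \<Longrightarrow> (AE z in fractional_measure b \<sigma>. P z)"
  unfolding fractional_measure_def AE_density[OF fractional_weight_sum_measurable] by (auto elim: eventually_mono)

lemma fractional_measure_trivial: "(\<And>k. b k = 0) \<Longrightarrow> (AE z in fractional_measure b \<sigma>. False)"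
  unfolding fractional_measure_def AE_density[OF fractional_weight_sum_measurable] by (simp add: fractional_weight_def)

lemma sets_fractional_measure: "sets (fractional_measure b \<sigma>) = sets lebesgue"
  by (simp add: fractional_measure_def)

text \<open>For h \<ge> 0 this is monotone convergence; in general subtract the negative from the
  positive part. Convergence of the series belongs to the claim because a weak solution is required
  to have it.\<close>

lemma fractional_measure_sums:
  fixes h :: "'a::euclidean_space \<times> 'a \<Rightarrow> real"
  assumes h: "integrable (fractional_measure b \<sigma>) h" and b: "\<And>k. 0 \<le> b k"
  shows "(\<lambda>k. \<integral>z. h z * fractional_weight (b k) (\<sigma> k) z \<partial>lebesgue) sums (\<integral>z. h z \<partial>fractional_measure b \<sigma>)"
proof -
  let ?\<mu> = "fractional_measure b \<sigma> :: ('a \<times> 'a) measure"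
  let ?w = "\<lambda>k. fractional_weight (b k) (\<sigma> k) :: 'a \<times> 'a \<Rightarrow> real"
  have pos: "integrable lebesgue (\<lambda>z. h z * ?w k z) \<and> (\<lambda>k. \<integral>z. h z * ?w k z \<partial>lebesgue) sums (\<integral>z. h z \<partial>?\<mu>)"
    if i: "integrable ?\<mu> h" and h0: "\<And>z. 0 \<le> h z" for h k
  proof -
    have hm: "h \<in> borel_measurable lebesgue"
      using borel_measurable_integrable[OF i] measurable_cong_sets[OF sets_fractional_measure refl] by blast
    have wm: "(\<lambda>z. h z * ?w k z) \<in> borel_measurable lebesgue" for k
      by (rule borel_measurable_times[OF hm fractional_weight_measurable])
    have w0: "0 \<le> h z * ?w k z" for k z by (intro mult_nonneg_nonneg h0 fractional_weight_nonneg b)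
    have w0': "0 \<le> ?w k z" for k z by (intro fractional_weight_nonneg b)
    have hm': "(\<lambda>z. ennreal (h z)) \<in> borel_measurable lebesgue" using hm by simp
    have eq: "ennreal (\<integral>z. h z \<partial>?\<mu>) = (\<Sum>k. \<integral>\<^sup>+z. ennreal (h z * ?w k z) \<partial>lebesgue)"
      using nn_integral_fractional_measure[OF hm', of b \<sigma>] nn_integral_eq_integral[OF i] h0 w0'
      by (simp add: ennreal_mult)
    have fin: "(\<integral>\<^sup>+z. ennreal (h z * ?w k z) \<partial>lebesgue) < \<infinity>" for k
    proof -
      let ?t = "\<lambda>k. \<integral>\<^sup>+z. ennreal (h z * ?w k z) \<partial>lebesgue"
      have "sum ?t {k} \<le> suminf ?t" by (intro sum_le_suminf summableI) auto
      also have "\<dots> < \<infinity>" unfolding eq[symmetric] by simp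
      finally show ?thesis by simp
    qed
    have I: "integrable lebesgue (\<lambda>z. h z * ?w k z)" for k
      using fin[of k] w0 by (intro integrableI_bounded wm) auto
    have "(\<integral>\<^sup>+z. ennreal (h z * ?w k z) \<partial>lebesgue) = ennreal (\<integral>z. h z * ?w k z \<partial>lebesgue)" for k
      by (rule nn_integral_eq_integral[OF I]) (use w0 in auto)
    then have "(\<Sum>k. ennreal (\<integral>z. h z * ?w k z \<partial>lebesgue)) = ennreal (\<integral>z. h z \<partial>?\<mu>)" using eq by simp
    then have "(\<lambda>k. ennreal (\<integral>z. h z * ?w k z \<partial>lebesgue)) sums ennreal (\<integral>z. h z \<partial>?\<mu>)"
      using summable_sums[OF summableI, of "\<lambda>k. ennreal (\<integral>z. h z * ?w k z \<partial>lebesgue)"] by simp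
    then show ?thesis
      using I w0 h0 by (subst (asm) sums_ennreal) (auto intro: integral_nonneg_AE)
  qed
  let ?h1 = "\<lambda>z. max 0 (h z)" and ?h2 = "\<lambda>z. max 0 (- h z)"
  have 1: "integrable ?\<mu> ?h1" and 2: "integrable ?\<mu> ?h2" using h by auto
  note p1 = pos[OF 1] and p2 = pos[OF 2]
  have hz: "h z = max 0 (h z) - max 0 (- h z)" for z by auto
  have "(\<integral>z. h z \<partial>?\<mu>) = (\<integral>z. ?h1 z - ?h2 z \<partial>?\<mu>)" by (intro Bochner_Integration.integral_cong refl hz)
  also have "\<dots> = (\<integral>z. ?h1 z \<partial>?\<mu>) - (\<integral>z. ?h2 z \<partial>?\<mu>)" by (rule Bochner_Integration.integral_diff[OF 1 2])
  finally have L: "(\<integral>z. h z \<partial>?\<mu>) = (\<integral>z. ?h1 z \<partial>?\<mu>) - (\<integral>z. ?h2 z \<partial>?\<mu>)" .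
  have R: "(\<integral>z. h z * ?w k z \<partial>lebesgue) = (\<integral>z. ?h1 z * ?w k z \<partial>lebesgue) - (\<integral>z. ?h2 z * ?w k z \<partial>lebesgue)" for k
  proof -
    have "(\<integral>z. h z * ?w k z \<partial>lebesgue) = (\<integral>z. ?h1 z * ?w k z - ?h2 z * ?w k z \<partial>lebesgue)"
      by (intro Bochner_Integration.integral_cong refl) (subst hz, simp only: left_diff_distrib)
    also have "\<dots> = (\<integral>z. ?h1 z * ?w k z \<partial>lebesgue) - (\<integral>z. ?h2 z * ?w k z \<partial>lebesgue)"
      by (rule Bochner_Integration.integral_diff) (use p1[of k] p2[of k] in auto)
    finally show ?thesis .
  qed
  show ?thesis unfolding L R by (rule sums_diff) (use p1 p2 in auto)
qed

lemma ennreal_powr_inverse: "0 < p \<Longrightarrow> ennreal_powr (ennreal_powr x (1 / p)) p = x"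
  by (cases x) (auto simp: ennreal_powr_def powr_powr)

lemma ennreal_powr_finite: "ennreal_powr x r < \<infinity> \<longleftrightarrow> x < \<infinity>"
  by (auto simp: ennreal_powr_def less_top)

lemma C_const_pos: "0 < s \<Longrightarrow> s < 1 \<Longrightarrow> 0 < p \<Longrightarrow> 0 < C_const N p s"
  unfolding C_const_def
  by (intro mult_pos_pos divide_pos_pos Gamma_real_pos add_nonneg_pos) auto

section \<open>The space and the forms of the statement inside the abstract setting\<close>

locale superposition =
  fixes \<Omega> :: "'a::euclidean_space set" and p :: real and s a :: "nat \<Rightarrow> real"
  assumes bounded: "bounded \<Omega>" and opn: "open \<Omega>" and p_ge_2: "2 \<le> p" and s0: "s 0 \<le> 1"
    and s_decreasing: "\<And>k. s (Suc k) < s k" and s_nonneg: "\<And>k. 0 \<le> s k"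
    and a0: "0 < a 0" and a_nonneg: "\<And>k. 0 \<le> a k"
begin

text \<open>Strict decrease leaves k = 0 as the only index that can have order 1, so the local part
  is a single term; \<open>frac_coeff\<close> drops that index.\<close>

definition local_coeff :: real where
  "local_coeff = (if s 0 = 1 then a 0 else 0)"

definition frac_coeff :: "nat \<Rightarrow> real" where
  "frac_coeff k = (if s k < 1 then a k * C_const DIM('a) p (s k) else 0)"

definition frac_measure :: "('a \<times> 'a) measure" where
  "frac_measure = fractional_measure frac_coeff (\<lambda>k. s k * p)"

text \<open>Each order strictly exceeds the next one, which is nonnegative. So order 0 never occurs,
  and with it the zero-order branches of the seminorm and of the form.\<close>

lemma s_pos: "0 < s k"
  using s_decreasing[of k] s_nonneg[of "Suc k"] by linarith

lemma s_less_1: "k \<noteq> 0 \<Longrightarrow> s k < 1"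
proof -
  assume "k \<noteq> 0"
  have "decseq s" using s_decreasing by (intro decseq_SucI) (rule less_imp_le)
  then have "s k \<le> s 1" using \<open>k \<noteq> 0\<close> by (auto simp: decseq_def)
  then show ?thesis using s_decreasing[of 0] s0 by simp
qed

lemma C_pos: "s k < 1 \<Longrightarrow> 0 < C_const N p (s k)"
  using C_const_pos[OF s_pos] p_ge_2 by auto

lemma frac_coeff_nonneg: "0 \<le> frac_coeff k"
  using a_nonneg[of k] C_pos[of k "DIM('a)"] by (simp add: frac_coeff_def less_imp_le)

lemma fractional_belowI:
  assumes "s k < 1" "0 < a k"
  shows "\<exists>\<sigma>>0. \<exists>c>0. fractional_below \<sigma> c frac_measure"
proof -
  have "fractional_below (s k * p) (frac_coeff k) frac_measure"
    unfolding frac_measure_def by (rule fractional_below_fractional_measure)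
  moreover have "0 < s k * p" "0 < frac_coeff k"
    using s_pos[of k] p_ge_2 C_pos[OF assms(1), of "DIM('a)"] assms by (auto simp: frac_coeff_def)
  ultimately show ?thesis by blast
qed

sublocale energy_setting \<Omega> p local_coeff frac_measure
proof
  \<comment> \<open>Without a local term s 0 < 1, and a 0 > 0 supplies the kernel to be
    dominated.\<close>
  show "\<exists>\<sigma>>0. \<exists>c>0. fractional_below \<sigma> c frac_measure" if "\<not> 0 < local_coeff"
    using that a0 s0 fractional_belowI[of 0] by (auto simp: local_coeff_def split: if_splits)
  show "AE z in frac_measure. P z" if "AE z in lebesgue. P z" for P
    unfolding frac_measure_def using that by (rule AE_fractional_measure)
  show "sets frac_measure = sets lebesgue" unfolding frac_measure_def by (rule sets_fractional_measure)
qed (use bounded opn p_ge_2 a0 in \<open>auto simp: local_coeff_def\<close>)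

text \<open>If no order below 1 has positive weight, only the p-Laplacian remains and the fractional
  measure is null. For the sup bound a nonlocal term is preferred even when a local one is present,
  whereas coercivity prefers the local term.\<close>

lemma nonlocal_or_local:
  "(\<exists>\<sigma>>0. \<exists>c>0. fractional_below \<sigma> c frac_measure) \<or> (0 < local_coeff \<and> (AE z in frac_measure. False))"
proof (cases "\<exists>k. s k < 1 \<and> 0 < a k")
  case True
  then show ?thesis using fractional_belowI by blast
next
  case False
  then have "s 0 = 1" using a0 s0 by force
  moreover have "frac_coeff k = 0" for k
  proof -
    have "a k = 0" if "s k < 1" using False a_nonneg[of k] that by force
    then show ?thesis by (simp add: frac_coeff_def)
  qed
  then have "AE z in frac_measure. False" unfolding frac_measure_def by (rule fractional_measure_trivial)
  ultimately show ?thesis using a0 by (simp add: local_coeff_def)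
qed

lemma local_coeff_pos_iff: "0 < local_coeff \<longleftrightarrow> s 0 = 1"
  using a0 by (simp add: local_coeff_def)

definition local_energy :: "('a \<Rightarrow> real) \<Rightarrow> ennreal" where
  "local_energy u = (if s 0 = 1 then ennreal (a 0) * (if \<exists>G. has_weak_gradient u G
      then \<integral>\<^sup>+x. ennreal (norm (weak_gradient u x) powr p) \<partial>lebesgue else \<infinity>) else 0)"

text \<open>Compare term by term: the outer power p undoes the root in each seminorm, and the
  constants move into the weights of \<open>frac_measure\<close>. The convention 0 * \<infinity> = 0
  agrees on both sides, since a vanishing weight yields the density 0.\<close>

lemma energy_series:
  assumes u: "u \<in> borel_measurable lebesgue"
  shows "(\<Sum>k. ennreal (a k) * ennreal_powr (seminorm_sp (s k) p u) p)
    = local_energy u + (\<integral>\<^sup>+z. ennreal (\<bar>dif u z\<bar> powr p) \<partial>frac_measure)"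
proof -
  let ?w = "\<lambda>k. fractional_weight (frac_coeff k) (s k * p) :: 'a \<times> 'a \<Rightarrow> real"
  let ?T = "\<lambda>k. \<integral>\<^sup>+z. ennreal (\<bar>dif u z\<bar> powr p) * ennreal (?w k z) \<partial>lebesgue"
  have p0: "0 < p" using p_ge_2 by simp
  have hm: "(\<lambda>z. ennreal (\<bar>dif u z\<bar> powr p)) \<in> borel_measurable lebesgue"
    using dif_measurable[OF u] by measurable
  have "ennreal (a k) * ennreal_powr (seminorm_sp (s k) p u) p = (if k = 0 then local_energy u else 0) + ?T k" for k
  proof (cases "s k < 1")
    case True
    let ?c = "real DIM('a) + s k * p"
    have km: "(\<lambda>z::'a \<times> 'a. ennreal (1 / norm (fst z - snd z) powr ?c)) \<in> borel_measurable lebesgue"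
      using fractional_weight_measurable[of 1 "s k * p", where 'a='a] by (auto simp: fractional_weight_def[abs_def])
    have l: "(if k = 0 then local_energy u else 0) = 0" using True by (auto simp: local_energy_def)
    have "ennreal (a k) * ennreal_powr (seminorm_sp (s k) p u) p
      = ennreal (a k) * (ennreal (C_const DIM('a) p (s k)) * (\<integral>\<^sup>+z. ennreal (\<bar>dif u z\<bar> powr p) * ennreal (1 / norm (fst z - snd z) powr ?c) \<partial>lebesgue))"
      using True s_pos[of k]
      by (simp add: seminorm_sp_def ennreal_powr_inverse[OF p0] dif_def case_prod_beta' ennreal_mult'[symmetric])
    also have "\<dots> = ennreal (frac_coeff k) * (\<integral>\<^sup>+z. ennreal (\<bar>dif u z\<bar> powr p) * ennreal (1 / norm (fst z - snd z) powr ?c) \<partial>lebesgue)"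
      using True a_nonneg[of k] C_pos[OF True, of "DIM('a)"] by (simp add: frac_coeff_def ennreal_mult' mult.assoc)
    also have "\<dots> = (\<integral>\<^sup>+z. ennreal (frac_coeff k) * (ennreal (\<bar>dif u z\<bar> powr p) * ennreal (1 / norm (fst z - snd z) powr ?c)) \<partial>lebesgue)"
      by (intro nn_integral_cmult[symmetric] borel_measurable_times_ennreal hm km)
    also have "\<dots> = ?T k"
      using frac_coeff_nonneg[of k]
      by (intro nn_integral_cong) (simp add: fractional_weight_def ennreal_mult'[symmetric] mult_ac)
    finally show ?thesis by (simp only: l add_0)
  next
    case False
    then have k: "k = 0" "s 0 = 1" using s_less_1[of k] s0 by force+
    have "?T k = 0" using False by (simp add: fractional_weight_def frac_coeff_def)
    moreover have "ennreal (a k) * ennreal_powr (seminorm_sp (s k) p u) p = local_energy u"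
      using k p0 by (auto simp: seminorm_sp_def local_energy_def Lp_norm_def ennreal_powr_inverse ennreal_powr_def[of top])
    ultimately show ?thesis using k by simp
  qed
  then have "(\<Sum>k. ennreal (a k) * ennreal_powr (seminorm_sp (s k) p u) p)
      = (\<Sum>k. (if k = 0 then local_energy u else 0) + ?T k)" by simp
  also have "\<dots> = (\<Sum>k. if k = 0 then local_energy u else 0) + (\<Sum>k. ?T k)"
    by (intro suminf_add[symmetric] summableI)
  also have "(\<Sum>k. if k = 0 then local_energy u else 0) = local_energy u"
    using sums_unique[OF sums_single[of 0 "\<lambda>_. local_energy u"]] by simp
  also have "(\<Sum>k. ?T k) = (\<integral>\<^sup>+z. ennreal (\<bar>dif u z\<bar> powr p) \<partial>frac_measure)"
    unfolding frac_measure_def by (rule nn_integral_fractional_measure[OF hm, symmetric])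
  finally show ?thesis .
qed

lemma mem_X_space_iff:
  "u \<in> X_space p s a \<Omega> \<longleftrightarrow> u \<in> borel_measurable lebesgue \<and> (\<forall>x. x \<notin> \<Omega> \<longrightarrow> u x = 0) \<and>
     local_energy u < \<infinity> \<and> (\<integral>\<^sup>+z. ennreal (\<bar>dif u z\<bar> powr p) \<partial>frac_measure) < \<infinity>"
  using energy_series[of u]
  by (auto simp: X_space_def X_norm_def ennreal_powr_finite[unfolded infinity_ennreal_def] ennreal_add_less_top)

text \<open>The space of the statement asks only for measurability. The exterior interaction with
  \<psi> = |u|^p makes u p-integrable, and |u| \<le> 1 + |u|^p on the bounded set \<Omega>.\<close>

lemma integrable_if_nonlocal:
  assumes um: "u \<in> borel_measurable lebesgue" and u0: "\<And>x. x \<notin> \<Omega> \<Longrightarrow> u x = 0"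
    and fin: "(\<integral>\<^sup>+z. ennreal (\<bar>dif u z\<bar> powr p) \<partial>frac_measure) < \<infinity>" and s: "s 0 < 1"
  shows "integrable lebesgue u"
proof -
  have p1: "1 \<le> p" using p_ge_2 by simp
  obtain \<sigma> c where f: "fractional_below \<sigma> c frac_measure" "\<sigma> > 0" "c > 0"
    using fractional_belowI[OF s a0] by blast
  obtain \<kappa> where \<kappa>: "\<kappa> > 0" "exterior_interaction \<kappa> \<Omega> frac_measure"
    using fractional_exterior_interaction[OF f bounded] by blast
  have "ennreal \<kappa> * (\<integral>\<^sup>+x. ennreal (\<bar>u x\<bar> powr p) \<partial>lebesgue) \<le> (\<integral>\<^sup>+z. ennreal (\<bar>dif u z\<bar> powr p) \<partial>frac_measure)"
    by (rule exterior_interactionD[OF \<kappa>(2)]) (use um u0 p1 in \<open>auto simp: dif_def\<close>)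
  then have "ennreal \<kappa> * (\<integral>\<^sup>+x. ennreal (\<bar>u x\<bar> powr p) \<partial>lebesgue) < \<infinity>" using fin by (rule le_less_trans)
  then have "(\<integral>\<^sup>+x. ennreal (\<bar>u x\<bar> powr p) \<partial>lebesgue) < \<infinity>"
    using \<kappa>(1) by (auto simp: ennreal_mult_less_top)
  then have "Lp_fun p lebesgue u" using um by (subst Lp_fun_iff) auto
  then have i: "integrable lebesgue (\<lambda>x. \<bar>u x\<bar> powr p)" by (simp add: Lp_fun_def)
  show ?thesis
  proof (rule Bochner_Integration.integrable_bound)
    show "integrable lebesgue (\<lambda>x. 1 * indicator \<Omega> x + \<bar>u x\<bar> powr p)"
      by (intro Bochner_Integration.integrable_add indicator_\<Omega>(1) i)
    show "AE x in lebesgue. norm (u x) \<le> norm (1 * indicator \<Omega> x + \<bar>u x\<bar> powr p)"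
    proof (rule AE_I2)
      fix x
      show "norm (u x) \<le> norm (1 * indicator \<Omega> x + \<bar>u x\<bar> powr p)"
      proof (cases "x \<in> \<Omega>")
        case True
        have "\<bar>u x\<bar> \<le> 1 + \<bar>u x\<bar> powr p"
        proof (cases "\<bar>u x\<bar> \<le> 1")
          case False
          then have "\<bar>u x\<bar> powr 1 \<le> \<bar>u x\<bar> powr p" using p1 by (intro powr_mono) auto
          then show ?thesis using False by simp
        qed (simp add: add_increasing2)
        then show ?thesis using True by simp
      qed (use u0 in simp)
    qed
  qed (rule um)
qed

text \<open>The one difference is integrability of u: with a local term it follows from the local
  integrability contained in \<open>has_weak_gradient\<close>, otherwise from the preceding
  lemma.\<close>

lemma X_space_eq_V: "X_space p s a \<Omega> = V"
proof (intro set_eqI iffI)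
  fix u
  assume "u \<in> X_space p s a \<Omega>"
  then have um: "u \<in> borel_measurable lebesgue" and u0: "\<And>x. x \<notin> \<Omega> \<Longrightarrow> u x = 0" and le: "local_energy u < \<infinity>"
    and fe: "(\<integral>\<^sup>+z. ennreal (\<bar>dif u z\<bar> powr p) \<partial>frac_measure) < \<infinity>"
    by (auto simp: mem_X_space_iff)
  have L: "Lp_fun p frac_measure (dif u)"
    using fe Lp_fun_iff[OF measurable_\<mu>[OF dif_measurable[OF um]]] by simp
  show "u \<in> V"
  proof (cases "s 0 = 1")
    case True
    then have ex: "\<exists>G. has_weak_gradient u G" and f: "(\<integral>\<^sup>+x. ennreal (norm (weak_gradient u x) powr p) \<partial>lebesgue) < \<infinity>"
      using le a0 by (auto simp: local_energy_def ennreal_mult_less_top split: if_splits)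
    have "wgrad u (gr u)" using ex True by (auto simp: local_coeff_pos_iff intro: gr_wgrad u0)
    moreover have "gr u = weak_gradient u" using True by (simp add: gr_def local_coeff_pos_iff)
    moreover from calculation have "Lp_fun p lebesgue (gr u)"
      using f by (subst Lp_fun_iff) (auto simp: wgrad_def)
    ultimately show ?thesis using ex L u0 by (auto simp: V_def wgrad_def)
  next
    case False
    then have "gr u = (\<lambda>_. 0)" by (simp add: gr_def local_coeff_pos_iff)
    moreover have "integrable lebesgue u" by (rule integrable_if_nonlocal[OF um u0 fe]) (use False s0 in auto)
    ultimately show ?thesis using L u0 False by (simp add: V_def local_coeff_pos_iff Lp_fun_def)
  qed
next
  fix u
  assume u: "u \<in> V"
  have um: "u \<in> borel_measurable lebesgue" using VD(1)[OF u] by auto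
  have "local_energy u < \<infinity>"
  proof (cases "s 0 = 1")
    case True
    then have "gr u = weak_gradient u" by (simp add: gr_def local_coeff_pos_iff)
    moreover have "\<exists>G. has_weak_gradient u G" using u True by (simp add: V_def local_coeff_pos_iff)
    moreover have "(\<integral>\<^sup>+x. ennreal (norm (gr u x) powr p) \<partial>lebesgue) < \<infinity>"
      using VD(4)[OF u] Lp_fun_iff[OF Lp_fun_measurable[OF VD(4)[OF u]]] by simp
    ultimately show ?thesis using True by (simp add: local_energy_def ennreal_mult_less_top)
  qed (simp add: local_energy_def)
  moreover have "(\<integral>\<^sup>+z. ennreal (\<bar>dif u z\<bar> powr p) \<partial>frac_measure) < \<infinity>"
    using VD(5)[OF u] Lp_fun_iff[OF Lp_fun_measurable[OF VD(5)[OF u]]] by simp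
  ultimately show "u \<in> X_space p s a \<Omega>" using um VD(2)[OF u] by (auto simp: mem_X_space_iff)
qed

text \<open>The fractional terms sum to the integral against the superposed measure. The local form
  integrates over \<Omega> only, which is the whole integral because the gradient vanishes almost
  everywhere outside.\<close>

lemma E_form_sums:
  assumes u: "u \<in> V" and v: "v \<in> V"
  shows "(\<lambda>k. a k * E_form \<Omega> p (s k) u v) sums D u v"
proof -
  let ?h = "\<lambda>z. pdot p (dif u z) (dif v z)"
  let ?t = "\<lambda>k. \<integral>z. ?h z * fractional_weight (frac_coeff k) (s k * p) z \<partial>lebesgue"
  let ?l = "local_coeff * (\<integral>x. pdot p (gr u x) (gr v x) \<partial>lebesgue)"
  have "?t sums (\<integral>z. ?h z \<partial>frac_measure)"
    unfolding frac_measure_def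
    by (rule fractional_measure_sums[OF integrable_pdot[OF p_ge_2 VD(5)[OF u] VD(5)[OF v], unfolded frac_measure_def] frac_coeff_nonneg])
  then have "(\<lambda>k. (if k = 0 then ?l else 0) + ?t k) sums (?l + (\<integral>z. ?h z \<partial>frac_measure))"
    by (rule sums_add[OF sums_single[of 0 "\<lambda>_. ?l"]])
  moreover have "a k * E_form \<Omega> p (s k) u v = (if k = 0 then ?l else 0) + ?t k" for k
  proof (cases "s k < 1")
    case True
    let ?C = "C_const DIM('a) p (s k)"
    have l: "(if k = 0 then ?l else 0) = 0" using True by (auto simp: local_coeff_def)
    have "a k * E_form \<Omega> p (s k) u v = (a k * ?C) * (\<integral>z. ?h z / norm (fst z - snd z) powr (real DIM('a) + s k * p) \<partial>lebesgue)"
      using True s_pos[of k] by (simp add: E_form_def signed_pow_eq_pdot case_prod_beta' dif_def)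
    also have "\<dots> = (\<integral>z. (a k * ?C) * (?h z / norm (fst z - snd z) powr (real DIM('a) + s k * p)) \<partial>lebesgue)"
      by (rule integral_mult_right_zero[symmetric])
    also have "\<dots> = ?t k"
      using True by (intro Bochner_Integration.integral_cong) (simp_all add: fractional_weight_def frac_coeff_def)
    finally show ?thesis by (simp only: l add_0)
  next
    case False
    then have k: "k = 0" "s 0 = 1" using s_less_1[of k] s0 by force+
    have g: "weak_gradient w = gr w" for w using k by (simp add: gr_def local_coeff_pos_iff)
    have m: "(\<lambda>x. pdot p (gr u x) (gr v x)) \<in> borel_measurable lebesgue"
      by (rule borel_measurable_integrable[OF integrable_pdot[OF p_ge_2 VD(4)[OF u] VD(4)[OF v]]])
    have "E_form \<Omega> p (s k) u v = (\<integral>x. indicator \<Omega> x *\<^sub>R pdot p (gr u x) (gr v x) \<partial>lebesgue)"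
      using k by (simp add: E_form_def g pdot_def set_lebesgue_integral_def)
    also have "\<dots> = (\<integral>x. pdot p (gr u x) (gr v x) \<partial>lebesgue)"
    proof (rule integral_cong_AE)
      show "AE x in lebesgue. indicator \<Omega> x *\<^sub>R pdot p (gr u x) (gr v x) = pdot p (gr u x) (gr v x)"
        using gr_zero_outside[OF u] by eventually_elim (auto simp: pdot_def indicator_def)
      show "(\<lambda>x. indicator \<Omega> x *\<^sub>R pdot p (gr u x) (gr v x)) \<in> borel_measurable lebesgue"
        using opn by (intro borel_measurable_scaleR borel_measurable_indicator m) auto
    qed (rule m)
    finally show ?thesis using k by (simp add: local_coeff_def fractional_weight_def frac_coeff_def)
  qed
  ultimately show ?thesis by (simp add: D_def)
qed

text \<open>A bound M for f makes the integral of its primitive M-Lipschitz in L^1, the only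
  property of the potential that the minimisation uses.\<close>

lemma exists_bounded_critical_point:
  assumes fm: "\<And>t. (\<lambda>x. f x t) \<in> borel_measurable lebesgue" and fc: "\<And>x. continuous_on UNIV (f x)"
    and fb: "\<And>x t. \<bar>f x t\<bar> \<le> M"
  shows "\<exists>u\<in>V. \<forall>v\<in>V. D u v = (\<integral>x. f x (u x) * v x \<partial>lebesgue)"
proof -
  have M0: "0 \<le> M" using fb[of undefined undefined] by linarith
  obtain F where F0: "\<And>x. F x 0 = 0" and FL: "\<And>x s t. \<bar>F x s - F x t\<bar> \<le> M * \<bar>s - t\<bar>"
    and Fd: "\<And>x t. (F x has_real_derivative f x t) (at t)"
    and Fm: "\<And>w. w \<in> borel_measurable lebesgue \<Longrightarrow> (\<lambda>x. F x (w x)) \<in> borel_measurable lebesgue"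
    using caratheodory_primitive[OF fm fc fb] by blast
  let ?\<Phi> = "\<lambda>u. \<integral>x. F x (u x) \<partial>lebesgue"
  have Fi: "integrable lebesgue (\<lambda>x. F x (w x))" if w: "integrable lebesgue w" for w
  proof (rule Bochner_Integration.integrable_bound)
    show "integrable lebesgue (\<lambda>x. M * w x)" using w by simp
    show "(\<lambda>x. F x (w x)) \<in> borel_measurable lebesgue" using w by (intro Fm) auto
    show "AE x in lebesgue. norm (F x (w x)) \<le> norm (M * w x)"
      using FL[of _ "w _" 0] F0 M0 by (simp add: abs_mult)
  qed
  have "\<bar>?\<Phi> u - ?\<Phi> v\<bar> \<le> M * (\<integral>x. \<bar>u x - v x\<bar> \<partial>lebesgue)"
    if u: "integrable lebesgue u" and v: "integrable lebesgue v" for u v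
  proof -
    have "\<bar>?\<Phi> u - ?\<Phi> v\<bar> = \<bar>\<integral>x. F x (u x) - F x (v x) \<partial>lebesgue\<bar>"
      using Fi[OF u] Fi[OF v] by simp
    also have "\<dots> \<le> (\<integral>x. \<bar>F x (u x) - F x (v x)\<bar> \<partial>lebesgue)" by (rule integral_abs_bound)
    also have "\<dots> \<le> (\<integral>x. M * \<bar>u x - v x\<bar> \<partial>lebesgue)"
      using Fi[OF u] Fi[OF v] u v FL by (intro integral_mono) auto
    finally show ?thesis by simp
  qed
  from exists_minimizer[where \<Phi>="?\<Phi>", OF M0 this] obtain u where u: "u \<in> V"
    and min: "\<And>w. w \<in> V \<Longrightarrow> E u / p - ?\<Phi> u \<le> E w / p - ?\<Phi> w" by blast
  have "D u v = (\<integral>x. f x (u x) * v x \<partial>lebesgue)" if v: "v \<in> V" for v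
    by (rule Euler_Lagrange[OF u v min F0 FL Fd Fm caratheodory_measurable_comp[OF fm fc]])
  then show ?thesis using u by blast
qed

text \<open>The hypothesis \<open>sup\<close> is the a priori bound for the truncated problem. It
  gives |u| \<le> \<delta> almost everywhere, where truncated and original right-hand sides agree;
  integrability of the latter against every v follows at the same time.\<close>

lemma weak_solution_if_small:
  assumes g: "caratheodory \<Omega> g" and K: "AE x in lebesgue_on \<Omega>. \<forall>t. \<bar>t\<bar> \<le> 1 \<longrightarrow> \<bar>g x t\<bar> \<le> K" "0 \<le> K"
    and \<delta>: "0 < \<delta>" "\<delta> \<le> 1" and r: "2 < critical_exponent DIM('a) p (s 0)" and lam: "0 \<le> lam" and gam: "0 \<le> gam"
    and sup: "\<And>u M h. u \<in> V \<Longrightarrow> M = lam * K + gam * \<delta> powr (critical_exponent DIM('a) p (s 0) - 1) \<Longrightarrow>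
      (\<And>x. \<bar>h x\<bar> \<le> M) \<Longrightarrow> (\<And>v. v \<in> V \<Longrightarrow> D u v = (\<integral>x. h x * v x \<partial>lebesgue)) \<Longrightarrow> (AE x in lebesgue. \<bar>u x\<bar> \<le> \<delta>)"
  shows "\<exists>u. weak_solution \<Omega> p s a g lam gam u"
proof -
  let ?r = "critical_exponent DIM('a) p (s 0)"
  let ?M = "lam * K + gam * \<delta> powr (?r - 1)"
  obtain f where fm: "\<And>t. (\<lambda>x. f x t) \<in> borel_measurable lebesgue" and fc: "\<And>x. continuous_on UNIV (f x)"
    and fb: "\<And>x t. \<bar>f x t\<bar> \<le> ?M"
    and feq: "AE x in lebesgue. x \<in> \<Omega> \<longrightarrow> (\<forall>t. \<bar>t\<bar> \<le> \<delta> \<longrightarrow> f x t = lam * g x t + gam * signed_pow ?r t)"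
    using truncated_nonlinearity[OF opn g K(1) \<delta> r lam gam K(2)] by blast
  obtain u where u: "u \<in> V" and EL: "\<And>v. v \<in> V \<Longrightarrow> D u v = (\<integral>x. f x (u x) * v x \<partial>lebesgue)"
    using exists_bounded_critical_point[OF fm fc fb] by blast
  have um: "u \<in> borel_measurable lebesgue" using VD(1)[OF u] by auto
  have ub: "AE x in lebesgue. \<bar>u x\<bar> \<le> \<delta>" by (rule sup[OF u refl fb EL])
  have fum: "(\<lambda>x. f x (u x)) \<in> borel_measurable lebesgue" by (rule caratheodory_measurable_comp[OF fm fc um])
  have "set_integrable lebesgue \<Omega> (\<lambda>x. (lam * g x (u x) + gam * signed_pow ?r (u x)) * v x) \<and>
    (LINT x:\<Omega>|lebesgue. (lam * g x (u x) + gam * signed_pow ?r (u x)) * v x) = D u v" if v: "v \<in> V" for v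
  proof -
    let ?rhs = "\<lambda>x. indicator \<Omega> x *\<^sub>R ((lam * g x (u x) + gam * signed_pow ?r (u x)) * v x)"
    have i: "integrable lebesgue (\<lambda>x. v x * f x (u x))"
      by (rule integrable_mult_bounded'[OF VD(1)[OF v] fum fb])
    have ae: "AE x in lebesgue. ?rhs x = v x * f x (u x)"
      using feq ub by eventually_elim (use VD(2)[OF v] in \<open>auto simp: indicator_def mult.commute\<close>)
    have m: "?rhs \<in> borel_measurable lebesgue"
      by (rule lebesgue_measurable_cong_AE[OF borel_measurable_integrable[OF i] ae])
    have "integrable lebesgue ?rhs" by (rule integrable_cong_AE_imp[OF i m]) (use ae in \<open>auto elim: eventually_mono\<close>)
    moreover have "(\<integral>x. ?rhs x \<partial>lebesgue) = (\<integral>x. v x * f x (u x) \<partial>lebesgue)"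
      by (rule integral_cong_AE[OF m borel_measurable_integrable[OF i] ae])
    ultimately show ?thesis
      using EL[OF v] by (simp add: set_integrable_def set_lebesgue_integral_def mult.commute)
  qed
  then have "weak_solution \<Omega> p s a g lam gam u"
    using E_form_sums[OF u] u by (simp add: weak_solution_def X_space_eq_V Let_def)
  then show ?thesis by blast
qed

end

theorem corollary8p7:
  fixes \<Omega> :: "'a::euclidean_space set"
    and p q :: real
    and s a :: "nat \<Rightarrow> real"
    and g :: "'a \<Rightarrow> real \<Rightarrow> real"
  assumes "bounded \<Omega>" and "open \<Omega>"
    and "2 \<le> p" and "p < real DIM('a)"
    and "s 0 \<le> 1" and "\<And>k. s (Suc k) < s k" and "\<And>k. 0 \<le> s k"
    and "summable a" and "0 < (\<Sum>k. a k)"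
    and "0 < a 0" and "\<And>k. k \<ge> 1 \<Longrightarrow> 0 \<le> a k"
    and "1 \<le> q" and "q < critical_exponent DIM('a) p (s 0)"
    and "caratheodory \<Omega> g"
    and "growth_bound \<Omega> q g"
  shows "\<forall>gam>0. \<exists>Lam>0. \<forall>lam. 0 < lam \<and> lam < Lam \<longrightarrow>
           (\<exists>u. weak_solution \<Omega> p s a g lam gam u)"
proof (intro allI impI)
  fix gam :: real assume gam: "0 < gam"
  have "0 \<le> a k" for k using assms(10,11) by (cases k) auto
  with assms interpret superposition \<Omega> p s a by unfold_locales auto
  let ?r = "critical_exponent DIM('a) p (s 0)"
  \<comment> \<open>The inequality is strict because s 0 > 0, and the denominator N - p s 0 is
    positive by p s 0 \<le> p < N.\<close>
  have pr: "p < ?r"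
  proof -
    have "p * s 0 \<le> p * 1" using assms(3,5) by (intro mult_left_mono) auto
    then have "0 < real DIM('a) - p * s 0" using assms(4) by simp
    moreover have "0 < p * (p * s 0)" using s_pos[of 0] assms(3) by simp
    ultimately show ?thesis by (simp add: critical_exponent_def pos_less_divide_eq right_diff_distrib)
  qed
  then have r2: "2 < ?r" using assms(3) by simp
  obtain c1 c2 where c: "0 < c1" "0 < c2"
    and gb: "AE x in lebesgue_on \<Omega>. \<forall>t. \<bar>g x t\<bar> \<le> c1 + c2 * (if q = 1 then 1 else \<bar>t\<bar> powr (q - 1))"
    using assms(15) by (auto simp: growth_bound_def)
  \<comment> \<open>The growth bound for |t| \<le> 1, where the power of |t| is at most 1.\<close>
  define K where "K = c1 + c2"
  have K: "0 < K" using c by (simp add: K_def)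
  have gK: "AE x in lebesgue_on \<Omega>. \<forall>t. \<bar>t\<bar> \<le> 1 \<longrightarrow> \<bar>g x t\<bar> \<le> K"
    using gb
  proof eventually_elim
    case (elim x)
    have "(if q = 1 then 1 else \<bar>t\<bar> powr (q - 1)) \<le> 1" if "\<bar>t\<bar> \<le> 1" for t
      using that powr_mono2[of "q - 1" "\<bar>t\<bar>" 1] assms(12) by auto
    then have "c2 * (if q = 1 then 1 else \<bar>t\<bar> powr (q - 1)) \<le> c2 * 1" if "\<bar>t\<bar> \<le> 1" for t
      using that c(2) by (intro mult_left_mono) auto
    then show ?case using elim unfolding K_def by (metis add_left_mono mult.right_neutral order_trans)
  qed
  obtain \<kappa> where \<kappa>: "0 < \<kappa>" and sb: "\<And>u \<delta> M h. u \<in> V \<Longrightarrow> 0 < \<delta> \<Longrightarrow> M < \<kappa> * \<delta> powr (p - 1) \<Longrightarrow> (\<forall>x. \<bar>h x\<bar> \<le> M) \<Longrightarrow>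
     (\<forall>v\<in>V. D u v = (\<integral>x. h x * v x \<partial>lebesgue)) \<Longrightarrow> (AE x in lebesgue. \<bar>u x\<bar> \<le> \<delta>)"
    using sup_bound[OF nonlocal_or_local] by blast
  \<comment> \<open>y solves gam y^(?r - p) = \<kappa> / 4, so the critical term takes at most a
    quarter of the admissible amount \<kappa> \<delta>^(p - 1).\<close>
  define y where "y = (\<kappa> / (4 * gam)) powr (1 / (?r - p))"
  define \<delta> where "\<delta> = min 1 y"
  have \<delta>: "0 < \<delta>" "\<delta> \<le> 1" "\<delta> \<le> y" using \<kappa> gam by (auto simp: \<delta>_def y_def)
  have "\<delta> powr (?r - p) \<le> y powr (?r - p)" using \<delta> pr by (intro powr_mono2) auto
  also have "\<dots> = \<kappa> / (4 * gam)" using pr \<kappa> gam by (simp add: y_def powr_powr)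
  finally have "gam * \<delta> powr (?r - p) \<le> \<kappa> / 4" using gam by (simp add: field_simps)
  then have "gam * \<delta> powr (?r - p) * \<delta> powr (p - 1) \<le> \<kappa> / 4 * \<delta> powr (p - 1)" by (intro mult_right_mono) auto
  moreover have "\<delta> powr (?r - p) * \<delta> powr (p - 1) = \<delta> powr (?r - 1)" by (simp add: powr_add[symmetric])
  ultimately have small: "gam * \<delta> powr (?r - 1) \<le> \<kappa> / 4 * \<delta> powr (p - 1)" by (simp only: mult.assoc)
  \<comment> \<open>Lam K is another quarter of the admissible amount, so the bound on the
    right-hand side stays below one half of it.\<close>
  define Lam where "Lam = \<kappa> * \<delta> powr (p - 1) / (4 * K)"
  have "0 < Lam" using \<kappa> \<delta> K by (simp add: Lam_def)
  moreover have "\<exists>u. weak_solution \<Omega> p s a g lam gam u" if lam: "0 < lam" "lam < Lam" for lam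
  proof (rule weak_solution_if_small[OF assms(14) gK _ \<delta>(1,2) r2])
    fix u M h
    assume u: "u \<in> V" and M: "M = lam * K + gam * \<delta> powr (?r - 1)" and h: "\<And>x. \<bar>h x\<bar> \<le> M"
      and eq: "\<And>v. v \<in> V \<Longrightarrow> D u v = (\<integral>x. h x * v x \<partial>lebesgue)"
    have "lam * K < Lam * K" using lam K by simp
    also have "\<dots> = \<kappa> / 4 * \<delta> powr (p - 1)" using K by (simp add: Lam_def)
    finally have "M < \<kappa> / 4 * \<delta> powr (p - 1) + \<kappa> / 4 * \<delta> powr (p - 1)" using small unfolding M by linarith
    also have "\<dots> \<le> \<kappa> * \<delta> powr (p - 1)" using \<kappa> by simp
    finally show "AE x in lebesgue. \<bar>u x\<bar> \<le> \<delta>" using sb[OF u \<delta>(1)] h eq by blast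
  qed (use K lam gam in auto)
  ultimately show "\<exists>Lam>0. \<forall>lam. 0 < lam \<and> lam < Lam \<longrightarrow> (\<exists>u. weak_solution \<Omega> p s a g lam gam u)" by blast
qed

end
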